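(* Let $\Omega\subset\mathbb{R}^d$ be a bounded domain, $K>1$, and let $\mathcal{L}_n$ ($n\in\mathbb{N}$) and $\mathcal{L}$ be the operators $$\mathcal{L}_nu=-\nabla_{A_n}\cdot\sigma_n\nabla_{A_n}u+q_nu,\qquad \mathcal{L}u=-\nabla_A\cdot\sigma\nabla_Au+qu$$ with Dirichlet condition $u|_{\partial\Omega}=0$, where $\sigma_n,\sigma\in M_K(\Omega)$, $A_n,A\in L^\infty(\Omega,\mathbb{R}^d)$ and $q_n,q\in L^\infty(\Omega,\mathbb{R})$ have $L^\infty$ norms at most $K$. Assume there is $\Omega'$ with $\overline{\Omega'}\subset\Omega$ compact such that $\sigma_n=\sigma$, $A_n=A$ and $q_n=q$ on $\Omega\setminus\Omega'$ for all $n$. If $\mathcal{L}_n$ $G$-converges to $\mathcal{L}$, then for every $\lambda\in\mathbb{C}\setminus\mathrm{spec}(\mathcal{L})$ $$\|\Lambda^\lambda_n-\Lambda^\lambda\|_{H^{1/2}(\partial\Omega)\to H^{-1/2}(\partial\Omega)}\to0\quad\text{as }n\to\infty,$$ and for every compact set $\mathbb{K}\subset\mathbb{C}$ with $\mathbb{K}\cap\mathrm{spec}(\mathcal{L})=\emptyset$ the convergence is uniform for $\lambda\in\mathbb{K}$. (The maps $\Lambda^\lambda_n$ are considered for $n$ large enough that $\lambda\notin\mathrm{spec}(\mathcal{L}_n)$.)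
   Context: $M_K(\Omega)$ is the set of measurable real symmetric $d\times d$ matrix fields $\sigma$ with $\frac1KI\le\sigma(x)\le KI$ for a.e. $x\in\Omega$. For a real vector field $A$, $\nabla_Au=\nabla u+iAu$ and $\nabla_A\cdot V=\nabla\cdot V+iA\cdot V$. Functions are complex-valued. The operators are the self-adjoint operators in $L^2(\Omega)$ associated with the quadratic forms $\int_\Omega \sigma\nabla_Au\cdot\overline{\nabla_Au}+q|u|^2$, $u\in H^1_0(\Omega)$; $\mathrm{spec}$ denotes their spectrum. There is $\lambda(K)\in\mathbb{R}$ such that $(-\infty,\lambda(K))$ does not meet the spectrum of any operator $-\nabla_B\cdot\tau\nabla_B+p$ with Dirichlet condition on $\partial\Omega$ whose coefficients satisfy $\tau\in M_K(\Omega)$, $B\in L^\infty(\Omega,\mathbb{R}^d)$, $p\in L^\infty(\Omega,\mathbb{R})$, $\|B\|_{L^\infty}\le K$ and $\|p\|_{L^\infty}\le K$. $\mathcal{L}_n$ $G$-converges to $\mathcal{L}$ if for every $f\in H^{-1}(\Omega)$ and $\lambda<\lambda(K)$, $(\mathcal{L}_n-\lambda I)^{-1}f\to(\mathcal{L}-\lambda I)^{-1}f$ weakly in $H^1_0(\Omega)$. $H^{1/2}(\partial\Omega)$ is the trace space of $H^1(\Omega)$, for a general bounded domain understood as $H^1(\Omega)/H^1_0(\Omega)$ with the quotient norm; $H^{-1/2}(\partial\Omega)$ is its dual. For $\lambda\notin\mathrm{spec}(\mathcal{L}_n)$ and $\psi\in H^{1/2}(\partial\Omega)$ let $u_n\in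 H^1(\Omega)$ be the unique solution of $(\mathcal{L}_n-\lambda)u_n=0$ in $\Omega$ (differential expression, weak sense), $u_n|_{\partial\Omega}=\psi$. The Dirichlet-to-Neumann map is $$\langle\Lambda^\lambda_n\psi,\varphi\rangle=\int_\Omega\big(\sigma_n\nabla_{A_n}u_n\cdot\overline{\nabla_{A_n}\tilde\varphi}+(q_n-\lambda)u_n\overline{\tilde\varphi}\big),$$ with $\tilde\varphi\in H^1(\Omega)$ any extension of $\varphi\in H^{1/2}(\partial\Omega)$; $\Lambda^\lambda$ is defined likewise from $\mathcal{L}$. *)

theory Defs
  imports "HOL-Analysis.Analysis"
begin

text \<open>
  Elements of \<open>L\<^sup>2\<close>, \<open>H\<^sup>1\<close>, \<open>H\<^sup>1\<^sub>0\<close> are represented by functions on the whole space. Only their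
  values on \<open>\<Omega>\<close>, up to Lebesgue null sets, matter.
\<close>

section \<open>Test functions and Sobolev spaces\<close>

primrec C_k :: "nat \<Rightarrow> (real^'d \<Rightarrow> complex) \<Rightarrow> bool" where
  "C_k 0 f \<longleftrightarrow> continuous_on UNIV f"
| "C_k (Suc k) f \<longleftrightarrow> (\<forall>x. f differentiable (at x)) \<and>
     (\<forall>i. C_k k (\<lambda>x. frechet_derivative f (at x) (axis i 1)))"

definition test_fun :: "(real^'d) set \<Rightarrow> (real^'d \<Rightarrow> complex) set" where
  "test_fun \<Omega> = {\<phi>. (\<forall>k. C_k k \<phi>) \<and>
     compact (closure {x. \<phi> x \<noteq> 0}) \<and> closure {x. \<phi> x \<noteq> 0} \<subseteq> \<Omega>}"

definition L2 :: "(real^'d) set \<Rightarrow> (real^'d \<Rightarrow> 'b::euclidean_space) set" where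
  "L2 \<Omega> = {u \<in> borel_measurable (lebesgue_on \<Omega>). integrable (lebesgue_on \<Omega>) (\<lambda>x. (norm (u x))\<^sup>2)}"

definition L2_norm :: "(real^'d) set \<Rightarrow> (real^'d \<Rightarrow> 'b::euclidean_space) \<Rightarrow> real" where
  "L2_norm \<Omega> u = sqrt (LINT x|lebesgue_on \<Omega>. (norm (u x))\<^sup>2)"

definition has_weak_grad :: "(real^'d) set \<Rightarrow> (real^'d \<Rightarrow> complex) \<Rightarrow> (real^'d \<Rightarrow> complex^'d) \<Rightarrow> bool" where
  "has_weak_grad \<Omega> u g \<longleftrightarrow> (\<forall>\<phi>\<in>test_fun \<Omega>. \<forall>i.
     (LINT x|lebesgue_on \<Omega>. u x * frechet_derivative \<phi> (at x) (axis i 1)) =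
     - (LINT x|lebesgue_on \<Omega>. g x $ i * \<phi> x))"

definition H1 :: "(real^'d) set \<Rightarrow> (real^'d \<Rightarrow> complex) set" where
  "H1 \<Omega> = {u \<in> L2 \<Omega>. \<exists>g\<in>L2 \<Omega>. has_weak_grad \<Omega> u g}"

definition wgrad :: "(real^'d) set \<Rightarrow> (real^'d \<Rightarrow> complex) \<Rightarrow> real^'d \<Rightarrow> complex^'d" where
  "wgrad \<Omega> u = (SOME g. g \<in> L2 \<Omega> \<and> has_weak_grad \<Omega> u g)"

definition H1_norm :: "(real^'d) set \<Rightarrow> (real^'d \<Rightarrow> complex) \<Rightarrow> real" where
  "H1_norm \<Omega> u = sqrt ((L2_norm \<Omega> u)\<^sup>2 + (L2_norm \<Omega> (wgrad \<Omega> u))\<^sup>2)"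

definition H10 :: "(real^'d) set \<Rightarrow> (real^'d \<Rightarrow> complex) set" where
  "H10 \<Omega> = {u \<in> H1 \<Omega>. \<exists>\<phi>. (\<forall>k::nat. \<phi> k \<in> test_fun \<Omega>) \<and>
     (\<lambda>k. H1_norm \<Omega> (\<lambda>x. u x - \<phi> k x)) \<longlonglongrightarrow> 0}"

text \<open>
  The duality pairings are sesquilinear, like the forms below, so elements of the dual spaces
  are bounded antilinear functionals. The bound makes a functional respect equality a.e.
\<close>

definition Hm1 :: "(real^'d) set \<Rightarrow> ((real^'d \<Rightarrow> complex) \<Rightarrow> complex) set" where
  "Hm1 \<Omega> = {F.
     (\<forall>v\<in>H10 \<Omega>. \<forall>w\<in>H10 \<Omega>. F (\<lambda>x. v x + w x) = F v + F w) \<and>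
     (\<forall>c. \<forall>v\<in>H10 \<Omega>. F (\<lambda>x. c * v x) = cnj c * F v) \<and>
     (\<exists>C. \<forall>v\<in>H10 \<Omega>. cmod (F v) \<le> C * H1_norm \<Omega> v)}"

definition weakly_converges_H10 ::
    "(real^'d) set \<Rightarrow> (nat \<Rightarrow> real^'d \<Rightarrow> complex) \<Rightarrow> (real^'d \<Rightarrow> complex) \<Rightarrow> bool" where
  "weakly_converges_H10 \<Omega> u v \<longleftrightarrow> (\<forall>F\<in>Hm1 \<Omega>. (\<lambda>n. F (u n)) \<longlonglongrightarrow> F v)"

section \<open>Coefficients, forms and operators\<close>

definition M_K :: "(real^'d) set \<Rightarrow> real \<Rightarrow> (real^'d \<Rightarrow> real^'d^'d) set" where
  "M_K \<Omega> K = {\<sigma> \<in> borel_measurable (lebesgue_on \<Omega>). AE x in lebesgue_on \<Omega>.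
     transpose (\<sigma> x) = \<sigma> x \<and>
     (\<forall>\<xi>. (1 / K) * (\<xi> \<bullet> \<xi>) \<le> \<xi> \<bullet> (\<sigma> x *v \<xi>) \<and> \<xi> \<bullet> (\<sigma> x *v \<xi>) \<le> K * (\<xi> \<bullet> \<xi>))}"

definition Linf_ball :: "(real^'d) set \<Rightarrow> real \<Rightarrow> (real^'d \<Rightarrow> 'b::euclidean_space) set" where
  "Linf_ball \<Omega> K = {f \<in> borel_measurable (lebesgue_on \<Omega>). AE x in lebesgue_on \<Omega>. norm (f x) \<le> K}"

definition mgrad :: "(real^'d) set \<Rightarrow> (real^'d \<Rightarrow> real^'d) \<Rightarrow> (real^'d \<Rightarrow> complex) \<Rightarrow> real^'d \<Rightarrow> complex^'d" where
  "mgrad \<Omega> A u x = (\<chi> i. wgrad \<Omega> u x $ i + \<i> * of_real (A x $ i) * u x)"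

text \<open>The form of \<open>\<L> - z\<close>; the quadratic form of \<open>\<L>\<close> itself is the case \<open>z = 0\<close>.\<close>

definition mform :: "(real^'d) set \<Rightarrow> (real^'d \<Rightarrow> real^'d^'d) \<Rightarrow> (real^'d \<Rightarrow> real^'d) \<Rightarrow> (real^'d \<Rightarrow> real) \<Rightarrow>
    complex \<Rightarrow> (real^'d \<Rightarrow> complex) \<Rightarrow> (real^'d \<Rightarrow> complex) \<Rightarrow> complex" where
  "mform \<Omega> \<sigma> A q z u v = (LINT x|lebesgue_on \<Omega>.
     (\<Sum>i\<in>UNIV. (\<Sum>j\<in>UNIV. of_real (\<sigma> x $ i $ j) * mgrad \<Omega> A u x $ j) * cnj (mgrad \<Omega> A v x $ i))
     + (of_real (q x) - z) * u x * cnj (v x))"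

text \<open>The graph of the self-adjoint operator that the representation theorem associates with the form.\<close>

definition op_graph :: "(real^'d) set \<Rightarrow> (real^'d \<Rightarrow> real^'d^'d) \<Rightarrow> (real^'d \<Rightarrow> real^'d) \<Rightarrow> (real^'d \<Rightarrow> real) \<Rightarrow>
    ((real^'d \<Rightarrow> complex) \<times> (real^'d \<Rightarrow> complex)) set" where
  "op_graph \<Omega> \<sigma> A q = {(u, f). u \<in> H10 \<Omega> \<and> f \<in> L2 \<Omega> \<and>
     (\<forall>v\<in>H10 \<Omega>. mform \<Omega> \<sigma> A q 0 u v = (LINT x|lebesgue_on \<Omega>. f x * cnj (v x)))}"

text \<open>
  For an operator \<open>T\<close> in \<open>L\<^sup>2(\<Omega>)\<close> given by its graph: \<open>T - z\<close> maps onto \<open>L\<^sup>2(\<Omega>)\<close>, and the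
  estimate says that it is injective (modulo null sets) with bounded inverse.
\<close>

definition resolvent_set_L2 ::
    "(real^'d) set \<Rightarrow> ((real^'d \<Rightarrow> complex) \<times> (real^'d \<Rightarrow> complex)) set \<Rightarrow> complex set" where
  "resolvent_set_L2 \<Omega> T = {z.
     (\<forall>f\<in>L2 \<Omega>. \<exists>u. (u, \<lambda>x. f x + z * u x) \<in> T) \<and>
     (\<exists>C. \<forall>(u, g)\<in>T. L2_norm \<Omega> u \<le> C * L2_norm \<Omega> (\<lambda>x. g x - z * u x))}"

definition op_spec :: "(real^'d) set \<Rightarrow> (real^'d \<Rightarrow> real^'d^'d) \<Rightarrow> (real^'d \<Rightarrow> real^'d) \<Rightarrow> (real^'d \<Rightarrow> real) \<Rightarrow>
    complex set" where
  "op_spec \<Omega> \<sigma> A q = - resolvent_set_L2 \<Omega> (op_graph \<Omega> \<sigma> A q)"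

text \<open>The property required of the number \<open>\<lambda>(K)\<close>.\<close>

definition below_all_spectra :: "(real^'d) set \<Rightarrow> real \<Rightarrow> real \<Rightarrow> bool" where
  "below_all_spectra \<Omega> K \<mu> \<longleftrightarrow>
     (\<forall>\<tau>\<in>M_K \<Omega> K. \<forall>B\<in>Linf_ball \<Omega> K. \<forall>p\<in>Linf_ball \<Omega> K.
        complex_of_real ` {..<\<mu>} \<inter> op_spec \<Omega> \<tau> B p = {})"

text \<open>\<open>(\<L> - z)\<^sup>-\<^sup>1 F\<close> for \<open>F \<in> H\<^sup>-\<^sup>1(\<Omega>)\<close>, determined up to null sets when \<open>z\<close> is not in the spectrum.\<close>

definition Hm1_resolvent :: "(real^'d) set \<Rightarrow> (real^'d \<Rightarrow> real^'d^'d) \<Rightarrow> (real^'d \<Rightarrow> real^'d) \<Rightarrow>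
    (real^'d \<Rightarrow> real) \<Rightarrow> complex \<Rightarrow> ((real^'d \<Rightarrow> complex) \<Rightarrow> complex) \<Rightarrow> real^'d \<Rightarrow> complex" where
  "Hm1_resolvent \<Omega> \<sigma> A q z F =
     (SOME u. u \<in> H10 \<Omega> \<and> (\<forall>v\<in>H10 \<Omega>. mform \<Omega> \<sigma> A q z u v = F v))"

definition G_converges :: "(real^'d) set \<Rightarrow> real \<Rightarrow>
    (nat \<Rightarrow> real^'d \<Rightarrow> real^'d^'d) \<Rightarrow> (nat \<Rightarrow> real^'d \<Rightarrow> real^'d) \<Rightarrow> (nat \<Rightarrow> real^'d \<Rightarrow> real) \<Rightarrow>
    (real^'d \<Rightarrow> real^'d^'d) \<Rightarrow> (real^'d \<Rightarrow> real^'d) \<Rightarrow> (real^'d \<Rightarrow> real) \<Rightarrow> bool" where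
  "G_converges \<Omega> \<mu> \<sigma>n An qn \<sigma> A q \<longleftrightarrow>
     (\<forall>F\<in>Hm1 \<Omega>. \<forall>t<\<mu>. weakly_converges_H10 \<Omega>
        (\<lambda>n. Hm1_resolvent \<Omega> (\<sigma>n n) (An n) (qn n) (complex_of_real t) F)
        (Hm1_resolvent \<Omega> \<sigma> A q (complex_of_real t) F))"

section \<open>Boundary spaces and the Dirichlet-to-Neumann map\<close>

definition trace_class :: "(real^'d) set \<Rightarrow> (real^'d \<Rightarrow> complex) \<Rightarrow> (real^'d \<Rightarrow> complex) set" where
  "trace_class \<Omega> u = {w \<in> H1 \<Omega>. (\<lambda>x. w x - u x) \<in> H10 \<Omega>}"

text \<open>\<open>H\<^sup>1(\<Omega>)/H\<^sup>1\<^sub>0(\<Omega>)\<close> as a set of cosets, with the quotient norm.\<close>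

definition Hhalf :: "(real^'d) set \<Rightarrow> (real^'d \<Rightarrow> complex) set set" where
  "Hhalf \<Omega> = trace_class \<Omega> ` H1 \<Omega>"

definition Hhalf_norm :: "(real^'d) set \<Rightarrow> (real^'d \<Rightarrow> complex) set \<Rightarrow> real" where
  "Hhalf_norm \<Omega> \<Psi> = Inf (H1_norm \<Omega> ` \<Psi>)"

text \<open>The next two norms are extended-valued: they are \<open>\<infinity>\<close> on unbounded functionals and maps.\<close>

definition Hmhalf_norm :: "(real^'d) set \<Rightarrow> ((real^'d \<Rightarrow> complex) set \<Rightarrow> complex) \<Rightarrow> ennreal" where
  "Hmhalf_norm \<Omega> l = (SUP \<Phi>\<in>{\<Phi> \<in> Hhalf \<Omega>. Hhalf_norm \<Omega> \<Phi> \<le> 1}. ennreal (cmod (l \<Phi>)))"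

definition boundary_op_norm :: "(real^'d) set \<Rightarrow>
    ((real^'d \<Rightarrow> complex) set \<Rightarrow> (real^'d \<Rightarrow> complex) set \<Rightarrow> complex) \<Rightarrow> ennreal" where
  "boundary_op_norm \<Omega> T = (SUP \<Psi>\<in>{\<Psi> \<in> Hhalf \<Omega>. Hhalf_norm \<Omega> \<Psi> \<le> 1}. Hmhalf_norm \<Omega> (T \<Psi>))"

definition dirichlet_sol :: "(real^'d) set \<Rightarrow> (real^'d \<Rightarrow> real^'d^'d) \<Rightarrow> (real^'d \<Rightarrow> real^'d) \<Rightarrow>
    (real^'d \<Rightarrow> real) \<Rightarrow> complex \<Rightarrow> (real^'d \<Rightarrow> complex) set \<Rightarrow> real^'d \<Rightarrow> complex" where
  "dirichlet_sol \<Omega> \<sigma> A q z \<Psi> =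
     (SOME u. u \<in> \<Psi> \<and> (\<forall>v\<in>H10 \<Omega>. mform \<Omega> \<sigma> A q z u v = 0))"

text \<open>
  \<open>DN \<Omega> \<sigma> A q z \<Psi> \<Phi>\<close> is \<open>\<langle>\<Lambda>\<^sup>z \<Psi>, \<Phi>\<rangle>\<close>. It does not depend on the chosen extension in \<open>\<Phi>\<close>, since
  the form vanishes for second arguments in \<open>H\<^sup>1\<^sub>0(\<Omega>)\<close>.
\<close>

definition DN :: "(real^'d) set \<Rightarrow> (real^'d \<Rightarrow> real^'d^'d) \<Rightarrow> (real^'d \<Rightarrow> real^'d) \<Rightarrow> (real^'d \<Rightarrow> real) \<Rightarrow>
    complex \<Rightarrow> (real^'d \<Rightarrow> complex) set \<Rightarrow> (real^'d \<Rightarrow> complex) set \<Rightarrow> complex" where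
  "DN \<Omega> \<sigma> A q z \<Psi> \<Phi> =
     mform \<Omega> \<sigma> A q z (dirichlet_sol \<Omega> \<sigma> A q z \<Psi>) (SOME \<phi>. \<phi> \<in> \<Phi>)"

definition DN_dist :: "(real^'d) set \<Rightarrow>
    (real^'d \<Rightarrow> real^'d^'d) \<Rightarrow> (real^'d \<Rightarrow> real^'d) \<Rightarrow> (real^'d \<Rightarrow> real) \<Rightarrow>
    (real^'d \<Rightarrow> real^'d^'d) \<Rightarrow> (real^'d \<Rightarrow> real^'d) \<Rightarrow> (real^'d \<Rightarrow> real) \<Rightarrow> complex \<Rightarrow> ennreal" where
  "DN_dist \<Omega> \<sigma>1 A1 q1 \<sigma>2 A2 q2 z =
     boundary_op_norm \<Omega> (\<lambda>\<Psi> \<Phi>. DN \<Omega> \<sigma>1 A1 q1 z \<Psi> \<Phi> - DN \<Omega> \<sigma>2 A2 q2 z \<Psi> \<Phi>)"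

end

theory Submission
  imports Defs "HOL-Complex_Analysis.Great_Picard" "HOL-Library.Diagonal_Subsequence"
begin

text \<open>
  The coefficients differ only where a fixed cut-off function \<open>\<eta>\<close> is 1, so the difference of the forms of
  \<open>\<L>\<^sub>n\<close> and \<open>\<L>\<close> does not change when an argument is multiplied by \<open>\<eta>\<close>. If \<open>u\<^sub>n\<close> and \<open>u\<close> solve the two Dirichlet
  problems and \<open>r = u\<^sub>n - u\<close>, the difference of the Dirichlet-to-Neumann maps becomes the form of \<open>\<L> - z\<close>
  at \<open>r\<close> and \<open>\<eta> v\<close>, where \<open>v\<close> solves the adjoint problem, and \<open>r + \<eta> u \<in> H\<^sup>1\<^sub>0\<close> solves the \<open>n\<close>-th equation
  with right-hand side \<open>(\<L> - z)(\<eta> u)\<close>. By Rellich's theorem and Caccioppoli's inequality the functions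
  \<open>\<eta> u\<close> and \<open>\<eta> v\<close> range over relatively compact subsets of \<open>H\<^sup>1\<^sub>0\<close> when the boundary data are bounded; on
  such sets the weak convergence of the resolvents is uniform, so \<open>r\<close> tends weakly to 0 and the form
  tends to 0 uniformly. Compactness arguments along subsequences \<open>n\<^sub>k \<rightarrow> \<infinity>\<close>, \<open>z\<^sub>k \<rightarrow> z\<close> transport
  the convergence from one real \<open>t\<close> below all spectra to compact sets of the resolvent set of \<open>\<L>\<close>.
\<close>

section \<open>Square integrable functions\<close>

text \<open>The boundary of \<open>\<Omega>\<close> is arbitrary, so bounded sequences in
  \<open>H1\<close> need not be relatively compact in \<open>L2\<close>; Rellich's theorem is
  available in \<open>H10\<close> only. This is why cut-offs appear: compactness is extracted either
  from functions with zero boundary values or from functions multiplied by a test function of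
  \<open>\<Omega>\<close>. A second obstacle is that nothing is known in advance about the spectra
  of the operators \<open>\<L>\<^sub>n\<close> near a given \<open>z\<close>. A lower bound for
  their forms at \<open>z\<close>, with a constant independent of large \<open>n\<close> and of
  \<open>z\<close> in the compact set, is derived from the mere absence of a kernel of the limit
  form. Together with the same bound at \<open>cnj z\<close> it yields existence, uniqueness and
  avoidance of the spectrum. Finally, the forms are Hermitian at real points and coercive far to the
  left. One such point \<open>t0\<close> is fixed; the form at any other \<open>z\<close> is the
  form at \<open>t0\<close> plus a multiple of the \<open>L2\<close> inner product, and this extra
  term is compact on \<open>H10\<close>.\<close>

lemma L2_measurable [measurable_dest]: "u \<in> L2 \<Omega> \<Longrightarrow> u \<in> borel_measurable (lebesgue_on \<Omega>)"
  by (simp add: L2_def)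

lemma L2_integrable: "u \<in> L2 \<Omega> \<Longrightarrow> integrable (lebesgue_on \<Omega>) (\<lambda>x. (norm (u x))\<^sup>2)"
  by (simp add: L2_def)

lemma L2_norm_nonneg [simp]: "0 \<le> L2_norm \<Omega> u"
  by (simp add: L2_norm_def)

lemma L2_norm_sq: "(L2_norm \<Omega> u)\<^sup>2 = (LINT x|lebesgue_on \<Omega>. (norm (u x))\<^sup>2)"
  by (simp add: L2_norm_def)

lemma L2_dominated:
  fixes f :: "real^'d \<Rightarrow> 'b::euclidean_space" and g :: "real^'d \<Rightarrow> 'c::euclidean_space"
  assumes f: "f \<in> L2 \<Omega>" and g: "g \<in> borel_measurable (lebesgue_on \<Omega>)"
    and le: "AE x in lebesgue_on \<Omega>. norm (g x) \<le> C * norm (f x)"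
  shows "g \<in> L2 \<Omega>" and "0 \<le> C \<Longrightarrow> L2_norm \<Omega> g \<le> C * L2_norm \<Omega> f"
proof -
  have ae: "AE x in lebesgue_on \<Omega>. (norm (g x))\<^sup>2 \<le> C\<^sup>2 * (norm (f x))\<^sup>2"
    using le
  proof eventually_elim
    case (elim x)
    then have "(norm (g x))\<^sup>2 \<le> (C * norm (f x))\<^sup>2" by (intro power_mono) auto
    then show ?case by (simp add: power_mult_distrib)
  qed
  have int: "integrable (lebesgue_on \<Omega>) (\<lambda>x. C\<^sup>2 * (norm (f x))\<^sup>2)"
    using L2_integrable[OF f] by simp
  have int': "integrable (lebesgue_on \<Omega>) (\<lambda>x. (norm (g x))\<^sup>2)"
    using int by (rule Bochner_Integration.integrable_bound) (use g ae in auto)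
  then show "g \<in> L2 \<Omega>" using g by (simp add: L2_def)
  assume C: "0 \<le> C"
  have "(L2_norm \<Omega> g)\<^sup>2 \<le> (LINT x|lebesgue_on \<Omega>. C\<^sup>2 * (norm (f x))\<^sup>2)"
    unfolding L2_norm_sq by (rule integral_mono_AE[OF int' int ae])
  also have "\<dots> = (C * L2_norm \<Omega> f)\<^sup>2"
    by (simp add: power_mult_distrib L2_norm_sq)
  finally show "L2_norm \<Omega> g \<le> C * L2_norm \<Omega> f"
    by (rule power2_le_imp_le) (use C in auto)
qed

lemma L2_norm_mono:
  fixes f :: "real^'d \<Rightarrow> 'b::euclidean_space" and g :: "real^'d \<Rightarrow> 'c::euclidean_space"
  assumes "f \<in> L2 \<Omega>" "g \<in> borel_measurable (lebesgue_on \<Omega>)"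
    and "AE x in lebesgue_on \<Omega>. norm (g x) \<le> norm (f x)"
  shows "g \<in> L2 \<Omega>" "L2_norm \<Omega> g \<le> L2_norm \<Omega> f"
  using L2_dominated[OF assms(1,2), of 1] assms(3) by auto

lemma L2_scaleR: "f \<in> L2 \<Omega> \<Longrightarrow> (\<lambda>x. c *\<^sub>R f x) \<in> L2 \<Omega>"
  by (rule L2_dominated(1)[where C = "\<bar>c\<bar>"]) auto

lemma L2_norm_scaleR: "L2_norm \<Omega> (\<lambda>x. c *\<^sub>R f x) = \<bar>c\<bar> * L2_norm \<Omega> f"
  by (simp add: L2_norm_def power_mult_distrib real_sqrt_mult)

lemma L2_uminus: "f \<in> L2 \<Omega> \<Longrightarrow> (\<lambda>x. - f x) \<in> L2 \<Omega>"
  using L2_scaleR[of f \<Omega> "-1"] by simp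

lemma L2_norm_uminus [simp]: "L2_norm \<Omega> (\<lambda>x. - f x) = L2_norm \<Omega> f"
  by (simp add: L2_norm_def)

lemma L2_norm_minus_commute: "L2_norm \<Omega> (\<lambda>x. f x - g x) = L2_norm \<Omega> (\<lambda>x. g x - f x)"
  by (simp add: L2_norm_def norm_minus_commute)

lemma L2_cmult:
  fixes f :: "real^'d \<Rightarrow> complex"
  shows "f \<in> L2 \<Omega> \<Longrightarrow> (\<lambda>x. c * f x) \<in> L2 \<Omega>"
  by (rule L2_dominated(1)[where C = "norm c"]) (auto simp: norm_mult)

lemma L2_norm_cmult:
  fixes f :: "real^'d \<Rightarrow> complex"
  shows "L2_norm \<Omega> (\<lambda>x. c * f x) = norm c * L2_norm \<Omega> f"
  by (simp add: L2_norm_def norm_mult power_mult_distrib real_sqrt_mult)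

lemma L2_zero [simp]: "(\<lambda>x. 0) \<in> L2 \<Omega>" "L2_norm \<Omega> (\<lambda>x. 0) = 0"
  by (auto simp: L2_def L2_norm_def)

lemma L2_norm_cong_AE:
  fixes f :: "real^'d \<Rightarrow> 'b::euclidean_space"
  assumes "f \<in> borel_measurable (lebesgue_on \<Omega>)" "g \<in> borel_measurable (lebesgue_on \<Omega>)"
    and "AE x in lebesgue_on \<Omega>. f x = g x"
  shows "L2_norm \<Omega> f = L2_norm \<Omega> g"
proof -
  have "(LINT x|lebesgue_on \<Omega>. (norm (f x))\<^sup>2) = (LINT x|lebesgue_on \<Omega>. (norm (g x))\<^sup>2)"
    by (rule integral_cong_AE) (use assms in auto)
  then show ?thesis by (simp add: L2_norm_def)
qed

lemma L2_norm_eq_0: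
  assumes f: "f \<in> L2 \<Omega>" and 0: "L2_norm \<Omega> f = 0"
  shows "AE x in lebesgue_on \<Omega>. f x = 0"
proof -
  have "(LINT x|lebesgue_on \<Omega>. (norm (f x))\<^sup>2) = 0"
    using L2_norm_sq[of \<Omega> f] 0 by simp
  then have "AE x in lebesgue_on \<Omega>. (norm (f x))\<^sup>2 = 0"
    using integral_nonneg_eq_0_iff_AE[OF L2_integrable[OF f]] by simp
  then show ?thesis by simp
qed

lemma L2_norm_0I:
  fixes f :: "real^'d \<Rightarrow> 'b::euclidean_space"
  assumes "AE x in lebesgue_on \<Omega>. f x = 0" "f \<in> borel_measurable (lebesgue_on \<Omega>)"
  shows "L2_norm \<Omega> f = 0"
  using L2_norm_cong_AE[of f \<Omega> "\<lambda>x. 0"] assms by auto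

section \<open>Cauchy-Schwarz and products of two square integrable functions\<close>

lemma L2_mult_integrable:
  fixes f :: "real^'d \<Rightarrow> 'b::euclidean_space" and g :: "real^'d \<Rightarrow> 'c::euclidean_space"
  assumes f: "f \<in> L2 \<Omega>" and g: "g \<in> L2 \<Omega>"
  shows "integrable (lebesgue_on \<Omega>) (\<lambda>x. norm (f x) * norm (g x))"
proof (rule Bochner_Integration.integrable_bound)
  show "integrable (lebesgue_on \<Omega>) (\<lambda>x. (norm (f x))\<^sup>2 + (norm (g x))\<^sup>2)"
    using L2_integrable[OF f] L2_integrable[OF g] by simp
  show "(\<lambda>x. norm (f x) * norm (g x)) \<in> borel_measurable (lebesgue_on \<Omega>)"
    using f g by measurable
  show "AE x in lebesgue_on \<Omega>. norm (norm (f x) * norm (g x)) \<le> norm ((norm (f x))\<^sup>2 + (norm (g x))\<^sup>2)"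
  proof (rule AE_I2)
    fix x
    have "2 * (norm (f x) * norm (g x)) \<le> (norm (f x))\<^sup>2 + (norm (g x))\<^sup>2"
      using sum_squares_bound[of "norm (f x)" "norm (g x)"] by simp
    moreover have "0 \<le> norm (f x) * norm (g x)" by simp
    ultimately have "norm (f x) * norm (g x) \<le> (norm (f x))\<^sup>2 + (norm (g x))\<^sup>2" by linarith
    then show "norm (norm (f x) * norm (g x)) \<le> norm ((norm (f x))\<^sup>2 + (norm (g x))\<^sup>2)"
      by simp
  qed
qed

lemma L2_Cauchy_Schwarz:
  fixes f :: "real^'d \<Rightarrow> 'b::euclidean_space" and g :: "real^'d \<Rightarrow> 'c::euclidean_space"
  assumes f: "f \<in> L2 \<Omega>" and g: "g \<in> L2 \<Omega>"
  shows "(LINT x|lebesgue_on \<Omega>. norm (f x) * norm (g x)) \<le> L2_norm \<Omega> f * L2_norm \<Omega> g"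
proof -
  let ?M = "lebesgue_on \<Omega>" and ?a = "L2_norm \<Omega> f" and ?b = "L2_norm \<Omega> g"
  let ?I = "LINT x|?M. norm (f x) * norm (g x)"
  note int = L2_mult_integrable[OF f g] L2_integrable[OF f] L2_integrable[OF g]
  show ?thesis
  proof (cases "?a = 0 \<or> ?b = 0")
    case True
    then have "AE x in ?M. norm (f x) * norm (g x) = 0"
      using L2_norm_eq_0[OF f] L2_norm_eq_0[OF g] by auto
    then have "?I = (LINT x|?M. 0)"
      using int(1) by (intro integral_cong_AE) auto
    then show ?thesis by simp
  next
    case False
    then have ab: "0 < ?a * ?b"
      using L2_norm_nonneg[of \<Omega> f] L2_norm_nonneg[of \<Omega> g] by (simp add: less_eq_real_def)
    \<comment> \<open>With the two norms crossed over, both quadratic terms integrate to the same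
      number and the expansion reads \<open>2ab I \<le> 2 (ab)^2\<close>; the case distinction
      allows division by \<open>ab\<close>.\<close>
    have "0 \<le> (LINT x|?M. (?b * norm (f x) - ?a * norm (g x))\<^sup>2)"
      by simp
    also have "\<dots> = (LINT x|?M. ?b\<^sup>2 * (norm (f x))\<^sup>2 + ?a\<^sup>2 * (norm (g x))\<^sup>2 - 2 * (?a * ?b) * (norm (f x) * norm (g x)))"
      by (intro Bochner_Integration.integral_cong) (auto simp: power2_eq_square algebra_simps)
    also have "\<dots> = ?b\<^sup>2 * ?a\<^sup>2 + ?a\<^sup>2 * ?b\<^sup>2 - 2 * (?a * ?b) * ?I"
      using int by (simp add: L2_norm_sq)
    finally have "(?a * ?b) * ?I \<le> (?a * ?b) * (?a * ?b)"
      by (simp add: power2_eq_square algebra_simps)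
    then show ?thesis using ab by (simp add: mult_le_cancel_left_pos)
  qed
qed

text \<open>The common source of the estimates for forms and pairings: their integrands are
  dominated pointwise by a product of two norms.\<close>

lemma L2_bilinear_bound:
  fixes f :: "real^'d \<Rightarrow> 'b::euclidean_space" and g :: "real^'d \<Rightarrow> 'c::euclidean_space"
    and h :: "real^'d \<Rightarrow> 'e::{banach, second_countable_topology}"
  assumes f: "f \<in> L2 \<Omega>" and g: "g \<in> L2 \<Omega>" and h: "h \<in> borel_measurable (lebesgue_on \<Omega>)"
    and le: "AE x in lebesgue_on \<Omega>. norm (h x) \<le> C * (norm (f x) * norm (g x))" and C: "0 \<le> C"
  shows "integrable (lebesgue_on \<Omega>) h"
    and "norm (LINT x|lebesgue_on \<Omega>. h x) \<le> C * (L2_norm \<Omega> f * L2_norm \<Omega> g)"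
proof -
  have i: "integrable (lebesgue_on \<Omega>) (\<lambda>x. C * (norm (f x) * norm (g x)))"
    using L2_mult_integrable[OF f g] by simp
  show *: "integrable (lebesgue_on \<Omega>) h"
    by (rule Bochner_Integration.integrable_bound[OF i h]) (use le C in \<open>auto simp: abs_mult\<close>)
  have "norm (LINT x|lebesgue_on \<Omega>. h x) \<le> (LINT x|lebesgue_on \<Omega>. norm (h x))"
    by (rule integral_norm_bound)
  also have "\<dots> \<le> (LINT x|lebesgue_on \<Omega>. C * (norm (f x) * norm (g x)))"
    by (rule integral_mono_AE) (use * i le in auto)
  also have "\<dots> \<le> C * (L2_norm \<Omega> f * L2_norm \<Omega> g)"
    using mult_left_mono[OF L2_Cauchy_Schwarz[OF f g] C] by simp
  finally show "norm (LINT x|lebesgue_on \<Omega>. h x) \<le> C * (L2_norm \<Omega> f * L2_norm \<Omega> g)" .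
qed

lemma L2_add:
  fixes f g :: "real^'d \<Rightarrow> 'b::euclidean_space"
  assumes f: "f \<in> L2 \<Omega>" and g: "g \<in> L2 \<Omega>"
  shows "(\<lambda>x. f x + g x) \<in> L2 \<Omega>" and "L2_norm \<Omega> (\<lambda>x. f x + g x) \<le> L2_norm \<Omega> f + L2_norm \<Omega> g"
proof -
  let ?M = "lebesgue_on \<Omega>"
  note int = L2_mult_integrable[OF f g] L2_integrable[OF f] L2_integrable[OF g]
  let ?s = "\<lambda>x. (norm (f x))\<^sup>2 + 2 * (norm (f x) * norm (g x)) + (norm (g x))\<^sup>2"
  have s: "integrable ?M ?s" using int by simp
  have le: "(norm (f x + g x))\<^sup>2 \<le> ?s x" for x
  proof -
    have "(norm (f x + g x))\<^sup>2 \<le> (norm (f x) + norm (g x))\<^sup>2"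
      by (intro power_mono norm_triangle_ineq) auto
    also have "\<dots> = ?s x" by (simp add: power2_eq_square algebra_simps)
    finally show ?thesis .
  qed
  have m: "(\<lambda>x. f x + g x) \<in> borel_measurable ?M" using f g by measurable
  have i: "integrable ?M (\<lambda>x. (norm (f x + g x))\<^sup>2)"
    by (rule Bochner_Integration.integrable_bound[OF s]) (use m le in auto)
  then show "(\<lambda>x. f x + g x) \<in> L2 \<Omega>" using m by (simp add: L2_def)
  have "(L2_norm \<Omega> (\<lambda>x. f x + g x))\<^sup>2 \<le> (LINT x|?M. ?s x)"
    unfolding L2_norm_sq using i s le by (intro integral_mono) auto
  also have "\<dots> = (L2_norm \<Omega> f)\<^sup>2 + 2 * (LINT x|?M. norm (f x) * norm (g x)) + (L2_norm \<Omega> g)\<^sup>2"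
    using int by (simp add: L2_norm_sq)
  also have "\<dots> \<le> (L2_norm \<Omega> f + L2_norm \<Omega> g)\<^sup>2"
    using L2_Cauchy_Schwarz[OF f g] by (simp add: power2_eq_square algebra_simps)
  finally show "L2_norm \<Omega> (\<lambda>x. f x + g x) \<le> L2_norm \<Omega> f + L2_norm \<Omega> g"
    by (rule power2_le_imp_le) simp
qed

lemma L2_diff:
  fixes f g :: "real^'d \<Rightarrow> 'b::euclidean_space"
  assumes f: "f \<in> L2 \<Omega>" and g: "g \<in> L2 \<Omega>"
  shows "(\<lambda>x. f x - g x) \<in> L2 \<Omega>" and "L2_norm \<Omega> (\<lambda>x. f x - g x) \<le> L2_norm \<Omega> f + L2_norm \<Omega> g"
  using L2_add[OF f L2_uminus[OF g]] by auto

lemma L2_norm_diff_triangle: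
  fixes f g h :: "real^'d \<Rightarrow> 'b::euclidean_space"
  assumes "f \<in> L2 \<Omega>" "g \<in> L2 \<Omega>" "h \<in> L2 \<Omega>"
  shows "L2_norm \<Omega> (\<lambda>x. f x - h x) \<le> L2_norm \<Omega> (\<lambda>x. f x - g x) + L2_norm \<Omega> (\<lambda>x. g x - h x)"
  using L2_add(2)[OF L2_diff(1)[OF assms(1,2)] L2_diff(1)[OF assms(2,3)]] by simp

lemma L2_norm_triangle_sub:
  fixes f g :: "real^'d \<Rightarrow> 'b::euclidean_space"
  assumes "f \<in> L2 \<Omega>" "g \<in> L2 \<Omega>"
  shows "L2_norm \<Omega> f \<le> L2_norm \<Omega> g + L2_norm \<Omega> (\<lambda>x. f x - g x)"
  using L2_add(2)[OF assms(2) L2_diff(1)[OF assms]] by simp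

lemma finite_measure_lebesgue_on_bounded:
  "bounded \<Omega> \<Longrightarrow> open \<Omega> \<Longrightarrow> finite_measure (lebesgue_on (\<Omega> :: (real^'d) set))"
  by (simp add: finite_measure_lebesgue_on fmeasurableI2 lmeasurable_open)

lemma L2_const:
  fixes c :: "'b::euclidean_space"
  assumes "finite_measure (lebesgue_on \<Omega>)"
  shows "(\<lambda>x. c) \<in> L2 \<Omega>"
  using assms by (simp add: L2_def finite_measure.integrable_const)

lemma L2_bounded:
  fixes f :: "real^'d \<Rightarrow> 'b::euclidean_space"
  assumes "finite_measure (lebesgue_on \<Omega>)" "f \<in> borel_measurable (lebesgue_on \<Omega>)"
    and "\<And>x. x \<in> \<Omega> \<Longrightarrow> norm (f x) \<le> C"
  shows "f \<in> L2 \<Omega>" "0 \<le> C \<Longrightarrow> L2_norm \<Omega> f \<le> C * L2_norm \<Omega> (\<lambda>x. 1::real)"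
proof -
  have "AE x in lebesgue_on \<Omega>. norm (f x) \<le> C * norm (1::real)"
    using assms(3) by (intro AE_I2) (simp add: space_restrict_space)
  note * = L2_dominated[OF L2_const[OF assms(1), of "1::real"] assms(2) this]
  show "f \<in> L2 \<Omega>" "0 \<le> C \<Longrightarrow> L2_norm \<Omega> f \<le> C * L2_norm \<Omega> (\<lambda>x. 1::real)"
    using * by auto
qed

lemma L2_integrable_self:
  fixes f :: "real^'d \<Rightarrow> 'b::euclidean_space"
  assumes "finite_measure (lebesgue_on \<Omega>)" "f \<in> L2 \<Omega>"
  shows "integrable (lebesgue_on \<Omega>) f"
    "(LINT x|lebesgue_on \<Omega>. norm (f x)) \<le> L2_norm \<Omega> f * L2_norm \<Omega> (\<lambda>x. 1::real)"
  using L2_bilinear_bound(1)[OF assms(2) L2_const[OF assms(1), of "1::real"], of f 1]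
    L2_Cauchy_Schwarz[OF assms(2) L2_const[OF assms(1), of "1::real"]] L2_measurable[OF assms(2)]
  by auto

text \<open>Riesz--Fischer for a finite measure: a subsequence with summable steps in \<open>L\<^sup>2\<close>, hence in
  \<open>L\<^sup>1\<close>, converges almost everywhere, and Fatou's lemma gives the convergence in norm.\<close>

lemma L2_complete:
  fixes u :: "nat \<Rightarrow> real^'d \<Rightarrow> 'b::euclidean_space"
  assumes fin: "finite_measure (lebesgue_on \<Omega>)"
    and u: "\<And>n. u n \<in> L2 \<Omega>"
    and Cauchy: "\<And>e. 0 < e \<Longrightarrow> \<exists>N. \<forall>m\<ge>N. \<forall>n\<ge>N. L2_norm \<Omega> (\<lambda>x. u m x - u n x) < e"
  obtains v where "v \<in> L2 \<Omega>" "(\<lambda>n. L2_norm \<Omega> (\<lambda>x. u n x - v x)) \<longlonglongrightarrow> 0"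
proof -
  let ?M = "lebesgue_on \<Omega>"
  note [measurable] = L2_measurable[OF u]
  have "\<forall>k. \<exists>N. \<forall>m\<ge>N. \<forall>n\<ge>N. L2_norm \<Omega> (\<lambda>x. u m x - u n x) < (1/2)^k"
    using Cauchy by simp
  then obtain N where N: "\<And>k m n. m \<ge> N k \<Longrightarrow> n \<ge> N k \<Longrightarrow> L2_norm \<Omega> (\<lambda>x. u m x - u n x) < (1/2)^k"
    by metis
  \<comment> \<open>The partial sum dominates \<open>N k\<close> and makes the indices
    nondecreasing; the summand \<open>k\<close> forces them to infinity even if every
    \<open>N i\<close> is 0.\<close>
  define r where "r k = (\<Sum>i\<le>k. N i) + k" for k
  have rN: "r k \<ge> N k" for k
    unfolding r_def using member_le_sum[of k "{..k}" N] by simp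
  have rmono: "r k \<le> r (Suc k)" for k by (simp add: r_def)
  have rk: "r k \<ge> k" for k by (simp add: r_def)
  define w where "w k x = u (r (Suc k)) x - u (r k) x" for k x
  have wL2: "w k \<in> L2 \<Omega>" for k unfolding w_def by (intro L2_diff u)
  have wn: "L2_norm \<Omega> (w k) \<le> (1/2)^k" for k
    unfolding w_def using N[of k "r (Suc k)" "r k"] rN[of k] rmono[of k] by simp
  let ?c = "L2_norm \<Omega> (\<lambda>x. 1::real)"
  have wint: "integrable ?M (w k)" for k by (rule L2_integrable_self(1)[OF fin wL2])
  have w1: "(LINT x|?M. norm (w k x)) \<le> (1/2)^k * ?c" for k
    using L2_integrable_self(2)[OF fin wL2[of k]] mult_right_mono[OF wn[of k], of ?c] by simp
  have "AE x in ?M. summable (\<lambda>k. norm (w k x))"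
  proof -
    have "(\<integral>\<^sup>+x. (\<Sum>k. ennreal (norm (w k x))) \<partial>?M) = (\<Sum>k. \<integral>\<^sup>+x. ennreal (norm (w k x)) \<partial>?M)"
      using wint by (intro nn_integral_suminf) auto
    also have "\<dots> = (\<Sum>k. ennreal (LINT x|?M. norm (w k x)))"
      using wint by (simp add: nn_integral_eq_integral)
    also have "\<dots> \<le> (\<Sum>k. ennreal ((1/2)^k * ?c))"
      using w1 by (intro suminf_le) (auto simp: ennreal_leI)
    also have "\<dots> = ennreal (\<Sum>k. (1/2)^k * ?c)"
      by (rule suminf_ennreal2) (auto intro!: summable_mult2 summable_geometric)
    also have "\<dots> < top" by simp
    finally have "(\<integral>\<^sup>+x. (\<Sum>k. ennreal (norm (w k x))) \<partial>?M) \<noteq> \<infinity>" by simp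
    then have "AE x in ?M. (\<Sum>k. ennreal (norm (w k x))) \<noteq> \<infinity>"
      using wint by (intro nn_integral_noteq_infinite) auto
    then show ?thesis
    proof eventually_elim
      case (elim x)
      then show ?case by (intro summable_suminf_not_top) auto
    qed
  qed
  then have conv: "AE x in ?M. convergent (\<lambda>k. u (r k) x)"
  proof eventually_elim
    case (elim x)
    then have s: "summable (\<lambda>k. w k x)" by (rule summable_norm_cancel)
    have "(\<Sum>i<k. w i x) = u (r k) x - u (r 0) x" for k
      unfolding w_def by (rule sum_lessThan_telescope)
    then have eq: "(\<lambda>k. u (r k) x) = (\<lambda>k. u (r 0) x + (\<Sum>i<k. w i x))"
      by (intro ext) (metis add.commute diff_add_cancel)
    have "convergent (\<lambda>k. u (r 0) x + (\<Sum>i<k. w i x))"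
      using s by (intro convergent_add convergent_const) (simp add: summable_iff_convergent)
    then show ?case unfolding eq .
  qed
  define v where "v x = lim (\<lambda>k. u (r k) x)" for x
  have vm[measurable]: "v \<in> borel_measurable ?M"
    unfolding v_def by measurable
  have lim: "AE x in ?M. (\<lambda>k. u (r k) x) \<longlonglongrightarrow> v x"
    using conv by eventually_elim (simp add: v_def convergent_LIMSEQ_iff)
  \<comment> \<open>Fatou along \<open>r\<close>: the distances from \<open>u m\<close> to
    \<open>u (r k)\<close> are at most \<open>e\<close> once \<open>r k \<ge> n0\<close>, and
    \<open>u (r k)\<close> tends to \<open>v\<close> almost everywhere.\<close>
  have key: "(\<integral>\<^sup>+x. ennreal ((norm (u m x - v x))\<^sup>2) \<partial>?M) \<le> ennreal (e\<^sup>2)"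
    if e: "0 < e" and m: "\<And>n. n \<ge> n0 \<Longrightarrow> L2_norm \<Omega> (\<lambda>x. u m x - u n x) \<le> e" for e m n0
  proof -
    have "(\<integral>\<^sup>+x. ennreal ((norm (u m x - v x))\<^sup>2) \<partial>?M)
        = (\<integral>\<^sup>+x. liminf (\<lambda>k. ennreal ((norm (u m x - u (r k) x))\<^sup>2)) \<partial>?M)"
    proof (rule nn_integral_cong_AE, use lim in eventually_elim)
      fix x assume "(\<lambda>k. u (r k) x) \<longlonglongrightarrow> v x"
      then have "(\<lambda>k. ennreal ((norm (u m x - u (r k) x))\<^sup>2)) \<longlonglongrightarrow> ennreal ((norm (u m x - v x))\<^sup>2)"
        by (intro tendsto_ennrealI tendsto_intros)
      then show "ennreal ((norm (u m x - v x))\<^sup>2) = liminf (\<lambda>k. ennreal ((norm (u m x - u (r k) x))\<^sup>2))"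
        by (intro lim_imp_Liminf[symmetric]) auto
    qed
    also have "\<dots> \<le> liminf (\<lambda>k. \<integral>\<^sup>+x. ennreal ((norm (u m x - u (r k) x))\<^sup>2) \<partial>?M)"
      by (rule nn_integral_liminf) auto
    also have "\<dots> \<le> liminf (\<lambda>k::nat. ennreal (e\<^sup>2))"
    proof (rule Liminf_mono)
      show "\<forall>\<^sub>F k in sequentially. (\<integral>\<^sup>+x. ennreal ((norm (u m x - u (r k) x))\<^sup>2) \<partial>?M) \<le> ennreal (e\<^sup>2)"
        unfolding eventually_sequentially
      proof (intro exI[of _ n0] allI impI)
        fix k assume "n0 \<le> k"
        then have "L2_norm \<Omega> (\<lambda>x. u m x - u (r k) x) \<le> e" using m rk[of k] by simp
        then have "(L2_norm \<Omega> (\<lambda>x. u m x - u (r k) x))\<^sup>2 \<le> e\<^sup>2" by (intro power_mono) auto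
        moreover have "(\<integral>\<^sup>+x. ennreal ((norm (u m x - u (r k) x))\<^sup>2) \<partial>?M)
            = ennreal ((L2_norm \<Omega> (\<lambda>x. u m x - u (r k) x))\<^sup>2)"
          unfolding L2_norm_sq using L2_integrable[OF L2_diff(1)[OF u u]]
          by (intro nn_integral_eq_integral) auto
        ultimately show "(\<integral>\<^sup>+x. ennreal ((norm (u m x - u (r k) x))\<^sup>2) \<partial>?M) \<le> ennreal (e\<^sup>2)"
          by (simp add: ennreal_leI)
      qed
    qed
    also have "\<dots> = ennreal (e\<^sup>2)" by (simp add: Liminf_const)
    finally show ?thesis .
  qed
  have diffL2: "(\<lambda>x. u m x - v x) \<in> L2 \<Omega> \<and> L2_norm \<Omega> (\<lambda>x. u m x - v x) \<le> e"
    if "0 < e" and "\<And>n. n \<ge> n0 \<Longrightarrow> L2_norm \<Omega> (\<lambda>x. u m x - u n x) \<le> e" for e m n0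
  proof -
    note k = key[OF that]
    have i: "integrable ?M (\<lambda>x. (norm (u m x - v x))\<^sup>2)"
      by (rule integrableI_bounded) (use k in \<open>auto simp: le_less_trans[OF k]\<close>)
    moreover have "(L2_norm \<Omega> (\<lambda>x. u m x - v x))\<^sup>2 \<le> e\<^sup>2"
      unfolding L2_norm_sq using k i that(1)
      by (simp add: nn_integral_eq_integral)
    ultimately show ?thesis using that(1) by (auto simp: L2_def intro: power2_le_imp_le)
  qed
  have ev: "\<exists>n0. \<forall>m\<ge>n0. (\<lambda>x. u m x - v x) \<in> L2 \<Omega> \<and> L2_norm \<Omega> (\<lambda>x. u m x - v x) \<le> e" if "0 < e" for e
  proof -
    obtain n0 where "\<forall>m\<ge>n0. \<forall>n\<ge>n0. L2_norm \<Omega> (\<lambda>x. u m x - u n x) < e" using Cauchy[OF \<open>0 < e\<close>] by blast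
    then have "\<And>m n. n0 \<le> m \<Longrightarrow> n0 \<le> n \<Longrightarrow> L2_norm \<Omega> (\<lambda>x. u m x - u n x) \<le> e"
      by (meson less_imp_le)
    then show ?thesis using diffL2[OF that, of n0] by blast
  qed
  obtain n1 where "(\<lambda>x. u n1 x - v x) \<in> L2 \<Omega>" using ev[of 1] by auto
  then have vL2: "v \<in> L2 \<Omega>"
    using L2_diff(1)[OF u[of n1], of "\<lambda>x. u n1 x - v x"] by simp
  have "(\<lambda>n. L2_norm \<Omega> (\<lambda>x. u n x - v x)) \<longlonglongrightarrow> 0"
  proof (rule LIMSEQ_I)
    fix e :: real assume "0 < e"
    then obtain n0 where "\<forall>m\<ge>n0. L2_norm \<Omega> (\<lambda>x. u m x - v x) \<le> e / 2" using ev[of "e/2"] by auto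
    then show "\<exists>no. \<forall>n\<ge>no. norm (L2_norm \<Omega> (\<lambda>x. u n x - v x) - 0) < e"
      using \<open>0 < e\<close> by (intro exI[of _ n0]) (auto simp: le_less_trans)
  qed
  then show thesis using vL2 that by blast
qed

section \<open>Smooth functions and mollifiers\<close>

abbreviation pdiff :: "'d::finite \<Rightarrow> (real^'d \<Rightarrow> complex) \<Rightarrow> real^'d \<Rightarrow> complex" where
  "pdiff i f \<equiv> (\<lambda>x. frechet_derivative f (at x) (axis i 1))"

definition smooth :: "(real^'d \<Rightarrow> complex) \<Rightarrow> bool" where
  "smooth f \<longleftrightarrow> (\<forall>k. C_k k f)"

lemma pdiff_eqI: "(f has_derivative f') (at x) \<Longrightarrow> pdiff i f x = f' (axis i 1)"
  using frechet_derivative_at by metis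

text \<open>\<open>C_k\<close> recurses to the partial derivatives, so the function has to vary in
  the induction on the order. A set closed under \<open>pdiff\<close> serves as the invariant, in
  the manner of a coinduction.\<close>

lemma smooth_coinduct:
  assumes "f \<in> S" and diff: "\<And>f x. f \<in> S \<Longrightarrow> f differentiable (at x)"
    and pd: "\<And>f i. f \<in> S \<Longrightarrow> pdiff i f \<in> S"
  shows "smooth f"
proof -
  have "C_k k f" if "f \<in> S" for k f
    using that
  proof (induction k arbitrary: f)
    case 0
    then show ?case
      using diff by (auto simp: continuous_on_eq_continuous_at intro: differentiable_imp_continuous_within)
  next
    case (Suc k)
    then show ?case using diff pd by simp
  qed
  then show ?thesis using assms(1) by (simp add: smooth_def)
qed

lemma smooth_differentiable: "smooth f \<Longrightarrow> f differentiable (at x)"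
  using C_k.simps(2)[of 0 f] by (simp add: smooth_def del: C_k.simps)

lemma smooth_has_derivative: "smooth f \<Longrightarrow> (f has_derivative frechet_derivative f (at x)) (at x)"
  using smooth_differentiable frechet_derivative_works by blast

lemma smooth_pdiff: "smooth f \<Longrightarrow> smooth (pdiff i f)"
  unfolding smooth_def by (metis C_k.simps(2))

lemma smooth_continuous: "smooth f \<Longrightarrow> continuous_on S f"
  using C_k.simps(1)[of f] by (auto simp: smooth_def intro: continuous_on_subset simp del: C_k.simps)

text \<open>Polynomial expressions in the functions of \<open>B\<close>. By the product rule this
  set is closed under \<open>pdiff\<close> once it contains the derivatives of its
  generators.\<close>

inductive_set fun_alg :: "(real^'d \<Rightarrow> complex) set \<Rightarrow> (real^'d \<Rightarrow> complex) set" for B where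
  base: "f \<in> B \<Longrightarrow> f \<in> fun_alg B"
| const: "(\<lambda>x. c) \<in> fun_alg B"
| add: "f \<in> fun_alg B \<Longrightarrow> g \<in> fun_alg B \<Longrightarrow> (\<lambda>x. f x + g x) \<in> fun_alg B"
| mult: "f \<in> fun_alg B \<Longrightarrow> g \<in> fun_alg B \<Longrightarrow> (\<lambda>x. f x * g x) \<in> fun_alg B"

text \<open>Only first derivatives of the generators are examined: if these are again polynomial
  expressions in the generators, so are all higher derivatives. This suits families that
  differentiate into each other, such as \<open>flat\<close>.\<close>

lemma fun_alg_smooth:
  assumes diff: "\<And>f x. f \<in> B \<Longrightarrow> f differentiable (at x)"
    and pd: "\<And>f i. f \<in> B \<Longrightarrow> pdiff i f \<in> fun_alg B"
    and f: "f \<in> fun_alg B"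
  shows "smooth f"
proof (rule smooth_coinduct[OF f])
  show d: "f differentiable (at x)" if "f \<in> fun_alg B" for f x
    using that by induction (auto intro: diff differentiable_add differentiable_mult)
  show "pdiff i f \<in> fun_alg B" if "f \<in> fun_alg B" for f i
    using that
  proof induction
    case (base f)
    then show ?case by (rule pd)
  next
    case (const c)
    have "pdiff i (\<lambda>x. c) = (\<lambda>x. 0)" by (rule ext) simp
    then show ?case using fun_alg.const[of 0 B] by simp
  next
    case (add f g)
    have "pdiff i (\<lambda>x. f x + g x) = (\<lambda>x. pdiff i f x + pdiff i g x)"
    proof (rule ext, rule pdiff_eqI[where f' = "\<lambda>h. frechet_derivative f (at x) h + frechet_derivative g (at x) h" for x, simplified])
      show "((\<lambda>x. f x + g x) has_derivative (\<lambda>h. frechet_derivative f (at x) h + frechet_derivative g (at x) h)) (at x)" for x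
        by (intro has_derivative_add frechet_derivative_works[THEN iffD1] d add.hyps)
    qed
    then show ?case using fun_alg.add[OF add.IH] by simp
  next
    case (mult f g)
    have "pdiff i (\<lambda>x. f x * g x) = (\<lambda>x. f x * pdiff i g x + pdiff i f x * g x)"
    proof (rule ext, rule pdiff_eqI[where f' = "\<lambda>h. f x * frechet_derivative g (at x) h + frechet_derivative f (at x) h * g x" for x, simplified])
      show "((\<lambda>x. f x * g x) has_derivative (\<lambda>h. f x * frechet_derivative g (at x) h + frechet_derivative f (at x) h * g x)) (at x)" for x
        by (intro has_derivative_mult frechet_derivative_works[THEN iffD1] d mult.hyps)
    qed
    then show ?case
      using fun_alg.add[OF fun_alg.mult[OF mult.hyps(1) mult.IH(2)] fun_alg.mult[OF mult.IH(1) mult.hyps(2)]] by simp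
  qed
qed

lemma pdiff_mult:
  assumes "smooth f" "smooth g"
  shows "pdiff i (\<lambda>x. f x * g x) x = f x * pdiff i g x + pdiff i f x * g x"
  using has_derivative_mult[OF smooth_has_derivative[OF assms(1)] smooth_has_derivative[OF assms(2)]]
  by (rule pdiff_eqI)

lemma smooth_alg: "f \<in> fun_alg (Collect smooth) \<Longrightarrow> smooth f"
  by (erule fun_alg_smooth[rotated 2]) (auto intro: smooth_differentiable fun_alg.base smooth_pdiff)

lemma smooth_mult: "smooth f \<Longrightarrow> smooth g \<Longrightarrow> smooth (\<lambda>x. f x * g x)"
  by (intro smooth_alg fun_alg.mult fun_alg.base) auto

lemma smooth_add: "smooth f \<Longrightarrow> smooth g \<Longrightarrow> smooth (\<lambda>x. f x + g x)"
  by (intro smooth_alg fun_alg.add fun_alg.base) auto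

lemma smooth_const: "smooth (\<lambda>x. c)"
  by (intro smooth_alg fun_alg.const)

lemma has_derivative_reflect:
  assumes "(f has_derivative f') (at (a - x :: real^'d))"
  shows "((\<lambda>x. f (a - x) :: complex) has_derivative (\<lambda>h. f' (- h))) (at x)"
proof -
  have "((\<lambda>x. a - x) has_derivative (\<lambda>h. - h)) (at x)"
    by (auto intro!: derivative_eq_intros)
  from diff_chain_at[OF this assms] show ?thesis by (simp add: o_def)
qed

lemma pdiff_reflect:
  assumes "smooth f"
  shows "pdiff i (\<lambda>x. f (a - x)) x = - pdiff i f (a - x)"
proof -
  have "pdiff i (\<lambda>x. f (a - x)) x = frechet_derivative f (at (a - x)) (- axis i 1)"
    by (intro pdiff_eqI has_derivative_reflect smooth_has_derivative assms)
  also have "\<dots> = - pdiff i f (a - x)"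
    using has_derivative_bounded_linear[OF smooth_has_derivative[OF assms]] linear_neg bounded_linear.linear by blast
  finally show ?thesis .
qed

lemma smooth_reflect:
  fixes f :: "real^'d \<Rightarrow> complex"
  assumes "smooth f"
  shows "smooth (\<lambda>x. f (a - x))"
proof (rule smooth_coinduct[where S = "{\<lambda>x. g (a - x) |g. smooth g}"])
  show "(\<lambda>x. f (a - x)) \<in> {\<lambda>x. g (a - x) |g. smooth g}" using assms by blast
  fix h :: "real^'d \<Rightarrow> complex" assume "h \<in> {\<lambda>x. g (a - x) |g. smooth g}"
  then obtain g where g: "h = (\<lambda>x. g (a - x))" "smooth g" by blast
  show "h differentiable (at x)" for x
    using has_derivative_reflect[OF smooth_has_derivative[OF g(2)]] unfolding g(1) differentiable_def by blast
  show "pdiff i h \<in> {\<lambda>x. g (a - x) |g. smooth g}" for i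
  proof -
    have "pdiff i h = (\<lambda>x. (\<lambda>y. (-1) * pdiff i g y) (a - x))"
      unfolding g(1) by (rule ext) (simp add: pdiff_reflect[OF g(2)])
    moreover have "smooth (\<lambda>y. (-1) * pdiff i g y)"
      by (intro smooth_mult smooth_const smooth_pdiff g(2))
    ultimately show ?thesis
      by (intro CollectI exI[of _ "\<lambda>y. (-1) * pdiff i g y"] conjI)
  qed
qed

lemma frechet_derivative_eq_sum:
  assumes "smooth f"
  shows "frechet_derivative f (at x) h = (\<Sum>i\<in>UNIV. (h $ i) *\<^sub>R pdiff i f x)"
proof -
  have l: "linear (frechet_derivative f (at x))"
    using has_derivative_bounded_linear[OF smooth_has_derivative[OF assms]] bounded_linear.linear by blast
  have "h = (\<Sum>i\<in>UNIV. (h $ i) *\<^sub>R axis i 1)"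
    using basis_expansion[of h] by (simp add: scalar_mult_eq_scaleR)
  then have "frechet_derivative f (at x) h = frechet_derivative f (at x) (\<Sum>i\<in>UNIV. (h $ i) *\<^sub>R axis i 1)"
    by simp
  also have "\<dots> = (\<Sum>i\<in>UNIV. (h $ i) *\<^sub>R pdiff i f x)"
    by (simp add: linear_sum[OF l] linear_cmul[OF l])
  finally show ?thesis .
qed

text \<open>\<open>t\<^sup>-\<^sup>m exp (-1/t)\<close>, extended by 0 to \<open>t \<le> 0\<close>; differentiating maps this family to its span.\<close>

definition flat :: "nat \<Rightarrow> real \<Rightarrow> real" where
  "flat m t = (if t \<le> 0 then 0 else (1/t)^m * exp (-(1/t)))"

text \<open>For \<open>s = 1/t\<close> the number \<open>s^(m+2) / fact (m+2)\<close> is a single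
  term of the exponential series of \<open>s\<close>. The two extra powers leave a factor
  \<open>t\<^sup>2\<close>, which makes the derivative at 0 exist and vanish for every
  \<open>m\<close>.\<close>

lemma flat_le: "\<bar>flat m t\<bar> \<le> fact (m + 2) * t\<^sup>2"
proof (cases "t \<le> 0")
  case True
  then show ?thesis by (simp add: flat_def)
next
  case False
  define s where "s = 1/t"
  have s: "s > 0" "t = 1/s" using False by (auto simp: s_def)
  have "(\<Sum>k\<in>{m+2}. s^k /\<^sub>R fact k) \<le> (\<Sum>k. s^k /\<^sub>R fact k)"
    using s by (intro sum_le_suminf summable_exp_generic) auto
  then have "s^(m+2) / fact (m+2) \<le> exp s"
    by (simp add: exp_def divide_inverse mult.commute)
  then have "s^(m+2) \<le> exp s * fact (m+2)" by (simp only: divide_le_eq) (simp add: fact_gt_zero)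
  then have "s^m * exp (-s) \<le> fact (m+2) * (1/s)\<^sup>2"
    using s by (simp add: exp_minus field_simps power2_eq_square power_add)
  moreover have "0 \<le> s^m * exp (-s)" using s by simp
  ultimately show ?thesis using False unfolding flat_def s_def[symmetric] s(2) using s by simp
qed

lemma flat_deriv: "(flat m has_real_derivative (flat (m+2) t - m * flat (m+1) t)) (at t)"
proof -
  consider "t < 0" | "t = 0" | "t > 0" by linarith
  then show ?thesis
  proof cases
    case 1
    have "((\<lambda>_. 0) has_real_derivative 0) (at t)" by simp
    then have "(flat m has_real_derivative 0) (at t)"
      by (rule has_field_derivative_transform_within_open[where S = "{..<0}"]) (use 1 in \<open>auto simp: flat_def\<close>)
    then show ?thesis using 1 by (simp add: flat_def)
  next
    case 2
    have "((\<lambda>h. (flat m (0 + h) - flat m 0) / h) \<longlongrightarrow> 0) (at 0)"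
    proof (rule Lim_null_comparison)
      show "((\<lambda>h. fact (m + 2) * \<bar>h\<bar>) \<longlongrightarrow> 0) (at (0::real))"
        by (rule tendsto_eq_intros | simp)+
      show "\<forall>\<^sub>F h in at 0. norm ((flat m (0 + h) - flat m 0) / h) \<le> fact (m + 2) * \<bar>h\<bar>"
        unfolding eventually_at_filter
      proof (intro always_eventually allI impI)
        fix h :: real assume "h \<noteq> 0"
        then show "norm ((flat m (0 + h) - flat m 0) / h) \<le> fact (m + 2) * \<bar>h\<bar>"
          using flat_le[of m h] by (simp add: flat_def[of m 0] divide_le_eq power2_eq_square abs_mult_self_eq mult.assoc del: fact_Suc)
      qed
    qed
    then show ?thesis using 2 by (simp add: DERIV_def flat_def)
  next
    case 3
    have "((\<lambda>t. (1/t)^m * exp (-(1/t))) has_real_derivative (flat (m+2) t - m * flat (m+1) t)) (at t)"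
      using 3
      by (auto intro!: derivative_eq_intros simp: flat_def field_simps power2_eq_square)
        (cases m; simp add: field_simps)
    then show ?thesis
      by (rule has_field_derivative_transform_within_open[where S = "{0<..}"]) (use 3 in \<open>auto simp: flat_def\<close>)
  qed
qed

lemma smooth_flat: "smooth (\<lambda>x::real^'d. complex_of_real (flat m (r - x \<bullet> x)))"
proof -
  \<comment> \<open>The coordinate functions belong to the generators because the chain rule applied
    to \<open>r - x \<bullet> x\<close> produces the factor \<open>-2 * x $ j\<close>.\<close>
  define B :: "(real^'d \<Rightarrow> complex) set" where
    "B = range (\<lambda>m x. complex_of_real (flat m (r - x \<bullet> x))) \<union> range (\<lambda>i x. complex_of_real (x $ i))"
  have d1: "((\<lambda>x. complex_of_real (flat m (r - x \<bullet> x))) has_derivative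
      (\<lambda>h. complex_of_real ((flat (m+2) (r - x \<bullet> x) - m * flat (m+1) (r - x \<bullet> x)) * (- 2 * (x \<bullet> h))))) (at x)"
    for m and x :: "real^'d"
  proof -
    have "((\<lambda>x. r - x \<bullet> x) has_derivative (\<lambda>h. - 2 * (x \<bullet> h))) (at x)"
      by (auto intro!: derivative_eq_intros simp: inner_commute)
    from has_derivative_compose[OF this flat_deriv[unfolded has_field_derivative_def]]
    show ?thesis by (intro has_derivative_of_real)
  qed
  have d2: "((\<lambda>x. complex_of_real (x $ i)) has_derivative (\<lambda>h. complex_of_real (h $ i))) (at x)"
    for i and x :: "real^'d"
    by (intro has_derivative_of_real bounded_linear_imp_has_derivative bounded_linear_vec_nth)
  show ?thesis
  proof (rule fun_alg_smooth[of B])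
    show "(\<lambda>x. complex_of_real (flat m (r - x \<bullet> x))) \<in> fun_alg B"
      by (rule fun_alg.base) (auto simp: B_def)
    fix f :: "real^'d \<Rightarrow> complex" assume "f \<in> B"
    then consider m where "f = (\<lambda>x. complex_of_real (flat m (r - x \<bullet> x)))" | i where "f = (\<lambda>x. complex_of_real (x $ i))"
      by (auto simp: B_def)
    note cases = this
    show "f differentiable (at x)" for x
      using d1[THEN differentiableI] d2[THEN differentiableI] by (cases rule: cases) blast+
    show "pdiff j f \<in> fun_alg B" for j
    proof (cases rule: cases)
      case (1 m)
      have "pdiff j f = (\<lambda>x. (of_real (flat (m+2) (r - x \<bullet> x)) + (- of_nat m) * of_real (flat (m+1) (r - x \<bullet> x)))
          * ((-2) * complex_of_real (x $ j)))"
        unfolding 1 by (rule ext) (simp add: pdiff_eqI[OF d1] inner_axis)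
      moreover have "\<dots> \<in> fun_alg B"
        by (intro fun_alg.mult fun_alg.add fun_alg.const fun_alg.base) (auto simp: B_def)
      ultimately show ?thesis by simp
    next
      case (2 i)
      have "pdiff j f = (\<lambda>x. complex_of_real ((axis j 1 :: real^'d) $ i))"
        unfolding 2 by (rule ext) (simp add: pdiff_eqI[OF d2])
      then show ?thesis using fun_alg.const by simp
    qed
  qed
qed

subsection \<open>Test functions\<close>

lemma test_funI:
  assumes "smooth f" "compact S" "S \<subseteq> \<Omega>" "\<And>x. x \<notin> S \<Longrightarrow> f x = 0"
  shows "f \<in> test_fun \<Omega>"
proof -
  have "{x. f x \<noteq> 0} \<subseteq> S" using assms(4) by blast
  then have "closure {x. f x \<noteq> 0} \<subseteq> S" using assms(2) by (simp add: closure_minimal compact_imp_closed)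
  then show ?thesis using assms
    by (auto simp: test_fun_def smooth_def intro: compact_closure[THEN iffD2] bounded_subset[OF compact_imp_bounded])
qed

lemma test_fun_smooth: "f \<in> test_fun \<Omega> \<Longrightarrow> smooth f"
  by (simp add: test_fun_def smooth_def)

text \<open>The closed support is taken for \<open>S\<close>: its complement is open, so
  \<open>f\<close> vanishes near each point outside and the derivatives vanish there as
  well.\<close>

lemma test_funE:
  fixes f :: "real^'d \<Rightarrow> complex"
  assumes "f \<in> test_fun \<Omega>"
  obtains S where "compact S" "S \<subseteq> \<Omega>" "\<And>x. x \<notin> S \<Longrightarrow> f x = 0" "\<And>x i. x \<notin> S \<Longrightarrow> pdiff i f x = 0"
proof
  let ?S = "closure {x. f x \<noteq> 0}"
  show "compact ?S" "?S \<subseteq> \<Omega>" using assms by (auto simp: test_fun_def)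
  show f0: "f x = 0" if "x \<notin> ?S" for x
    using that closure_subset[of "{x. f x \<noteq> 0}"] by blast
  show "pdiff i f x = 0" if "x \<notin> ?S" for x i
  proof -
    have "(f has_derivative (\<lambda>h. 0)) (at x)"
    proof (rule has_derivative_transform_within_open)
      show "((\<lambda>x. 0) has_derivative (\<lambda>h. 0)) (at x)" by simp
      show "open (- ?S)" "x \<in> - ?S" using that by auto
      show "0 = f y" if "y \<in> - ?S" for y using f0[of y] that by simp
    qed
    then show ?thesis by (rule pdiff_eqI)
  qed
qed

lemma test_fun_mono: "\<Omega> \<subseteq> \<Omega>1 \<Longrightarrow> f \<in> test_fun \<Omega> \<Longrightarrow> f \<in> test_fun \<Omega>1"
  by (auto simp: test_fun_def)

lemma test_fun_UNIV: "f \<in> test_fun \<Omega> \<Longrightarrow> f \<in> test_fun UNIV"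
  by (rule test_fun_mono) auto

lemma test_fun_pdiff: "f \<in> test_fun \<Omega> \<Longrightarrow> pdiff i f \<in> test_fun \<Omega>"
  by (rule test_funE, assumption, rule test_funI[OF smooth_pdiff[OF test_fun_smooth]])

lemma test_fun_mult: "f \<in> test_fun \<Omega> \<Longrightarrow> smooth g \<Longrightarrow> (\<lambda>x. f x * g x) \<in> test_fun \<Omega>"
  by (rule test_funE, assumption, rule test_funI) (auto intro: smooth_mult test_fun_smooth)

lemma test_fun_cmult: "f \<in> test_fun \<Omega> \<Longrightarrow> (\<lambda>x. c * f x) \<in> test_fun \<Omega>"
  using test_fun_mult[OF _ smooth_const, of f \<Omega> c] by (simp add: mult.commute)

lemma test_fun_add:
  assumes "f \<in> test_fun \<Omega>" "g \<in> test_fun \<Omega>"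
  shows "(\<lambda>x. f x + g x) \<in> test_fun \<Omega>"
proof -
  obtain S where "compact S" "S \<subseteq> \<Omega>" "\<And>x. x \<notin> S \<Longrightarrow> f x = 0" using test_funE[OF assms(1)] by metis
  moreover obtain T where "compact T" "T \<subseteq> \<Omega>" "\<And>x. x \<notin> T \<Longrightarrow> g x = 0" using test_funE[OF assms(2)] by metis
  ultimately show ?thesis using assms
    by (intro test_funI[where S = "S \<union> T"] smooth_add) (auto intro: test_fun_smooth)
qed

lemma test_fun_reflect:
  assumes f: "f \<in> test_fun UNIV"
  shows "(\<lambda>x. f (a - x)) \<in> test_fun UNIV"
proof -
  obtain S where S: "compact S" "\<And>x. x \<notin> S \<Longrightarrow> f x = 0" using test_funE[OF f] by metis
  have "compact ((\<lambda>x. a - x) ` S)"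
    by (intro compact_continuous_image S continuous_intros)
  then show ?thesis
  proof (rule test_funI[rotated])
    fix x assume x: "x \<notin> (\<lambda>x. a - x) ` S"
    have "a - x \<notin> S" using x by (metis image_eqI diff_diff_eq2 add_diff_cancel_left')
    then show "f (a - x) = 0" by (rule S)
  qed (auto intro: smooth_reflect test_fun_smooth f)
qed

lemma test_fun_bounded:
  fixes f :: "real^'d \<Rightarrow> complex"
  assumes "f \<in> test_fun \<Omega>"
  obtains C where "C > 0" "\<And>x. norm (f x) \<le> C"
proof -
  obtain S where S: "compact S" "\<And>x. x \<notin> S \<Longrightarrow> f x = 0" using test_funE[OF assms] by metis
  have "bounded (f ` S)"
    by (intro compact_imp_bounded compact_continuous_image S smooth_continuous test_fun_smooth[OF assms])
  then obtain C where "C > 0" "\<And>x. x \<in> S \<Longrightarrow> norm (f x) \<le> C" by (auto simp: bounded_pos)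
  then have "norm (f x) \<le> C" for x using S(2)[of x] by (cases "x \<in> S") auto
  then show thesis using that \<open>C > 0\<close> by blast
qed

lemma test_fun_uniformly_continuous:
  fixes f :: "real^'d \<Rightarrow> complex"
  assumes "f \<in> test_fun \<Omega>" and "e > 0"
  obtains d where "d > 0" "\<And>x y. dist x y < d \<Longrightarrow> dist (f x) (f y) < e"
proof -
  obtain S where S: "compact S" "\<And>x. x \<notin> S \<Longrightarrow> f x = 0" using test_funE[OF assms(1)] by metis
  obtain R where R: "\<And>x. x \<in> S \<Longrightarrow> norm x \<le> R"
    using compact_imp_bounded[OF S(1)] unfolding bounded_iff by blast
  \<comment> \<open>If one of two points at distance below 1 lies in \<open>S\<close>, both lie in
    this ball; if neither does, both values are 0.\<close>
  have "uniformly_continuous_on (cball 0 (R+1)) f"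
    by (intro compact_uniformly_continuous smooth_continuous test_fun_smooth[OF assms(1)]) auto
  then obtain d where d: "d > 0" "\<And>x y. x \<in> cball 0 (R+1) \<Longrightarrow> y \<in> cball 0 (R+1) \<Longrightarrow> dist x y < d \<Longrightarrow> dist (f x) (f y) < e"
    using \<open>e > 0\<close> unfolding uniformly_continuous_on_def by (metis dist_commute)
  show thesis
  proof (rule that[of "min d 1"])
    fix x y :: "real^'d" assume xy: "dist x y < min d 1"
    show "dist (f x) (f y) < e"
    proof (cases "x \<in> S \<or> y \<in> S")
      case True
      then have "norm x \<le> R \<or> norm y \<le> R" using R by auto
      then have "norm x \<le> R + 1 \<and> norm y \<le> R + 1"
        using xy norm_triangle_ineq2[of x y] norm_triangle_ineq2[of y x] by (auto simp: dist_norm norm_minus_commute)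
      then show ?thesis using d(2)[of x y] xy by simp
    next
      case False
      then show ?thesis using S(2)[of x] S(2)[of y] \<open>e > 0\<close> by simp
    qed
  qed (use d in auto)
qed

text \<open>Uniform continuity of the partial derivatives and the mean value inequality on
  \<open>ball x d\<close> give a first order remainder that is small uniformly in \<open>x\<close>.
  The later estimates for derivatives of convolutions and for translations integrate this
  remainder.\<close>

lemma test_fun_uniformly_differentiable:
  fixes f :: "real^'d \<Rightarrow> complex"
  assumes f: "f \<in> test_fun \<Omega>" and "e > 0"
  obtains d where "d > 0"
    "\<And>x h. norm h < d \<Longrightarrow> norm (f (x + h) - f x - (\<Sum>i\<in>UNIV. (h $ i) *\<^sub>R pdiff i f x)) \<le> e * norm h"
proof -
  let ?n = "real CARD('d)"
  have sm: "smooth f" by (rule test_fun_smooth[OF f])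
  have e': "e / ?n > 0" using \<open>e > 0\<close> by simp
  have "\<exists>d>0. \<forall>x y. dist x y < d \<longrightarrow> dist (pdiff i f x) (pdiff i f y) < e / ?n" for i
    using test_fun_uniformly_continuous[OF test_fun_pdiff[OF f] e'] by metis
  then obtain D where D: "\<And>i. D i > 0" "\<And>i x y. dist x y < D i \<Longrightarrow> dist (pdiff i f x) (pdiff i f y) < e / ?n"
    by metis
  define d where "d = Min (range D)"
  have d: "d > 0" "d \<le> D i" for i using D(1) by (auto simp: d_def)
  show thesis
  proof (rule that[OF d(1)])
    fix x h :: "real^'d" assume h: "norm h < d"
    have "norm (f (x + h) - f x - frechet_derivative f (at x) (x + h - x)) \<le> norm (x + h - x) * e"
    proof (rule differentiable_bound_linearization[where S = "ball x d"])
      show "x + t *\<^sub>R (x + h - x) \<in> ball x d" if "t \<in> {0..1}" for t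
      proof -
        have "\<bar>t\<bar> * norm h \<le> 1 * norm h" using that by (intro mult_right_mono) auto
        then show ?thesis using h by (simp add: dist_norm)
      qed
      show "(f has_derivative frechet_derivative f (at y)) (at y within ball x d)" for y
        using smooth_has_derivative[OF sm] has_derivative_at_withinI by blast
      show "x \<in> ball x d" using d by simp
      fix y assume y: "y \<in> ball x d"
      show "onorm (frechet_derivative f (at y) - frechet_derivative f (at x)) \<le> e"
      proof (rule onorm_le)
        fix v :: "real^'d"
        have "norm ((frechet_derivative f (at y) - frechet_derivative f (at x)) v)
            = norm (\<Sum>i\<in>UNIV. (v $ i) *\<^sub>R (pdiff i f y - pdiff i f x))"
          by (simp add: frechet_derivative_eq_sum[OF sm, of _ v] sum_subtractf scaleR_diff_right)
        also have "\<dots> \<le> (\<Sum>i\<in>(UNIV::'d set). norm v * (e / ?n))"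
        proof (rule sum_norm_le)
          fix i
          have "norm (pdiff i f y - pdiff i f x) \<le> e / ?n"
            using D(2)[of y x i] y d(2)[of i] by (auto simp: dist_norm norm_minus_commute less_imp_le)
          then show "norm ((v $ i) *\<^sub>R (pdiff i f y - pdiff i f x)) \<le> norm v * (e / ?n)"
            using mult_mono[OF component_le_norm_cart[of v i] \<open>norm (pdiff i f y - pdiff i f x) \<le> e / ?n\<close>] by simp
        qed
        also have "\<dots> = e * norm v" by simp
        finally show "norm ((frechet_derivative f (at y) - frechet_derivative f (at x)) v) \<le> e * norm v" .
      qed
    qed
    then show "norm (f (x + h) - f x - (\<Sum>i\<in>UNIV. (h $ i) *\<^sub>R pdiff i f x)) \<le> e * norm h"
      by (simp add: frechet_derivative_eq_sum[OF sm, of _ h] mult.commute)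
  qed
qed

subsection \<open>Translations\<close>

lemma lebesgue_distr_translation: "distr lebesgue lebesgue (\<lambda>x. x - y) = (lebesgue :: 'a::euclidean_space measure)"
proof -
  have *: "(\<lambda>x. - y + (\<Sum>j\<in>Basis. (1 * (x \<bullet> j)) *\<^sub>R j)) = (\<lambda>x. x - y)"
    by (simp add: euclidean_representation fun_eq_iff)
  show ?thesis
    using lebesgue_affine_euclidean[of "\<lambda>_. 1" "-y"] unfolding * by (simp add: density_1)
qed

lemma lebesgue_measurable_translation: "(\<lambda>x. x - y) \<in> lebesgue \<rightarrow>\<^sub>M (lebesgue :: 'a::euclidean_space measure)"
proof -
  have *: "(\<lambda>x. - y + (\<Sum>j\<in>Basis. (1 * (x \<bullet> j)) *\<^sub>R j)) = (\<lambda>x. x - y)"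
    by (simp add: euclidean_representation fun_eq_iff)
  show ?thesis
    using lebesgue_affine_measurable[of "\<lambda>_. 1" "-y"] unfolding * by simp
qed

lemma borel_measurable_lebesgue_translation:
  "f \<in> borel_measurable lebesgue \<Longrightarrow> (\<lambda>x. f (x - y)) \<in> borel_measurable (lebesgue :: 'a::euclidean_space measure)"
  using measurable_compose[OF lebesgue_measurable_translation] .

lemma L2_translation:
  fixes f :: "real^'d \<Rightarrow> 'b::euclidean_space"
  assumes f: "f \<in> L2 UNIV"
  shows "(\<lambda>x. f (x - y)) \<in> L2 UNIV" "L2_norm UNIV (\<lambda>x. f (x - y)) = L2_norm UNIV f"
proof -
  have f': "f \<in> borel_measurable lebesgue" "integrable lebesgue (\<lambda>x. (norm (f x))\<^sup>2)"
    using f by (auto simp: L2_def lebesgue_on_UNIV_eq)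
  have m: "(\<lambda>x. (norm (f x))\<^sup>2) \<in> borel_measurable lebesgue" using f' by measurable
  have "integrable (distr lebesgue lebesgue (\<lambda>x. x - y)) (\<lambda>x. (norm (f x))\<^sup>2)"
    unfolding lebesgue_distr_translation by (rule f')
  then have "integrable lebesgue (\<lambda>x. (norm (f (x - y)))\<^sup>2)"
    by (subst (asm) integrable_distr_eq[OF lebesgue_measurable_translation m])
  then show "(\<lambda>x. f (x - y)) \<in> L2 UNIV"
    using borel_measurable_lebesgue_translation[OF f'(1)] by (auto simp: L2_def lebesgue_on_UNIV_eq)
  have "integral\<^sup>L (distr lebesgue lebesgue (\<lambda>x. x - y)) (\<lambda>x. (norm (f x))\<^sup>2)
      = integral\<^sup>L lebesgue (\<lambda>x. (norm (f (x - y)))\<^sup>2)"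
    by (rule integral_distr[OF lebesgue_measurable_translation m])
  then show "L2_norm UNIV (\<lambda>x. f (x - y)) = L2_norm UNIV f"
    unfolding lebesgue_distr_translation by (simp add: L2_norm_def lebesgue_on_UNIV_eq)
qed

lemma lebesgue_integral_translation:
  fixes f :: "'a::euclidean_space \<Rightarrow> 'b::{banach, second_countable_topology}"
  assumes "f \<in> borel_measurable lebesgue"
  shows "(LINT x|lebesgue. f (x - y)) = (LINT x|lebesgue. f x)"
  using integral_distr[OF lebesgue_measurable_translation assms, of y]
  unfolding lebesgue_distr_translation by simp

lemma lborel_distr_reflect: "distr lborel borel (\<lambda>x. a - x) = (lborel :: 'a::euclidean_space measure)"
  using lborel_affine[of "-1" a] by (simp add: density_1)

lemma nn_integral_lborel_reflect:
  fixes a :: "'a::euclidean_space"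
  assumes "f \<in> borel_measurable borel"
  shows "(\<integral>\<^sup>+x. f (a - x) \<partial>lborel) = (\<integral>\<^sup>+x. f x \<partial>lborel)"
  using nn_integral_distr[of "\<lambda>x. a - x" lborel borel f] assms
  unfolding lborel_distr_reflect by simp

lemma integral_lborel_reflect:
  fixes a :: "'a::euclidean_space" and f :: "'a \<Rightarrow> 'b::{banach, second_countable_topology}"
  assumes "f \<in> borel_measurable borel"
  shows "(LINT x|lborel. f (a - x)) = (LINT x|lborel. f x)"
  using integral_distr[of "\<lambda>x. a - x" lborel borel f] assms
  unfolding lborel_distr_reflect by simp

lemma borel_imp_lebesgue: "f \<in> borel_measurable borel \<Longrightarrow> f \<in> borel_measurable lebesgue"
  by (intro measurable_completion) simp

lemma continuous_imp_L2:
  fixes g :: "real^'d \<Rightarrow> 'b::euclidean_space"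
  assumes "continuous_on UNIV g" "\<And>x. R < norm x \<Longrightarrow> g x = 0"
    "\<And>x. norm (g x) \<le> C" "0 \<le> C"
  shows "g \<in> L2 UNIV" "L2_norm UNIV g \<le> C * L2_norm UNIV (indicat_real (cball (0::real^'d) R))"
proof -
  have i: "indicat_real (cball (0::real^'d) R) \<in> L2 UNIV"
    unfolding L2_def lebesgue_on_UNIV_eq mem_Collect_eq
  proof
    have "(\<lambda>x. (norm (indicat_real (cball (0::real^'d) R) x))\<^sup>2) = indicat_real (cball 0 R)"
      by (auto simp: indicator_def)
    then show "integrable lebesgue (\<lambda>x. (norm (indicat_real (cball (0::real^'d) R) x))\<^sup>2)"
      using lmeasurable_cball[of "0::real^'d" R] by (simp add: lmeasurable_iff_integrable)
  qed (rule borel_imp_lebesgue, simp add: borel_measurable_indicator borel_closed)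
  have m: "g \<in> borel_measurable (lebesgue_on UNIV)"
    unfolding lebesgue_on_UNIV_eq using assms(1) by (intro borel_imp_lebesgue borel_measurable_continuous_onI)
  have le: "AE x in lebesgue_on UNIV. norm (g x) \<le> C * norm (indicat_real (cball (0::real^'d) R) x)"
    using assms by (auto simp: indicator_def)
  show "g \<in> L2 UNIV" "L2_norm UNIV g \<le> C * L2_norm UNIV (indicat_real (cball (0::real^'d) R))"
    using L2_dominated[OF i m le] assms(4) by auto
qed

section \<open>Approximation by continuous functions and continuity of translations\<close>

lemma L2_norm_tendsto_0_dominated:
  fixes f :: "nat \<Rightarrow> real^'d \<Rightarrow> 'b::euclidean_space" and g :: "real^'d \<Rightarrow> 'c::euclidean_space"
  assumes "\<And>n. f n \<in> borel_measurable (lebesgue_on \<Omega>)" and g: "g \<in> L2 \<Omega>"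
    and lim: "AE x in lebesgue_on \<Omega>. (\<lambda>n. f n x) \<longlonglongrightarrow> 0"
    and le: "\<And>n. AE x in lebesgue_on \<Omega>. norm (f n x) \<le> norm (g x)"
  shows "(\<lambda>n. L2_norm \<Omega> (f n)) \<longlonglongrightarrow> 0"
proof -
  note [measurable] = assms(1)
  have "(\<lambda>n. LINT x|lebesgue_on \<Omega>. (norm (f n x))\<^sup>2) \<longlonglongrightarrow> (LINT x|lebesgue_on \<Omega>. 0)"
  proof (rule integral_dominated_convergence)
    show "integrable (lebesgue_on \<Omega>) (\<lambda>x. (norm (g x))\<^sup>2)" by (rule L2_integrable[OF g])
    show "AE x in lebesgue_on \<Omega>. (\<lambda>n. (norm (f n x))\<^sup>2) \<longlonglongrightarrow> 0"
      using lim by eventually_elim (auto intro!: tendsto_eq_intros)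
    show "AE x in lebesgue_on \<Omega>. norm ((norm (f n x))\<^sup>2) \<le> (norm (g x))\<^sup>2" for n
      using le[of n] by eventually_elim (simp add: power_mono)
  qed auto
  then show ?thesis
    unfolding L2_norm_def using tendsto_real_sqrt by fastforce
qed

text \<open>The gauge-integral notion \<open>measurable_on\<close> is defined through continuous
  approximants off a negligible set, and these are extracted here.\<close>

lemma lebesgue_measurable_AE_limit_continuous:
  fixes f :: "real^'d \<Rightarrow> 'b::euclidean_space"
  assumes "f \<in> borel_measurable lebesgue"
  obtains g where "\<And>n. continuous_on UNIV (g n)" "AE x in lebesgue. (\<lambda>n. g n x) \<longlonglongrightarrow> f x"
proof -
  have "f measurable_on UNIV"
    by (rule lebesgue_measurable_imp_measurable_on) (use assms in auto)
  then obtain N g where N: "negligible N" and g: "\<And>n. continuous_on UNIV (g n)"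
    and lim: "\<And>x. x \<notin> N \<Longrightarrow> (\<lambda>n. g n x) \<longlonglongrightarrow> f x"
    unfolding measurable_on_def by auto
  have "AE x in lebesgue. x \<notin> N"
    using N by (simp add: AE_not_in negligible_iff_null_sets)
  then have "AE x in lebesgue. (\<lambda>n. g n x) \<longlonglongrightarrow> f x"
    by eventually_elim (rule lim)
  with g that show thesis by blast
qed

text \<open>Fubini's theorem for products of \<open>lborel\<close> asks for Borel functions, hence
  this passage to a representative. The function \<open>lim\<close> of a sequence of continuous
  functions is Borel on the whole space, including the points of divergence.\<close>

lemma lebesgue_measurable_borel_version:
  fixes f :: "real^'d \<Rightarrow> 'b::euclidean_space"
  assumes "f \<in> borel_measurable lebesgue"
  obtains f' where "f' \<in> borel_measurable borel" "AE x in lebesgue. f x = f' x"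
proof -
  obtain g where g: "\<And>n. continuous_on UNIV (g n)" "AE x in lebesgue. (\<lambda>n. g n x) \<longlonglongrightarrow> f x"
    using lebesgue_measurable_AE_limit_continuous[OF assms] by blast
  have [measurable]: "g n \<in> borel_measurable borel" for n
    using g(1) by (rule borel_measurable_continuous_onI)
  have "(\<lambda>x. lim (\<lambda>n. g n x)) \<in> borel_measurable borel" by measurable
  moreover have "AE x in lebesgue. f x = lim (\<lambda>n. g n x)"
    using g(2) by eventually_elim (simp add: limI)
  ultimately show thesis using that by blast
qed

text \<open>The almost everywhere approximants carry no bound, so dominated convergence does not
  apply to them directly. They are truncated at a height \<open>M\<close> for which the truncation
  of \<open>f\<close> is already close to \<open>f\<close>, and multiplied by a cut-off
  \<open>k\<close>.\<close>

lemma L2_approx_continuous: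
  fixes f :: "real^'d \<Rightarrow> 'b::euclidean_space"
  assumes f: "f \<in> L2 UNIV" and R: "\<And>x. R < norm x \<Longrightarrow> f x = 0" and e: "0 < e"
  obtains g C where "continuous_on UNIV g" "\<And>x. R + 1 < norm x \<Longrightarrow> g x = 0" "\<And>x. norm (g x) \<le> C"
    "L2_norm UNIV (\<lambda>x. f x - g x) < e"
proof -
  have fm: "f \<in> borel_measurable lebesgue" using f by (simp add: L2_def lebesgue_on_UNIV_eq)
  \<comment> \<open>The nearest point of a ball is a continuous truncation for values in any
    Euclidean space.\<close>
  define c where "c M v = closest_point (cball (0::'b) M) v" for M v
  have c_cont: "continuous_on UNIV (c M)" if "0 \<le> M" for M
    unfolding c_def using that by (intro continuous_on_closest_point) auto
  have c_norm: "norm (c M v) \<le> M" if "0 \<le> M" for M v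
    unfolding c_def using closest_point_in_set[of "cball (0::'b) M" v] that by auto
  have c_id: "c M v = v" if "norm v \<le> M" for M v
    unfolding c_def by (rule closest_point_self) (use that in auto)
  have c_le: "norm (c M v) \<le> norm v" if "0 \<le> M" for M v
    using c_id[of v M] c_norm[OF that, of v] by (cases "norm v \<le> M") auto
  have cm: "c M \<in> borel_measurable borel" if "0 \<le> M" for M
    using c_cont[OF that] by (rule borel_measurable_continuous_onI)
  have "(\<lambda>n. L2_norm UNIV (\<lambda>x. f x - c (real n) (f x))) \<longlonglongrightarrow> 0"
  proof (rule L2_norm_tendsto_0_dominated)
    show "(\<lambda>x. f x - c (real n) (f x)) \<in> borel_measurable (lebesgue_on UNIV)" for n
      unfolding lebesgue_on_UNIV_eq using fm measurable_compose[OF fm cm, of n] by measurable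
    show "(\<lambda>x. 2 *\<^sub>R f x) \<in> L2 UNIV" by (rule L2_scaleR[OF f])
    show "AE x in lebesgue_on UNIV. norm (f x - c (real n) (f x)) \<le> norm (2 *\<^sub>R f x)" for n
    proof (rule AE_I2)
      fix x
      show "norm (f x - c (real n) (f x)) \<le> norm (2 *\<^sub>R f x)"
        using norm_triangle_ineq4[of "f x" "c (real n) (f x)"] c_le[of "real n" "f x"] by simp
    qed
    show "AE x in lebesgue_on UNIV. (\<lambda>n. f x - c (real n) (f x)) \<longlonglongrightarrow> 0"
    proof (rule AE_I2)
      fix x
      have "\<forall>\<^sub>F n in sequentially. f x - c (real n) (f x) = 0"
        using eventually_ge_at_top[of "nat \<lceil>norm (f x)\<rceil>"]
        by eventually_elim (simp add: c_id nat_ceiling_le_eq)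
      then show "(\<lambda>n. f x - c (real n) (f x)) \<longlonglongrightarrow> 0" by (rule tendsto_eventually)
    qed
  qed
  then have "\<forall>\<^sub>F n in sequentially. L2_norm UNIV (\<lambda>x. f x - c (real n) (f x)) < e / 2"
    by (rule order_tendstoD(2)) (use e in simp)
  then obtain n where n: "L2_norm UNIV (\<lambda>x. f x - c (real n) (f x)) < e / 2"
    by (auto simp: eventually_sequentially)
  define M where "M = real n"
  have M: "0 \<le> M" by (simp add: M_def)
  obtain h where h: "\<And>n. continuous_on UNIV (h n)" "AE x in lebesgue. (\<lambda>n. h n x) \<longlonglongrightarrow> f x"
    using lebesgue_measurable_AE_limit_continuous[OF fm] by blast
  \<comment> \<open>Equal to 1 where \<open>f\<close> may be nonzero and 0 beyond
    \<open>R + 1\<close>, so multiplication by \<open>k\<close> leaves the truncated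
    \<open>f\<close> unchanged.\<close>
  define k where "k x = max 0 (min 1 (R + 1 - norm x))" for x :: "real^'d"
  have k: "0 \<le> k x" "k x \<le> 1" "norm x \<le> R \<Longrightarrow> k x = 1" "R + 1 < norm x \<Longrightarrow> k x = 0" for x
    by (auto simp: k_def)
  have kc: "continuous_on UNIV k" unfolding k_def by (intro continuous_intros)
  define g where "g n x = k x *\<^sub>R c M (h n x)" for n x
  have gc: "continuous_on UNIV (g n)" for n
    unfolding g_def by (intro continuous_on_scaleR kc continuous_on_compose2[OF c_cont[OF M] h(1)]) auto
  have gM: "norm (g n x) \<le> M" for n x
    using k(1,2)[of x] c_norm[OF M, of "h n x"] M mult_mono[of "\<bar>k x\<bar>" 1 "norm (c M (h n x))" M]
    by (simp add: g_def)
  have g0: "g n x = 0" if "R + 1 < norm x" for n x using k(4)[OF that] by (simp add: g_def)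
  have gL2: "g n \<in> L2 UNIV" for n
    by (rule continuous_imp_L2(1)[where R = "R + 1" and C = M]) (use gc g0 gM M in auto)
  have cf: "k x *\<^sub>R c M (f x) = c M (f x)" for x
    using k(3)[of x] R[of x] c_id[of 0 M] M by (cases "norm x \<le> R") auto
  have cfm: "(\<lambda>x. c M (f x)) \<in> borel_measurable lebesgue" using measurable_compose[OF fm cm[OF M]] .
  have gm: "g n \<in> borel_measurable lebesgue" for n using gL2 by (simp add: L2_def lebesgue_on_UNIV_eq)
  have cfL2: "(\<lambda>x. c M (f x)) \<in> L2 UNIV"
    by (rule L2_norm_mono(1)[OF f]) (use cfm c_le[OF M] in \<open>auto simp: lebesgue_on_UNIV_eq\<close>)
  have "(\<lambda>n. L2_norm UNIV (\<lambda>x. c M (f x) - g n x)) \<longlonglongrightarrow> 0"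
  proof (rule L2_norm_tendsto_0_dominated)
    show "(\<lambda>x. c M (f x) - g n x) \<in> borel_measurable (lebesgue_on UNIV)" for n
      unfolding lebesgue_on_UNIV_eq using cfm gm[of n] by measurable
    have kM: "norm ((2 * M) * k x) \<le> 2 * M" for x
      using k(1,2)[of x] M mult_left_mono[of "k x" 1 "2 * M"] by (simp add: abs_mult)
    show "(\<lambda>x. (2 * M) * k x) \<in> L2 UNIV"
      by (rule continuous_imp_L2(1)[where R = "R + 1" and C = "2 * M"])
        (use k(4) kM M in \<open>auto intro!: continuous_intros kc\<close>)
    show "AE x in lebesgue_on UNIV. norm (c M (f x) - g n x) \<le> norm ((2 * M) * k x)" for n
    proof (rule AE_I2)
      fix x
      have "c M (f x) - g n x = k x *\<^sub>R (c M (f x) - c M (h n x))"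
        unfolding g_def by (simp add: scaleR_diff_right cf)
      moreover have "norm (c M (f x) - c M (h n x)) \<le> 2 * M"
        using norm_triangle_ineq4[of "c M (f x)" "c M (h n x)"] c_norm[OF M, of "f x"] c_norm[OF M, of "h n x"]
        by simp
      ultimately show "norm (c M (f x) - g n x) \<le> norm ((2 * M) * k x)"
        using k(1)[of x] M mult_left_mono[of "norm (c M (f x) - c M (h n x))" "2 * M" "k x"]
        by (simp add: abs_mult mult.commute)
    qed
    show "AE x in lebesgue_on UNIV. (\<lambda>n. c M (f x) - g n x) \<longlonglongrightarrow> 0"
      unfolding lebesgue_on_UNIV_eq using h(2)
    proof eventually_elim
      case (elim x)
      have "isCont (c M) (f x)" using c_cont[OF M] by (simp add: continuous_on_eq_continuous_at)
      then have "(\<lambda>n. c M (h n x)) \<longlonglongrightarrow> c M (f x)" using elim isCont_tendsto_compose by blast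
      then have "(\<lambda>n. k x *\<^sub>R c M (f x) - k x *\<^sub>R c M (h n x)) \<longlonglongrightarrow> k x *\<^sub>R c M (f x) - k x *\<^sub>R c M (f x)"
        by (intro tendsto_intros)
      then show ?case by (simp add: g_def cf)
    qed
  qed
  then have "\<forall>\<^sub>F n in sequentially. L2_norm UNIV (\<lambda>x. c M (f x) - g n x) < e / 2"
    by (rule order_tendstoD(2)) (use e in simp)
  then obtain m where m: "L2_norm UNIV (\<lambda>x. c M (f x) - g m x) < e / 2"
    by (auto simp: eventually_sequentially)
  have "L2_norm UNIV (\<lambda>x. f x - g m x) < e"
    using L2_norm_diff_triangle[OF f cfL2 gL2, of m] n m unfolding M_def by simp
  then show thesis using that gc g0 gM by blast
qed

lemma L2_translation_continuous:
  fixes f :: "real^'d \<Rightarrow> 'b::euclidean_space"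
  assumes f: "f \<in> L2 UNIV" and R: "\<And>x. R < norm x \<Longrightarrow> f x = 0" and e: "0 < e"
  obtains r where "0 < r" "\<And>y. norm y \<le> r \<Longrightarrow> L2_norm UNIV (\<lambda>x. f (x - y) - f x) \<le> e"
proof -
  have e3: "0 < e / 3" using e by simp
  obtain g C where g: "continuous_on UNIV g" "\<And>x. R + 1 < norm x \<Longrightarrow> g x = 0" "\<And>x. norm (g x) \<le> C"
    "L2_norm UNIV (\<lambda>x. f x - g x) < e / 3"
    by (rule L2_approx_continuous[OF f _ e3, of R]) (erule R, blast)
  have C: "0 \<le> C" using g(3)[of 0] norm_ge_zero order_trans by blast
  have gL2: "g \<in> L2 UNIV"
    by (rule continuous_imp_L2(1)[where R = "R + 1" and C = C]) (use g C in auto)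
  \<comment> \<open>The radius \<open>R + 2\<close> covers the support of \<open>g\<close> and of
    its translates by vectors of length at most 1. Points of this ball moved by such vectors stay in
    \<open>cball 0 (R+3)\<close>.\<close>
  define I where "I = L2_norm UNIV (indicat_real (cball (0::real^'d) (R + 2)))"
  have I: "I \<ge> 0" by (simp add: I_def)
  define e1 where "e1 = e / (3 * (I + 1))"
  have e1: "e1 > 0" "e1 * I \<le> e / 3" using e I by (auto simp: e1_def field_simps)
  have "uniformly_continuous_on (cball 0 (R+3)) g"
    by (intro compact_uniformly_continuous continuous_on_subset[OF g(1)]) auto
  then obtain d where d: "d > 0"
      "\<And>x y. x \<in> cball 0 (R+3) \<Longrightarrow> y \<in> cball 0 (R+3) \<Longrightarrow> dist x y < d \<Longrightarrow> dist (g x) (g y) < e1"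
    using e1 unfolding uniformly_continuous_on_def by (metis dist_commute)
  show thesis
  proof (rule that[of "min (d/2) 1"])
    fix y :: "real^'d" assume y: "norm y \<le> min (d/2) 1"
    have z: "g (x - y) - g x = 0" if "R + 2 < norm x" for x
      using g(2)[of x] g(2)[of "x - y"] that y norm_triangle_ineq2[of x y] by auto
    have b: "norm (g (x - y) - g x) \<le> e1" for x
    proof (cases "norm x \<le> R + 2")
      case True
      then show ?thesis
        using d(2)[of "x - y" x] y d(1) norm_triangle_ineq4[of x y]
        by (auto simp: dist_norm norm_minus_commute intro: less_imp_le)
    qed (use z[of x] e1 in auto)
    have gc: "continuous_on UNIV (\<lambda>x. g (x - y) - g x)"
      by (intro continuous_intros continuous_on_compose2[OF g(1)] g(1)) auto
    have gd: "(\<lambda>x. g (x - y) - g x) \<in> L2 UNIV" "L2_norm UNIV (\<lambda>x. g (x - y) - g x) \<le> e1 * I"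
      unfolding I_def by (rule continuous_imp_L2[where R = "R + 2" and C = e1]; use gc z b e1 in auto)+
    have 1: "L2_norm UNIV (\<lambda>x. f (x - y) - g (x - y)) < e / 3"
      using L2_translation(2)[OF L2_diff(1)[OF f gL2], where y = y] g(4) by simp
    have 2: "L2_norm UNIV (\<lambda>x. g x - f x) < e / 3"
      using g(4) by (subst L2_norm_minus_commute)
    have "L2_norm UNIV (\<lambda>x. f (x - y) - f x) \<le>
        L2_norm UNIV (\<lambda>x. f (x - y) - g (x - y)) + L2_norm UNIV (\<lambda>x. g (x - y) - f x)"
      by (intro L2_norm_diff_triangle L2_translation f gL2)
    also have "L2_norm UNIV (\<lambda>x. g (x - y) - f x) \<le> L2_norm UNIV (\<lambda>x. g (x - y) - g x) + L2_norm UNIV (\<lambda>x. g x - f x)"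
      by (intro L2_norm_diff_triangle L2_translation f gL2)
    finally show "L2_norm UNIV (\<lambda>x. f (x - y) - f x) \<le> e" using 1 2 gd(2) e1(2) by simp
  qed (use d in auto)
qed

subsection \<open>Convolution\<close>

definition conv :: "(real^'d \<Rightarrow> complex) \<Rightarrow> (real^'d \<Rightarrow> complex) \<Rightarrow> real^'d \<Rightarrow> complex" where
  "conv \<rho> f x = (LINT y|lebesgue. \<rho> (x - y) * f y)"

lemma smooth_borel: "smooth f \<Longrightarrow> f \<in> borel_measurable borel"
  by (intro borel_measurable_continuous_onI smooth_continuous)

lemma smooth_measurable: "smooth f \<Longrightarrow> f \<in> borel_measurable (lebesgue_on \<Omega>)"
  by (intro measurable_restrict_space1 borel_imp_lebesgue smooth_borel)

lemma test_fun_mult_integrable: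
  assumes "\<rho> \<in> test_fun UNIV" "integrable lebesgue f"
  shows "integrable lebesgue (\<lambda>y. \<rho> (x - y) * f y)"
proof -
  obtain C where C: "C > 0" "\<And>x. norm (\<rho> x) \<le> C" using test_fun_bounded[OF assms(1)] by metis
  have [measurable]: "f \<in> borel_measurable lebesgue" using assms(2) by simp
  have [measurable]: "(\<lambda>y. \<rho> (x - y)) \<in> borel_measurable lebesgue"
    by (intro borel_imp_lebesgue smooth_borel smooth_reflect test_fun_smooth[OF assms(1)])
  show ?thesis
  proof (rule Bochner_Integration.integrable_bound)
    show "integrable lebesgue (\<lambda>y. C * norm (f y))" using assms(2) by simp
    show "AE y in lebesgue. norm (\<rho> (x - y) * f y) \<le> norm (C * norm (f y))"
      using C by (intro AE_I2) (simp add: norm_mult mult_right_mono)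
  qed measurable
qed

text \<open>The remainder of \<open>\<rho>\<close> is small uniformly in the base point, so it can
  be integrated against \<open>f\<close>; the error is bounded by \<open>e1 * norm h\<close> times
  the integral of \<open>norm (f y)\<close>.\<close>

lemma conv_has_derivative:
  fixes \<rho> f :: "real^'d \<Rightarrow> complex"
  assumes \<rho>: "\<rho> \<in> test_fun UNIV" and f: "integrable lebesgue f"
  shows "(conv \<rho> f has_derivative (\<lambda>h. \<Sum>i\<in>UNIV. (h $ i) *\<^sub>R conv (pdiff i \<rho>) f x)) (at x)"
  unfolding has_derivative_at_alt
proof (intro conjI allI impI)
  show "bounded_linear (\<lambda>h::real^'d. \<Sum>i\<in>UNIV. (h $ i) *\<^sub>R conv (pdiff i \<rho>) f x)"
    by (intro bounded_linear_sum bounded_linear_scaleR_const bounded_linear_vec_nth)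
  fix e :: real assume e: "0 < e"
  define F where "F = (LINT y|lebesgue. norm (f y))"
  have F: "F \<ge> 0" by (simp add: F_def)
  define e1 where "e1 = e / (F + 1)"
  have e1: "e1 > 0" "e1 * F \<le> e" using e F by (auto simp: e1_def field_simps)
  obtain d where d: "d > 0" "\<And>x h. norm h < d \<Longrightarrow> norm (\<rho> (x + h) - \<rho> x - (\<Sum>i\<in>UNIV. (h $ i) *\<^sub>R pdiff i \<rho> x)) \<le> e1 * norm h"
    by (rule test_fun_uniformly_differentiable[OF \<rho> e1(1)]) blast
  show "\<exists>d>0. \<forall>y. norm (y - x) < d \<longrightarrow>
      norm (conv \<rho> f y - conv \<rho> f x - (\<Sum>i\<in>UNIV. ((y - x) $ i) *\<^sub>R conv (pdiff i \<rho>) f x)) \<le> e * norm (y - x)"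
  proof (intro exI[of _ d] conjI allI impI d(1))
    fix y assume y: "norm (y - x) < d"
    define h where "h = y - x"
    note i1 = test_fun_mult_integrable[OF \<rho> f] and i2 = test_fun_mult_integrable[OF test_fun_pdiff[OF \<rho>] f]
    let ?R = "\<lambda>z. \<rho> (y - z) - \<rho> (x - z) - (\<Sum>i\<in>UNIV. (h $ i) *\<^sub>R pdiff i \<rho> (x - z))"
    have eq: "?R z * f z = \<rho> (y - z) * f z - \<rho> (x - z) * f z - (\<Sum>i\<in>UNIV. (h $ i) *\<^sub>R (pdiff i \<rho> (x - z) * f z))" for z
      by (simp add: algebra_simps sum_distrib_left)
    have int: "integrable lebesgue (\<lambda>z. ?R z * f z)"
      unfolding eq by (intro Bochner_Integration.integrable_diff Bochner_Integration.integrable_sum integrable_scaleR_right i1 i2)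
    have E: "conv \<rho> f y - conv \<rho> f x - (\<Sum>i\<in>UNIV. (h $ i) *\<^sub>R conv (pdiff i \<rho>) f x) = (LINT z|lebesgue. ?R z * f z)"
      unfolding conv_def eq using i1 i2 by simp
    have "norm (conv \<rho> f y - conv \<rho> f x - (\<Sum>i\<in>UNIV. (h $ i) *\<^sub>R conv (pdiff i \<rho>) f x))
        \<le> (LINT z|lebesgue. norm (?R z * f z))"
      unfolding E by (rule integral_norm_bound)
    also have "\<dots> \<le> (LINT z|lebesgue. (e1 * norm h) * norm (f z))"
    proof (rule integral_mono)
      show "norm (?R z * f z) \<le> (e1 * norm h) * norm (f z)" for z
        using d(2)[of h "x - z"] y unfolding norm_mult h_def
        by (intro mult_right_mono) (auto simp: algebra_simps)
    qed (use int f in auto)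
    also have "\<dots> = (e1 * F) * norm h" by (simp add: F_def)
    also have "\<dots> \<le> e * norm h" using e1 by (intro mult_right_mono) auto
    finally show "norm (conv \<rho> f y - conv \<rho> f x - (\<Sum>i\<in>UNIV. ((y - x) $ i) *\<^sub>R conv (pdiff i \<rho>) f x)) \<le> e * norm (y - x)"
      unfolding h_def .
  qed
qed

lemma pdiff_conv:
  fixes \<rho> f :: "real^'d \<Rightarrow> complex"
  assumes "\<rho> \<in> test_fun UNIV" "integrable lebesgue f"
  shows "pdiff i (conv \<rho> f) = conv (pdiff i \<rho>) f"
proof
  fix x
  have "(\<Sum>j\<in>UNIV. ((axis i 1 :: real^'d) $ j) *\<^sub>R conv (pdiff j \<rho>) f x)
      = (\<Sum>j\<in>UNIV. if j = i then conv (pdiff i \<rho>) f x else 0)"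
    by (intro sum.cong) (auto simp: axis_def)
  then show "pdiff i (conv \<rho> f) x = conv (pdiff i \<rho>) f x"
    using pdiff_eqI[OF conv_has_derivative[OF assms]] by simp
qed

text \<open>Every derivative falls on the kernel, so the convolutions of the fixed \<open>f\<close>
  with all test functions form an invariant for \<open>smooth_coinduct\<close>.\<close>

lemma conv_smooth:
  fixes \<rho> f :: "real^'d \<Rightarrow> complex"
  assumes "\<rho> \<in> test_fun UNIV" "integrable lebesgue f"
  shows "smooth (conv \<rho> f)"
proof (rule smooth_coinduct[where S = "{conv \<rho> f |\<rho>. \<rho> \<in> test_fun UNIV}"])
  show "conv \<rho> f \<in> {conv \<rho> f |\<rho>. \<rho> \<in> test_fun UNIV}" using assms by blast
  fix g assume "g \<in> {conv \<rho> f |\<rho>. \<rho> \<in> test_fun UNIV}"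
  then obtain \<rho> where g: "g = conv \<rho> f" "\<rho> \<in> test_fun UNIV" by blast
  show "g differentiable (at x)" for x
    using conv_has_derivative[OF g(2) assms(2)] unfolding g(1) differentiable_def by blast
  show "pdiff i g \<in> {conv \<rho> f |\<rho>. \<rho> \<in> test_fun UNIV}" for i
    unfolding g(1) pdiff_conv[OF g(2) assms(2)] using test_fun_pdiff[OF g(2)] by blast
qed

text \<open>The radius is a parameter in place of a scale factor: a bump is normalised for each
  radius separately, and no integral has to be rescaled. The values are real so that positivity and
  square roots make sense; they are embedded into the complex numbers for convolutions.\<close>

definition mollifier :: "real \<Rightarrow> (real^'d \<Rightarrow> real) \<Rightarrow> bool" where
  "mollifier r \<rho> \<longleftrightarrow> (\<lambda>x. complex_of_real (\<rho> x)) \<in> test_fun UNIV \<and> (\<forall>x. 0 \<le> \<rho> x) \<and>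
     (\<forall>x. r \<le> norm x \<longrightarrow> \<rho> x = 0) \<and> (LINT x|lborel. \<rho> x) = 1"

lemma test_fun_integrable:
  assumes "f \<in> test_fun UNIV"
  shows "integrable lebesgue f" "integrable lborel f"
proof -
  obtain C where C: "C > 0" "\<And>x. norm (f x) \<le> C" using test_fun_bounded[OF assms] by metis
  obtain S where S: "compact S" "\<And>x. x \<notin> S \<Longrightarrow> f x = 0" using test_funE[OF assms] by metis
  have m: "f \<in> borel_measurable borel" by (intro smooth_borel test_fun_smooth[OF assms])
  have "integrable lebesgue (indicat_real S)"
    using lmeasurable_compact[OF S(1)] by (simp add: lmeasurable_iff_integrable)
  then have "integrable lebesgue (\<lambda>x. C * indicat_real S x)" by simp
  then show "integrable lebesgue f"
  proof (rule Bochner_Integration.integrable_bound)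
    show "f \<in> borel_measurable lebesgue" using m by (rule borel_imp_lebesgue)
    show "AE x in lebesgue. norm (f x) \<le> norm (C * indicat_real S x)"
      using C S by (intro AE_I2) (auto simp: indicator_def)
  qed
  then show "integrable lborel f" using integrable_completion[of f lborel] m by simp
qed

lemma mollifier_exists:
  assumes r: "0 < r"
  obtains \<rho> :: "real^'d \<Rightarrow> real" where "mollifier r \<rho>"
proof -
  define b where "b x = flat 0 (r\<^sup>2 - x \<bullet> x)" for x :: "real^'d"
  have b: "0 \<le> b x" "r \<le> norm x \<Longrightarrow> b x = 0" "norm x < r \<Longrightarrow> 0 < b x" for x
  proof -
    show "0 \<le> b x" by (simp add: b_def flat_def)
    show "b x = 0" if "r \<le> norm x"
      using that r power_mono[of r "norm x" 2] by (simp add: b_def flat_def power2_norm_eq_inner)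
    show "0 < b x" if "norm x < r"
      using that power_strict_mono[of "norm x" r 2] by (simp add: b_def flat_def power2_norm_eq_inner)
  qed
  have bt: "(\<lambda>x. complex_of_real (b x)) \<in> test_fun UNIV"
    by (rule test_funI[where S = "cball 0 r"]) (use b(2) smooth_flat in \<open>auto simp: b_def\<close>)
  have bi: "integrable lborel b"
    using integrable_Re[OF test_fun_integrable(2)[OF bt]] by simp
  define I where "I = (LINT x|lborel. b x)"
  \<comment> \<open>A vanishing integral would make the open ball, where \<open>b\<close> is
    positive, a null set.\<close>
  have "I \<noteq> 0"
  proof
    assume "I = 0"
    then have "AE x in lborel. b x = 0"
      unfolding I_def using integral_nonneg_eq_0_iff_AE[OF bi] b by simp
    then have "AE x in lborel. x \<notin> ball (0::real^'d) r"
    proof eventually_elim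
      case (elim x)
      then show ?case using b(3)[of x] by auto
    qed
    then have "AE x in lebesgue. x \<notin> ball (0::real^'d) r" by (rule AE_completion)
    then have "negligible (ball (0::real^'d) r)"
      by (simp add: negligible_iff_null_sets AE_iff_null_sets)
    then show False using open_not_negligible[of "ball (0::real^'d) r"] r by auto
  qed
  then have I: "I > 0" using b(1) unfolding I_def by (simp add: less_le)
  have "mollifier r (\<lambda>x. b x / I)"
    unfolding mollifier_def
  proof (intro conjI allI impI)
    show "(\<lambda>x. complex_of_real (b x / I)) \<in> test_fun UNIV"
      using test_fun_cmult[OF bt, of "1 / of_real I"] by simp
    show "(LINT x|lborel. b x / I) = 1" using I by (simp add: I_def)
  qed (use b I in auto)
  then show thesis by (rule that)
qed

lemma mollifierD:
  assumes "mollifier r (\<rho> :: real^'d \<Rightarrow> real)"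
  shows "(\<lambda>x. complex_of_real (\<rho> x)) \<in> test_fun UNIV" "0 \<le> \<rho> x" "r \<le> norm x \<Longrightarrow> \<rho> x = 0"
    "integrable lborel \<rho>" "(LINT x|lborel. \<rho> x) = 1" "\<rho> \<in> borel_measurable borel"
proof -
  show t: "(\<lambda>x. complex_of_real (\<rho> x)) \<in> test_fun UNIV" and "0 \<le> \<rho> x" "r \<le> norm x \<Longrightarrow> \<rho> x = 0"
    "(LINT x|lborel. \<rho> x) = 1"
    using assms by (auto simp: mollifier_def)
  show i: "integrable lborel \<rho>"
    using integrable_Re[OF test_fun_integrable(2)[OF t]] by simp
  then show "\<rho> \<in> borel_measurable borel" by simp
qed

text \<open>The convolution is an average of translates of \<open>f\<close>. Pointwise
  Cauchy-Schwarz with respect to the probability density \<open>\<rho>\<close>, followed by Tonelli,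
  bounds the error by the average of the translation errors; only translations shorter than
  \<open>r\<close> carry weight.\<close>

lemma conv_mollifier_close_borel:
  fixes f :: "real^'d \<Rightarrow> complex"
  assumes \<rho>: "mollifier r \<rho>" and fm[measurable]: "f \<in> borel_measurable borel"
    and fi: "integrable lborel f" and fL2: "f \<in> L2 UNIV"
    and e: "\<And>y. norm y \<le> r \<Longrightarrow> L2_norm UNIV (\<lambda>x. f (x - y) - f x) \<le> e" and r: "0 \<le> r"
  shows "(\<integral>\<^sup>+x. ennreal ((norm ((LINT y|lborel. of_real (\<rho> (x - y)) * f y) - f x))\<^sup>2) \<partial>lborel) \<le> ennreal (e\<^sup>2)"
proof -
  note m = mollifierD[OF \<rho>]
  note [measurable] = m(6)
  have fi': "integrable lebesgue f" using integrable_completion[of f lborel] fi by simp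
  have ri: "integrable lborel (\<lambda>y. \<rho> (x - y))" for x
  proof -
    have "integrable lborel (\<lambda>y. complex_of_real (\<rho> (x - y)))"
      using test_fun_integrable(2)[OF test_fun_reflect[OF m(1)]] .
    from integrable_Re[OF this] show ?thesis by simp
  qed
  have rnn: "(\<integral>\<^sup>+z. ennreal (\<rho> z) \<partial>lborel) = 1"
    using nn_integral_eq_integral[OF m(4)] m(2,5) by simp
  have pt: "ennreal ((norm ((LINT y|lborel. of_real (\<rho> (x - y)) * f y) - f x))\<^sup>2)
      \<le> (\<integral>\<^sup>+z. ennreal (\<rho> z) * ennreal ((norm (f (x - z) - f x))\<^sup>2) \<partial>lborel)" for x
  proof -
    have i1: "integrable lborel (\<lambda>y. of_real (\<rho> (x - y)) * f y)"
      using test_fun_mult_integrable[OF m(1) fi', of x] by (subst integrable_completion[symmetric]) measurable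
    have i2: "integrable lborel (\<lambda>y. complex_of_real (\<rho> (x - y)) * f x)"
      by (intro integrable_mult_left integrable_of_real ri)
    have r1: "(LINT y|lborel. complex_of_real (\<rho> (x - y))) = 1"
      using integral_lborel_reflect[of \<rho> x] m(5,6) by simp
    have "(LINT y|lborel. of_real (\<rho> (x - y)) * f y) - f x = (LINT y|lborel. of_real (\<rho> (x - y)) * f y) - (LINT y|lborel. of_real (\<rho> (x - y)) * f x)"
      using r1 by simp
    also have "\<dots> = (LINT y|lborel. of_real (\<rho> (x - y)) * (f y - f x))"
      using i1 i2 by (simp add: algebra_simps)
    finally have eq: "(LINT y|lborel. of_real (\<rho> (x - y)) * f y) - f x = (LINT y|lborel. of_real (\<rho> (x - y)) * (f y - f x))" .
    have "integrable lborel (\<lambda>y. of_real (\<rho> (x - y)) * (f y - f x))"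
      using Bochner_Integration.integrable_diff[OF i1 i2] by (simp add: algebra_simps)
    then have "ennreal (norm (LINT y|lborel. of_real (\<rho> (x - y)) * (f y - f x)))
        \<le> (\<integral>\<^sup>+y. ennreal (norm (of_real (\<rho> (x - y)) * (f y - f x))) \<partial>lborel)"
      by (rule integral_norm_bound_ennreal)
    also have "\<dots> = (\<integral>\<^sup>+z. ennreal (norm (of_real (\<rho> (x - (x - z))) * (f (x - z) - f x))) \<partial>lborel)"
      by (rule nn_integral_lborel_reflect[symmetric]) measurable
    \<comment> \<open>The weight is split as \<open>sqrt (\<rho> z) * sqrt (\<rho> z)\<close>, so
      that the first Cauchy-Schwarz factor is the total mass 1.\<close>
    also have "\<dots> = (\<integral>\<^sup>+z. ennreal (sqrt (\<rho> z)) * ennreal (sqrt (\<rho> z) * norm (f (x - z) - f x)) \<partial>lborel)"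
      using m(2) by (intro nn_integral_cong) (simp add: norm_mult ennreal_mult[symmetric] mult.assoc[symmetric])
    finally have le: "ennreal (norm ((LINT y|lborel. of_real (\<rho> (x - y)) * f y) - f x))
      \<le> (\<integral>\<^sup>+z. ennreal (sqrt (\<rho> z)) * ennreal (sqrt (\<rho> z) * norm (f (x - z) - f x)) \<partial>lborel)"
      unfolding eq .
    have "ennreal ((norm ((LINT y|lborel. of_real (\<rho> (x - y)) * f y) - f x))\<^sup>2)
      = (ennreal (norm ((LINT y|lborel. of_real (\<rho> (x - y)) * f y) - f x)))\<^sup>2"
      by (simp add: ennreal_power)
    also have "\<dots> \<le> (\<integral>\<^sup>+z. ennreal (sqrt (\<rho> z)) * ennreal (sqrt (\<rho> z) * norm (f (x - z) - f x)) \<partial>lborel)\<^sup>2"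
      using le by (intro power_mono) auto
    also have "\<dots> \<le> (\<integral>\<^sup>+z. (ennreal (sqrt (\<rho> z)))\<^sup>2 \<partial>lborel) * (\<integral>\<^sup>+z. (ennreal (sqrt (\<rho> z) * norm (f (x - z) - f x)))\<^sup>2 \<partial>lborel)"
      by (rule Cauchy_Schwarz_nn_integral) measurable
    also have "(\<integral>\<^sup>+z. (ennreal (sqrt (\<rho> z)))\<^sup>2 \<partial>lborel) = 1"
      using m(2) rnn by (simp add: ennreal_power)
    also have "(\<integral>\<^sup>+z. (ennreal (sqrt (\<rho> z) * norm (f (x - z) - f x)))\<^sup>2 \<partial>lborel)
        = (\<integral>\<^sup>+z. ennreal (\<rho> z) * ennreal ((norm (f (x - z) - f x))\<^sup>2) \<partial>lborel)"
      using m(2) by (intro nn_integral_cong) (simp add: ennreal_power power_mult_distrib ennreal_mult)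
    finally show ?thesis by simp
  qed
  have inner: "ennreal (\<rho> z) * (\<integral>\<^sup>+x. ennreal ((norm (f (x - z) - f x))\<^sup>2) \<partial>lborel) \<le> ennreal (\<rho> z) * ennreal (e\<^sup>2)" for z
  proof (cases "r \<le> norm z")
    case True
    then show ?thesis using m(3)[of z] by simp
  next
    case False
    then have le: "L2_norm UNIV (\<lambda>x. f (x - z) - f x) \<le> e" by (intro e) simp
    have d: "(\<lambda>x. f (x - z) - f x) \<in> L2 UNIV" by (intro L2_diff L2_translation fL2)
    have "(\<integral>\<^sup>+x. ennreal ((norm (f (x - z) - f x))\<^sup>2) \<partial>lborel) = (\<integral>\<^sup>+x. ennreal ((norm (f (x - z) - f x))\<^sup>2) \<partial>lebesgue)"
      by (rule nn_integral_completion[symmetric])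
    also have "\<dots> = ennreal ((L2_norm UNIV (\<lambda>x. f (x - z) - f x))\<^sup>2)"
      using L2_integrable[OF d] unfolding L2_norm_sq lebesgue_on_UNIV_eq
      by (intro nn_integral_eq_integral) auto
    also have "\<dots> \<le> ennreal (e\<^sup>2)"
      using le by (intro ennreal_leI power_mono) auto
    finally show ?thesis by (intro mult_left_mono) auto
  qed
  have "(\<integral>\<^sup>+x. ennreal ((norm ((LINT y|lborel. of_real (\<rho> (x - y)) * f y) - f x))\<^sup>2) \<partial>lborel)
    \<le> (\<integral>\<^sup>+x. (\<integral>\<^sup>+z. ennreal (\<rho> z) * ennreal ((norm (f (x - z) - f x))\<^sup>2) \<partial>lborel) \<partial>lborel)"
    by (intro nn_integral_mono pt)
  also have "\<dots> = (\<integral>\<^sup>+z. (\<integral>\<^sup>+x. ennreal (\<rho> z) * ennreal ((norm (f (x - z) - f x))\<^sup>2) \<partial>lborel) \<partial>lborel)"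
    by (rule lborel_pair.Fubini') measurable
  also have "\<dots> = (\<integral>\<^sup>+z. ennreal (\<rho> z) * (\<integral>\<^sup>+x. ennreal ((norm (f (x - z) - f x))\<^sup>2) \<partial>lborel) \<partial>lborel)"
    by (intro nn_integral_cong nn_integral_cmult) measurable
  also have "\<dots> \<le> (\<integral>\<^sup>+z. ennreal (\<rho> z) * ennreal (e\<^sup>2) \<partial>lborel)"
    by (intro nn_integral_mono inner)
  also have "\<dots> = ennreal (e\<^sup>2)"
    using rnn by (subst nn_integral_multc) auto
  finally show ?thesis .
qed

text \<open>\<open>f\<close> is exchanged for a Borel representative: changes on a null set affect
  neither the convolution nor the norms of differences of translates.\<close>

lemma conv_mollifier_close:
  fixes f :: "real^'d \<Rightarrow> complex"
  assumes \<rho>: "mollifier r \<rho>" and fi: "integrable lebesgue f" and fL2: "f \<in> L2 UNIV"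
    and e: "\<And>y. norm y \<le> r \<Longrightarrow> L2_norm UNIV (\<lambda>x. f (x - y) - f x) \<le> e" and r: "0 \<le> r"
  shows "(\<lambda>x. conv (\<lambda>x. of_real (\<rho> x)) f x - f x) \<in> L2 UNIV"
    and "L2_norm UNIV (\<lambda>x. conv (\<lambda>x. of_real (\<rho> x)) f x - f x) \<le> e"
proof -
  note m = mollifierD[OF \<rho>]
  note [measurable] = m(6)
  have fm[measurable]: "f \<in> borel_measurable lebesgue" using fi by simp
  obtain f' where f'[measurable]: "f' \<in> borel_measurable borel" and ae: "AE x in lebesgue. f x = f' x"
    using lebesgue_measurable_borel_version[OF fm] by blast
  have f'm[measurable]: "f' \<in> borel_measurable lebesgue" using f' by (rule borel_imp_lebesgue)
  have f'i: "integrable lborel f'"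
    using fi integrable_cong_AE[OF fm f'm ae] integrable_completion[of f' lborel] by simp
  have f'L2: "f' \<in> L2 UNIV"
    using fL2
  proof (rule L2_norm_mono(1))
    show "AE x in lebesgue_on UNIV. norm (f' x) \<le> norm (f x)"
      unfolding lebesgue_on_UNIV_eq using ae by eventually_elim simp
  qed (simp add: lebesgue_on_UNIV_eq)
  have d0: "L2_norm UNIV (\<lambda>x. f' x - f x) = 0" "L2_norm UNIV (\<lambda>x. f x - f' x) = 0"
  proof -
    have ae': "AE x in lebesgue_on UNIV. f x - f' x = 0"
      unfolding lebesgue_on_UNIV_eq using ae by eventually_elim simp
    have m': "(\<lambda>x. f x - f' x) \<in> borel_measurable (lebesgue_on UNIV)"
      unfolding lebesgue_on_UNIV_eq by measurable
    show "L2_norm UNIV (\<lambda>x. f x - f' x) = 0" by (rule L2_norm_0I[OF ae' m'])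
    then show "L2_norm UNIV (\<lambda>x. f' x - f x) = 0" by (subst L2_norm_minus_commute)
  qed
  have e': "L2_norm UNIV (\<lambda>x. f' (x - y) - f' x) \<le> e" if "norm y \<le> r" for y
  proof -
    have "L2_norm UNIV (\<lambda>x. f' (x - y) - f' x) \<le> L2_norm UNIV (\<lambda>x. f' (x - y) - f (x - y)) + L2_norm UNIV (\<lambda>x. f (x - y) - f' x)"
      by (intro L2_norm_diff_triangle L2_translation fL2 f'L2)
    also have "L2_norm UNIV (\<lambda>x. f' (x - y) - f (x - y)) = 0"
      using L2_translation(2)[OF L2_diff(1)[OF f'L2 fL2], where y = y] d0 by simp
    also have "L2_norm UNIV (\<lambda>x. f (x - y) - f' x) \<le> L2_norm UNIV (\<lambda>x. f (x - y) - f x) + L2_norm UNIV (\<lambda>x. f x - f' x)"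
      by (intro L2_norm_diff_triangle L2_translation fL2 f'L2)
    finally show ?thesis using e[OF that] d0 by simp
  qed
  have conv_eq: "conv (\<lambda>x. of_real (\<rho> x)) f x = (LINT y|lborel. of_real (\<rho> (x - y)) * f' y)" for x
  proof -
    have mr: "(\<lambda>y. complex_of_real (\<rho> (x - y))) \<in> borel_measurable lebesgue"
      by (rule borel_imp_lebesgue) measurable
    have "conv (\<lambda>x. of_real (\<rho> x)) f x = (LINT y|lebesgue. of_real (\<rho> (x - y)) * f' y)"
      unfolding conv_def using ae mr by (intro integral_cong_AE borel_measurable_times) auto
    also have "\<dots> = (LINT y|lborel. of_real (\<rho> (x - y)) * f' y)"
      by (rule integral_completion) measurable
    finally show ?thesis .
  qed
  have cm[measurable]: "conv (\<lambda>x. of_real (\<rho> x)) f \<in> borel_measurable lebesgue"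
    by (intro borel_imp_lebesgue smooth_borel conv_smooth m fi)
  let ?N = "\<lambda>x. conv (\<lambda>x. of_real (\<rho> x)) f x - f x"
  have "(\<integral>\<^sup>+x. ennreal ((norm (?N x))\<^sup>2) \<partial>lebesgue) = (\<integral>\<^sup>+x. ennreal ((norm ((LINT y|lborel. of_real (\<rho> (x - y)) * f' y) - f' x))\<^sup>2) \<partial>lebesgue)"
    using ae by (intro nn_integral_cong_AE) (auto simp: conv_eq)
  also have "\<dots> = (\<integral>\<^sup>+x. ennreal ((norm ((LINT y|lborel. of_real (\<rho> (x - y)) * f' y) - f' x))\<^sup>2) \<partial>lborel)"
    by (rule nn_integral_completion)
  also have "\<dots> \<le> ennreal (e\<^sup>2)"
    by (rule conv_mollifier_close_borel[OF \<rho> f' f'i f'L2 e' r])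
  finally have le: "(\<integral>\<^sup>+x. ennreal ((norm (?N x))\<^sup>2) \<partial>lebesgue) \<le> ennreal (e\<^sup>2)" .
  have i: "integrable lebesgue (\<lambda>x. (norm (?N x))\<^sup>2)"
    by (rule integrableI_bounded) (use le in \<open>auto simp: le_less_trans[OF le]\<close>)
  then show "?N \<in> L2 UNIV" by (simp add: L2_def lebesgue_on_UNIV_eq)
  have "0 \<le> e" using e[of 0] r L2_norm_nonneg[of UNIV "\<lambda>x. f (x - 0) - f x"] by simp
  have E: "(\<integral>\<^sup>+x. ennreal ((norm (?N x))\<^sup>2) \<partial>lebesgue) = ennreal ((L2_norm UNIV ?N)\<^sup>2)"
    unfolding L2_norm_sq lebesgue_on_UNIV_eq by (rule nn_integral_eq_integral[OF i]) simp
  have "(L2_norm UNIV ?N)\<^sup>2 \<le> e\<^sup>2"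
    using le unfolding E by (simp only: ennreal_le_iff zero_le_power2)
  then show "L2_norm UNIV ?N \<le> e" using \<open>0 \<le> e\<close> by (rule power2_le_imp_le)
qed

text \<open>The estimate covers every smaller radius and every mollifier of that radius, so that one
  mollifier can serve finitely many functions at once, such as a function and its partial
  derivatives.\<close>

lemma mollification_approximates:
  fixes f :: "real^'d \<Rightarrow> complex"
  assumes fL2: "f \<in> L2 UNIV" and fi: "integrable lebesgue f" and R: "\<And>x. R < norm x \<Longrightarrow> f x = 0" and e: "0 < e"
  obtains r where "0 < r" "\<And>s \<rho>. 0 < s \<Longrightarrow> s \<le> r \<Longrightarrow> mollifier s \<rho> \<Longrightarrow>
      (\<lambda>x. conv (\<lambda>x. of_real (\<rho> x)) f x - f x) \<in> L2 UNIV \<and>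
      L2_norm UNIV (\<lambda>x. conv (\<lambda>x. of_real (\<rho> x)) f x - f x) \<le> e"
proof -
  obtain r where r: "0 < r" "\<And>y. norm y \<le> r \<Longrightarrow> L2_norm UNIV (\<lambda>x. f (x - y) - f x) \<le> e"
    by (rule L2_translation_continuous[OF fL2 _ e, of R]) (erule R, blast)
  show thesis
  proof (rule that[OF r(1)])
    fix s and \<rho> :: "real^'d \<Rightarrow> real" assume s: "0 < s" "s \<le> r" and \<rho>: "mollifier s \<rho>"
    have le: "L2_norm UNIV (\<lambda>x. f (x - y) - f x) \<le> e" if "norm y \<le> s" for y
      using r(2)[of y] that s by linarith
    show "(\<lambda>x. conv (\<lambda>x. of_real (\<rho> x)) f x - f x) \<in> L2 UNIV \<and>
      L2_norm UNIV (\<lambda>x. conv (\<lambda>x. of_real (\<rho> x)) f x - f x) \<le> e"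
      by (intro conjI conv_mollifier_close[OF \<rho> fi fL2]) (use s le in auto)
  qed
qed

lemma conv_eq_0:
  assumes "\<And>y. y \<in> S \<Longrightarrow> \<rho> (x - y) = 0" "\<And>y. y \<notin> S \<Longrightarrow> f y = 0"
  shows "conv \<rho> f x = 0"
proof -
  have "(\<lambda>y. \<rho> (x - y) * f y) = (\<lambda>y. 0)" using assms by (metis mult_eq_0_iff)
  then show ?thesis by (simp add: conv_def)
qed

section \<open>Weak gradients\<close>

lemma L2_restrict:
  fixes f :: "real^'d \<Rightarrow> 'b::euclidean_space"
  assumes S: "S \<in> sets lebesgue"
  shows "(\<lambda>x. if x \<in> S then f x else 0) \<in> L2 UNIV \<longleftrightarrow> f \<in> L2 S"
    and "L2_norm UNIV (\<lambda>x. if x \<in> S then f x else 0) = L2_norm S f"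
proof -
  have eq: "(\<lambda>x. (norm (if x \<in> S then f x else 0))\<^sup>2) = (\<lambda>x. if x \<in> S then (norm (f x))\<^sup>2 else 0)"
    by auto
  show "(\<lambda>x. if x \<in> S then f x else 0) \<in> L2 UNIV \<longleftrightarrow> f \<in> L2 S"
    unfolding L2_def mem_Collect_eq lebesgue_on_UNIV_eq eq
    by (simp add: Lebesgue_Measure.integrable_restrict_UNIV[OF S] borel_measurable_if[OF S])
  show "L2_norm UNIV (\<lambda>x. if x \<in> S then f x else 0) = L2_norm S f"
    unfolding L2_norm_def lebesgue_on_UNIV_eq eq Lebesgue_Measure.integral_restrict_UNIV[OF S] ..
qed

lemma lebesgue_on_integral_eq:
  fixes f :: "real^'d \<Rightarrow> 'b::euclidean_space"
  assumes S: "S \<in> sets lebesgue" and 0: "\<And>x. x \<notin> S \<Longrightarrow> f x = 0"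
  shows "(LINT x|lebesgue_on S. f x) = (LINT x|lebesgue. f x)"
proof -
  have "(\<lambda>x. if x \<in> S then f x else 0) = f" using 0 by auto
  then show ?thesis using Lebesgue_Measure.integral_restrict_UNIV[OF S, of f] by simp
qed

text \<open>Testing with \<open>y \<mapsto> \<rho> (x - y)\<close> shows that mollifications of \<open>f\<close> vanish away from the boundary.\<close>

lemma fundamental_lemma:
  fixes f :: "real^'d \<Rightarrow> complex"
  assumes \<Omega>: "open \<Omega>" "bounded \<Omega>" and f: "f \<in> L2 \<Omega>"
    and 0: "\<And>\<phi>. \<phi> \<in> test_fun \<Omega> \<Longrightarrow> (LINT x|lebesgue_on \<Omega>. f x * \<phi> x) = 0"
  shows "AE x in lebesgue_on \<Omega>. f x = 0"
proof -
  have S: "\<Omega> \<in> sets lebesgue" using \<Omega>(1) by (simp add: borel_open)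
  have fin: "finite_measure (lebesgue_on \<Omega>)" by (rule finite_measure_lebesgue_on_bounded[OF \<Omega>(2,1)])
  define f0 where "f0 x = (if x \<in> \<Omega> then f x else 0)" for x
  have f0L2: "f0 \<in> L2 UNIV" unfolding f0_def using L2_restrict(1)[OF S] f by blast
  have f0i: "integrable lebesgue f0"
    unfolding f0_def Lebesgue_Measure.integrable_restrict_UNIV[OF S] by (rule L2_integrable_self(1)[OF fin f])
  obtain R where R: "\<And>x. x \<in> \<Omega> \<Longrightarrow> norm x \<le> R" using \<Omega>(2) unfolding bounded_iff by blast
  have f0R: "f0 x = 0" if "R < norm x" for x using R[of x] that by (auto simp: f0_def)
  have "- \<Omega> \<noteq> {}" using \<Omega>(2) not_bounded_UNIV by (metis Compl_UNIV_eq double_compl)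
  have cl: "closed (- \<Omega>)" using \<Omega>(1) by (simp add: closed_def)
  have AE: "AE x in lebesgue. d < infdist x (- \<Omega>) \<longrightarrow> f0 x = 0" if d: "d > 0" for d
  proof -
    \<comment> \<open>For \<open>x\<close> in \<open>U\<close> a kernel of radius at most
      \<open>d\<close>, reflected and centred at \<open>x\<close>, is a test function of
      \<open>\<Omega>\<close>. The mollification of \<open>f0\<close> therefore vanishes on
      \<open>U\<close>, where \<open>f0\<close> is the mollification error up to sign.\<close>
    define U where "U = {x. d < infdist x (- \<Omega>)}"
    have U: "open U" unfolding U_def by (intro open_Collect_less continuous_intros)
    then have Us: "U \<in> sets lebesgue" by (simp add: borel_open)
    have cb: "cball x d \<subseteq> \<Omega>" if "x \<in> U" for x
      using that infdist_le[of _ "- \<Omega>" x] unfolding U_def by force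
    have gL2: "(\<lambda>x. if x \<in> U then f0 x else 0) \<in> L2 UNIV"
      by (rule L2_norm_mono(1)[OF f0L2]) (use f0L2 Us in \<open>auto simp: L2_def lebesgue_on_UNIV_eq intro!: measurable_If_set\<close>)
    have "L2_norm UNIV (\<lambda>x. if x \<in> U then f0 x else 0) \<le> e" if e: "0 < e" for e
    proof -
      obtain r where r: "0 < r" "\<And>s \<rho>. 0 < s \<Longrightarrow> s \<le> r \<Longrightarrow> mollifier s \<rho> \<Longrightarrow>
          (\<lambda>x. conv (\<lambda>x. of_real (\<rho> x)) f0 x - f0 x) \<in> L2 UNIV \<and>
          L2_norm UNIV (\<lambda>x. conv (\<lambda>x. of_real (\<rho> x)) f0 x - f0 x) \<le> e"
        by (rule mollification_approximates[OF f0L2 f0i _ e, of R]) (erule f0R, blast)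
      define s where "s = min r d"
      have s: "0 < s" "s \<le> r" "s \<le> d" using r d by (auto simp: s_def)
      obtain \<rho> :: "real^'d \<Rightarrow> real" where \<rho>: "mollifier s \<rho>" using mollifier_exists[OF s(1)] .
      note m = mollifierD[OF \<rho>] and c = r(2)[OF s(1,2) \<rho>]
      have z: "conv (\<lambda>x. of_real (\<rho> x)) f0 x = 0" if x: "x \<in> U" for x
      proof -
        have "(\<lambda>y. complex_of_real (\<rho> (x - y))) \<in> test_fun \<Omega>"
        proof (rule test_funI)
          show "smooth (\<lambda>y. complex_of_real (\<rho> (x - y)))"
            by (rule test_fun_smooth[OF test_fun_reflect[OF m(1)]])
          show "cball x s \<subseteq> \<Omega>" using cb[OF x] s(3) by force
          show "complex_of_real (\<rho> (x - y)) = 0" if "y \<notin> cball x s" for y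
            using that m(3)[of "x - y"] by (simp add: dist_norm)
        qed auto
        from 0[OF this] have "(LINT y|lebesgue_on \<Omega>. f y * complex_of_real (\<rho> (x - y))) = 0" .
        also have "(LINT y|lebesgue_on \<Omega>. f y * complex_of_real (\<rho> (x - y)))
            = (LINT y|lebesgue_on \<Omega>. of_real (\<rho> (x - y)) * f0 y)"
          by (rule Bochner_Integration.integral_cong) (auto simp: f0_def space_restrict_space)
        also have "\<dots> = conv (\<lambda>x. of_real (\<rho> x)) f0 x"
          unfolding conv_def by (rule lebesgue_on_integral_eq[OF S]) (simp add: f0_def)
        finally show ?thesis .
      qed
      have "L2_norm UNIV (\<lambda>x. if x \<in> U then f0 x else 0) \<le> L2_norm UNIV (\<lambda>x. conv (\<lambda>x. of_real (\<rho> x)) f0 x - f0 x)"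
        by (rule L2_norm_mono(2)) (use c L2_measurable[OF gL2] z in \<open>auto intro!: AE_I2\<close>)
      then show ?thesis using c by simp
    qed
    then have "L2_norm UNIV (\<lambda>x. if x \<in> U then f0 x else 0) \<le> 0" by (rule field_le_epsilon) simp
    then have "L2_norm UNIV (\<lambda>x. if x \<in> U then f0 x else 0) = 0" by (intro antisym) auto
    from L2_norm_eq_0[OF gL2 this] have "AE x in lebesgue. (if x \<in> U then f0 x else 0) = 0"
      unfolding lebesgue_on_UNIV_eq .
    then show ?thesis by eventually_elim (auto simp: U_def)
  qed
  have "AE x in lebesgue. \<forall>n::nat. 1 / Suc n < infdist x (- \<Omega>) \<longrightarrow> f0 x = 0"
    unfolding AE_all_countable using AE by simp
  then have "AE x in lebesgue. x \<in> \<Omega> \<longrightarrow> f x = 0"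
  proof eventually_elim
    case (elim x)
    show ?case
    proof
      assume x: "x \<in> \<Omega>"
      have "infdist x (- \<Omega>) \<noteq> 0"
        using in_closed_iff_infdist_zero[OF cl \<open>- \<Omega> \<noteq> {}\<close>] x by auto
      then have "0 < infdist x (- \<Omega>)" using infdist_nonneg[of x "- \<Omega>"] by linarith
      then obtain n where "1 / Suc n < infdist x (- \<Omega>)" using nat_approx_posE by blast
      then show "f x = 0" using elim x by (auto simp: f0_def)
    qed
  qed
  then show ?thesis using S by (subst AE_restrict_space_iff) auto
qed

text \<open>Differentiating the translation invariance of the integral; the difference quotients converge
  uniformly on a bounded set.\<close>

lemma integral_pdiff_eq_0:
  fixes \<phi> :: "real^'d \<Rightarrow> complex"
  assumes \<phi>: "\<phi> \<in> test_fun UNIV"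
  shows "(LINT x|lebesgue. pdiff i \<phi> x) = 0"
proof -
  obtain S where S: "compact S" "\<And>x. x \<notin> S \<Longrightarrow> \<phi> x = 0" "\<And>x i. x \<notin> S \<Longrightarrow> pdiff i \<phi> x = 0"
    using test_funE[OF \<phi>] by metis
  obtain R where R: "\<And>x. x \<in> S \<Longrightarrow> norm x \<le> R"
    using compact_imp_bounded[OF S(1)] unfolding bounded_iff by blast
  let ?B = "cball (0::real^'d) (R + 1)"
  have Bi: "integrable lebesgue (indicat_real ?B)"
    using lmeasurable_cball[of "0::real^'d" "R+1"] by (simp add: lmeasurable_iff_integrable)
  define V where "V = (LINT x|lebesgue. indicat_real ?B x)"
  note i1 = test_fun_integrable(1)[OF \<phi>] and i3 = test_fun_integrable(1)[OF test_fun_pdiff[OF \<phi>]]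
  let ?I = "LINT x|lebesgue. pdiff i \<phi> x"
  have le: "norm ?I \<le> e * V" if e: "0 < e" for e
  proof -
    obtain d where d: "d > 0" "\<And>x h. norm h < d \<Longrightarrow> norm (\<phi> (x + h) - \<phi> x - (\<Sum>i\<in>UNIV. (h $ i) *\<^sub>R pdiff i \<phi> x)) \<le> e * norm h"
      by (rule test_fun_uniformly_differentiable[OF \<phi> e]) blast
    \<comment> \<open>\<open>t < d\<close> admits the first order expansion;
      \<open>t \<le> 1\<close> keeps the supports of \<open>\<phi>\<close> and of its translate
      inside \<open>?B\<close>.\<close>
    define t where "t = min (d/2) 1"
    have t: "0 < t" "t < d" "t \<le> 1" using d by (auto simp: t_def)
    define h where "h = t *\<^sub>R (axis i 1 :: real^'d)"
    have h: "norm h = t" using t by (simp add: h_def)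
    have hs: "(\<Sum>j\<in>UNIV. (h $ j) *\<^sub>R pdiff j \<phi> x) = t *\<^sub>R pdiff i \<phi> x" for x
    proof -
      have "(\<Sum>j\<in>UNIV. (h $ j) *\<^sub>R pdiff j \<phi> x) = (\<Sum>j\<in>UNIV. if j = i then t *\<^sub>R pdiff i \<phi> x else 0)"
        by (intro sum.cong) (auto simp: h_def axis_def)
      then show ?thesis by simp
    qed
    have mphi: "\<phi> \<in> borel_measurable lebesgue" using i1 by simp
    have i2: "integrable lebesgue (\<lambda>x. \<phi> (x + h))"
    proof -
      have "(\<lambda>x. \<phi> (x + h)) = (\<lambda>x. (\<lambda>y. \<phi> (0 - y)) (- h - x))" by simp
      moreover have "(\<lambda>x. (\<lambda>y. \<phi> (0 - y)) (- h - x)) \<in> test_fun UNIV"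
        by (intro test_fun_reflect \<phi>)
      ultimately show ?thesis using test_fun_integrable(1) by metis
    qed
    have "(LINT x|lebesgue. \<phi> (x + h)) = (LINT x|lebesgue. \<phi> x)"
      using lebesgue_integral_translation[OF mphi, of "- h"] by simp
    then have "(LINT x|lebesgue. \<phi> (x + h) - \<phi> x - t *\<^sub>R pdiff i \<phi> x) = - (t *\<^sub>R ?I)"
      using i1 i2 i3 by simp
    then have "t * norm ?I = norm (LINT x|lebesgue. \<phi> (x + h) - \<phi> x - t *\<^sub>R pdiff i \<phi> x)"
      using t by simp
    also have "\<dots> \<le> (LINT x|lebesgue. norm (\<phi> (x + h) - \<phi> x - t *\<^sub>R pdiff i \<phi> x))"
      by (rule integral_norm_bound)
    also have "\<dots> \<le> (LINT x|lebesgue. (e * t) * indicat_real ?B x)"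
    proof (rule integral_mono)
      show "integrable lebesgue (\<lambda>x. norm (\<phi> (x + h) - \<phi> x - t *\<^sub>R pdiff i \<phi> x))"
        using i1 i2 i3 by simp
      show "integrable lebesgue (\<lambda>x. (e * t) * indicat_real ?B x)" using Bi by simp
      show "norm (\<phi> (x + h) - \<phi> x - t *\<^sub>R pdiff i \<phi> x) \<le> (e * t) * indicat_real ?B x" for x
      proof (cases "x \<in> ?B")
        case True
        then show ?thesis using d(2)[of h x] h t hs by simp
      next
        case False
        then have "x \<notin> S" "x + h \<notin> S" using R[of x] R[of "x + h"] h t norm_triangle_ineq4[of "x + h" h] by auto
        then show ?thesis using S False by simp
      qed
    qed
    also have "\<dots> = t * (e * V)" by (simp add: V_def)
    finally show ?thesis using t by simp
  qed
  have V: "0 \<le> V" by (simp add: V_def)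
  have "norm ?I \<le> 0"
  proof (rule field_le_epsilon)
    fix e :: real assume e: "0 < e"
    have "norm ?I \<le> e / (V + 1) * V" using le[of "e / (V + 1)"] e V by simp
    also have "\<dots> \<le> 0 + e" using e V by (simp add: field_simps)
    finally show "norm ?I \<le> 0 + e" .
  qed
  then show ?thesis by simp
qed

lemma has_weak_grad_smooth:
  fixes u :: "real^'d \<Rightarrow> complex"
  assumes \<Omega>: "open \<Omega>" and u: "smooth u"
  shows "has_weak_grad \<Omega> u (\<lambda>x. \<chi> i. pdiff i u x)"
  unfolding has_weak_grad_def
proof (intro ballI allI)
  fix \<phi> i assume \<phi>: "\<phi> \<in> test_fun \<Omega>"
  have S: "\<Omega> \<in> sets lebesgue" using \<Omega> by (simp add: borel_open)
  obtain C where C: "C \<subseteq> \<Omega>" "\<And>x. x \<notin> C \<Longrightarrow> \<phi> x = 0" "\<And>x i. x \<notin> C \<Longrightarrow> pdiff i \<phi> x = 0"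
    using test_funE[OF \<phi>] by metis
  note \<phi>' = test_fun_UNIV[OF \<phi>]
  have i1: "integrable lebesgue (\<lambda>x. u x * pdiff i \<phi> x)"
    using test_fun_integrable(1)[OF test_fun_mult[OF test_fun_pdiff[OF \<phi>'] u]] by (simp add: mult.commute)
  have i2: "integrable lebesgue (\<lambda>x. pdiff i u x * \<phi> x)"
    using test_fun_integrable(1)[OF test_fun_mult[OF \<phi>' smooth_pdiff[OF u]]] by (simp add: mult.commute)
  have t: "(\<lambda>x. u x * \<phi> x) \<in> test_fun UNIV"
    using test_fun_mult[OF \<phi>' u] by (simp add: mult.commute)
  have "0 = (LINT x|lebesgue. pdiff i (\<lambda>x. u x * \<phi> x) x)"
    using integral_pdiff_eq_0[OF t] by simp
  also have "\<dots> = (LINT x|lebesgue. u x * pdiff i \<phi> x + pdiff i u x * \<phi> x)"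
    using pdiff_mult[OF u test_fun_smooth[OF \<phi>]] by simp
  also have "\<dots> = (LINT x|lebesgue. u x * pdiff i \<phi> x) + (LINT x|lebesgue. pdiff i u x * \<phi> x)"
    using i1 i2 by simp
  finally have "(LINT x|lebesgue. u x * pdiff i \<phi> x) = - (LINT x|lebesgue. pdiff i u x * \<phi> x)"
    by (simp add: eq_neg_iff_add_eq_0)
  moreover have "(LINT x|lebesgue_on \<Omega>. u x * pdiff i \<phi> x) = (LINT x|lebesgue. u x * pdiff i \<phi> x)"
    by (rule lebesgue_on_integral_eq[OF S]) (use C in auto)
  moreover have "(LINT x|lebesgue_on \<Omega>. pdiff i u x * \<phi> x) = (LINT x|lebesgue. pdiff i u x * \<phi> x)"
    by (rule lebesgue_on_integral_eq[OF S]) (use C in auto)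
  ultimately show "(LINT x|lebesgue_on \<Omega>. u x * pdiff i \<phi> x) = - (LINT x|lebesgue_on \<Omega>. (\<chi> i. pdiff i u x) $ i * \<phi> x)"
    by simp
qed

section \<open>Sobolev spaces\<close>

lemma borel_measurable_vec_nth [measurable (raw)]:
  fixes f :: "'a \<Rightarrow> complex^'d"
  assumes "f \<in> borel_measurable M"
  shows "(\<lambda>x. f x $ i) \<in> borel_measurable M"
  by (rule measurable_compose[OF assms borel_measurable_continuous_onI]) (intro continuous_intros)

lemma borel_measurable_vecI:
  fixes f :: "'a \<Rightarrow> complex^'d"
  assumes "\<And>i. (\<lambda>x. f x $ i) \<in> borel_measurable M"
  shows "f \<in> borel_measurable M"
proof (rule borel_measurable_euclidean_space[THEN iffD2], rule ballI)
  fix b :: "complex^'d" assume "b \<in> Basis"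
  then obtain i c where b: "b = axis i c" unfolding Basis_vec_def by blast
  have "(\<lambda>x. f x $ i \<bullet> c) \<in> borel_measurable M" using assms[of i] by measurable
  then show "(\<lambda>x. f x \<bullet> b) \<in> borel_measurable M" unfolding b inner_axis .
qed

lemma norm_vec_sq: "(norm (v :: complex^'d))\<^sup>2 = (\<Sum>i\<in>UNIV. (norm (v $ i))\<^sup>2)"
  by (simp add: norm_vec_def L2_set_def sum_nonneg)

lemma L2_vec_nth:
  fixes g :: "real^'n \<Rightarrow> complex^'d"
  assumes "g \<in> L2 \<Omega>"
  shows "(\<lambda>x. g x $ i) \<in> L2 \<Omega>" "L2_norm \<Omega> (\<lambda>x. g x $ i) \<le> L2_norm \<Omega> g"
proof -
  have m: "(\<lambda>x. g x $ i) \<in> borel_measurable (lebesgue_on \<Omega>)"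
    using L2_measurable[OF assms] by (rule borel_measurable_vec_nth)
  have le: "AE x in lebesgue_on \<Omega>. norm (g x $ i) \<le> norm (g x)"
    by (intro AE_I2 Finite_Cartesian_Product.norm_nth_le)
  show "(\<lambda>x. g x $ i) \<in> L2 \<Omega>" "L2_norm \<Omega> (\<lambda>x. g x $ i) \<le> L2_norm \<Omega> g"
    by (rule L2_norm_mono[OF assms m le])+
qed

lemma L2_vecI:
  fixes g :: "real^'n \<Rightarrow> complex^'d"
  assumes "\<And>i. (\<lambda>x. g x $ i) \<in> L2 \<Omega>"
  shows "g \<in> L2 \<Omega>" "(L2_norm \<Omega> g)\<^sup>2 = (\<Sum>i\<in>UNIV. (L2_norm \<Omega> (\<lambda>x. g x $ i))\<^sup>2)"
proof -
  have "integrable (lebesgue_on \<Omega>) (\<lambda>x. (norm (g x))\<^sup>2)"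
    unfolding norm_vec_sq using L2_integrable[OF assms] by simp
  then show "g \<in> L2 \<Omega>"
    using borel_measurable_vecI[OF L2_measurable[OF assms]] by (simp add: L2_def)
  show "(L2_norm \<Omega> g)\<^sup>2 = (\<Sum>i\<in>UNIV. (L2_norm \<Omega> (\<lambda>x. g x $ i))\<^sup>2)"
    unfolding L2_norm_sq norm_vec_sq using L2_integrable[OF assms] by simp
qed

text \<open>Treating a function and its gradient as one square integrable function turns the
  \<open>H1\<close> norm into an \<open>L2\<close> norm; the triangle inequality and completeness
  are inherited.\<close>

definition jet :: "(real^'d) set \<Rightarrow> (real^'d \<Rightarrow> complex) \<Rightarrow> real^'d \<Rightarrow> complex \<times> (complex^'d)" where
  "jet \<Omega> u x = (u x, wgrad \<Omega> u x)"

lemma norm_smult_cvec: "norm (c *s (v :: complex^'n)) = norm c * norm v"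
proof -
  have "(norm (c *s v))\<^sup>2 = (norm c * norm v)\<^sup>2"
    by (simp add: power_mult_distrib norm_vec_sq norm_mult sum_distrib_left)
  then show ?thesis by (simp add: power2_eq_iff_nonneg)
qed

locale bounded_open =
  fixes \<Omega> :: "(real^'d) set"
  assumes open_\<Omega>: "open \<Omega>" and bounded_\<Omega>: "bounded \<Omega>"
begin

lemma sets_\<Omega>: "\<Omega> \<in> sets lebesgue"
  using open_\<Omega> by (simp add: borel_open)

lemma finite_\<Omega>: "finite_measure (lebesgue_on \<Omega>)"
  by (rule finite_measure_lebesgue_on_bounded[OF bounded_\<Omega> open_\<Omega>])

lemma test_fun_L2: "\<phi> \<in> test_fun UNIV \<Longrightarrow> \<phi> \<in> L2 \<Omega>"
proof -
  assume \<phi>: "\<phi> \<in> test_fun UNIV"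
  obtain C where "C > 0" "\<And>x. norm (\<phi> x) \<le> C" using test_fun_bounded[OF \<phi>] by metis
  then show "\<phi> \<in> L2 \<Omega>"
    by (intro L2_bounded(1)[OF finite_\<Omega>]) (auto intro: smooth_measurable test_fun_smooth[OF \<phi>])
qed

lemma L2_mult_test_fun:
  assumes u: "u \<in> L2 \<Omega>" and \<phi>: "\<phi> \<in> test_fun UNIV"
  shows "(\<lambda>x. \<phi> x * u x) \<in> L2 \<Omega>" "integrable (lebesgue_on \<Omega>) (\<lambda>x. u x * \<phi> x)"
    "norm (LINT x|lebesgue_on \<Omega>. u x * \<phi> x) \<le> L2_norm \<Omega> u * L2_norm \<Omega> \<phi>"
proof -
  obtain C where C: "C > 0" "\<And>x. norm (\<phi> x) \<le> C" using test_fun_bounded[OF \<phi>] by metis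
  have m[measurable]: "\<phi> \<in> borel_measurable (lebesgue_on \<Omega>)" by (intro smooth_measurable test_fun_smooth[OF \<phi>])
  note [measurable] = L2_measurable[OF u]
  show "(\<lambda>x. \<phi> x * u x) \<in> L2 \<Omega>"
  proof (rule L2_dominated(1)[OF u])
    show "AE x in lebesgue_on \<Omega>. norm (\<phi> x * u x) \<le> C * norm (u x)"
      using C by (intro AE_I2) (simp add: norm_mult mult_right_mono)
  qed measurable
  have mm: "(\<lambda>x. u x * \<phi> x) \<in> borel_measurable (lebesgue_on \<Omega>)" by measurable
  have le: "AE x in lebesgue_on \<Omega>. norm (u x * \<phi> x) \<le> 1 * (norm (u x) * norm (\<phi> x))"
    by (intro AE_I2) (simp add: norm_mult)
  show "integrable (lebesgue_on \<Omega>) (\<lambda>x. u x * \<phi> x)"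
    "norm (LINT x|lebesgue_on \<Omega>. u x * \<phi> x) \<le> L2_norm \<Omega> u * L2_norm \<Omega> \<phi>"
    using L2_bilinear_bound[OF u test_fun_L2[OF \<phi>] mm le] by auto
qed

text \<open>This makes the choice operator in \<open>wgrad\<close> harmless: its value is determined
  almost everywhere, and the later identities for it are of that kind.\<close>

lemma weak_grad_unique:
  assumes "g \<in> L2 \<Omega>" "h \<in> L2 \<Omega>" "has_weak_grad \<Omega> u g" "has_weak_grad \<Omega> u h"
  shows "AE x in lebesgue_on \<Omega>. g x = h x"
proof -
  have "AE x in lebesgue_on \<Omega>. g x $ i - h x $ i = 0" for i
  proof (rule fundamental_lemma[OF open_\<Omega> bounded_\<Omega>])
    show "(\<lambda>x. g x $ i - h x $ i) \<in> L2 \<Omega>" by (intro L2_diff L2_vec_nth assms)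
    fix \<phi> assume \<phi>: "\<phi> \<in> test_fun \<Omega>"
    note i = L2_mult_test_fun(2)[OF L2_vec_nth(1) test_fun_UNIV[OF \<phi>]]
    have "(LINT x|lebesgue_on \<Omega>. (g x $ i - h x $ i) * \<phi> x)
      = (LINT x|lebesgue_on \<Omega>. g x $ i * \<phi> x) - (LINT x|lebesgue_on \<Omega>. h x $ i * \<phi> x)"
      using i[OF assms(1)] i[OF assms(2)] by (simp add: left_diff_distrib)
    also have "\<dots> = 0"
      using bspec[OF assms(3)[unfolded has_weak_grad_def] \<phi>, THEN spec, of i]
        bspec[OF assms(4)[unfolded has_weak_grad_def] \<phi>, THEN spec, of i] by simp
    finally show "(LINT x|lebesgue_on \<Omega>. (g x $ i - h x $ i) * \<phi> x) = 0" .
  qed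
  then have "AE x in lebesgue_on \<Omega>. \<forall>i. g x $ i - h x $ i = 0"
    by (simp add: AE_all_countable)
  then show ?thesis by eventually_elim (simp add: vec_eq_iff)
qed

lemma has_weak_grad_add:
  assumes "u \<in> L2 \<Omega>" "v \<in> L2 \<Omega>" "g \<in> L2 \<Omega>" "h \<in> L2 \<Omega>" "has_weak_grad \<Omega> u g" "has_weak_grad \<Omega> v h"
  shows "has_weak_grad \<Omega> (\<lambda>x. u x + v x) (\<lambda>x. g x + h x)"
  unfolding has_weak_grad_def
proof (intro ballI allI)
  fix \<phi> i assume \<phi>: "\<phi> \<in> test_fun \<Omega>"
  note i1 = L2_mult_test_fun(2)[OF _ test_fun_UNIV[OF test_fun_pdiff[OF \<phi>]]]
  note i2 = L2_mult_test_fun(2)[OF L2_vec_nth(1) test_fun_UNIV[OF \<phi>]]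
  show "(LINT x|lebesgue_on \<Omega>. (u x + v x) * pdiff i \<phi> x) = - (LINT x|lebesgue_on \<Omega>. (g x + h x) $ i * \<phi> x)"
    using assms(5,6) \<phi> i1[OF assms(1)] i1[OF assms(2)] i2[OF assms(3)] i2[OF assms(4)]
    by (simp add: has_weak_grad_def distrib_right)
qed

lemma has_weak_grad_cmult:
  assumes "u \<in> L2 \<Omega>" "g \<in> L2 \<Omega>" "has_weak_grad \<Omega> u g"
  shows "has_weak_grad \<Omega> (\<lambda>x. c * u x) (\<lambda>x. c *s g x)"
  using assms(3) by (simp add: has_weak_grad_def mult.assoc)

lemma L2_smult:
  assumes "g \<in> L2 \<Omega>"
  shows "(\<lambda>x. c *s g x :: complex^'d) \<in> L2 \<Omega>"
  by (rule L2_vecI) (simp add: L2_cmult L2_vec_nth[OF assms])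

section \<open>Calculus in H1\<close>

lemma H1D:
  assumes "u \<in> H1 \<Omega>"
  shows "u \<in> L2 \<Omega>" "wgrad \<Omega> u \<in> L2 \<Omega>" "has_weak_grad \<Omega> u (wgrad \<Omega> u)"
proof -
  obtain g where "u \<in> L2 \<Omega>" "g \<in> L2 \<Omega>" "has_weak_grad \<Omega> u g" using assms unfolding H1_def by blast
  then show "u \<in> L2 \<Omega>" "wgrad \<Omega> u \<in> L2 \<Omega>" "has_weak_grad \<Omega> u (wgrad \<Omega> u)"
    unfolding wgrad_def using someI[of "\<lambda>g. g \<in> L2 \<Omega> \<and> has_weak_grad \<Omega> u g" g] by auto
qed

lemma H1I:
  assumes "u \<in> L2 \<Omega>" "g \<in> L2 \<Omega>" "has_weak_grad \<Omega> u g"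
  shows "u \<in> H1 \<Omega>" "AE x in lebesgue_on \<Omega>. wgrad \<Omega> u x = g x"
proof -
  show u: "u \<in> H1 \<Omega>" using assms unfolding H1_def by blast
  show "AE x in lebesgue_on \<Omega>. wgrad \<Omega> u x = g x"
    using weak_grad_unique[OF H1D(2)[OF u] assms(2) H1D(3)[OF u] assms(3)] .
qed

lemma H1_add:
  assumes u: "u \<in> H1 \<Omega>" and v: "v \<in> H1 \<Omega>"
  shows "(\<lambda>x. u x + v x) \<in> H1 \<Omega>"
    "AE x in lebesgue_on \<Omega>. wgrad \<Omega> (\<lambda>x. u x + v x) x = wgrad \<Omega> u x + wgrad \<Omega> v x"
  using H1I[OF L2_add(1)[OF H1D(1)[OF u] H1D(1)[OF v]] L2_add(1)[OF H1D(2)[OF u] H1D(2)[OF v]]]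
    has_weak_grad_add[OF H1D(1)[OF u] H1D(1)[OF v] H1D(2)[OF u] H1D(2)[OF v] H1D(3)[OF u] H1D(3)[OF v]]
  by auto

lemma H1_cmult:
  assumes u: "u \<in> H1 \<Omega>"
  shows "(\<lambda>x. c * u x) \<in> H1 \<Omega>"
    "AE x in lebesgue_on \<Omega>. wgrad \<Omega> (\<lambda>x. c * u x) x = c *s wgrad \<Omega> u x"
  using H1I[OF L2_cmult[OF H1D(1)[OF u]] L2_smult[OF H1D(2)[OF u]] has_weak_grad_cmult[OF H1D[OF u]]]
  by auto

lemma H1_diff:
  assumes u: "u \<in> H1 \<Omega>" and v: "v \<in> H1 \<Omega>"
  shows "(\<lambda>x. u x - v x) \<in> H1 \<Omega>"
    "AE x in lebesgue_on \<Omega>. wgrad \<Omega> (\<lambda>x. u x - v x) x = wgrad \<Omega> u x - wgrad \<Omega> v x"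
proof -
  have eq: "(\<lambda>x. u x - v x) = (\<lambda>x. u x + (-1) * v x)" by simp
  show "(\<lambda>x. u x - v x) \<in> H1 \<Omega>" unfolding eq by (intro H1_add H1_cmult u v)
  show "AE x in lebesgue_on \<Omega>. wgrad \<Omega> (\<lambda>x. u x - v x) x = wgrad \<Omega> u x - wgrad \<Omega> v x"
    unfolding eq using H1_add(2)[OF u H1_cmult(1)[OF v, of "-1"]] H1_cmult(2)[OF v, of "-1"]
    by eventually_elim (simp add: vec_eq_iff)
qed

lemma jet_measurable: "u \<in> H1 \<Omega> \<Longrightarrow> jet \<Omega> u \<in> borel_measurable (lebesgue_on \<Omega>)"
  unfolding jet_def[abs_def] using H1D[of u] by (intro borel_measurable_Pair L2_measurable)

lemma jet_L2: "u \<in> H1 \<Omega> \<Longrightarrow> jet \<Omega> u \<in> L2 \<Omega>"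
  using jet_measurable L2_integrable[OF H1D(1)] L2_integrable[OF H1D(2)]
  by (simp add: L2_def jet_def norm_Pair)

lemma H1_norm_eq_jet: "u \<in> H1 \<Omega> \<Longrightarrow> H1_norm \<Omega> u = L2_norm \<Omega> (jet \<Omega> u)"
  using L2_integrable[OF H1D(1)] L2_integrable[OF H1D(2)]
  by (simp add: H1_norm_def L2_norm_sq L2_norm_def[of _ "jet \<Omega> u"] jet_def norm_Pair)

lemma H1_norm_nonneg [simp]: "0 \<le> H1_norm \<Omega> u"
  by (simp add: H1_norm_def)

lemma L2_norm_le_H1_norm: "L2_norm \<Omega> u \<le> H1_norm \<Omega> u"
  by (simp add: H1_norm_def real_le_rsqrt)

lemma H1_norm_diff_jet:
  assumes u: "u \<in> H1 \<Omega>" and v: "v \<in> H1 \<Omega>"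
  shows "H1_norm \<Omega> (\<lambda>x. u x - v x) = L2_norm \<Omega> (\<lambda>x. jet \<Omega> u x - jet \<Omega> v x)"
proof -
  have "H1_norm \<Omega> (\<lambda>x. u x - v x) = L2_norm \<Omega> (jet \<Omega> (\<lambda>x. u x - v x))"
    by (intro H1_norm_eq_jet H1_diff u v)
  also have "\<dots> = L2_norm \<Omega> (\<lambda>x. jet \<Omega> u x - jet \<Omega> v x)"
  proof (rule L2_norm_cong_AE)
    show "AE x in lebesgue_on \<Omega>. jet \<Omega> (\<lambda>x. u x - v x) x = jet \<Omega> u x - jet \<Omega> v x"
      using H1_diff(2)[OF u v] by eventually_elim (simp add: jet_def)
  qed (intro L2_measurable L2_diff jet_L2 jet_measurable H1_diff u v)+
  finally show ?thesis .
qed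

lemma H1_norm_add:
  assumes u: "u \<in> H1 \<Omega>" and v: "v \<in> H1 \<Omega>"
  shows "H1_norm \<Omega> (\<lambda>x. u x + v x) \<le> H1_norm \<Omega> u + H1_norm \<Omega> v"
proof -
  have "H1_norm \<Omega> (\<lambda>x. u x + v x) = L2_norm \<Omega> (jet \<Omega> (\<lambda>x. u x + v x))"
    by (intro H1_norm_eq_jet H1_add u v)
  also have "\<dots> = L2_norm \<Omega> (\<lambda>x. jet \<Omega> u x + jet \<Omega> v x)"
  proof (rule L2_norm_cong_AE)
    show "AE x in lebesgue_on \<Omega>. jet \<Omega> (\<lambda>x. u x + v x) x = jet \<Omega> u x + jet \<Omega> v x"
      using H1_add(2)[OF u v] by eventually_elim (simp add: jet_def)
  qed (intro L2_measurable L2_add jet_L2 jet_measurable H1_add u v)+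
  also have "\<dots> \<le> H1_norm \<Omega> u + H1_norm \<Omega> v"
    unfolding H1_norm_eq_jet[OF u] H1_norm_eq_jet[OF v] by (intro L2_add jet_L2 u v)
  finally show ?thesis .
qed

lemma H1_norm_cmult:
  assumes u: "u \<in> H1 \<Omega>"
  shows "H1_norm \<Omega> (\<lambda>x. c * u x) = norm c * H1_norm \<Omega> u"
proof -
  have "L2_norm \<Omega> (wgrad \<Omega> (\<lambda>x. c * u x)) = L2_norm \<Omega> (\<lambda>x. c *s wgrad \<Omega> u x)"
    by (rule L2_norm_cong_AE[OF _ _ H1_cmult(2)[OF u]]) (intro L2_measurable H1D H1_cmult L2_smult u)+
  also have "\<dots> = norm c * L2_norm \<Omega> (wgrad \<Omega> u)"
    by (simp add: L2_norm_def norm_smult_cvec power_mult_distrib real_sqrt_mult)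
  finally show ?thesis
    by (simp add: H1_norm_def L2_norm_cmult power_mult_distrib real_sqrt_mult distrib_left[symmetric])
qed

lemma H1_norm_minus: "u \<in> H1 \<Omega> \<Longrightarrow> H1_norm \<Omega> (\<lambda>x. - u x) = H1_norm \<Omega> u"
  using H1_norm_cmult[of u "-1"] by simp

lemma H1_norm_diff:
  assumes u: "u \<in> H1 \<Omega>" and v: "v \<in> H1 \<Omega>"
  shows "H1_norm \<Omega> (\<lambda>x. u x - v x) \<le> H1_norm \<Omega> u + H1_norm \<Omega> v"
  using H1_norm_add[OF u H1_cmult(1)[OF v, of "-1"]] H1_norm_minus[OF v] by simp

lemma H1_norm_minus_commute:
  assumes u: "u \<in> H1 \<Omega>" and v: "v \<in> H1 \<Omega>"
  shows "H1_norm \<Omega> (\<lambda>x. u x - v x) = H1_norm \<Omega> (\<lambda>x. v x - u x)"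
  unfolding H1_norm_diff_jet[OF u v] H1_norm_diff_jet[OF v u] by (rule L2_norm_minus_commute)

lemma H1_norm_diff_triangle:
  assumes "u \<in> H1 \<Omega>" "v \<in> H1 \<Omega>" "w \<in> H1 \<Omega>"
  shows "H1_norm \<Omega> (\<lambda>x. u x - w x) \<le> H1_norm \<Omega> (\<lambda>x. u x - v x) + H1_norm \<Omega> (\<lambda>x. v x - w x)"
  using H1_norm_add[OF H1_diff(1)[OF assms(1,2)] H1_diff(1)[OF assms(2,3)]] by simp

lemma test_fun_H1:
  assumes \<phi>: "\<phi> \<in> test_fun UNIV"
  shows "\<phi> \<in> H1 \<Omega>" "AE x in lebesgue_on \<Omega>. wgrad \<Omega> \<phi> x = (\<chi> i. pdiff i \<phi> x)"
proof -
  have g: "(\<lambda>x. \<chi> i. pdiff i \<phi> x) \<in> L2 \<Omega>"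
    by (rule L2_vecI) (simp add: test_fun_L2[OF test_fun_pdiff[OF \<phi>]])
  show "\<phi> \<in> H1 \<Omega>" "AE x in lebesgue_on \<Omega>. wgrad \<Omega> \<phi> x = (\<chi> i. pdiff i \<phi> x)"
    using H1I[OF test_fun_L2[OF \<phi>] g has_weak_grad_smooth[OF open_\<Omega> test_fun_smooth[OF \<phi>]]] by auto
qed

text \<open>Leibniz' rule: the weak gradient of \<open>u\<close> is tested with
  \<open>\<eta> x * \<phi> x\<close>, whose derivative splits into two terms. The support of
  \<open>\<eta>\<close> may reach beyond \<open>\<Omega>\<close>, since \<open>\<phi>\<close>
  already vanishes near the boundary.\<close>

lemma H1_mult_test_fun:
  assumes u: "u \<in> H1 \<Omega>" and \<eta>: "\<eta> \<in> test_fun UNIV"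
  shows "(\<lambda>x. \<eta> x * u x) \<in> H1 \<Omega>"
    "AE x in lebesgue_on \<Omega>. wgrad \<Omega> (\<lambda>x. \<eta> x * u x) x = (\<chi> i. \<eta> x * wgrad \<Omega> u x $ i + pdiff i \<eta> x * u x)"
proof -
  note uD = H1D[OF u]
  have g: "(\<lambda>x. \<chi> i. \<eta> x * wgrad \<Omega> u x $ i + pdiff i \<eta> x * u x) \<in> L2 \<Omega>"
    by (rule L2_vecI) (simp add: L2_add L2_mult_test_fun \<eta> test_fun_pdiff uD L2_vec_nth)
  have "has_weak_grad \<Omega> (\<lambda>x. \<eta> x * u x) (\<lambda>x. \<chi> i. \<eta> x * wgrad \<Omega> u x $ i + pdiff i \<eta> x * u x)"
    unfolding has_weak_grad_def
  proof (intro ballI allI)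
    fix \<phi> i assume \<phi>: "\<phi> \<in> test_fun \<Omega>"
    note \<phi>' = test_fun_UNIV[OF \<phi>]
    note s = test_fun_smooth[OF \<eta>] test_fun_smooth[OF \<phi>]
    have i1: "integrable (lebesgue_on \<Omega>) (\<lambda>x. u x * (\<eta> x * pdiff i \<phi> x))"
      by (intro L2_mult_test_fun uD test_fun_mult \<eta> smooth_pdiff s)
    have i2: "integrable (lebesgue_on \<Omega>) (\<lambda>x. u x * (pdiff i \<eta> x * \<phi> x))"
      by (intro L2_mult_test_fun uD test_fun_mult test_fun_pdiff \<eta> s)
    have i3: "integrable (lebesgue_on \<Omega>) (\<lambda>x. wgrad \<Omega> u x $ i * (\<eta> x * \<phi> x))"
      by (intro L2_mult_test_fun uD test_fun_mult L2_vec_nth \<eta> s)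
    have t: "(\<lambda>x. \<eta> x * \<phi> x) \<in> test_fun \<Omega>"
      using test_fun_mult[OF \<phi> s(1)] by (simp add: mult.commute)
    have "(LINT x|lebesgue_on \<Omega>. u x * pdiff i (\<lambda>x. \<eta> x * \<phi> x) x) = - (LINT x|lebesgue_on \<Omega>. wgrad \<Omega> u x $ i * (\<eta> x * \<phi> x))"
      using uD(3) t unfolding has_weak_grad_def by blast
    then have eq: "(LINT x|lebesgue_on \<Omega>. u x * (\<eta> x * pdiff i \<phi> x)) + (LINT x|lebesgue_on \<Omega>. u x * (pdiff i \<eta> x * \<phi> x))
      = - (LINT x|lebesgue_on \<Omega>. wgrad \<Omega> u x $ i * (\<eta> x * \<phi> x))"
      using i1 i2 by (simp add: pdiff_mult[OF s] distrib_left)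
    have "(LINT x|lebesgue_on \<Omega>. (\<chi> i. \<eta> x * wgrad \<Omega> u x $ i + pdiff i \<eta> x * u x) $ i * \<phi> x)
      = (LINT x|lebesgue_on \<Omega>. wgrad \<Omega> u x $ i * (\<eta> x * \<phi> x) + u x * (pdiff i \<eta> x * \<phi> x))"
      by (simp add: algebra_simps)
    also have "\<dots> = (LINT x|lebesgue_on \<Omega>. wgrad \<Omega> u x $ i * (\<eta> x * \<phi> x)) + (LINT x|lebesgue_on \<Omega>. u x * (pdiff i \<eta> x * \<phi> x))"
      using i2 i3 by simp
    also have "\<dots> = - (LINT x|lebesgue_on \<Omega>. u x * (\<eta> x * pdiff i \<phi> x))"
      using eq by (simp add: algebra_simps eq_neg_iff_add_eq_0)
    also have "(LINT x|lebesgue_on \<Omega>. u x * (\<eta> x * pdiff i \<phi> x)) = (LINT x|lebesgue_on \<Omega>. \<eta> x * u x * pdiff i \<phi> x)"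
      by (simp add: algebra_simps)
    finally show "(LINT x|lebesgue_on \<Omega>. \<eta> x * u x * pdiff i \<phi> x)
      = - (LINT x|lebesgue_on \<Omega>. (\<chi> i. \<eta> x * wgrad \<Omega> u x $ i + pdiff i \<eta> x * u x) $ i * \<phi> x)" by simp
  qed
  then show "(\<lambda>x. \<eta> x * u x) \<in> H1 \<Omega>"
    "AE x in lebesgue_on \<Omega>. wgrad \<Omega> (\<lambda>x. \<eta> x * u x) x = (\<chi> i. \<eta> x * wgrad \<Omega> u x $ i + pdiff i \<eta> x * u x)"
    using H1I[OF L2_mult_test_fun(1)[OF uD(1) \<eta>] g] by auto
qed

end

section \<open>The closure of the test functions in H1\<close>

context bounded_open
begin

lemma H1_zero [simp]: "(\<lambda>x. 0) \<in> H1 \<Omega>"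
proof -
  have "(\<lambda>x. 0) \<in> test_fun UNIV" by (rule test_funI[of _ "{}"]) (auto intro: smooth_const)
  then show ?thesis by (rule test_fun_H1)
qed

lemma H1_norm_zero [simp]: "H1_norm \<Omega> (\<lambda>x. 0) = 0"
  using H1_norm_cmult[OF H1_zero, of 0] by simp

lemma H10_H1: "u \<in> H10 \<Omega> \<Longrightarrow> u \<in> H1 \<Omega>"
  by (simp add: H10_def)

lemma test_fun_H1': "\<phi> \<in> test_fun \<Omega> \<Longrightarrow> \<phi> \<in> H1 \<Omega>"
  by (intro test_fun_H1 test_fun_UNIV)

lemma H10I:
  assumes u: "u \<in> H1 \<Omega>" and ex: "\<And>e. 0 < e \<Longrightarrow> \<exists>\<phi>\<in>test_fun \<Omega>. H1_norm \<Omega> (\<lambda>x. u x - \<phi> x) \<le> e"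
  shows "u \<in> H10 \<Omega>"
proof -
  have "\<forall>k::nat. \<exists>\<phi>\<in>test_fun \<Omega>. H1_norm \<Omega> (\<lambda>x. u x - \<phi> x) \<le> 1 / Suc k"
    by (intro allI ex) simp
  then obtain \<phi> where \<phi>: "\<And>k. \<phi> k \<in> test_fun \<Omega>" "\<And>k. H1_norm \<Omega> (\<lambda>x. u x - \<phi> k x) \<le> 1 / Suc k"
    by metis
  have "(\<lambda>k. H1_norm \<Omega> (\<lambda>x. u x - \<phi> k x)) \<longlonglongrightarrow> 0"
    by (rule tendsto_sandwich[OF _ _ tendsto_const LIMSEQ_Suc[OF lim_1_over_n]])
      (use \<phi>(2) in \<open>auto intro!: always_eventually simp del: of_nat_Suc\<close>)
  then show ?thesis using u \<phi>(1) unfolding H10_def by blast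
qed

lemma H10D:
  assumes "u \<in> H10 \<Omega>" "0 < e"
  obtains \<phi> where "\<phi> \<in> test_fun \<Omega>" "H1_norm \<Omega> (\<lambda>x. u x - \<phi> x) < e"
proof -
  obtain \<phi> where \<phi>: "\<And>k::nat. \<phi> k \<in> test_fun \<Omega>" "(\<lambda>k. H1_norm \<Omega> (\<lambda>x. u x - \<phi> k x)) \<longlonglongrightarrow> 0"
    using assms(1) unfolding H10_def by blast
  then have "\<forall>\<^sub>F k in sequentially. H1_norm \<Omega> (\<lambda>x. u x - \<phi> k x) < e"
    using assms(2) by (rule_tac order_tendstoD(2))
  then show thesis using \<phi>(1) that by (auto simp: eventually_sequentially)
qed

lemma H10_closed:
  assumes u: "u \<in> H1 \<Omega>" and ex: "\<And>e. 0 < e \<Longrightarrow> \<exists>v\<in>H10 \<Omega>. H1_norm \<Omega> (\<lambda>x. u x - v x) < e"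
  shows "u \<in> H10 \<Omega>"
proof (rule H10I[OF u])
  fix e :: real assume e: "0 < e"
  obtain v where v: "v \<in> H10 \<Omega>" "H1_norm \<Omega> (\<lambda>x. u x - v x) < e / 2" using ex[of "e/2"] e by auto
  obtain \<phi> where \<phi>: "\<phi> \<in> test_fun \<Omega>" "H1_norm \<Omega> (\<lambda>x. v x - \<phi> x) < e / 2"
    by (rule H10D[OF v(1) half_gt_zero[OF e]])
  have "H1_norm \<Omega> (\<lambda>x. u x - \<phi> x) \<le> e"
    using H1_norm_diff_triangle[OF u H10_H1[OF v(1)] test_fun_H1'[OF \<phi>(1)]] v \<phi> by simp
  then show "\<exists>\<phi>\<in>test_fun \<Omega>. H1_norm \<Omega> (\<lambda>x. u x - \<phi> x) \<le> e" using \<phi>(1) by blast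
qed

lemma H10_add:
  assumes u: "u \<in> H10 \<Omega>" and v: "v \<in> H10 \<Omega>"
  shows "(\<lambda>x. u x + v x) \<in> H10 \<Omega>"
proof (rule H10I)
  show "(\<lambda>x. u x + v x) \<in> H1 \<Omega>" by (intro H1_add H10_H1 u v)
  fix e :: real assume e: "0 < e"
  obtain \<phi> where \<phi>: "\<phi> \<in> test_fun \<Omega>" "H1_norm \<Omega> (\<lambda>x. u x - \<phi> x) < e / 2"
    by (rule H10D[OF u half_gt_zero[OF e]])
  obtain \<psi> where \<psi>: "\<psi> \<in> test_fun \<Omega>" "H1_norm \<Omega> (\<lambda>x. v x - \<psi> x) < e / 2"
    by (rule H10D[OF v half_gt_zero[OF e]])
  have "H1_norm \<Omega> (\<lambda>x. (u x - \<phi> x) + (v x - \<psi> x)) \<le> H1_norm \<Omega> (\<lambda>x. u x - \<phi> x) + H1_norm \<Omega> (\<lambda>x. v x - \<psi> x)"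
    by (intro H1_norm_add H1_diff H10_H1 u v test_fun_H1' \<phi> \<psi>)
  moreover have "(\<lambda>x. (u x - \<phi> x) + (v x - \<psi> x)) = (\<lambda>x. u x + v x - (\<phi> x + \<psi> x))" by auto
  ultimately have "H1_norm \<Omega> (\<lambda>x. u x + v x - (\<phi> x + \<psi> x)) \<le> e" using \<phi> \<psi> by simp
  then show "\<exists>\<phi>\<in>test_fun \<Omega>. H1_norm \<Omega> (\<lambda>x. u x + v x - \<phi> x) \<le> e"
    using test_fun_add[OF \<phi>(1) \<psi>(1)] by (intro bexI[of _ "\<lambda>x. \<phi> x + \<psi> x"])
qed

lemma H10_cmult:
  assumes u: "u \<in> H10 \<Omega>"
  shows "(\<lambda>x. c * u x) \<in> H10 \<Omega>"
proof (rule H10I)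
  show "(\<lambda>x. c * u x) \<in> H1 \<Omega>" by (intro H1_cmult H10_H1 u)
  fix e :: real assume e: "0 < e"
  then have "0 < e / (norm c + 1)" by (simp add: add_nonneg_pos)
  then obtain \<phi> where \<phi>: "\<phi> \<in> test_fun \<Omega>" "H1_norm \<Omega> (\<lambda>x. u x - \<phi> x) < e / (norm c + 1)"
    by (rule H10D[OF u])
  have "H1_norm \<Omega> (\<lambda>x. c * u x - c * \<phi> x) = norm c * H1_norm \<Omega> (\<lambda>x. u x - \<phi> x)"
    using H1_norm_cmult[OF H1_diff(1)[OF H10_H1[OF u] test_fun_H1'[OF \<phi>(1)]], of c] by (simp add: right_diff_distrib)
  also have "\<dots> \<le> norm c * (e / (norm c + 1))"
    using \<phi>(2) by (intro mult_left_mono) auto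
  also have "\<dots> \<le> e"
  proof -
    have "norm c * e \<le> (norm c + 1) * e" using e by (intro mult_right_mono) auto
    moreover have "0 < norm c + 1" by (simp add: add_nonneg_pos)
    ultimately show ?thesis by (simp add: pos_divide_le_eq mult.commute)
  qed
  finally show "\<exists>\<phi>\<in>test_fun \<Omega>. H1_norm \<Omega> (\<lambda>x. c * u x - \<phi> x) \<le> e"
    using test_fun_cmult[OF \<phi>(1), of c] by (intro bexI[of _ "\<lambda>x. c * \<phi> x"])
qed

lemma H10_zero [simp]: "(\<lambda>x. 0) \<in> H10 \<Omega>"
  by (rule H10I) (auto intro!: bexI[of _ "\<lambda>x. 0"] test_funI[of _ "{}"] smooth_const)

lemma H10_minus: "u \<in> H10 \<Omega> \<Longrightarrow> (\<lambda>x. - u x) \<in> H10 \<Omega>"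
  using H10_cmult[of u "-1"] by simp

lemma H10_diff: "u \<in> H10 \<Omega> \<Longrightarrow> v \<in> H10 \<Omega> \<Longrightarrow> (\<lambda>x. u x - v x) \<in> H10 \<Omega>"
  using H10_add[OF _ H10_minus, of u v] by simp

text \<open>For a fixed test function both sides of the defining identity are continuous in
  \<open>L2\<close>, so the weak gradient is a closed operator.\<close>

lemma has_weak_grad_limit:
  assumes uL2: "\<And>n. u n \<in> L2 \<Omega>" and gL2: "\<And>n. g n \<in> L2 \<Omega>" and wg: "\<And>n. has_weak_grad \<Omega> (u n) (g n)"
    and v: "v \<in> L2 \<Omega>" "(\<lambda>n. L2_norm \<Omega> (\<lambda>x. u n x - v x)) \<longlonglongrightarrow> 0"
    and h: "h \<in> L2 \<Omega>" "(\<lambda>n. L2_norm \<Omega> (\<lambda>x. g n x - h x)) \<longlonglongrightarrow> 0"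
  shows "has_weak_grad \<Omega> v h"
  unfolding has_weak_grad_def
proof (intro ballI allI)
  fix \<phi> i assume \<phi>: "\<phi> \<in> test_fun \<Omega>"
  have lim: "(\<lambda>n. LINT x|lebesgue_on \<Omega>. w n x * \<psi> x) \<longlonglongrightarrow> (LINT x|lebesgue_on \<Omega>. w' x * \<psi> x)"
    if \<psi>: "\<psi> \<in> test_fun UNIV" and w: "\<And>n. w n \<in> L2 \<Omega>" "w' \<in> L2 \<Omega>"
      and c: "(\<lambda>n. L2_norm \<Omega> (\<lambda>x. w n x - w' x)) \<longlonglongrightarrow> 0" for w w' \<psi>
  proof (rule LIM_zero_cancel, rule Lim_null_comparison)
    show "(\<lambda>n. L2_norm \<Omega> (\<lambda>x. w n x - w' x) * L2_norm \<Omega> \<psi>) \<longlonglongrightarrow> 0"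
      using tendsto_mult_left_zero[OF c] .
    show "\<forall>\<^sub>F n in sequentially. norm ((LINT x|lebesgue_on \<Omega>. w n x * \<psi> x) - (LINT x|lebesgue_on \<Omega>. w' x * \<psi> x))
        \<le> L2_norm \<Omega> (\<lambda>x. w n x - w' x) * L2_norm \<Omega> \<psi>"
    proof (intro always_eventually allI)
      fix n
      have "(LINT x|lebesgue_on \<Omega>. w n x * \<psi> x) - (LINT x|lebesgue_on \<Omega>. w' x * \<psi> x)
        = (LINT x|lebesgue_on \<Omega>. (w n x - w' x) * \<psi> x)"
        using L2_mult_test_fun(2)[OF w(1)[of n] \<psi>] L2_mult_test_fun(2)[OF w(2) \<psi>] by (simp add: left_diff_distrib)
      then show "norm ((LINT x|lebesgue_on \<Omega>. w n x * \<psi> x) - (LINT x|lebesgue_on \<Omega>. w' x * \<psi> x))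
        \<le> L2_norm \<Omega> (\<lambda>x. w n x - w' x) * L2_norm \<Omega> \<psi>"
        using L2_mult_test_fun(3)[OF L2_diff(1)[OF w(1)[of n] w(2)] \<psi>] by simp
    qed
  qed
  have "(\<lambda>n. LINT x|lebesgue_on \<Omega>. u n x * pdiff i \<phi> x) \<longlonglongrightarrow> (LINT x|lebesgue_on \<Omega>. v x * pdiff i \<phi> x)"
    by (intro lim test_fun_UNIV[OF test_fun_pdiff[OF \<phi>]] uL2 v)
  moreover have "(\<lambda>n. LINT x|lebesgue_on \<Omega>. g n x $ i * \<phi> x) \<longlonglongrightarrow> (LINT x|lebesgue_on \<Omega>. h x $ i * \<phi> x)"
  proof (intro lim test_fun_UNIV[OF \<phi>] L2_vec_nth gL2 h)
    show "(\<lambda>n. L2_norm \<Omega> (\<lambda>x. g n x $ i - h x $ i)) \<longlonglongrightarrow> 0"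
    proof (rule tendsto_sandwich[OF _ _ tendsto_const h(2)])
      show "\<forall>\<^sub>F n in sequentially. L2_norm \<Omega> (\<lambda>x. g n x $ i - h x $ i) \<le> L2_norm \<Omega> (\<lambda>x. g n x - h x)"
        using L2_vec_nth(2)[OF L2_diff(1)[OF gL2 h(1)]] by (intro always_eventually) simp
    qed simp
  qed
  moreover have "(LINT x|lebesgue_on \<Omega>. u n x * pdiff i \<phi> x) = - (LINT x|lebesgue_on \<Omega>. g n x $ i * \<phi> x)" for n
    using wg[of n] \<phi> by (simp add: has_weak_grad_def)
  ultimately have "(\<lambda>n. - (LINT x|lebesgue_on \<Omega>. g n x $ i * \<phi> x)) \<longlonglongrightarrow> (LINT x|lebesgue_on \<Omega>. v x * pdiff i \<phi> x)"
    "(\<lambda>n. - (LINT x|lebesgue_on \<Omega>. g n x $ i * \<phi> x)) \<longlonglongrightarrow> - (LINT x|lebesgue_on \<Omega>. h x $ i * \<phi> x)"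
    by (auto intro: tendsto_minus)
  then show "(LINT x|lebesgue_on \<Omega>. v x * pdiff i \<phi> x) = - (LINT x|lebesgue_on \<Omega>. h x $ i * \<phi> x)"
    by (rule LIMSEQ_unique)
qed

text \<open>The jets form a Cauchy sequence in \<open>L2\<close>. The components of their limit are
  the limit function and, by closedness of the weak gradient, its gradient.\<close>

lemma H10_complete:
  assumes u: "\<And>n. u n \<in> H10 \<Omega>"
    and Cauchy: "\<And>e. 0 < e \<Longrightarrow> \<exists>N. \<forall>m\<ge>N. \<forall>n\<ge>N. H1_norm \<Omega> (\<lambda>x. u m x - u n x) < e"
  obtains v where "v \<in> H10 \<Omega>" "(\<lambda>n. H1_norm \<Omega> (\<lambda>x. u n x - v x)) \<longlonglongrightarrow> 0"
proof -
  have u1: "u n \<in> H1 \<Omega>" for n using u H10_H1 by blast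
  have "\<exists>N. \<forall>m\<ge>N. \<forall>n\<ge>N. L2_norm \<Omega> (\<lambda>x. jet \<Omega> (u m) x - jet \<Omega> (u n) x) < e" if "0 < e" for e
    using Cauchy[OF that] unfolding H1_norm_diff_jet[OF u1 u1] .
  then obtain J where J: "J \<in> L2 \<Omega>" "(\<lambda>n. L2_norm \<Omega> (\<lambda>x. jet \<Omega> (u n) x - J x)) \<longlonglongrightarrow> 0"
    using L2_complete[OF finite_\<Omega>, of "\<lambda>n. jet \<Omega> (u n)"] jet_L2[OF u1] by blast
  define v where "v x = fst (J x)" for x
  define g where "g x = snd (J x)" for x
  have Jm: "J \<in> borel_measurable (lebesgue_on \<Omega>)" using J(1) by (rule L2_measurable)
  have vm: "v \<in> borel_measurable (lebesgue_on \<Omega>)"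
    unfolding v_def by (rule measurable_compose[OF Jm borel_measurable_continuous_onI]) (intro continuous_intros)
  have gm: "g \<in> borel_measurable (lebesgue_on \<Omega>)"
    unfolding g_def by (rule measurable_compose[OF Jm borel_measurable_continuous_onI]) (intro continuous_intros)
  have vL2: "v \<in> L2 \<Omega>" by (rule L2_norm_mono(1)[OF J(1) vm]) (intro AE_I2, metis v_def norm_fst_le prod.collapse)
  have gL2: "g \<in> L2 \<Omega>" by (rule L2_norm_mono(1)[OF J(1) gm]) (intro AE_I2, metis g_def norm_snd_le prod.collapse)
  have le: "L2_norm \<Omega> (\<lambda>x. u n x - v x) \<le> L2_norm \<Omega> (\<lambda>x. jet \<Omega> (u n) x - J x)"
    "L2_norm \<Omega> (\<lambda>x. wgrad \<Omega> (u n) x - g x) \<le> L2_norm \<Omega> (\<lambda>x. jet \<Omega> (u n) x - J x)" for n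
  proof -
    have d: "(\<lambda>x. jet \<Omega> (u n) x - J x) \<in> L2 \<Omega>" by (intro L2_diff jet_L2 u1 J)
    have p: "jet \<Omega> (u n) x - J x = (u n x - v x, wgrad \<Omega> (u n) x - g x)" for x
      by (simp add: jet_def v_def g_def prod_eq_iff)
    show "L2_norm \<Omega> (\<lambda>x. u n x - v x) \<le> L2_norm \<Omega> (\<lambda>x. jet \<Omega> (u n) x - J x)"
    proof (rule L2_norm_mono(2)[OF d])
      show "AE x in lebesgue_on \<Omega>. norm (u n x - v x) \<le> norm (jet \<Omega> (u n) x - J x)"
        unfolding p by (intro AE_I2 norm_fst_le)
    qed (intro L2_measurable L2_diff H1D[OF u1] vL2)
    show "L2_norm \<Omega> (\<lambda>x. wgrad \<Omega> (u n) x - g x) \<le> L2_norm \<Omega> (\<lambda>x. jet \<Omega> (u n) x - J x)"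
    proof (rule L2_norm_mono(2)[OF d])
      show "AE x in lebesgue_on \<Omega>. norm (wgrad \<Omega> (u n) x - g x) \<le> norm (jet \<Omega> (u n) x - J x)"
        unfolding p by (intro AE_I2 norm_snd_le)
    qed (intro L2_measurable L2_diff H1D[OF u1] gL2)
  qed
  have lim1: "(\<lambda>n. L2_norm \<Omega> (\<lambda>x. u n x - v x)) \<longlonglongrightarrow> 0"
    by (rule tendsto_sandwich[OF _ _ tendsto_const J(2)]) (use le(1) in \<open>auto intro!: always_eventually\<close>)
  have lim2: "(\<lambda>n. L2_norm \<Omega> (\<lambda>x. wgrad \<Omega> (u n) x - g x)) \<longlonglongrightarrow> 0"
    by (rule tendsto_sandwich[OF _ _ tendsto_const J(2)]) (use le(2) in \<open>auto intro!: always_eventually\<close>)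
  have "has_weak_grad \<Omega> v g"
    by (rule has_weak_grad_limit[OF H1D(1)[OF u1] H1D(2)[OF u1] H1D(3)[OF u1] vL2 lim1 gL2 lim2])
  note vg = H1I[OF vL2 gL2 this]
  have v1: "v \<in> H1 \<Omega>" by (rule vg(1))
  have ae: "AE x in lebesgue_on \<Omega>. jet \<Omega> v x = J x"
    using vg(2)
  proof eventually_elim
    case (elim x)
    show ?case unfolding jet_def elim unfolding v_def g_def by (rule prod.collapse)
  qed
  have eq: "H1_norm \<Omega> (\<lambda>x. u n x - v x) = L2_norm \<Omega> (\<lambda>x. jet \<Omega> (u n) x - J x)" for n
    unfolding H1_norm_diff_jet[OF u1 v1]
  proof (rule L2_norm_cong_AE)
    show "AE x in lebesgue_on \<Omega>. jet \<Omega> (u n) x - jet \<Omega> v x = jet \<Omega> (u n) x - J x"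
      using ae by eventually_elim simp
  qed (intro L2_measurable L2_diff jet_L2 u1 v1 J)+
  have lim: "(\<lambda>n. H1_norm \<Omega> (\<lambda>x. u n x - v x)) \<longlonglongrightarrow> 0" unfolding eq by (rule J(2))
  have "v \<in> H10 \<Omega>"
  proof (rule H10_closed[OF v1])
    fix e :: real assume "0 < e"
    then have "\<forall>\<^sub>F n in sequentially. H1_norm \<Omega> (\<lambda>x. u n x - v x) < e" by (rule order_tendstoD(2)[OF lim])
    then obtain n where "H1_norm \<Omega> (\<lambda>x. u n x - v x) < e" by (auto simp: eventually_sequentially)
    then show "\<exists>w\<in>H10 \<Omega>. H1_norm \<Omega> (\<lambda>x. v x - w x) < e"
      using u[of n] H1_norm_minus_commute[OF u1 v1, of n] by (intro bexI[of _ "u n"]) simp_all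
  qed
  then show thesis using lim that by blast
qed

text \<open>Mollifying \<open>\<eta> u\<close> commutes with the weak gradient because \<open>y \<mapsto> \<eta> y * \<rho> (x - y)\<close> is a test function
  of \<open>\<Omega>\<close> for every \<open>x\<close>.\<close>

lemma test_fun_mult_H10:
  assumes u: "u \<in> H1 \<Omega>" and \<eta>: "\<eta> \<in> test_fun \<Omega>"
  shows "(\<lambda>x. \<eta> x * u x) \<in> H10 \<Omega>"
proof (rule H10I)
  note \<eta>' = test_fun_UNIV[OF \<eta>] and uD = H1D[OF u]
  define v where "v x = \<eta> x * u x" for x
  define G where "G i x = \<eta> x * wgrad \<Omega> u x $ i + pdiff i \<eta> x * u x" for i x
  have vH1: "v \<in> H1 \<Omega>" and vg: "AE x in lebesgue_on \<Omega>. wgrad \<Omega> v x = (\<chi> i. G i x)"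
    unfolding v_def[abs_def] G_def using H1_mult_test_fun[OF u \<eta>'] by auto
  show "(\<lambda>x. \<eta> x * u x) \<in> H1 \<Omega>" using vH1 by (simp add: v_def[abs_def])
  obtain S where S: "compact S" "S \<subseteq> \<Omega>" "\<And>x. x \<notin> S \<Longrightarrow> \<eta> x = 0" "\<And>x i. x \<notin> S \<Longrightarrow> pdiff i \<eta> x = 0"
    using test_funE[OF \<eta>] by metis
  have v0: "v x = 0" if "x \<notin> S" for x using S(3)[OF that] by (simp add: v_def)
  have G0: "G i x = 0" if "x \<notin> S" for i x using S(3,4)[OF that] by (simp add: G_def)
  obtain R where R: "\<And>x. x \<in> S \<Longrightarrow> norm x \<le> R"
    using compact_imp_bounded[OF S(1)] unfolding bounded_iff by blast
  have ext: "w \<in> L2 UNIV \<and> integrable lebesgue w \<and> L2_norm UNIV w = L2_norm \<Omega> w"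
    if w: "w \<in> L2 \<Omega>" "\<And>x. x \<notin> S \<Longrightarrow> w x = 0" for w :: "real^'d \<Rightarrow> complex"
  proof -
    have eq: "(\<lambda>x. if x \<in> \<Omega> then w x else 0) = w"
    proof
      fix x show "(if x \<in> \<Omega> then w x else 0) = w x" using w(2)[of x] S(2) by auto
    qed
    show ?thesis
      using L2_restrict[OF sets_\<Omega>, of w] w(1) Lebesgue_Measure.integrable_restrict_UNIV[OF sets_\<Omega>, of w]
        L2_integrable_self(1)[OF finite_\<Omega> w(1)]
      unfolding eq by simp
  qed
  have GL2: "G i \<in> L2 \<Omega>" for i
    unfolding G_def[abs_def] by (intro L2_add L2_mult_test_fun \<eta>' test_fun_pdiff uD L2_vec_nth)
  note vE = ext[OF H1D(1)[OF vH1] v0] and GE = ext[OF GL2 G0]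
  obtain \<delta> where \<delta>: "\<delta> > 0" "(\<Union>x\<in>S. cball x \<delta>) \<subseteq> \<Omega>"
    using compact_subset_open_imp_cball_epsilon_subset[OF S(1) open_\<Omega> S(2)] by blast
  fix e :: real assume e: "0 < e"
  \<comment> \<open>The squared \<open>H1\<close> norm of the error is a sum of
    \<open>1 + CARD('d)\<close> squared \<open>L2\<close> norms, each at most
    \<open>e1\<^sup>2\<close>.\<close>
  define e1 where "e1 = e / sqrt (1 + real CARD('d))"
  have e1: "e1 > 0" "e1\<^sup>2 + real CARD('d) * e1\<^sup>2 = e\<^sup>2"
  proof -
    have p: "0 < 1 + real CARD('d)" by simp
    then show "e1 > 0" using e by (simp add: e1_def)
    have "e1\<^sup>2 = e\<^sup>2 / (1 + real CARD('d))" using p by (simp add: e1_def power_divide)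
    then have "(1 + real CARD('d)) * e1\<^sup>2 = e\<^sup>2" using p by simp
    then show "e1\<^sup>2 + real CARD('d) * e1\<^sup>2 = e\<^sup>2" by (simp add: distrib_right)
  qed
  obtain r0 where r0: "0 < r0" "\<And>s \<rho>. 0 < s \<Longrightarrow> s \<le> r0 \<Longrightarrow> mollifier s \<rho> \<Longrightarrow>
      (\<lambda>x. conv (\<lambda>x. of_real (\<rho> x)) v x - v x) \<in> L2 UNIV \<and>
      L2_norm UNIV (\<lambda>x. conv (\<lambda>x. of_real (\<rho> x)) v x - v x) \<le> e1"
    by (rule mollification_approximates[of v R, OF _ _ _ e1(1)]) (use vE v0 R in force)+
  define good where "good i r \<longleftrightarrow> (\<forall>s \<rho>. 0 < s \<longrightarrow> s \<le> r \<longrightarrow> mollifier s \<rho> \<longrightarrow>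
      (\<lambda>x. conv (\<lambda>x. of_real (\<rho> x)) (G i) x - G i x) \<in> L2 UNIV \<and>
      L2_norm UNIV (\<lambda>x. conv (\<lambda>x. of_real (\<rho> x)) (G i) x - G i x) \<le> e1)" for i r
  have "\<exists>r>0. good i r" for i
    unfolding good_def
    by (rule mollification_approximates[of "G i" R, OF _ _ _ e1(1)]) (use GE G0 R in force)+
  then have "\<forall>i. \<exists>r. 0 < r \<and> good i r" by blast
  from choice[OF this] obtain r where r: "\<And>i. 0 < r i" "\<And>i. good i (r i)" by blast
  \<comment> \<open>One radius for the function and all its derivatives;
    \<open>s \<le> \<delta>\<close> keeps the support of the mollified function inside
    \<open>\<Omega>\<close>.\<close>
  define s where "s = min \<delta> (min r0 (Min (range r)))"
  have s: "0 < s" "s \<le> \<delta>" "s \<le> r0" "\<And>i. s \<le> r i"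
    using \<delta>(1) r0(1) r(1) by (auto simp: s_def min_le_iff_disj)
  obtain \<rho> :: "real^'d \<Rightarrow> real" where \<rho>: "mollifier s \<rho>" using mollifier_exists[OF s(1)] .
  note m = mollifierD[OF \<rho>]
  let ?\<rho> = "\<lambda>x. complex_of_real (\<rho> x)"
  define \<phi> where "\<phi> = conv ?\<rho> v"
  have \<phi>s: "smooth \<phi>" unfolding \<phi>_def by (intro conv_smooth m) (use vE in simp)
  have \<phi>t: "\<phi> \<in> test_fun \<Omega>"
  proof (rule test_funI[OF \<phi>s])
    show "compact {x + y |x y. x \<in> S \<and> y \<in> cball 0 s}" by (rule compact_sums[OF S(1)]) simp
    show "{x + y |x y. x \<in> S \<and> y \<in> cball 0 s} \<subseteq> \<Omega>"
    proof safe
      fix x y :: "real^'d" assume "x \<in> S" "y \<in> cball 0 s"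
      then have "x + y \<in> cball x \<delta>" using s(2) by (simp add: dist_norm)
      then show "x + y \<in> \<Omega>" using \<delta>(2) \<open>x \<in> S\<close> by blast
    qed
    show "\<phi> x = 0" if x: "x \<notin> {x + y |x y. x \<in> S \<and> y \<in> cball 0 s}" for x
      unfolding \<phi>_def
    proof (rule conv_eq_0[where S = S])
      fix y assume y: "y \<in> S"
      have "x - y \<notin> cball 0 s"
        proof
          assume "x - y \<in> cball 0 s"
          moreover have "x = y + (x - y)" by simp
          ultimately show False using x y by blast
        qed
      then show "complex_of_real (\<rho> (x - y)) = 0" using m(3)[of "x - y"] by simp
    qed (rule v0)
  qed
  have \<phi>p: "pdiff i \<phi> x = conv ?\<rho> (G i) x" for i x
  proof -
    let ?\<psi> = "\<lambda>y. \<eta> y * ?\<rho> (x - y)"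
    have sr: "smooth (\<lambda>y. ?\<rho> (x - y))" by (rule test_fun_smooth[OF test_fun_reflect[OF m(1)]])
    have st: "(\<lambda>y. ?\<rho> (x - y)) \<in> test_fun UNIV" by (rule test_fun_reflect[OF m(1)])
    have sp: "(\<lambda>y. pdiff i ?\<rho> (x - y)) \<in> test_fun UNIV" by (rule test_fun_reflect[OF test_fun_pdiff[OF m(1)]])
    note se = test_fun_smooth[OF \<eta>]
    have \<psi>: "?\<psi> \<in> test_fun \<Omega>" by (rule test_fun_mult[OF \<eta> sr])
    have p\<psi>: "pdiff i ?\<psi> y = - (\<eta> y * pdiff i ?\<rho> (x - y)) + pdiff i \<eta> y * ?\<rho> (x - y)" for y
      using pdiff_mult[OF se sr, where i = i and x = y] pdiff_reflect[OF test_fun_smooth[OF m(1)], where i = i and a = x and x = y] by simp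
    have i1: "integrable (lebesgue_on \<Omega>) (\<lambda>y. u y * (\<eta> y * pdiff i ?\<rho> (x - y)))"
      by (rule L2_mult_test_fun(2)[OF uD(1)], rule test_fun_mult[OF \<eta>' test_fun_smooth[OF sp]])
    have i2: "integrable (lebesgue_on \<Omega>) (\<lambda>y. u y * (pdiff i \<eta> y * ?\<rho> (x - y)))"
      by (rule L2_mult_test_fun(2)[OF uD(1)], rule test_fun_mult[OF test_fun_pdiff[OF \<eta>'] sr])
    have i3: "integrable (lebesgue_on \<Omega>) (\<lambda>y. wgrad \<Omega> u y $ i * (\<eta> y * ?\<rho> (x - y)))"
      by (rule L2_mult_test_fun(2)[OF L2_vec_nth(1)[OF uD(2)]], rule test_fun_mult[OF \<eta>' sr])
    have "(LINT y|lebesgue_on \<Omega>. u y * pdiff i ?\<psi> y) = - (LINT y|lebesgue_on \<Omega>. wgrad \<Omega> u y $ i * ?\<psi> y)"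
      using uD(3) \<psi> unfolding has_weak_grad_def by blast
    moreover have "(LINT y|lebesgue_on \<Omega>. u y * pdiff i ?\<psi> y)
        = (LINT y|lebesgue_on \<Omega>. u y * (pdiff i \<eta> y * ?\<rho> (x - y)) - u y * (\<eta> y * pdiff i ?\<rho> (x - y)))"
      unfolding p\<psi> by (simp add: algebra_simps)
    ultimately have eq: "(LINT y|lebesgue_on \<Omega>. u y * (\<eta> y * pdiff i ?\<rho> (x - y)))
      = (LINT y|lebesgue_on \<Omega>. u y * (pdiff i \<eta> y * ?\<rho> (x - y))) + (LINT y|lebesgue_on \<Omega>. wgrad \<Omega> u y $ i * ?\<psi> y)"
      using i1 i2 by (simp add: algebra_simps add_eq_0_iff2)
    have "pdiff i \<phi> x = conv (pdiff i ?\<rho>) v x"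
      unfolding \<phi>_def by (rule fun_cong[OF pdiff_conv[OF m(1)]]) (use vE in simp)
    also have "\<dots> = (LINT y|lebesgue_on \<Omega>. pdiff i ?\<rho> (x - y) * v y)"
      unfolding conv_def by (rule lebesgue_on_integral_eq[OF sets_\<Omega>, symmetric]) (use v0 S(2) in auto)
    also have "\<dots> = (LINT y|lebesgue_on \<Omega>. u y * (\<eta> y * pdiff i ?\<rho> (x - y)))"
      by (simp add: v_def algebra_simps)
    also have "\<dots> = (LINT y|lebesgue_on \<Omega>. u y * (pdiff i \<eta> y * ?\<rho> (x - y)) + wgrad \<Omega> u y $ i * ?\<psi> y)"
      unfolding eq using i2 i3 by simp
    also have "\<dots> = (LINT y|lebesgue_on \<Omega>. ?\<rho> (x - y) * G i y)"
      by (simp add: G_def algebra_simps)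
    also have "\<dots> = conv ?\<rho> (G i) x"
      unfolding conv_def by (rule lebesgue_on_integral_eq[OF sets_\<Omega>]) (use G0 S(2) in auto)
    finally show ?thesis .
  qed
  have le: "L2_norm \<Omega> w \<le> e1" if "w \<in> L2 UNIV" "L2_norm UNIV w \<le> e1" "w \<in> L2 \<Omega>" for w :: "real^'d \<Rightarrow> complex"
  proof -
    have "L2_norm UNIV (\<lambda>x. if x \<in> \<Omega> then w x else 0) \<le> L2_norm UNIV w"
      by (rule L2_norm_mono(2)[OF that(1)])
        (use L2_measurable[of "\<lambda>x. if x \<in> \<Omega> then w x else 0" UNIV] L2_restrict(1)[OF sets_\<Omega>, of w] that(3) in auto)
    then show ?thesis unfolding L2_restrict(2)[OF sets_\<Omega>] using that(2) by simp
  qed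
  note \<phi>1 = test_fun_H1[OF test_fun_UNIV[OF \<phi>t]]
  have "(H1_norm \<Omega> (\<lambda>x. v x - \<phi> x))\<^sup>2 = (L2_norm \<Omega> (\<lambda>x. v x - \<phi> x))\<^sup>2 + (L2_norm \<Omega> (wgrad \<Omega> (\<lambda>x. v x - \<phi> x)))\<^sup>2"
    by (simp add: H1_norm_def)
  also have "L2_norm \<Omega> (wgrad \<Omega> (\<lambda>x. v x - \<phi> x)) = L2_norm \<Omega> (\<lambda>x. \<chi> i. G i x - pdiff i \<phi> x)"
  proof (rule L2_norm_cong_AE)
    show "AE x in lebesgue_on \<Omega>. wgrad \<Omega> (\<lambda>x. v x - \<phi> x) x = (\<chi> i. G i x - pdiff i \<phi> x)"
      using H1_diff(2)[OF vH1 \<phi>1(1)] vg \<phi>1(2) by eventually_elim (simp add: vec_eq_iff)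
    show "wgrad \<Omega> (\<lambda>x. v x - \<phi> x) \<in> borel_measurable (lebesgue_on \<Omega>)"
      by (rule L2_measurable[OF H1D(2)[OF H1_diff(1)[OF vH1 \<phi>1(1)]]])
    show "(\<lambda>x. \<chi> i. G i x - pdiff i \<phi> x) \<in> borel_measurable (lebesgue_on \<Omega>)"
      by (rule L2_measurable, rule L2_vecI)
        (simp add: L2_diff GL2 test_fun_L2[OF test_fun_UNIV[OF test_fun_pdiff[OF \<phi>t]]])
  qed
  also have "(L2_norm \<Omega> (\<lambda>x. \<chi> i. G i x - pdiff i \<phi> x))\<^sup>2 = (\<Sum>i\<in>UNIV. (L2_norm \<Omega> (\<lambda>x. G i x - pdiff i \<phi> x))\<^sup>2)"
    using L2_vecI(2)[of "\<lambda>x. \<chi> i. G i x - pdiff i \<phi> x" \<Omega>]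
    by (simp add: L2_diff GL2 test_fun_L2[OF test_fun_UNIV[OF test_fun_pdiff[OF \<phi>t]]])
  also have "(L2_norm \<Omega> (\<lambda>x. v x - \<phi> x))\<^sup>2 + \<dots> \<le> e1\<^sup>2 + (\<Sum>i\<in>(UNIV::'d set). e1\<^sup>2)"
  proof (intro add_mono sum_mono power_mono L2_norm_nonneg)
    have "L2_norm \<Omega> (\<lambda>x. \<phi> x - v x) \<le> e1"
      using r0(2)[OF s(1,3) \<rho>] unfolding \<phi>_def[symmetric]
      by (intro le) (auto intro: L2_diff(1)[OF H1D(1)[OF \<phi>1(1)] H1D(1)[OF vH1]])
    then show "L2_norm \<Omega> (\<lambda>x. v x - \<phi> x) \<le> e1" by (subst L2_norm_minus_commute)
    fix i
    have "(\<lambda>x. pdiff i \<phi> x - G i x) \<in> L2 UNIV \<and> L2_norm UNIV (\<lambda>x. pdiff i \<phi> x - G i x) \<le> e1"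
      unfolding \<phi>p by (rule r(2)[of i, unfolded good_def, rule_format, OF s(1,4) \<rho>])
    note c = this
    have "L2_norm \<Omega> (\<lambda>x. pdiff i \<phi> x - G i x) \<le> e1"
      by (rule le[OF conjunct1[OF c] conjunct2[OF c]
          L2_diff(1)[OF test_fun_L2[OF test_fun_UNIV[OF test_fun_pdiff[OF \<phi>t]]] GL2]])
    then show "L2_norm \<Omega> (\<lambda>x. G i x - pdiff i \<phi> x) \<le> e1" by (subst L2_norm_minus_commute)
  qed
  also have "\<dots> = e\<^sup>2" using e1(2) by simp
  finally have "(H1_norm \<Omega> (\<lambda>x. v x - \<phi> x))\<^sup>2 \<le> e\<^sup>2" .
  then have "H1_norm \<Omega> (\<lambda>x. v x - \<phi> x) \<le> e" by (rule power2_le_imp_le) (rule less_imp_le[OF e])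
  then show "\<exists>\<phi>\<in>test_fun \<Omega>. H1_norm \<Omega> (\<lambda>x. \<eta> x * u x - \<phi> x) \<le> e"
    using \<phi>t unfolding v_def by blast
qed

end

text \<open>The indicator of the closed neighbourhood of radius \<open>2 * d\<close> is mollified at
  radius \<open>d = \<delta> / 3\<close>: the value is 1 at distance less than \<open>d\<close> from
  \<open>S\<close>, and the support stays within distance \<open>3 * d = \<delta>\<close>. Having
  the value 1 on an open set \<open>W\<close> makes the gradient vanish on \<open>S\<close> too;
  realness lets \<open>\<eta>\<close> pass from one argument of a Hermitian form to the
  other.\<close>

lemma cutoff_exists:
  fixes S U :: "(real^'d) set"
  assumes S: "compact S" and U: "open U" "S \<subseteq> U"
  obtains \<eta> W where "\<eta> \<in> test_fun U" "\<And>x. cnj (\<eta> x) = \<eta> x" "open W" "S \<subseteq> W" "\<And>x. x \<in> W \<Longrightarrow> \<eta> x = 1"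
    "\<And>x i. x \<in> W \<Longrightarrow> pdiff i \<eta> x = 0"
proof -
  obtain \<delta> where \<delta>: "\<delta> > 0" "(\<Union>x\<in>S. cball x \<delta>) \<subseteq> U"
    using compact_subset_open_imp_cball_epsilon_subset[OF S U] by blast
  define d where "d = \<delta> / 3"
  have d: "d > 0" "3 * d = \<delta>" using \<delta> by (auto simp: d_def)
  define N where "N = {x + y |x y. x \<in> S \<and> y \<in> cball 0 (2 * d)}"
  have N: "compact N" unfolding N_def by (rule compact_sums[OF S]) simp
  have "integrable lebesgue (indicat_real N)"
    using lmeasurable_compact[OF N] by (simp add: lmeasurable_iff_integrable)
  then have fi: "integrable lebesgue (\<lambda>x. complex_of_real (indicat_real N x))" by simp
  obtain \<rho> :: "real^'d \<Rightarrow> real" where \<rho>: "mollifier d \<rho>" using mollifier_exists[OF d(1)] .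
  note m = mollifierD[OF \<rho>]
  let ?\<rho> = "\<lambda>x. complex_of_real (\<rho> x)"
  define \<eta> where "\<eta> = conv ?\<rho> (\<lambda>x. complex_of_real (indicat_real N x))"
  define W where "W = (\<Union>x\<in>S. ball x d)"
  have sm: "smooth \<eta>" unfolding \<eta>_def by (rule conv_smooth[OF m(1) fi])
  have W1: "\<eta> x = 1" if x: "x \<in> W" for x
  proof -
    obtain z where z: "z \<in> S" "dist z x < d" using x unfolding W_def by auto
    have "(\<lambda>y. ?\<rho> (x - y) * complex_of_real (indicat_real N y)) = (\<lambda>y. ?\<rho> (x - y))"
    proof
      fix y
      show "?\<rho> (x - y) * complex_of_real (indicat_real N y) = ?\<rho> (x - y)"
      proof (cases "y \<in> N")
        case False
        have "d \<le> norm (x - y)"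
        proof (rule ccontr)
          assume "\<not> d \<le> norm (x - y)"
          then have "dist z y \<le> 2 * d" using z(2) dist_triangle[of z y x] by (simp add: dist_norm)
          then have "y - z \<in> cball 0 (2 * d)" by (simp add: dist_norm norm_minus_commute)
          moreover have "y = z + (y - z)" by simp
          ultimately have "y \<in> N" using z(1) unfolding N_def by blast
          then show False using False by simp
        qed
        then show ?thesis using m(3)[of "x - y"] by simp
      qed simp
    qed
    then have "\<eta> x = (LINT y|lebesgue. ?\<rho> (x - y))" by (simp add: \<eta>_def conv_def)
    also have "\<dots> = (LINT y|lborel. ?\<rho> (x - y))"
      using smooth_borel[OF test_fun_smooth[OF test_fun_reflect[OF m(1), of x]]] by (intro integral_completion) simp
    also have "\<dots> = 1" using integral_lborel_reflect[OF m(6), of x] m(5) by simp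
    finally show ?thesis .
  qed
  show thesis
  proof (rule that[of \<eta> W])
    show "\<eta> \<in> test_fun U"
    proof (rule test_funI[OF sm])
      show "compact {x + y |x y. x \<in> N \<and> y \<in> cball 0 d}" by (rule compact_sums[OF N]) simp
      show "{x + y |x y. x \<in> N \<and> y \<in> cball 0 d} \<subseteq> U"
      proof safe
        fix x y :: "real^'d" assume "x \<in> N" "y \<in> cball 0 d"
        then obtain z w where z: "z \<in> S" "norm w \<le> 2 * d" "x = z + w" "norm y \<le> d" by (auto simp: N_def)
        have "norm (w + y) \<le> \<delta>" using z d(2) norm_triangle_ineq[of w y] by simp
        moreover have "z - (x + y) = - (w + y)" using z(3) by simp
        ultimately have "x + y \<in> cball z \<delta>" by (simp only: mem_cball dist_norm norm_minus_cancel)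
        then show "x + y \<in> U" using \<delta>(2) z(1) by blast
      qed
      show "\<eta> x = 0" if x: "x \<notin> {x + y |x y. x \<in> N \<and> y \<in> cball 0 d}" for x
        unfolding \<eta>_def
      proof (rule conv_eq_0[where S = N])
        fix y assume y: "y \<in> N"
        have "x - y \<notin> cball 0 d"
        proof
          assume "x - y \<in> cball 0 d"
          moreover have "x = y + (x - y)" by simp
          ultimately show False using x y by blast
        qed
        then show "complex_of_real (\<rho> (x - y)) = 0" using m(3)[of "x - y"] by simp
      qed simp
    qed
    show "cnj (\<eta> x) = \<eta> x" for x
      unfolding \<eta>_def conv_def by (simp del: of_real_mult add: of_real_mult[symmetric])
    show W: "open W" "S \<subseteq> W" using d by (auto simp: W_def)
    show "\<eta> x = 1" if "x \<in> W" for x by (rule W1[OF that])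
    show "pdiff i \<eta> x = 0" if x: "x \<in> W" for x i
    proof (rule pdiff_eqI[where f' = "\<lambda>h. 0"])
      show "(\<eta> has_derivative (\<lambda>h. 0)) (at x)"
        by (rule has_derivative_transform_within_open[OF has_derivative_const[of 1] W(1) x]) (simp add: W1)
    qed
  qed
qed

section \<open>Rellich's theorem\<close>

lemma L2_sum:
  fixes f :: "'i \<Rightarrow> real^'d \<Rightarrow> 'b::euclidean_space"
  assumes "finite I" "\<And>i. i \<in> I \<Longrightarrow> f i \<in> L2 \<Omega>"
  shows "(\<lambda>x. \<Sum>i\<in>I. f i x) \<in> L2 \<Omega> \<and> L2_norm \<Omega> (\<lambda>x. \<Sum>i\<in>I. f i x) \<le> (\<Sum>i\<in>I. L2_norm \<Omega> (f i))"
  using assms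
proof (induction I rule: finite_induct)
  case (insert j I)
  then have IH: "(\<lambda>x. \<Sum>i\<in>I. f i x) \<in> L2 \<Omega>" "L2_norm \<Omega> (\<lambda>x. \<Sum>i\<in>I. f i x) \<le> (\<Sum>i\<in>I. L2_norm \<Omega> (f i))"
    and j: "f j \<in> L2 \<Omega>" by auto
  show ?case using L2_add[OF j IH(1)] IH(2) insert.hyps by simp
qed simp

lemma test_fun_L2_UNIV: "\<phi> \<in> test_fun UNIV \<Longrightarrow> \<phi> \<in> L2 UNIV"
proof -
  assume \<phi>: "\<phi> \<in> test_fun UNIV"
  obtain C where C: "C > 0" "\<And>x. norm (\<phi> x) \<le> C" using test_fun_bounded[OF \<phi>] by metis
  obtain S where S: "compact S" "\<And>x. x \<notin> S \<Longrightarrow> \<phi> x = 0" using test_funE[OF \<phi>] by metis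
  obtain R where R: "\<And>x. x \<in> S \<Longrightarrow> norm x \<le> R"
    using compact_imp_bounded[OF S(1)] unfolding bounded_iff by blast
  show ?thesis
  proof (rule continuous_imp_L2(1)[where R = R and C = C])
    show "\<phi> x = 0" if "R < norm x" for x using R[of x] S(2)[of x] that by force
  qed (use C smooth_continuous[OF test_fun_smooth[OF \<phi>]] in auto)
qed

text \<open>The modulus of continuity \<open>N h\<close> is subadditive, so \<open>N h \<le> m * N (h / m)\<close>, and the linear
  bound for large \<open>m\<close> follows from uniform differentiability.\<close>

lemma test_fun_translation_bound:
  fixes \<phi> :: "real^'d \<Rightarrow> complex"
  assumes \<phi>: "\<phi> \<in> test_fun UNIV"
  shows "L2_norm UNIV (\<lambda>x. \<phi> (x - h) - \<phi> x) \<le> norm h * (\<Sum>i\<in>UNIV. L2_norm UNIV (pdiff i \<phi>))"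
proof -
  define N where "N h = L2_norm UNIV (\<lambda>x. \<phi> (x - h) - \<phi> x)" for h
  define G where "G = (\<Sum>i\<in>UNIV. L2_norm UNIV (pdiff i \<phi>))"
  note \<phi>L2 = test_fun_L2_UNIV[OF \<phi>] and pL2 = test_fun_L2_UNIV[OF test_fun_pdiff[OF \<phi>]]
  note tr = L2_translation(1)[OF \<phi>L2]
  have N_add: "N (h + k) \<le> N h + N k" for h k
  proof -
    have "N (h + k) \<le> L2_norm UNIV (\<lambda>x. \<phi> (x - (h + k)) - \<phi> (x - k)) + L2_norm UNIV (\<lambda>x. \<phi> (x - k) - \<phi> x)"
      unfolding N_def by (intro L2_norm_diff_triangle tr \<phi>L2)
    also have "L2_norm UNIV (\<lambda>x. \<phi> (x - (h + k)) - \<phi> (x - k)) = N h"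
      unfolding N_def using L2_translation(2)[OF L2_diff(1)[OF tr[of h] \<phi>L2], of k] by (simp add: algebra_simps)
    finally show ?thesis unfolding N_def .
  qed
  have N_scale: "N (real m *\<^sub>R k) \<le> real m * N k" for m k
  proof (induction m)
    case 0
    show ?case by (simp add: N_def)
  next
    case (Suc m)
    have "N (real (Suc m) *\<^sub>R k) \<le> N (real m *\<^sub>R k) + N k"
      using N_add[of "real m *\<^sub>R k" k] by (simp add: algebra_simps)
    then show ?case using Suc by (simp add: algebra_simps)
  qed
  obtain S where S: "compact S" "\<And>x. x \<notin> S \<Longrightarrow> \<phi> x = 0" "\<And>x i. x \<notin> S \<Longrightarrow> pdiff i \<phi> x = 0"
    using test_funE[OF \<phi>] by metis
  obtain R where R: "\<And>x. x \<in> S \<Longrightarrow> norm x \<le> R"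
    using compact_imp_bounded[OF S(1)] unfolding bounded_iff by blast
  define V where "V = L2_norm UNIV (indicat_real (cball (0::real^'d) (R + 1)))"
  have V: "0 \<le> V" by (simp add: V_def)
  have le: "N h \<le> norm h * G + e * (norm h * V)" if e: "0 < e" for e
  proof -
    obtain d where d: "d > 0" "\<And>x h. norm h < d \<Longrightarrow> norm (\<phi> (x + h) - \<phi> x - (\<Sum>i\<in>UNIV. (h $ i) *\<^sub>R pdiff i \<phi> x)) \<le> e * norm h"
      by (rule test_fun_uniformly_differentiable[OF \<phi> e]) blast
    \<comment> \<open>The step \<open>k\<close>, which is \<open>h\<close> divided by
      \<open>m\<close>, is shorter than \<open>d\<close>, as the remainder estimate requires, and
      shorter than 1, so that the supports stay in the ball of radius \<open>R + 1\<close>.\<close>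
    define m where "m = Suc (nat \<lceil>norm h / min d 1\<rceil>)"
    have m: "real m > 0" "norm h / real m < min d 1"
    proof -
      show m0: "real m > 0" by (simp add: m_def)
      have "norm h / min d 1 < real m" unfolding m_def by linarith
      moreover have "0 < min d 1" using d(1) by simp
      ultimately have "norm h < real m * min d 1" by (simp only: pos_divide_less_eq)
      then show "norm h / real m < min d 1" by (simp only: pos_divide_less_eq[OF m0] mult.commute)
    qed
    define k where "k = (1 / real m) *\<^sub>R h"
    have k: "norm k < d" "norm k < 1" "real m *\<^sub>R k = h" "real m * norm k = norm h"
      using m by (auto simp: k_def)
    define L where "L x = (\<Sum>i\<in>UNIV. (- k $ i) *\<^sub>R pdiff i \<phi> x)" for x
    have L: "L \<in> L2 UNIV" "L2_norm UNIV L \<le> norm k * G"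
    proof -
      have L': "L \<in> L2 UNIV \<and> L2_norm UNIV L \<le> (\<Sum>i\<in>UNIV. L2_norm UNIV (\<lambda>x. (- k $ i) *\<^sub>R pdiff i \<phi> x))"
        unfolding L_def[abs_def] by (rule L2_sum) (simp, rule L2_scaleR[OF pL2])
      have "(\<Sum>i\<in>UNIV. L2_norm UNIV (\<lambda>x. (- k $ i) *\<^sub>R pdiff i \<phi> x)) \<le> (\<Sum>i\<in>UNIV. norm k * L2_norm UNIV (pdiff i \<phi>))"
        unfolding L2_norm_scaleR using component_le_norm_cart[of k] by (intro sum_mono mult_right_mono) auto
      then show "L \<in> L2 UNIV" "L2_norm UNIV L \<le> norm k * G"
        using L' unfolding G_def sum_distrib_left by auto
    qed
    have b: "norm (\<phi> (x - k) - \<phi> x - L x) \<le> e * norm k" for x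
      using d(2)[of "- k" x] k(1) by (simp add: L_def)
    have z: "\<phi> (x - k) - \<phi> x - L x = 0" if "R + 1 < norm x" for x
    proof -
      have "x \<notin> S" "x - k \<notin> S" using R[of x] R[of "x - k"] that k(2) norm_triangle_ineq2[of x k] by auto
      then show ?thesis using S by (simp add: L_def)
    qed
    have c: "continuous_on UNIV (\<lambda>x. \<phi> (x - k) - \<phi> x - L x)"
    proof (intro continuous_on_diff)
      show "continuous_on UNIV \<phi>" by (rule smooth_continuous[OF test_fun_smooth[OF \<phi>]])
      then show "continuous_on UNIV (\<lambda>x. \<phi> (x - k))"
        by (rule continuous_on_compose2) (auto intro!: continuous_intros)
      show "continuous_on UNIV L" unfolding L_def
        by (intro continuous_on_sum continuous_on_scaleR continuous_on_const smooth_continuous[OF test_fun_smooth[OF test_fun_pdiff[OF \<phi>]]])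
    qed
    have d2: "L2_norm UNIV (\<lambda>x. \<phi> (x - k) - \<phi> x - L x) \<le> (e * norm k) * V"
      unfolding V_def by (rule continuous_imp_L2(2)) (use b z c e in auto)
    have "N k \<le> L2_norm UNIV L + L2_norm UNIV (\<lambda>x. \<phi> (x - k) - \<phi> x - L x)"
      unfolding N_def by (intro L2_norm_triangle_sub L2_diff tr \<phi>L2 L)
    also have "\<dots> \<le> norm k * G + (e * norm k) * V" using L(2) d2 by simp
    finally have "real m * N k \<le> real m * (norm k * G + (e * norm k) * V)" using m(1) by simp
    also have "\<dots> = (real m * norm k) * G + e * ((real m * norm k) * V)" by (simp add: algebra_simps)
    finally have "real m * N k \<le> norm h * G + e * (norm h * V)" unfolding k(4) .
    then show ?thesis using N_scale[of m k] unfolding k(3) by simp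
  qed
  have "N h \<le> norm h * G"
  proof (rule field_le_epsilon)
    fix e :: real assume e: "0 < e"
    define c where "c = norm h * V"
    have c: "0 \<le> c" using V by (simp add: c_def)
    have "e / (c + 1) * c \<le> e"
      using e c by (simp add: pos_divide_le_eq mult_left_mono)
    then show "N h \<le> norm h * G + e" using le[of "e / (c + 1)"] e c unfolding c_def[symmetric] by simp
  qed
  then show ?thesis unfolding N_def G_def .
qed

text \<open>For each \<open>e\<close> only a subsequence with all mutual distances below
  \<open>e\<close> is available. From index \<open>Suc n\<close> on, the diagonal sequence is a
  subsequence of the one chosen for \<open>1 / Suc n\<close>, and the property passes to
  subsequences.\<close>

lemma diagonal_Cauchy_subsequence:
  fixes D :: "nat \<Rightarrow> nat \<Rightarrow> real"
  assumes ex: "\<And>e (s :: nat \<Rightarrow> nat). 0 < e \<Longrightarrow> strict_mono s \<Longrightarrow> \<exists>r :: nat \<Rightarrow> nat. strict_mono r \<and> (\<forall>k l. D (s (r k)) (s (r l)) < e)"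
  obtains r :: "nat \<Rightarrow> nat" where "strict_mono r" "\<And>e. 0 < e \<Longrightarrow> \<exists>N. \<forall>k\<ge>N. \<forall>l\<ge>N. D (r k) (r l) < e"
proof -
  define P where "P n s \<longleftrightarrow> (\<forall>k l. D (s k) (s l) < 1 / real (Suc n))" for n and s :: "nat \<Rightarrow> nat"
  interpret subseqs P
  proof
    fix n and s :: "nat \<Rightarrow> nat" assume "strict_mono s"
    then show "\<exists>r'. strict_mono r' \<and> P n (s \<circ> r')"
      using ex[of "1 / real (Suc n)" s] by (simp add: P_def)
  qed
  have h: "P n (diagseq \<circ> (+) (Suc n))" for n
    by (rule diagseq_holds) (auto simp: P_def)
  show thesis
  proof (rule that[OF subseq_diagseq])
    fix e :: real assume "0 < e"
    then obtain n where n: "1 / real (Suc n) < e" using nat_approx_posE by blast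
    show "\<exists>N. \<forall>k\<ge>N. \<forall>l\<ge>N. D (diagseq k) (diagseq l) < e"
    proof (intro exI[of _ "Suc n"] allI impI)
      fix k l assume kl: "Suc n \<le> k" "Suc n \<le> l"
      then obtain k' l' where kl': "k = Suc n + k'" "l = Suc n + l'" by (auto simp: le_iff_add)
      have "D (diagseq k) (diagseq l) < 1 / real (Suc n)"
        using h[of n] unfolding kl' by (simp add: P_def o_def)
      then show "D (diagseq k) (diagseq l) < e" using n by simp
    qed
  qed
qed

context bounded_open
begin

text \<open>The translation and convolution estimates use norms over the whole space; for functions
  supported in \<open>\<Omega>\<close> they are controlled by the \<open>H1\<close> norm on
  \<open>\<Omega>\<close>.\<close>

lemma test_fun_H1_norm_bounds:
  assumes \<phi>: "\<phi> \<in> test_fun \<Omega>"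
  shows "(\<Sum>i\<in>UNIV. L2_norm UNIV (pdiff i \<phi>)) \<le> real CARD('d) * H1_norm \<Omega> \<phi>"
    and "(LINT x|lebesgue. norm (\<phi> x)) \<le> H1_norm \<Omega> \<phi> * L2_norm \<Omega> (\<lambda>x. 1::real)"
proof -
  obtain S where S: "S \<subseteq> \<Omega>" "\<And>x. x \<notin> S \<Longrightarrow> \<phi> x = 0" "\<And>x i. x \<notin> S \<Longrightarrow> pdiff i \<phi> x = 0"
    using test_funE[OF \<phi>] by metis
  note \<phi>1 = test_fun_H1[OF test_fun_UNIV[OF \<phi>]]
  have "L2_norm UNIV (pdiff i \<phi>) \<le> H1_norm \<Omega> \<phi>" for i
  proof -
    have eq: "(\<lambda>x. if x \<in> \<Omega> then pdiff i \<phi> x else 0) = pdiff i \<phi>"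
    proof
      fix x show "(if x \<in> \<Omega> then pdiff i \<phi> x else 0) = pdiff i \<phi> x" using S(1) S(3)[of x i] by auto
    qed
    have "L2_norm UNIV (pdiff i \<phi>) = L2_norm \<Omega> (pdiff i \<phi>)"
      using L2_restrict(2)[OF sets_\<Omega>, of "pdiff i \<phi>"] unfolding eq .
    also have "\<dots> = L2_norm \<Omega> (\<lambda>x. wgrad \<Omega> \<phi> x $ i)"
    proof (rule L2_norm_cong_AE)
      show "AE x in lebesgue_on \<Omega>. pdiff i \<phi> x = wgrad \<Omega> \<phi> x $ i"
        using \<phi>1(2) by eventually_elim simp
      show "pdiff i \<phi> \<in> borel_measurable (lebesgue_on \<Omega>)"
        by (rule smooth_measurable[OF test_fun_smooth[OF test_fun_pdiff[OF \<phi>]]])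
      show "(\<lambda>x. wgrad \<Omega> \<phi> x $ i) \<in> borel_measurable (lebesgue_on \<Omega>)"
        by (intro L2_measurable L2_vec_nth H1D \<phi>1)
    qed
    also have "\<dots> \<le> L2_norm \<Omega> (wgrad \<Omega> \<phi>)" by (intro L2_vec_nth H1D \<phi>1)
    also have "\<dots> \<le> H1_norm \<Omega> \<phi>" by (simp add: H1_norm_def real_le_rsqrt)
    finally show ?thesis .
  qed
  then have "(\<Sum>i\<in>UNIV. L2_norm UNIV (pdiff i \<phi>)) \<le> (\<Sum>i\<in>(UNIV::'d set). H1_norm \<Omega> \<phi>)"
    by (intro sum_mono) auto
  then show "(\<Sum>i\<in>UNIV. L2_norm UNIV (pdiff i \<phi>)) \<le> real CARD('d) * H1_norm \<Omega> \<phi>" by simp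
  have "(LINT x|lebesgue. norm (\<phi> x)) = (LINT x|lebesgue_on \<Omega>. norm (\<phi> x))"
    by (rule lebesgue_on_integral_eq[OF sets_\<Omega>, symmetric]) (use S in auto)
  also have "\<dots> \<le> L2_norm \<Omega> \<phi> * L2_norm \<Omega> (\<lambda>x. 1::real)"
    by (rule L2_integrable_self(2)[OF finite_\<Omega> H1D(1)[OF \<phi>1(1)]])
  also have "\<dots> \<le> H1_norm \<Omega> \<phi> * L2_norm \<Omega> (\<lambda>x. 1::real)"
    by (intro mult_right_mono L2_norm_le_H1_norm) simp
  finally show "(LINT x|lebesgue. norm (\<phi> x)) \<le> H1_norm \<Omega> \<phi> * L2_norm \<Omega> (\<lambda>x. 1::real)" .
qed

text \<open>The mollifications with a fixed \<open>\<rho>\<close> are equicontinuous, and uniformly \<open>L\<^sup>2\<close>-close to the functions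
  themselves by the translation bound.\<close>

lemma test_fun_subsequence_close:
  fixes \<phi> :: "nat \<Rightarrow> real^'d \<Rightarrow> complex"
  assumes \<phi>: "\<And>k. \<phi> k \<in> test_fun \<Omega>" and C: "\<And>k. H1_norm \<Omega> (\<phi> k) \<le> C" and e: "0 < e"
  obtains r :: "nat \<Rightarrow> nat" where "strict_mono r" "\<And>k l. L2_norm \<Omega> (\<lambda>x. \<phi> (r k) x - \<phi> (r l) x) < e"
proof -
  define n where "n = real CARD('d)"
  define V where "V = L2_norm \<Omega> (\<lambda>x. 1::real)"
  have V: "0 \<le> V" and n: "0 \<le> n" by (auto simp: V_def n_def)
  have C0: "0 \<le> C" using C[of 0] H1_norm_nonneg[of "\<phi> 0"] by linarith
  \<comment> \<open>Chosen so that the translation bound \<open>s * (n * C)\<close> is at most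
    \<open>e / 5\<close>; the 1 guards against \<open>C = 0\<close>. Two mollification errors and
    the distance of the mollified functions add up to three fifths of \<open>e\<close>.\<close>
  define s where "s = e / (5 * (n * C + 1))"
  have s: "0 < s" "s * (n * C) \<le> e / 5"
  proof -
    have p: "0 < n * C + 1" using n C0 by (simp add: add_nonneg_pos)
    then show "0 < s" using e by (simp add: s_def)
    have "e * (n * C) \<le> e * (n * C + 1)" using e by (intro mult_left_mono) auto
    then show "s * (n * C) \<le> e / 5" using p by (simp add: s_def field_simps)
  qed
  obtain \<rho> :: "real^'d \<Rightarrow> real" where \<rho>: "mollifier s \<rho>" using mollifier_exists[OF s(1)] .
  note m = mollifierD[OF \<rho>]
  define F where "F k = conv (\<lambda>x. complex_of_real (\<rho> x)) (\<phi> k)" for k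
  note \<phi>U = test_fun_UNIV[OF \<phi>]
  note \<phi>i = test_fun_integrable(1)[OF \<phi>U]
  have close: "L2_norm \<Omega> (\<lambda>x. F k x - \<phi> k x) \<le> e / 5" and FL2: "F k \<in> L2 \<Omega>" for k
  proof -
    have t: "L2_norm UNIV (\<lambda>x. \<phi> k (x - y) - \<phi> k x) \<le> e / 5" if "norm y \<le> s" for y
    proof -
      have "L2_norm UNIV (\<lambda>x. \<phi> k (x - y) - \<phi> k x) \<le> norm y * (\<Sum>i\<in>UNIV. L2_norm UNIV (pdiff i (\<phi> k)))"
        by (rule test_fun_translation_bound[OF \<phi>U])
      also have "\<dots> \<le> s * (n * C)"
      proof (intro mult_mono that)
        show "(\<Sum>i\<in>UNIV. L2_norm UNIV (pdiff i (\<phi> k))) \<le> n * C"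
          using test_fun_H1_norm_bounds(1)[OF \<phi>, of k] mult_left_mono[OF C n, of k] unfolding n_def by linarith
      qed (use s in \<open>auto intro!: sum_nonneg\<close>)
      finally show ?thesis using s(2) by simp
    qed
    have cl: "(\<lambda>x. F k x - \<phi> k x) \<in> L2 UNIV" "L2_norm UNIV (\<lambda>x. F k x - \<phi> k x) \<le> e / 5"
      unfolding F_def by (rule conv_mollifier_close[OF \<rho> \<phi>i test_fun_L2_UNIV[OF \<phi>U], where e = "e / 5"]; use t s in simp)+
    have Fs: "smooth (F k)" unfolding F_def by (rule conv_smooth[OF m(1) \<phi>i])
    let ?w = "\<lambda>x. F k x - \<phi> k x"
    have wm: "(\<lambda>x. if x \<in> \<Omega> then ?w x else 0) \<in> borel_measurable (lebesgue_on UNIV)"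
      unfolding lebesgue_on_UNIV_eq borel_measurable_if[OF sets_\<Omega>]
      using smooth_measurable[OF Fs] smooth_measurable[OF test_fun_smooth[OF \<phi>U]] by (intro borel_measurable_diff)
    have wL: "(\<lambda>x. if x \<in> \<Omega> then ?w x else 0) \<in> L2 UNIV" "L2_norm UNIV (\<lambda>x. if x \<in> \<Omega> then ?w x else 0) \<le> L2_norm UNIV ?w"
      by (rule L2_norm_mono[OF cl(1) wm]; simp)+
    then show "L2_norm \<Omega> ?w \<le> e / 5" unfolding L2_restrict(2)[OF sets_\<Omega>] using cl(2) by simp
    have "?w \<in> L2 \<Omega>" using wL(1) L2_restrict(1)[OF sets_\<Omega>] by blast
    from L2_add(1)[OF this test_fun_L2[OF \<phi>U[of k]]] show "F k \<in> L2 \<Omega>" by simp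
  qed
  obtain R where R: "\<And>x. x \<in> \<Omega> \<Longrightarrow> norm x \<le> R" using bounded_\<Omega> unfolding bounded_iff by blast
  obtain c where c: "c > 0" "\<And>x. norm (complex_of_real (\<rho> x)) \<le> c" using test_fun_bounded[OF m(1)] by metis
  define Q where "Q = C * V"
  have Q: "0 \<le> Q" using C0 V by (simp add: Q_def)
  have L1: "(LINT x|lebesgue. norm (\<phi> k x)) \<le> Q" for k
    using test_fun_H1_norm_bounds(2)[OF \<phi>, of k] mult_right_mono[OF C V, of k] unfolding V_def Q_def by linarith
  note ci = test_fun_mult_integrable[OF m(1) \<phi>i]
  have Fb: "norm (F k x) \<le> c * Q" for k x
  proof -
    have "norm (F k x) \<le> (LINT y|lebesgue. norm (complex_of_real (\<rho> (x - y)) * \<phi> k y))"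
      unfolding F_def conv_def by (rule integral_norm_bound)
    also have "\<dots> \<le> (LINT y|lebesgue. c * norm (\<phi> k y))"
      by (intro integral_mono integrable_norm ci integrable_mult_right \<phi>i) (simp only: norm_mult mult_right_mono[OF c(2)] norm_ge_zero)
    also have "\<dots> \<le> c * Q" using mult_left_mono[OF L1, of c k] c(1) by simp
    finally show ?thesis .
  qed
  have eqc: "\<exists>d>0. \<forall>k y. y \<in> cball 0 R \<and> norm (x - y) < d \<longrightarrow> norm (F k x - F k y) < \<epsilon>" if \<epsilon>: "0 < \<epsilon>" for x \<epsilon>
  proof -
    define \<epsilon>1 where "\<epsilon>1 = \<epsilon> / (2 * (Q + 1))"
    have \<epsilon>1: "0 < \<epsilon>1" "\<epsilon>1 * Q < \<epsilon>"
    proof -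
      show p: "0 < \<epsilon>1" using \<epsilon> Q by (simp add: \<epsilon>1_def)
      have "\<epsilon>1 * (2 * (Q + 1)) = \<epsilon>" using Q by (simp add: \<epsilon>1_def)
      moreover have "\<epsilon>1 * Q < \<epsilon>1 * (2 * (Q + 1))" using p Q by (intro mult_strict_left_mono) auto
      ultimately show "\<epsilon>1 * Q < \<epsilon>" by simp
    qed
    obtain d where d: "d > 0" "\<And>x y. dist x y < d \<Longrightarrow> dist (complex_of_real (\<rho> x)) (complex_of_real (\<rho> y)) < \<epsilon>1"
      by (rule test_fun_uniformly_continuous[OF m(1) \<epsilon>1(1)]) blast
    have "norm (F k x - F k y) < \<epsilon>" if xy: "norm (x - y) < d" for k y
    proof -
      have E: "F k x - F k y = (LINT z|lebesgue. (complex_of_real (\<rho> (x - z)) - complex_of_real (\<rho> (y - z))) * \<phi> k z)"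
        unfolding F_def conv_def left_diff_distrib using ci[of x k] ci[of y k] by simp
      have i: "integrable lebesgue (\<lambda>z. (complex_of_real (\<rho> (x - z)) - complex_of_real (\<rho> (y - z))) * \<phi> k z)"
        unfolding left_diff_distrib by (intro Bochner_Integration.integrable_diff ci)
      have "norm (F k x - F k y) \<le> (LINT z|lebesgue. norm ((complex_of_real (\<rho> (x - z)) - complex_of_real (\<rho> (y - z))) * \<phi> k z))"
        unfolding E by (rule integral_norm_bound)
      also have "\<dots> \<le> (LINT z|lebesgue. \<epsilon>1 * norm (\<phi> k z))"
      proof (intro integral_mono integrable_norm i integrable_mult_right \<phi>i)
        fix z
        have "dist (x - z) (y - z) < d" using xy by (simp add: dist_norm)
        from d(2)[OF this] have "norm (complex_of_real (\<rho> (x - z)) - complex_of_real (\<rho> (y - z))) \<le> \<epsilon>1"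
          by (simp add: dist_norm)
        then show "norm ((complex_of_real (\<rho> (x - z)) - complex_of_real (\<rho> (y - z))) * \<phi> k z) \<le> \<epsilon>1 * norm (\<phi> k z)"
          unfolding norm_mult by (rule mult_right_mono) simp
      qed
      also have "\<dots> \<le> \<epsilon>1 * Q" using mult_left_mono[OF L1, of \<epsilon>1 k] \<epsilon>1(1) by simp
      finally show ?thesis using \<epsilon>1(2) by simp
    qed
    then show ?thesis using d(1) by blast
  qed
  \<comment> \<open>The ball contains \<open>\<Omega>\<close>, and \<open>\<Omega>\<close> has
    finite measure, so uniform convergence there implies closeness in \<open>L2\<close>.\<close>
  obtain g and r0 :: "nat \<Rightarrow> nat" where r0: "strict_mono r0"
    "\<And>\<epsilon>. 0 < \<epsilon> \<Longrightarrow> \<exists>N. \<forall>n x. n \<ge> N \<and> x \<in> cball 0 R \<longrightarrow> norm (F (r0 n) x - g x) < \<epsilon>"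
  proof (rule Arzela_Ascoli[of "cball (0::real^'d) R" F "c * Q"])
    show "compact (cball (0::real^'d) R)" by simp
  qed (use Fb eqc in blast)+
  define \<epsilon> where "\<epsilon> = e / (10 * (V + 1))"
  have \<epsilon>: "0 < \<epsilon>" "(2 * \<epsilon>) * V \<le> e / 5"
  proof -
    show p: "0 < \<epsilon>" using e V by (simp add: \<epsilon>_def)
    have "\<epsilon> * (10 * (V + 1)) = e" using V by (simp add: \<epsilon>_def)
    then show "(2 * \<epsilon>) * V \<le> e / 5" using p by (simp add: algebra_simps)
  qed
  obtain N where N: "\<And>n x. n \<ge> N \<Longrightarrow> x \<in> cball 0 R \<Longrightarrow> norm (F (r0 n) x - g x) < \<epsilon>"
    using r0(2)[OF \<epsilon>(1)] by blast
  \<comment> \<open>The first \<open>N\<close> terms are discarded, so that every pair of members is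
    close and not only the late ones.\<close>
  define r where "r k = r0 (N + k)" for k
  have "strict_mono r" using r0(1) by (auto simp: r_def strict_mono_def)
  moreover have "L2_norm \<Omega> (\<lambda>x. \<phi> (r k) x - \<phi> (r l) x) < e" for k l
  proof -
    note \<phi>L = test_fun_L2[OF \<phi>U]
    have F2: "L2_norm \<Omega> (\<lambda>x. F (r k) x - F (r l) x) \<le> e / 5"
    proof -
      have b: "norm (F (r k) x - F (r l) x) \<le> 2 * \<epsilon>" if "x \<in> \<Omega>" for x
      proof -
        have x: "x \<in> cball 0 R" using R[OF that] by simp
        show ?thesis
          using N[of "N + k" x] N[of "N + l" x] x norm_triangle_ineq4[of "F (r k) x - g x" "F (r l) x - g x"]
          unfolding r_def by simp
      qed
      have mm: "(\<lambda>x. F (r k) x - F (r l) x) \<in> borel_measurable (lebesgue_on \<Omega>)"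
        by (intro L2_measurable L2_diff FL2)
      have "L2_norm \<Omega> (\<lambda>x. F (r k) x - F (r l) x) \<le> (2 * \<epsilon>) * V"
        unfolding V_def using L2_bounded(2)[OF finite_\<Omega> mm b] \<epsilon>(1) by simp
      then show ?thesis using \<epsilon>(2) by simp
    qed
    have "L2_norm \<Omega> (\<lambda>x. \<phi> (r k) x - \<phi> (r l) x) \<le> L2_norm \<Omega> (\<lambda>x. \<phi> (r k) x - F (r k) x) + L2_norm \<Omega> (\<lambda>x. F (r k) x - \<phi> (r l) x)"
      by (intro L2_norm_diff_triangle \<phi>L FL2)
    also have "L2_norm \<Omega> (\<lambda>x. F (r k) x - \<phi> (r l) x) \<le> L2_norm \<Omega> (\<lambda>x. F (r k) x - F (r l) x) + L2_norm \<Omega> (\<lambda>x. F (r l) x - \<phi> (r l) x)"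
      by (intro L2_norm_diff_triangle \<phi>L FL2)
    finally have "L2_norm \<Omega> (\<lambda>x. \<phi> (r k) x - \<phi> (r l) x) \<le> e / 5 + (e / 5 + e / 5)"
      using F2 close[of "r l"] close[of "r k"] L2_norm_minus_commute[of \<Omega> "\<phi> (r k)" "F (r k)"] by simp
    then show ?thesis using e by simp
  qed
  ultimately show thesis by (rule that)
qed

text \<open>Membership in \<open>H10\<close> allows each \<open>u k\<close> to be replaced by a test
  function at distance below \<open>1 / Suc k\<close>, which does not change the limit. Test
  functions extend by zero, so the shape of the boundary does not matter.\<close>

theorem Rellich:
  assumes u: "\<And>k. u k \<in> H10 \<Omega>" and C: "\<And>k. H1_norm \<Omega> (u k) \<le> C"
  obtains r :: "nat \<Rightarrow> nat" and v where "strict_mono r" "v \<in> L2 \<Omega>" "(\<lambda>k. L2_norm \<Omega> (\<lambda>x. u (r k) x - v x)) \<longlonglongrightarrow> 0"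
proof -
  have "\<exists>\<phi>\<in>test_fun \<Omega>. H1_norm \<Omega> (\<lambda>x. u k x - \<phi> x) < 1 / Suc k" for k
    using H10D[OF u[of k], of "1 / Suc k"] by (metis of_nat_0_less_iff zero_less_Suc zero_less_divide_1_iff)
  then obtain \<phi> where \<phi>: "\<And>k. \<phi> k \<in> test_fun \<Omega>" "\<And>k. H1_norm \<Omega> (\<lambda>x. u k x - \<phi> k x) < 1 / Suc k"
    by metis
  note u1 = H10_H1[OF u] and \<phi>1 = test_fun_H1'[OF \<phi>(1)]
  have \<phi>C: "H1_norm \<Omega> (\<phi> k) \<le> C + 1" for k
  proof -
    have "H1_norm \<Omega> (\<lambda>x. u k x - (u k x - \<phi> k x)) \<le> H1_norm \<Omega> (u k) + H1_norm \<Omega> (\<lambda>x. u k x - \<phi> k x)"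
      by (intro H1_norm_diff H1_diff u1 \<phi>1)
    then have "H1_norm \<Omega> (\<phi> k) \<le> H1_norm \<Omega> (u k) + H1_norm \<Omega> (\<lambda>x. u k x - \<phi> k x)" by simp
    moreover have "1 / real (Suc k) \<le> 1" by simp
    ultimately show ?thesis using C[of k] \<phi>(2)[of k] by linarith
  qed
  have sub: "\<exists>r :: nat \<Rightarrow> nat. strict_mono r \<and> (\<forall>k l. L2_norm \<Omega> (\<lambda>x. \<phi> (s (r k)) x - \<phi> (s (r l)) x) < e)"
    if e: "0 < e" for e and s :: "nat \<Rightarrow> nat"
  proof -
    obtain r :: "nat \<Rightarrow> nat" where "strict_mono r" "\<And>k l. L2_norm \<Omega> (\<lambda>x. \<phi> (s (r k)) x - \<phi> (s (r l)) x) < e"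
      by (rule test_fun_subsequence_close[of "\<lambda>k. \<phi> (s k)" "C + 1" e]) (use \<phi>(1) \<phi>C e in blast)+
    then show ?thesis by blast
  qed
  obtain r :: "nat \<Rightarrow> nat" where r: "strict_mono r"
    "\<And>e. 0 < e \<Longrightarrow> \<exists>N. \<forall>k\<ge>N. \<forall>l\<ge>N. L2_norm \<Omega> (\<lambda>x. \<phi> (r k) x - \<phi> (r l) x) < e"
    by (rule diagonal_Cauchy_subsequence[where D = "\<lambda>k l. L2_norm \<Omega> (\<lambda>x. \<phi> k x - \<phi> l x)"], erule sub) blast
  note \<phi>L = H1D(1)[OF \<phi>1] and uL = H1D(1)[OF u1]
  obtain v where v: "v \<in> L2 \<Omega>" "(\<lambda>k. L2_norm \<Omega> (\<lambda>x. \<phi> (r k) x - v x)) \<longlonglongrightarrow> 0"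
    by (rule L2_complete[OF finite_\<Omega>, of "\<lambda>k. \<phi> (r k)"]) (use \<phi>L r(2) in blast)+
  have "(\<lambda>k. L2_norm \<Omega> (\<lambda>x. u (r k) x - v x)) \<longlonglongrightarrow> 0"
  proof (rule tendsto_sandwich[OF _ _ tendsto_const])
    have "(\<lambda>k. 1 / real (Suc (r k))) \<longlonglongrightarrow> 0"
      using LIMSEQ_subseq_LIMSEQ[OF LIMSEQ_Suc[OF lim_1_over_n] r(1)] by (simp add: o_def)
    from tendsto_add[OF this v(2)]
    show "(\<lambda>k. 1 / real (Suc (r k)) + L2_norm \<Omega> (\<lambda>x. \<phi> (r k) x - v x)) \<longlonglongrightarrow> 0" by simp
    show "\<forall>\<^sub>F k in sequentially. L2_norm \<Omega> (\<lambda>x. u (r k) x - v x) \<le> 1 / real (Suc (r k)) + L2_norm \<Omega> (\<lambda>x. \<phi> (r k) x - v x)"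
    proof (intro always_eventually allI)
      fix k
      have "L2_norm \<Omega> (\<lambda>x. u (r k) x - v x) \<le> L2_norm \<Omega> (\<lambda>x. u (r k) x - \<phi> (r k) x) + L2_norm \<Omega> (\<lambda>x. \<phi> (r k) x - v x)"
        by (intro L2_norm_diff_triangle \<phi>L uL v)
      then show "L2_norm \<Omega> (\<lambda>x. u (r k) x - v x) \<le> 1 / real (Suc (r k)) + L2_norm \<Omega> (\<lambda>x. \<phi> (r k) x - v x)"
        using L2_norm_le_H1_norm[of "\<lambda>x. u (r k) x - \<phi> (r k) x"] \<phi>(2)[of "r k"] by simp
    qed
  qed simp
  then show thesis using that r(1) v(1) by blast
qed

end

section \<open>The sesquilinear forms\<close>

text \<open>The jet of a product at a point: \<open>c\<close> and \<open>e\<close> stand for the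
  value and the gradient of the multiplier, \<open>U\<close> for the jet of the other factor. A
  constant multiplier has \<open>e = 0\<close>.\<close>

definition jmult :: "complex \<Rightarrow> complex^'d \<Rightarrow> complex \<times> (complex^'d) \<Rightarrow> complex \<times> (complex^'d)" where
  "jmult c e U = (c * fst U, c *s snd U + fst U *s e)"

definition mg :: "real^'d \<Rightarrow> complex \<times> (complex^'d) \<Rightarrow> complex^'d" where
  "mg \<alpha> U = (\<chi> i. snd U $ i + \<i> * of_real (\<alpha> $ i) * fst U)"

definition sform :: "real^'d^'d \<Rightarrow> complex^'d \<Rightarrow> complex^'d \<Rightarrow> complex" where
  "sform S X Y = (\<Sum>i\<in>UNIV. (\<Sum>j\<in>UNIV. of_real (S $ i $ j) * X $ j) * cnj (Y $ i))"

text \<open>The integrand of \<open>mform\<close> on jets, with the coefficients frozen at one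
  point. Algebraic identities and estimates are obtained in finite dimension and only afterwards
  integrated.\<close>

definition pform :: "real^'d^'d \<Rightarrow> real^'d \<Rightarrow> real \<Rightarrow> complex \<Rightarrow> complex \<times> (complex^'d) \<Rightarrow> complex \<times> (complex^'d) \<Rightarrow> complex" where
  "pform S \<alpha> p z U V = sform S (mg \<alpha> U) (mg \<alpha> V) + (of_real p - z) * fst U * cnj (fst V)"

lemma mform_eq_pform:
  "mform \<Omega> \<sigma> A q z u v = (LINT x|lebesgue_on \<Omega>. pform (\<sigma> x) (A x) (q x) z (jet \<Omega> u x) (jet \<Omega> v x))"
  by (simp add: mform_def pform_def sform_def mg_def jet_def mgrad_def)

lemma mg_add: "mg \<alpha> (U + V) = mg \<alpha> U + mg \<alpha> V"
  by (simp add: mg_def vec_eq_iff algebra_simps)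

lemma mg_jmult: "mg \<alpha> (jmult c e U) = c *s mg \<alpha> U + fst U *s e"
  by (simp add: mg_def jmult_def vec_eq_iff algebra_simps)

lemma fst_jmult [simp]: "fst (jmult c e U) = c * fst U"
  by (simp add: jmult_def)

lemma sform_add_left: "sform S (X + X') Y = sform S X Y + sform S X' Y"
  by (simp add: sform_def distrib_left distrib_right sum.distrib)

lemma sform_add_right: "sform S X (Y + Y') = sform S X Y + sform S X Y'"
  by (simp add: sform_def distrib_left sum.distrib)

lemma sform_smult_left: "sform S (c *s X) Y = c * sform S X Y"
  by (simp add: sform_def sum_distrib_left sum_distrib_right algebra_simps)

lemma sform_smult_right: "sform S X (c *s Y) = cnj c * sform S X Y"
  by (simp add: sform_def sum_distrib_left sum_distrib_right algebra_simps)

lemma pform_add_left: "pform S \<alpha> p z (U + U') V = pform S \<alpha> p z U V + pform S \<alpha> p z U' V"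
  by (simp add: pform_def mg_add sform_add_left algebra_simps)

lemma pform_jmult_left: "pform S \<alpha> p z (jmult c 0 U) V = c * pform S \<alpha> p z U V"
  by (simp add: pform_def mg_jmult sform_smult_left algebra_simps)

lemma pform_shift: "pform S \<alpha> p z U V = pform S \<alpha> p w U V + (w - z) * (fst U * cnj (fst V))"
  by (simp add: pform_def algebra_simps)

lemma cnj_sform:
  assumes "transpose S = S"
  shows "cnj (sform S X Y) = sform S Y X"
proof -
  have s: "S $ i $ j = S $ j $ i" for i j
    using arg_cong[OF assms, of "\<lambda>M. M $ j $ i"] by (simp add: transpose_def)
  have "cnj (sform S X Y) = (\<Sum>i\<in>UNIV. \<Sum>j\<in>UNIV. of_real (S $ i $ j) * cnj (X $ j) * Y $ i)"
    by (simp add: sform_def sum_distrib_right)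
  also have "\<dots> = (\<Sum>j\<in>UNIV. \<Sum>i\<in>UNIV. of_real (S $ i $ j) * cnj (X $ j) * Y $ i)"
    by (rule sum.swap)
  also have "\<dots> = sform S Y X"
    unfolding sform_def sum_distrib_right by (intro sum.cong refl) (simp add: s mult.commute mult.left_commute)
  finally show ?thesis .
qed

lemma cnj_pform:
  assumes "transpose S = S"
  shows "cnj (pform S \<alpha> p z U V) = pform S \<alpha> p (cnj z) V U"
  by (simp add: pform_def cnj_sform[OF assms])

text \<open>The commutator of multiplication by a real \<open>\<eta>\<close> with gradient \<open>e\<close> and the form contains no
  products of two gradients.\<close>

lemma pform_commutator:
  assumes "cnj \<eta> = \<eta>"
  shows "pform S \<alpha> p z (jmult \<eta> e U) V - pform S \<alpha> p z U (jmult \<eta> e V)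
    = sform S (fst U *s e) (mg \<alpha> V) - sform S (mg \<alpha> U) (fst V *s e)"
  using assms
  by (simp add: pform_def mg_jmult sform_add_left sform_add_right sform_smult_left sform_smult_right algebra_simps)

definition coeff_ok :: "real \<Rightarrow> real^'d^'d \<Rightarrow> real^'d \<Rightarrow> real \<Rightarrow> bool" where
  "coeff_ok K S \<alpha> p \<longleftrightarrow> transpose S = S \<and>
     (\<forall>\<xi>. (1 / K) * (\<xi> \<bullet> \<xi>) \<le> \<xi> \<bullet> (S *v \<xi>) \<and> \<xi> \<bullet> (S *v \<xi>) \<le> K * (\<xi> \<bullet> \<xi>)) \<and> norm \<alpha> \<le> K \<and> \<bar>p\<bar> \<le> K"

text \<open>Polarisation: at the sum and at the difference of the two unit vectors the quadratic
  form lies between 0 and \<open>4 * K\<close>, and the two values differ by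
  \<open>4 * S $ i $ j\<close>. For \<open>i = j\<close> the difference is the zero vector.\<close>

lemma coeff_entry_bound:
  fixes S :: "real^'d^'d"
  assumes ok: "coeff_ok K S \<alpha> p" and K: "0 < K"
  shows "\<bar>S $ i $ j\<bar> \<le> K"
proof -
  let ?a = "axis i 1 :: real^'d" and ?b = "axis j 1 :: real^'d"
  have e: "axis k 1 \<bullet> (S *v axis l 1) = S $ k $ l" for k l
    by (simp add: inner_axis' matrix_vector_mult_basis column_def)
  have s: "S $ j $ i = S $ i $ j"
  proof -
    have "transpose S $ i $ j = S $ i $ j" using ok by (simp add: coeff_ok_def)
    then show ?thesis by (simp add: transpose_def)
  qed
  have q: "0 \<le> \<xi> \<bullet> (S *v \<xi>)" "\<xi> \<bullet> (S *v \<xi>) \<le> K * (\<xi> \<bullet> \<xi>)" for \<xi>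
  proof -
    have "0 \<le> (1 / K) * (\<xi> \<bullet> \<xi>)" using K by simp
    then show "0 \<le> \<xi> \<bullet> (S *v \<xi>)" "\<xi> \<bullet> (S *v \<xi>) \<le> K * (\<xi> \<bullet> \<xi>)"
      using ok unfolding coeff_ok_def by (auto intro: order_trans)
  qed
  have exp: "(?a + t *\<^sub>R ?b) \<bullet> (S *v (?a + t *\<^sub>R ?b)) = S $ i $ i + t * (2 * S $ i $ j) + t\<^sup>2 * S $ j $ j" for t
    by (simp add: matrix_vector_right_distrib inner_add_left inner_add_right matrix_vector_mult_scaleR e s power2_eq_square algebra_simps)
  have n1: "?a \<bullet> ?a = 1" "?b \<bullet> ?b = 1" by (simp_all add: inner_axis')
  have n2: "\<bar>?a \<bullet> ?b\<bar> \<le> 1" using Cauchy_Schwarz_ineq2[of ?a ?b] by simp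
  have nt: "(?a + t *\<^sub>R ?b) \<bullet> (?a + t *\<^sub>R ?b) = 1 + 2 * t * (?a \<bullet> ?b) + t\<^sup>2" for t
    using n1 by (simp add: inner_add_left inner_add_right inner_commute[of ?b ?a] power2_eq_square algebra_simps)
  have p1: "S $ i $ i + 2 * S $ i $ j + S $ j $ j \<le> K * (2 + 2 * (?a \<bullet> ?b))"
    using q(2)[of "?a + 1 *\<^sub>R ?b"] unfolding exp nt by simp
  have p2: "S $ i $ i - 2 * S $ i $ j + S $ j $ j \<le> K * (2 - 2 * (?a \<bullet> ?b))"
    using q(2)[of "?a + (-1) *\<^sub>R ?b"] unfolding exp nt by simp
  have p3: "0 \<le> S $ i $ i + 2 * S $ i $ j + S $ j $ j" using q(1)[of "?a + 1 *\<^sub>R ?b"] unfolding exp by simp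
  have p4: "0 \<le> S $ i $ i - 2 * S $ i $ j + S $ j $ j" using q(1)[of "?a + (-1) *\<^sub>R ?b"] unfolding exp by simp
  have "K * (2 + 2 * (?a \<bullet> ?b)) \<le> K * 4" "K * (2 - 2 * (?a \<bullet> ?b)) \<le> K * 4"
    using n2 K by (intro mult_left_mono; simp)+
  then show ?thesis using p1 p2 p3 p4 by linarith
qed

lemma sform_bound:
  fixes S :: "real^'d^'d"
  assumes "\<And>i j. \<bar>S $ i $ j\<bar> \<le> K" and K: "0 \<le> K"
  shows "norm (sform S X Y) \<le> (real CARD('d))\<^sup>2 * K * (norm X * norm Y)"
proof -
  have "norm (sform S X Y) \<le> (\<Sum>i\<in>(UNIV::'d set). real CARD('d) * (K * (norm X * norm Y)))"
    unfolding sform_def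
  proof (rule sum_norm_le)
    fix i
    have "norm ((\<Sum>j\<in>UNIV. of_real (S $ i $ j) * X $ j) * cnj (Y $ i))
        \<le> (\<Sum>j\<in>(UNIV::'d set). K * norm X) * norm Y"
      unfolding norm_mult
    proof (intro mult_mono sum_norm_le)
      fix j
      show "norm (complex_of_real (S $ i $ j) * X $ j) \<le> K * norm X"
        unfolding norm_mult using assms(1)[of i j] K
        by (intro mult_mono) (auto simp: Finite_Cartesian_Product.norm_nth_le)
    qed (use K in \<open>auto simp: Finite_Cartesian_Product.norm_nth_le intro!: sum_nonneg\<close>)
    also have "\<dots> = real CARD('d) * (K * (norm X * norm Y))" by simp
    finally show "norm ((\<Sum>j\<in>UNIV. of_real (S $ i $ j) * X $ j) * cnj (Y $ i)) \<le> real CARD('d) * (K * (norm X * norm Y))" .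
  qed
  also have "\<dots> = (real CARD('d))\<^sup>2 * K * (norm X * norm Y)" by (simp add: power2_eq_square)
  finally show ?thesis .
qed

lemma mg_eq: "mg \<alpha> U = snd U + (\<i> * fst U) *s (\<chi> i. of_real (\<alpha> $ i))"
  by (simp add: mg_def vec_eq_iff)

lemma norm_of_real_vec: "norm (\<chi> i. complex_of_real ((\<alpha> :: real^'d) $ i)) = norm \<alpha>"
  by (simp add: norm_vec_def)

lemma norm_fst: "norm (fst U) \<le> norm U" and norm_snd: "norm (snd U) \<le> norm U"
  by (metis norm_fst_le prod.collapse, metis norm_snd_le prod.collapse)

lemma norm_mg:
  assumes "norm \<alpha> \<le> K"
  shows "norm (mg \<alpha> U) \<le> (1 + K) * norm U"
proof -
  have "norm (mg \<alpha> U) \<le> norm (snd U) + norm ((\<i> * fst U) *s (\<chi> i. complex_of_real (\<alpha> $ i)))"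
    unfolding mg_eq by (rule norm_triangle_ineq)
  also have "\<dots> = norm (snd U) + norm (fst U) * norm \<alpha>"
    unfolding norm_smult_cvec norm_of_real_vec by (simp add: norm_mult)
  also have "\<dots> \<le> norm U + norm U * K"
    using assms norm_fst[of U] norm_snd[of U] by (intro add_mono mult_mono) auto
  finally show ?thesis by (simp add: algebra_simps)
qed

text \<open>The factor \<open>(real CARD('d))\<^sup>2 * K\<close> comes from the double sum over the
  matrix entries, and each of the two magnetic gradients contributes \<open>1 + K\<close>. The type
  argument carries the dimension.\<close>

definition form_const :: "'d itself \<Rightarrow> real \<Rightarrow> real" where
  "form_const _ K = (real CARD('d))\<^sup>2 * K * (1 + K)\<^sup>2"

lemma form_const_nonneg: "0 \<le> K \<Longrightarrow> 0 \<le> form_const TYPE('d::finite) K"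
  by (simp add: form_const_def)

lemma pform_bound:
  fixes S :: "real^'d^'d"
  assumes ok: "coeff_ok K S \<alpha> p" and K: "0 < K"
  shows "norm (pform S \<alpha> p z U V) \<le> (form_const TYPE('d) K + K + norm z) * (norm U * norm V)"
proof -
  have \<alpha>: "norm \<alpha> \<le> K" and p: "\<bar>p\<bar> \<le> K" using ok by (auto simp: coeff_ok_def)
  have "norm (sform S (mg \<alpha> U) (mg \<alpha> V)) \<le> (real CARD('d))\<^sup>2 * K * (norm (mg \<alpha> U) * norm (mg \<alpha> V))"
    by (rule sform_bound[OF coeff_entry_bound[OF ok K]]) (use K in simp)
  also have "\<dots> \<le> (real CARD('d))\<^sup>2 * K * (((1 + K) * norm U) * ((1 + K) * norm V))"
    using K by (intro mult_left_mono mult_mono norm_mg[OF \<alpha>]) auto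
  also have "\<dots> = form_const TYPE('d) K * (norm U * norm V)"
    by (simp add: form_const_def power2_eq_square)
  finally have 1: "norm (sform S (mg \<alpha> U) (mg \<alpha> V)) \<le> form_const TYPE('d) K * (norm U * norm V)" .
  have "norm (complex_of_real p - z) \<le> K + norm z"
    using norm_triangle_ineq4[of "complex_of_real p" z] p by simp
  then have "norm ((of_real p - z) * fst U * cnj (fst V)) \<le> (K + norm z) * norm U * norm V"
    unfolding norm_mult using norm_fst[of U] norm_fst[of V] K by (intro mult_mono) auto
  then show ?thesis
    unfolding pform_def using 1 norm_triangle_ineq[of "sform S (mg \<alpha> U) (mg \<alpha> V)" "(of_real p - z) * fst U * cnj (fst V)"]
    by (simp add: algebra_simps)
qed

lemma sform_coercive:
  fixes S :: "real^'d^'d"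
  assumes ok: "coeff_ok K S \<alpha> p"
  shows "(1 / K) * (norm X)\<^sup>2 \<le> Re (sform S X X)"
proof -
  define a b :: "real^'d" where "a = (\<chi> i. Re (X $ i))" and "b = (\<chi> i. Im (X $ i))"
  have "Re (sform S X X) = (\<Sum>i\<in>UNIV. \<Sum>j\<in>UNIV. S $ i $ j * (Re (X $ j) * Re (X $ i)) + S $ i $ j * (Im (X $ j) * Im (X $ i)))"
    unfolding sform_def sum_distrib_right by (simp add: algebra_simps)
  also have "\<dots> = a \<bullet> (S *v a) + b \<bullet> (S *v b)"
    unfolding inner_vec_def matrix_vector_mult_def a_def b_def
    by (simp add: sum.distrib sum_distrib_left sum_distrib_right algebra_simps)
  also have "\<dots> \<ge> (1 / K) * (a \<bullet> a) + (1 / K) * (b \<bullet> b)"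
    using ok by (intro add_mono) (auto simp: coeff_ok_def)
  moreover have "(norm X)\<^sup>2 = a \<bullet> a + b \<bullet> b"
    unfolding norm_vec_sq inner_vec_def a_def b_def cmod_power2 sum.distrib
    by (simp add: power2_eq_square)
  ultimately show ?thesis by (simp add: distrib_left)
qed

text \<open>The plain gradient is recovered from the magnetic one by
  \<open>|g|^2 \<le> 2 |mg|^2 + 2 K^2 |u|^2\<close>. Weighted with \<open>1 / (2 * K)\<close>, the
  first term is covered by ellipticity and the second equals \<open>K |u|^2\<close>. For
  \<open>t \<le> - 2 * K - 1\<close> the coefficient \<open>p - t\<close> is at least
  \<open>K + 1\<close>, which pays for this loss and leaves enough of \<open>|u|^2\<close>.\<close>

lemma pform_coercive:
  fixes S :: "real^'d^'d"
  assumes ok: "coeff_ok K S \<alpha> p" and K: "1 < K" and t: "t \<le> - 2 * K - 1"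
  shows "1 / (2 * K) * (norm U)\<^sup>2 \<le> Re (pform S \<alpha> p (of_real t) U U)"
proof -
  have \<alpha>: "norm \<alpha> \<le> K" and p: "\<bar>p\<bar> \<le> K" using ok by (auto simp: coeff_ok_def)
  let ?a = "norm (fst U)" and ?g = "norm (snd U)" and ?M = "norm (mg \<alpha> U)"
  have E: "snd U = mg \<alpha> U - (\<i> * fst U) *s (\<chi> i. of_real (\<alpha> $ i))" by (simp add: mg_eq)
  have "?g \<le> ?M + norm ((\<i> * fst U) *s (\<chi> i. complex_of_real (\<alpha> $ i)))"
    by (subst E) (rule norm_triangle_ineq4)
  also have "\<dots> = ?M + ?a * norm \<alpha>"
    unfolding norm_smult_cvec norm_of_real_vec by (simp add: norm_mult)
  also have "\<dots> \<le> ?M + ?a * K" using \<alpha> by (simp add: mult_left_mono)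
  finally have "?g\<^sup>2 \<le> (?M + ?a * K)\<^sup>2" by (rule power_mono) simp
  also have "\<dots> \<le> 2 * ?M\<^sup>2 + 2 * (?a * K)\<^sup>2"
    using sum_squares_bound[of ?M "?a * K"] by (simp add: power2_sum)
  finally have g: "?g\<^sup>2 \<le> 2 * ?M\<^sup>2 + 2 * (?a * K)\<^sup>2" .
  have "1 / (2 * K) * ?g\<^sup>2 \<le> 1 / (2 * K) * (2 * ?M\<^sup>2 + 2 * (?a * K)\<^sup>2)"
    using g K by (intro mult_left_mono) auto
  also have "\<dots> = (1 / K) * ?M\<^sup>2 + K * ?a\<^sup>2" using K by (simp add: field_simps power2_eq_square)
  finally have 1: "1 / (2 * K) * ?g\<^sup>2 - K * ?a\<^sup>2 \<le> (1 / K) * ?M\<^sup>2" by simp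
  have "1 / (2 * K) * ?a\<^sup>2 \<le> 1 * ?a\<^sup>2" using K by (intro mult_right_mono) (auto simp: field_simps)
  moreover have "(K + 1) * ?a\<^sup>2 \<le> (p - t) * ?a\<^sup>2" using p t by (intro mult_right_mono) auto
  ultimately have 2: "1 / (2 * K) * ?a\<^sup>2 + K * ?a\<^sup>2 \<le> (p - t) * ?a\<^sup>2" by (simp add: algebra_simps)
  have "(of_real p - of_real t) * fst U * cnj (fst U) = complex_of_real ((p - t) * ?a\<^sup>2)"
    by (simp only: mult.assoc complex_norm_square[symmetric] of_real_mult of_real_diff)
  then have "Re (pform S \<alpha> p (of_real t) U U) = Re (sform S (mg \<alpha> U) (mg \<alpha> U)) + (p - t) * ?a\<^sup>2"
    unfolding pform_def by (simp only: plus_complex.sel Re_complex_of_real)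
  also have "\<dots> \<ge> (1 / K) * ?M\<^sup>2 + (p - t) * ?a\<^sup>2" using sform_coercive[OF ok] by simp
  finally have "1 / (2 * K) * ?g\<^sup>2 + 1 / (2 * K) * ?a\<^sup>2 \<le> Re (pform S \<alpha> p (of_real t) U U)" using 1 2 by linarith
  moreover have "(norm U)\<^sup>2 = ?a\<^sup>2 + ?g\<^sup>2" by (metis norm_Pair prod.collapse real_sqrt_pow2 sum_power2_ge_zero)
  ultimately show ?thesis by (simp add: distrib_left)
qed

text \<open>The undifferentiated factors \<open>fst U\<close> and \<open>fst V\<close> are kept
  apart from the full jets, because in the compactness argument only they become small.\<close>

lemma commutator_bound:
  fixes S :: "real^'d^'d"
  assumes ok: "coeff_ok K S \<alpha> p" and K: "0 < K" and \<eta>: "cnj \<eta> = \<eta>"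
  shows "norm (pform S \<alpha> p z (jmult \<eta> e U) V - pform S \<alpha> p z U (jmult \<eta> e V))
    \<le> form_const TYPE('d) K * ((norm e * norm (fst U)) * norm V + norm U * (norm e * norm (fst V)))"
proof -
  have \<alpha>: "norm \<alpha> \<le> K" using ok by (auto simp: coeff_ok_def)
  let ?d = "(real CARD('d))\<^sup>2 * K"
  have K1: "(1 + K) \<le> (1 + K)\<^sup>2" using K by (simp add: power2_eq_square)
  have c: "?d * (1 + K) \<le> form_const TYPE('d) K"
    unfolding form_const_def using K by (intro mult_left_mono K1) auto
  have b: "norm (sform S X Y) \<le> ?d * (norm X * norm Y)" for X Y
    by (rule sform_bound[OF coeff_entry_bound[OF ok K]]) (use K in simp)
  have "norm (sform S (fst U *s e) (mg \<alpha> V)) \<le> ?d * ((norm e * norm (fst U)) * ((1 + K) * norm V))"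
    by (rule order_trans[OF b]) (use K in \<open>intro mult_left_mono mult_mono norm_mg[OF \<alpha>]; simp add: norm_smult_cvec mult.commute\<close>)
  also have "\<dots> = (?d * (1 + K)) * ((norm e * norm (fst U)) * norm V)" by simp
  also have "\<dots> \<le> form_const TYPE('d) K * ((norm e * norm (fst U)) * norm V)"
    by (intro mult_right_mono c) simp
  finally have 1: "norm (sform S (fst U *s e) (mg \<alpha> V)) \<le> form_const TYPE('d) K * ((norm e * norm (fst U)) * norm V)" .
  have "norm (sform S (mg \<alpha> U) (fst V *s e)) \<le> ?d * (((1 + K) * norm U) * (norm e * norm (fst V)))"
    by (rule order_trans[OF b]) (use K in \<open>intro mult_left_mono mult_mono norm_mg[OF \<alpha>]; simp add: norm_smult_cvec mult.commute\<close>)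
  also have "\<dots> = (?d * (1 + K)) * (norm U * (norm e * norm (fst V)))" by simp
  also have "\<dots> \<le> form_const TYPE('d) K * (norm U * (norm e * norm (fst V)))"
    by (intro mult_right_mono c) simp
  finally have 2: "norm (sform S (mg \<alpha> U) (fst V *s e)) \<le> form_const TYPE('d) K * (norm U * (norm e * norm (fst V)))" .
  show ?thesis
    unfolding pform_commutator[OF \<eta>] distrib_left
    using norm_triangle_ineq4[of "sform S (fst U *s e) (mg \<alpha> V)" "sform S (mg \<alpha> U) (fst V *s e)"] 1 2 by linarith
qed

section \<open>Coercive forms and the resolvent\<close>

definition ip :: "(real^'d) set \<Rightarrow> (real^'d \<Rightarrow> complex) \<Rightarrow> (real^'d \<Rightarrow> complex) \<Rightarrow> complex" where
  "ip \<Omega> u v = (LINT x|lebesgue_on \<Omega>. u x * cnj (v x))"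

lemma ip_integrable:
  assumes "u \<in> L2 \<Omega>" "v \<in> L2 \<Omega>"
  shows "integrable (lebesgue_on \<Omega>) (\<lambda>x. u x * cnj (v x))"
    and "norm (ip \<Omega> u v) \<le> L2_norm \<Omega> u * L2_norm \<Omega> v"
proof -
  note [measurable] = L2_measurable[OF assms(1)] L2_measurable[OF assms(2)]
  have [measurable]: "(\<lambda>x. cnj (v x)) \<in> borel_measurable (lebesgue_on \<Omega>)"
    by (rule measurable_compose[OF L2_measurable[OF assms(2)] borel_measurable_continuous_onI]) (intro continuous_intros)
  have m: "(\<lambda>x. u x * cnj (v x)) \<in> borel_measurable (lebesgue_on \<Omega>)" by measurable
  have le: "AE x in lebesgue_on \<Omega>. norm (u x * cnj (v x)) \<le> 1 * (norm (u x) * norm (v x))"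
    by (intro AE_I2) (simp add: norm_mult)
  show "integrable (lebesgue_on \<Omega>) (\<lambda>x. u x * cnj (v x))" "norm (ip \<Omega> u v) \<le> L2_norm \<Omega> u * L2_norm \<Omega> v"
    unfolding ip_def using L2_bilinear_bound[OF assms m le] by auto
qed

lemma ip_add_left:
  "u \<in> L2 \<Omega> \<Longrightarrow> u' \<in> L2 \<Omega> \<Longrightarrow> v \<in> L2 \<Omega> \<Longrightarrow> ip \<Omega> (\<lambda>x. u x + u' x) v = ip \<Omega> u v + ip \<Omega> u' v"
  using ip_integrable(1)[of u \<Omega> v] ip_integrable(1)[of u' \<Omega> v] by (simp add: ip_def distrib_right)

lemma ip_cmult_left: "ip \<Omega> (\<lambda>x. k * u x) v = k * ip \<Omega> u v"
  by (simp add: ip_def mult.assoc)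

lemma cnj_ip: "cnj (ip \<Omega> u v) = ip \<Omega> v u"
  unfolding ip_def by (subst Bochner_Integration.integral_cnj[symmetric]) (simp add: mult.commute)

lemma ip_self: "ip \<Omega> u u = of_real ((L2_norm \<Omega> u)\<^sup>2)"
  unfolding ip_def L2_norm_sq by (simp add: complex_norm_square[symmetric] flip: of_real_power integral_complex_of_real)

lemma ip_diff_left:
  "u \<in> L2 \<Omega> \<Longrightarrow> u' \<in> L2 \<Omega> \<Longrightarrow> v \<in> L2 \<Omega> \<Longrightarrow> ip \<Omega> (\<lambda>x. u x - u' x) v = ip \<Omega> u v - ip \<Omega> u' v"
  using ip_integrable(1)[of u \<Omega> v] ip_integrable(1)[of u' \<Omega> v] by (simp add: ip_def left_diff_distrib)

lemma ip_add_right: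
  "u \<in> L2 \<Omega> \<Longrightarrow> u' \<in> L2 \<Omega> \<Longrightarrow> v \<in> L2 \<Omega> \<Longrightarrow> ip \<Omega> v (\<lambda>x. u x + u' x) = ip \<Omega> v u + ip \<Omega> v u'"
  using ip_add_left[of u \<Omega> u' v] by (metis cnj_ip complex_cnj_add)

lemma ip_diff_right:
  "u \<in> L2 \<Omega> \<Longrightarrow> u' \<in> L2 \<Omega> \<Longrightarrow> v \<in> L2 \<Omega> \<Longrightarrow> ip \<Omega> v (\<lambda>x. u x - u' x) = ip \<Omega> v u - ip \<Omega> v u'"
  using ip_diff_left[of u \<Omega> u' v] by (metis cnj_ip complex_cnj_diff)

lemma ip_cmult_right: "ip \<Omega> v (\<lambda>x. k * u x) = cnj k * ip \<Omega> v u"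
  using ip_cmult_left[of \<Omega> k u v] by (metis cnj_ip complex_cnj_mult)

section \<open>Functionals on H10\<close>

lemma Hm1D:
  assumes "F \<in> Hm1 \<Omega>"
  shows "v \<in> H10 \<Omega> \<Longrightarrow> w \<in> H10 \<Omega> \<Longrightarrow> F (\<lambda>x. v x + w x) = F v + F w"
    "v \<in> H10 \<Omega> \<Longrightarrow> F (\<lambda>x. k * v x) = cnj k * F v"
  using assms by (auto simp: Hm1_def)

context bounded_open
begin

lemma Hm1_bound:
  assumes "F \<in> Hm1 \<Omega>"
  obtains C where "0 \<le> C" "\<And>v. v \<in> H10 \<Omega> \<Longrightarrow> norm (F v) \<le> C * H1_norm \<Omega> v"
proof -
  obtain C where C: "\<forall>v\<in>H10 \<Omega>. cmod (F v) \<le> C * H1_norm \<Omega> v" using assms by (auto simp: Hm1_def)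
  \<comment> \<open>The constant in the definition of \<open>Hm1\<close> may be negative, whereas
    later estimates use it as a nonnegative factor.\<close>
  have "norm (F v) \<le> max C 0 * H1_norm \<Omega> v" if "v \<in> H10 \<Omega>" for v
    using bspec[OF C that] mult_right_mono[of C "max C 0" "H1_norm \<Omega> v"] by simp
  then show thesis using that[of "max C 0"] by simp
qed

lemma Hm1_diff:
  assumes F: "F \<in> Hm1 \<Omega>" and v: "v \<in> H10 \<Omega>" and w: "w \<in> H10 \<Omega>"
  shows "F (\<lambda>x. v x - w x) = F v - F w"
  using Hm1D(1)[OF F v H10_minus[OF w]] Hm1D(2)[OF F w, of "-1"] by simp

lemma Hm1I:
  assumes "\<And>v w. v \<in> H10 \<Omega> \<Longrightarrow> w \<in> H10 \<Omega> \<Longrightarrow> F (\<lambda>x. v x + w x) = F v + F w"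
    "\<And>k v. v \<in> H10 \<Omega> \<Longrightarrow> F (\<lambda>x. k * v x) = cnj k * F v"
    "\<And>v. v \<in> H10 \<Omega> \<Longrightarrow> norm (F v) \<le> C * H1_norm \<Omega> v"
  shows "F \<in> Hm1 \<Omega>"
  using assms unfolding Hm1_def by blast

lemma H1_L2: "u \<in> H1 \<Omega> \<Longrightarrow> u \<in> L2 \<Omega>" by (rule H1D)

lemma H10_L2: "u \<in> H10 \<Omega> \<Longrightarrow> u \<in> L2 \<Omega>" by (intro H1D H10_H1)

lemma ip_le_H1:
  assumes "u \<in> L2 \<Omega>" "v \<in> H1 \<Omega>"
  shows "norm (ip \<Omega> u v) \<le> L2_norm \<Omega> u * H1_norm \<Omega> v"
  using ip_integrable(2)[OF assms(1) H1_L2[OF assms(2)]] mult_left_mono[OF L2_norm_le_H1_norm[of v], of "L2_norm \<Omega> u"]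
  by simp

lemma ip_Hm1:
  assumes "w \<in> L2 \<Omega>"
  shows "(\<lambda>v. ip \<Omega> w v) \<in> Hm1 \<Omega>"
  by (rule Hm1I[where C = "L2_norm \<Omega> w"]) (use assms ip_le_H1[OF assms H10_H1] in \<open>auto simp: ip_add_right H10_L2 ip_cmult_right\<close>)

lemma Hm1_zero: "(\<lambda>v. 0) \<in> Hm1 \<Omega>"
  by (rule Hm1I[where C = 0]) auto

lemma Hm1_lincomb:
  assumes F: "F \<in> Hm1 \<Omega>" and G: "G \<in> Hm1 \<Omega>"
  shows "(\<lambda>v. F v + k * G v) \<in> Hm1 \<Omega>"
proof -
  obtain C where C: "\<And>v. v \<in> H10 \<Omega> \<Longrightarrow> norm (F v) \<le> C * H1_norm \<Omega> v" using Hm1_bound[OF F] by metis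
  obtain D where D: "\<And>v. v \<in> H10 \<Omega> \<Longrightarrow> norm (G v) \<le> D * H1_norm \<Omega> v" using Hm1_bound[OF G] by metis
  show ?thesis
  proof (rule Hm1I[where C = "C + norm k * D"])
    fix v assume v: "v \<in> H10 \<Omega>"
    have "norm (F v + k * G v) \<le> norm (F v) + norm k * norm (G v)"
      by (rule order_trans[OF norm_triangle_ineq]) (simp add: norm_mult)
    also have "\<dots> \<le> C * H1_norm \<Omega> v + norm k * (D * H1_norm \<Omega> v)"
      by (intro add_mono mult_left_mono C D v) simp
    finally show "norm (F v + k * G v) \<le> (C + norm k * D) * H1_norm \<Omega> v" by (simp add: algebra_simps)
  qed (use Hm1D[OF F] Hm1D[OF G] in \<open>auto simp: algebra_simps\<close>)
qed

end

text \<open>The space \<open>X\<close> is a parameter: the forms of the operators live on all of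
  \<open>H1\<close>, while \<open>solvable\<close> constructs an auxiliary form on
  \<open>H10\<close> only. Hermitian symmetry confines the notion to a real spectral point; other
  points enter through \<open>shift\<close>.\<close>

locale good_form = bounded_open \<Omega> for \<Omega> :: "(real^'d) set" +
  fixes X :: "(real^'d \<Rightarrow> complex) set" and c C :: real
    and a :: "(real^'d \<Rightarrow> complex) \<Rightarrow> (real^'d \<Rightarrow> complex) \<Rightarrow> complex"
  assumes X_H1: "X \<subseteq> H1 \<Omega>" and H10_X: "H10 \<Omega> \<subseteq> X"
    and X_add: "\<And>u v. u \<in> X \<Longrightarrow> v \<in> X \<Longrightarrow> (\<lambda>x. u x + v x) \<in> X"
    and X_cmult: "\<And>k u. u \<in> X \<Longrightarrow> (\<lambda>x. k * u x) \<in> X"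
    and add_left: "\<And>u v w. u \<in> X \<Longrightarrow> v \<in> X \<Longrightarrow> w \<in> X \<Longrightarrow> a (\<lambda>x. u x + v x) w = a u w + a v w"
    and cmult_left: "\<And>k u w. u \<in> X \<Longrightarrow> w \<in> X \<Longrightarrow> a (\<lambda>x. k * u x) w = k * a u w"
    and herm: "\<And>u v. u \<in> X \<Longrightarrow> v \<in> X \<Longrightarrow> a v u = cnj (a u v)"
    and bound: "\<And>u v. u \<in> X \<Longrightarrow> v \<in> X \<Longrightarrow> norm (a u v) \<le> C * (H1_norm \<Omega> u * H1_norm \<Omega> v)"
    and coercive: "\<And>u. u \<in> X \<Longrightarrow> c * (H1_norm \<Omega> u)\<^sup>2 \<le> Re (a u u)"
    and c_pos: "0 < c" and C_nonneg: "0 \<le> C"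
begin

lemma restrict_H10: "good_form \<Omega> (H10 \<Omega>) c C a"
proof
  have X: "u \<in> X" if "u \<in> H10 \<Omega>" for u using that H10_X by blast
  show "H10 \<Omega> \<subseteq> H1 \<Omega>" using H10_H1 by blast
  show "a (\<lambda>x. u x + v x) w = a u w + a v w" if "u \<in> H10 \<Omega>" "v \<in> H10 \<Omega>" "w \<in> H10 \<Omega>" for u v w
    using that by (intro add_left X)
  show "a (\<lambda>x. k * u x) w = k * a u w" if "u \<in> H10 \<Omega>" "w \<in> H10 \<Omega>" for k u w
    using that by (intro cmult_left X)
  show "a v u = cnj (a u v)" if "u \<in> H10 \<Omega>" "v \<in> H10 \<Omega>" for u v
    using that by (intro herm X)
  show "norm (a u v) \<le> C * (H1_norm \<Omega> u * H1_norm \<Omega> v)" if "u \<in> H10 \<Omega>" "v \<in> H10 \<Omega>" for u v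
    using that by (intro bound X)
  show "c * (H1_norm \<Omega> u)\<^sup>2 \<le> Re (a u u)" if "u \<in> H10 \<Omega>" for u
    using that by (intro coercive X)
qed (auto intro: H10_add H10_cmult c_pos C_nonneg)

lemma add_right: "u \<in> X \<Longrightarrow> v \<in> X \<Longrightarrow> w \<in> X \<Longrightarrow> a w (\<lambda>x. u x + v x) = a w u + a w v"
  using herm[of "\<lambda>x. u x + v x" w] herm[of u w] herm[of v w] by (simp add: X_add add_left)

lemma cmult_right: "u \<in> X \<Longrightarrow> w \<in> X \<Longrightarrow> a w (\<lambda>x. k * u x) = cnj k * a w u"
  using herm[of "\<lambda>x. k * u x" w] herm[of u w] by (simp add: X_cmult cmult_left)

lemma X_minus: "u \<in> X \<Longrightarrow> (\<lambda>x. - u x) \<in> X"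
  using X_cmult[of u "-1"] by simp

lemma X_diff: "u \<in> X \<Longrightarrow> v \<in> X \<Longrightarrow> (\<lambda>x. u x - v x) \<in> X"
  using X_add[OF _ X_minus, of u v] by simp

lemma diff_left: "u \<in> X \<Longrightarrow> v \<in> X \<Longrightarrow> w \<in> X \<Longrightarrow> a (\<lambda>x. u x - v x) w = a u w - a v w"
  using add_left[of u "\<lambda>x. - v x" w] cmult_left[of v w "-1"] by (simp add: X_minus)

lemma diff_right: "u \<in> X \<Longrightarrow> v \<in> X \<Longrightarrow> w \<in> X \<Longrightarrow> a w (\<lambda>x. u x - v x) = a w u - a w v"
  using add_right[of u "\<lambda>x. - v x" w] cmult_right[of v w "-1"] by (simp add: X_minus)

lemma a_Hm1:
  assumes "u \<in> X"
  shows "(\<lambda>v. a u v) \<in> Hm1 \<Omega>"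
  by (rule Hm1I[where C = "C * H1_norm \<Omega> u"])
    (use assms bound[OF assms] H10_X in \<open>auto simp: subset_iff add_right cmult_right mult.assoc\<close>)

lemma Im_a_self: "u \<in> X \<Longrightarrow> Im (a u u) = 0"
  using arg_cong[OF herm[of u u], of Im] by simp

text \<open>The functional is tested with \<open>e\<close> itself. The hypothesis says that its dual
  norm is at most \<open>\<delta>\<close>, without introducing that norm.\<close>

lemma coercive_bound:
  assumes e: "e \<in> H10 \<Omega>" and le: "\<And>v. v \<in> H10 \<Omega> \<Longrightarrow> norm (a e v) \<le> \<delta> * H1_norm \<Omega> v" and \<delta>: "0 \<le> \<delta>"
  shows "c * H1_norm \<Omega> e \<le> \<delta>"
proof (cases "H1_norm \<Omega> e = 0")
  case False
  then have p: "0 < H1_norm \<Omega> e" using H1_norm_nonneg[of e] by linarith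
  have "(c * H1_norm \<Omega> e) * H1_norm \<Omega> e \<le> Re (a e e)"
    using coercive[of e] e H10_X by (auto simp: power2_eq_square mult.assoc)
  also have "\<dots> \<le> \<delta> * H1_norm \<Omega> e" using le[OF e] complex_Re_le_cmod[of "a e e"] by linarith
  finally show ?thesis using p by (simp add: mult_le_cancel_right)
qed (use \<delta> in simp)

text \<open>Along a line the functional to be minimised is a quadratic polynomial in
  \<open>t\<close>. Its values at 1/2 and 1 give the Cauchy property of minimising sequences, its
  linear coefficient gives the Euler equation.\<close>

lemma minimizer_identity:
  assumes v: "v \<in> H10 \<Omega>" and w: "w \<in> H10 \<Omega>" and F: "F \<in> Hm1 \<Omega>"
  shows "Re (a (\<lambda>x. v x + of_real t * w x) (\<lambda>x. v x + of_real t * w x)) - 2 * Re (F (\<lambda>x. v x + of_real t * w x))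
    = (Re (a v v) - 2 * Re (F v)) + 2 * t * Re (a v w - F w) + t\<^sup>2 * Re (a w w)"
proof -
  have vX: "v \<in> X" and wX: "w \<in> X" using v w H10_X by auto
  note tw = X_cmult[OF wX, of "of_real t"]
  have "a (\<lambda>x. v x + of_real t * w x) (\<lambda>x. v x + of_real t * w x)
    = a v v + of_real t * a v w + (of_real t * cnj (a v w) + of_real t * (of_real t * a w w))"
    using herm[OF vX wX]
    by (simp add: add_left[OF vX tw X_add[OF vX tw]] add_right[OF vX tw] vX wX tw cmult_left cmult_right algebra_simps)
  moreover have "F (\<lambda>x. v x + of_real t * w x) = F v + of_real t * F w"
    using Hm1D[OF F] v w H10_cmult by simp
  ultimately show ?thesis by (simp add: algebra_simps power2_eq_square)
qed

text \<open>The representation theorem, by minimising \<open>Re (a v v) - 2 Re (F v)\<close>.\<close>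

lemma representation:
  assumes F: "F \<in> Hm1 \<Omega>"
  obtains u where "u \<in> H10 \<Omega>" "\<And>v. v \<in> H10 \<Omega> \<Longrightarrow> a u v = F v"
proof -
  define J where "J v = Re (a v v) - 2 * Re (F v)" for v
  obtain D where D: "0 \<le> D" "\<And>v. v \<in> H10 \<Omega> \<Longrightarrow> norm (F v) \<le> D * H1_norm \<Omega> v" using Hm1_bound[OF F] by metis
  have X: "v \<in> X" if "v \<in> H10 \<Omega>" for v using that H10_X by auto
  have lower: "- (D\<^sup>2 / c) \<le> J v" if v: "v \<in> H10 \<Omega>" for v
  proof -
    let ?n = "H1_norm \<Omega> v"
    have "Re (F v) \<le> D * ?n" using D(2)[OF v] complex_Re_le_cmod[of "F v"] by linarith
    then have "c * ?n\<^sup>2 - 2 * (D * ?n) \<le> J v" using coercive[OF X[OF v]] unfolding J_def by linarith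
    moreover have "0 \<le> (c * ?n - D)\<^sup>2 / c" using c_pos by simp
    then have "- (D\<^sup>2 / c) \<le> c * ?n\<^sup>2 - 2 * (D * ?n)"
      using c_pos by (simp add: power2_eq_square field_simps)
    ultimately show ?thesis by linarith
  qed
  define I where "I = Inf (J ` H10 \<Omega>)"
  have bdd: "bdd_below (J ` H10 \<Omega>)" using lower by (auto intro!: bdd_belowI)
  have I_le: "I \<le> J v" if "v \<in> H10 \<Omega>" for v unfolding I_def using bdd that by (intro cInf_lower) auto
  have ne: "J ` H10 \<Omega> \<noteq> {}" using H10_zero by blast
  have "\<exists>v\<in>H10 \<Omega>. J v < I + 1 / real (Suc n)" for n
  proof -
    have "I < I + 1 / real (Suc n)" by simp
    then have "\<exists>y\<in>J ` H10 \<Omega>. y < I + 1 / real (Suc n)"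
      unfolding I_def by (rule cInf_less_iff[OF ne bdd, THEN iffD1])
    then show ?thesis by blast
  qed
  then obtain v where v: "\<And>n. v n \<in> H10 \<Omega>" "\<And>n. J (v n) < I + 1 / real (Suc n)" by metis
  \<comment> \<open>Parallelogram law: \<open>Re (a d d)\<close> is twice
    \<open>J (v n) + J (v m) - 2 * J mid\<close>, and the value at the midpoint is at least the
    infimum \<open>I\<close>.\<close>
  have est: "c * (H1_norm \<Omega> (\<lambda>x. v m x - v n x))\<^sup>2 \<le> 2 * (1 / real (Suc m) + 1 / real (Suc n))" for m n
  proof -
    define d where "d x = v n x - v m x" for x
    have d: "d \<in> H10 \<Omega>" unfolding d_def[abs_def] by (intro H10_diff v)
    define mid where "mid x = v m x + complex_of_real (1/2) * d x" for x
    have midH: "mid \<in> H10 \<Omega>" unfolding mid_def[abs_def] by (intro H10_add H10_cmult v d)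
    have vn: "v n = (\<lambda>x. v m x + complex_of_real 1 * d x)" by (simp add: d_def)
    have 1: "J (v n) = J (v m) + 2 * Re (a (v m) d - F d) + Re (a d d)"
      unfolding J_def using minimizer_identity[OF v(1)[of m] d F, of 1] unfolding vn[symmetric] by simp
    have 2: "J mid = J (v m) + Re (a (v m) d - F d) + (1/4) * Re (a d d)"
      unfolding J_def mid_def[abs_def] using minimizer_identity[OF v(1)[of m] d F, of "1/2"] by (simp add: power2_eq_square)
    have "c * (H1_norm \<Omega> d)\<^sup>2 \<le> Re (a d d)" by (rule coercive[OF X[OF d]])
    also have "\<dots> = 2 * (J (v n) + J (v m) - 2 * J mid)" using 1 2 by simp
    also have "\<dots> \<le> 2 * (1 / real (Suc m) + 1 / real (Suc n))"
    proof -
      have "y + x - 2 * k \<le> p + q" if "x < I + p" "y < I + q" "I \<le> k" for x y k p q :: real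
        using that by linarith
      from this[OF v(2)[of m] v(2)[of n] I_le[OF midH]] show ?thesis by (intro mult_left_mono) simp_all
    qed
    finally show ?thesis
      using H1_norm_minus_commute[OF H10_H1[OF v(1)[of n]] H10_H1[OF v(1)[of m]]] unfolding d_def by simp
  qed
  have "\<exists>N. \<forall>m\<ge>N. \<forall>n\<ge>N. H1_norm \<Omega> (\<lambda>x. v m x - v n x) < e" if e: "0 < e" for e
  proof -
    have "0 < c * e\<^sup>2 / 4" using e c_pos by simp
    then obtain N where N: "1 / real (Suc N) < c * e\<^sup>2 / 4" using nat_approx_posE by blast
    show ?thesis
    proof (intro exI[of _ N] allI impI)
      fix m n assume mn: "N \<le> m" "N \<le> n"
      have "1 / real (Suc m) \<le> 1 / real (Suc N)" "1 / real (Suc n) \<le> 1 / real (Suc N)"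
        using mn by (auto intro!: divide_left_mono simp del: of_nat_Suc)
      then have "1 / real (Suc m) + 1 / real (Suc n) \<le> 1 / real (Suc N) + 1 / real (Suc N)" by (rule add_mono)
      then have "c * (H1_norm \<Omega> (\<lambda>x. v m x - v n x))\<^sup>2 \<le> 2 * (1 / real (Suc N) + 1 / real (Suc N))"
        by (intro order_trans[OF est[of m n]] mult_left_mono) auto
      moreover have "2 * (r + r) < t" if "r < t / 4" for r t :: real using that by (simp add: field_simps)
      ultimately have "c * (H1_norm \<Omega> (\<lambda>x. v m x - v n x))\<^sup>2 < c * e\<^sup>2" using N by (meson order_le_less_trans)
      then show "H1_norm \<Omega> (\<lambda>x. v m x - v n x) < e" using c_pos e by (simp add: power2_less_imp_less)
    qed
  qed
  then obtain u where u: "u \<in> H10 \<Omega>" "(\<lambda>n. H1_norm \<Omega> (\<lambda>x. v n x - u x)) \<longlonglongrightarrow> 0"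
    using H10_complete[of v] v(1) by blast
  have re0: "Re (a u w - F w) = 0" if w: "w \<in> H10 \<Omega>" for w
  proof -
    define B where "B = Re (a w w)"
    define Y where "Y = Re (a u w - F w)"
    have B: "0 \<le> B" using coercive[OF X[OF w]] c_pos unfolding B_def
      by (meson mult_nonneg_nonneg less_imp_le zero_le_power2 order_trans)
    have lim: "(\<lambda>n. a (v n) w) \<longlonglongrightarrow> a u w"
    proof (rule LIM_zero_cancel, rule Lim_null_comparison)
      show "(\<lambda>n. C * (H1_norm \<Omega> (\<lambda>x. v n x - u x) * H1_norm \<Omega> w)) \<longlonglongrightarrow> 0"
        using tendsto_mult_right_zero[OF tendsto_mult_left_zero[OF u(2)]] .
      show "\<forall>\<^sub>F n in sequentially. norm (a (v n) w - a u w) \<le> C * (H1_norm \<Omega> (\<lambda>x. v n x - u x) * H1_norm \<Omega> w)"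
        using bound[OF X_diff[OF X[OF v(1)] X[OF u(1)]] X[OF w]] diff_left[OF X[OF v(1)] X[OF u(1)] X[OF w]]
        by (intro always_eventually) simp
    qed
    have "0 \<le> 2 * t * Y + t\<^sup>2 * B" for t
    proof (rule LIMSEQ_le_const)
      have "(\<lambda>n. 1 / real (Suc n) + 2 * t * Re (a (v n) w - F w) + t\<^sup>2 * B) \<longlonglongrightarrow> 0 + 2 * t * Re (a u w - F w) + t\<^sup>2 * B"
        by (intro tendsto_intros lim LIMSEQ_Suc[OF lim_1_over_n])
      then show "(\<lambda>n. 1 / real (Suc n) + 2 * t * Re (a (v n) w - F w) + t\<^sup>2 * B) \<longlonglongrightarrow> 2 * t * Y + t\<^sup>2 * B"
        by (simp add: Y_def)
      show "\<exists>N. \<forall>n\<ge>N. 0 \<le> 1 / real (Suc n) + 2 * t * Re (a (v n) w - F w) + t\<^sup>2 * B"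
      proof (intro exI[of _ 0] allI impI)
        fix n
        have "I \<le> J (\<lambda>x. v n x + of_real t * w x)" by (intro I_le H10_add H10_cmult v w)
        also have "\<dots> = J (v n) + 2 * t * Re (a (v n) w - F w) + t\<^sup>2 * B"
          unfolding J_def B_def by (rule minimizer_identity[OF v(1) w F])
        finally show "0 \<le> 1 / real (Suc n) + 2 * t * Re (a (v n) w - F w) + t\<^sup>2 * B" using v(2)[of n] by linarith
      qed
    qed
    note q = this
    \<comment> \<open>At \<open>t = - (Y * s)\<close> the polynomial is at most
      \<open>- s * Y\<^sup>2\<close>, which forces \<open>Y = 0\<close>; the summand 1 allows
      \<open>B = 0\<close>.\<close>
    define s where "s = 1 / (B + 1)"
    have s: "0 < s" "s * B \<le> 1" using B by (auto simp: s_def)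
    have "0 \<le> 2 * (- (Y * s)) * Y + (- (Y * s))\<^sup>2 * B" by (rule q)
    also have "\<dots> = s * Y\<^sup>2 * (s * B - 2)" by (simp add: power2_eq_square algebra_simps)
    also have "\<dots> \<le> s * Y\<^sup>2 * (- 1)" using s by (intro mult_left_mono) auto
    finally have "s * Y\<^sup>2 \<le> 0" by simp
    then have "Y\<^sup>2 \<le> 0" using s(1) by (simp add: mult_le_0_iff)
    then show ?thesis unfolding Y_def by simp
  qed
  have "a u w = F w" if w: "w \<in> H10 \<Omega>" for w
  proof (rule complex_eqI)
    show "Re (a u w) = Re (F w)" using re0[OF w] by simp
    \<comment> \<open>Both sides are antilinear in \<open>w\<close>, so their imaginary parts are
      the real parts of the values at \<open>\<i> * w\<close>.\<close>
    show "Im (a u w) = Im (F w)"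
      using re0[OF H10_cmult[OF w, of \<i>]] cmult_right[OF X[OF w] X[OF u(1)], of \<i>] Hm1D(2)[OF F w, of \<i>] by simp
  qed
  then show thesis using that u(1) by blast
qed

lemma solution_unique:
  assumes "u \<in> H10 \<Omega>" "u' \<in> H10 \<Omega>" "\<And>v. v \<in> H10 \<Omega> \<Longrightarrow> a u v = a u' v"
  shows "H1_norm \<Omega> (\<lambda>x. u x - u' x) = 0"
proof -
  have "c * H1_norm \<Omega> (\<lambda>x. u x - u' x) \<le> 0"
    by (rule coercive_bound) (use assms H10_diff diff_left H10_X in \<open>auto simp: subset_iff\<close>)
  moreover have "0 \<le> c * H1_norm \<Omega> (\<lambda>x. u x - u' x)" using c_pos by simp
  ultimately have "c * H1_norm \<Omega> (\<lambda>x. u x - u' x) = 0" by linarith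
  then show ?thesis using c_pos by simp
qed

end

lemma (in bounded_open) Hm1_eq_of_norm_diff_0:
  assumes "F \<in> Hm1 \<Omega>" "u \<in> H10 \<Omega>" "u' \<in> H10 \<Omega>" "H1_norm \<Omega> (\<lambda>x. u x - u' x) = 0"
  shows "F u = F u'"
proof -
  obtain D where "\<And>v. v \<in> H10 \<Omega> \<Longrightarrow> norm (F v) \<le> D * H1_norm \<Omega> v" using Hm1_bound[OF assms(1)] by metis
  from this[OF H10_diff[OF assms(2,3)]] show ?thesis using assms by (simp add: Hm1_diff)
qed

text \<open>If \<open>a\<close> is the form of \<open>\<L> - t0\<close>, this is the form of
  \<open>\<L> - z\<close>. Splitting off the inner product isolates the only non-Hermitian part,
  which is compact on \<open>H10\<close>.\<close>

definition shift :: "(real^'d) set \<Rightarrow> real \<Rightarrow> ((real^'d \<Rightarrow> complex) \<Rightarrow> (real^'d \<Rightarrow> complex) \<Rightarrow> complex) \<Rightarrow> complex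
    \<Rightarrow> (real^'d \<Rightarrow> complex) \<Rightarrow> (real^'d \<Rightarrow> complex) \<Rightarrow> complex" where
  "shift \<Omega> t0 a z u v = a u v + (of_real t0 - z) * ip \<Omega> u v"

context good_form
begin

lemma X_L2: "u \<in> X \<Longrightarrow> u \<in> L2 \<Omega>" using X_H1 H1_L2 by auto

lemma shift_add_left: "u \<in> X \<Longrightarrow> v \<in> X \<Longrightarrow> w \<in> X \<Longrightarrow>
  shift \<Omega> t0 a z (\<lambda>x. u x + v x) w = shift \<Omega> t0 a z u w + shift \<Omega> t0 a z v w"
  by (simp add: shift_def add_left ip_add_left X_L2 algebra_simps)

lemma shift_cmult_left: "u \<in> X \<Longrightarrow> w \<in> X \<Longrightarrow> shift \<Omega> t0 a z (\<lambda>x. k * u x) w = k * shift \<Omega> t0 a z u w"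
  by (simp add: shift_def cmult_left ip_cmult_left algebra_simps)

lemma shift_diff_left: "u \<in> X \<Longrightarrow> v \<in> X \<Longrightarrow> w \<in> X \<Longrightarrow>
  shift \<Omega> t0 a z (\<lambda>x. u x - v x) w = shift \<Omega> t0 a z u w - shift \<Omega> t0 a z v w"
  by (simp add: shift_def diff_left ip_diff_left X_L2 algebra_simps)

lemma shift_herm: "u \<in> X \<Longrightarrow> v \<in> X \<Longrightarrow> shift \<Omega> t0 a z v u = cnj (shift \<Omega> t0 a (cnj z) u v)"
  by (simp add: shift_def herm[of u v] cnj_ip)

lemma shift_diff_right: "u \<in> X \<Longrightarrow> v \<in> X \<Longrightarrow> w \<in> X \<Longrightarrow>
  shift \<Omega> t0 a z w (\<lambda>x. u x - v x) = shift \<Omega> t0 a z w u - shift \<Omega> t0 a z w v"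
  by (simp add: shift_def diff_right ip_diff_right X_L2 algebra_simps)

lemma shift_bound:
  assumes "u \<in> X" "v \<in> X"
  shows "norm (shift \<Omega> t0 a z u v) \<le> (C + norm (of_real t0 - z)) * (H1_norm \<Omega> u * H1_norm \<Omega> v)"
proof -
  have v1: "v \<in> H1 \<Omega>" using assms X_H1 by auto
  have "norm (ip \<Omega> u v) \<le> H1_norm \<Omega> u * H1_norm \<Omega> v"
    using ip_le_H1[OF X_L2[OF assms(1)] v1] mult_right_mono[OF L2_norm_le_H1_norm[of u], of "H1_norm \<Omega> v"] by simp
  then have "norm (of_real t0 - z) * norm (ip \<Omega> u v) \<le> norm (of_real t0 - z) * (H1_norm \<Omega> u * H1_norm \<Omega> v)"
    by (intro mult_left_mono) auto
  then have "norm ((of_real t0 - z) * ip \<Omega> u v) \<le> norm (of_real t0 - z) * (H1_norm \<Omega> u * H1_norm \<Omega> v)"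
    by (simp only: norm_mult)
  then show ?thesis
    unfolding shift_def distrib_right
    using bound[OF assms] norm_triangle_ineq[of "a u v" "(of_real t0 - z) * ip \<Omega> u v"] by linarith
qed

lemma shift_Hm1:
  assumes "u \<in> X"
  shows "(\<lambda>v. shift \<Omega> t0 a z u v) \<in> Hm1 \<Omega>"
  unfolding shift_def by (intro Hm1_lincomb a_Hm1 ip_Hm1 X_L2 assms)

end

section \<open>Sequences of forms whose resolvents converge weakly\<close>

text \<open>The convergence hypothesis speaks of arbitrary solutions in place of a resolvent, so it
  is insensitive to the choice of representatives. The common constants \<open>c\<close> and
  \<open>C\<close> make the estimates uniform in \<open>n\<close>.\<close>

locale G_family = bounded_open \<Omega> for \<Omega> :: "(real^'d) set" +
  fixes a :: "nat \<Rightarrow> (real^'d \<Rightarrow> complex) \<Rightarrow> (real^'d \<Rightarrow> complex) \<Rightarrow> complex"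
    and b :: "(real^'d \<Rightarrow> complex) \<Rightarrow> (real^'d \<Rightarrow> complex) \<Rightarrow> complex"
    and t0 c C :: real
  assumes ga: "good_form \<Omega> (H1 \<Omega>) c C (a n)" and gb: "good_form \<Omega> (H1 \<Omega>) c C b"
    and weak_convergence: "\<And>F \<Phi> u v. F \<in> Hm1 \<Omega> \<Longrightarrow> \<Phi> \<in> Hm1 \<Omega> \<Longrightarrow> (\<And>n. u n \<in> H10 \<Omega>) \<Longrightarrow> v \<in> H10 \<Omega> \<Longrightarrow>
      (\<And>n w. w \<in> H10 \<Omega> \<Longrightarrow> a n (u n) w = F w) \<Longrightarrow> (\<And>w. w \<in> H10 \<Omega> \<Longrightarrow> b v w = F w) \<Longrightarrow>
      (\<lambda>n. \<Phi> (u n)) \<longlonglongrightarrow> \<Phi> v"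
begin

sublocale a: good_form \<Omega> "H1 \<Omega>" c C "a n" for n by (rule ga)
sublocale b: good_form \<Omega> "H1 \<Omega>" c C b by (rule gb)

text \<open>A bounded sequence of approximate solutions has an \<open>L\<^sup>2\<close>-limit \<open>w\<close> along a subsequence by Rellich.
  Moving the spectral shift to the right-hand side leaves a strongly convergent right-hand side at \<open>t0\<close>,
  so the sequence is asymptotically the sequence of resolvents at \<open>t0\<close> of one fixed functional.\<close>

lemma approximate_solutions:
  assumes n: "filterlim n at_top sequentially" and z: "zs \<longlonglongrightarrow> z"
    and u: "\<And>k. u k \<in> H10 \<Omega>" and B: "\<And>k. H1_norm \<Omega> (u k) \<le> B"
    and G: "G \<in> Hm1 \<Omega>" and eps: "\<epsilon> \<longlonglongrightarrow> 0"
    and sol: "\<And>k v. v \<in> H10 \<Omega> \<Longrightarrow> norm (shift \<Omega> t0 (a (n k)) (zs k) (u k) v - G v) \<le> \<epsilon> k * H1_norm \<Omega> v"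
  obtains r :: "nat \<Rightarrow> nat" and v where "strict_mono r" "v \<in> H10 \<Omega>"
    "\<And>w. w \<in> H10 \<Omega> \<Longrightarrow> shift \<Omega> t0 b z v w = G w"
    "(\<lambda>k. L2_norm \<Omega> (\<lambda>x. u (r k) x - v x)) \<longlonglongrightarrow> 0"
    "\<And>\<Phi>. \<Phi> \<in> Hm1 \<Omega> \<Longrightarrow> (\<lambda>k. \<Phi> (u (r k))) \<longlonglongrightarrow> \<Phi> v"
proof -
  obtain r :: "nat \<Rightarrow> nat" and w where r: "strict_mono r" and w: "w \<in> L2 \<Omega>"
    and lim: "(\<lambda>k. L2_norm \<Omega> (\<lambda>x. u (r k) x - w x)) \<longlonglongrightarrow> 0"
    by (rule Rellich[OF u B])
  \<comment> \<open>Rewritten at \<open>t0\<close>, the approximate equation has the right-hand side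
    \<open>G\<close> plus \<open>zs k - t0\<close> times \<open>u k\<close>; along the subsequence
    its strong limit in the dual space is \<open>f\<close>.\<close>
  define f where "f v = G v + (z - of_real t0) * ip \<Omega> w v" for v
  have f: "f \<in> Hm1 \<Omega>" unfolding f_def by (intro Hm1_lincomb G ip_Hm1 w)
  have "\<exists>R\<in>H10 \<Omega>. \<forall>v\<in>H10 \<Omega>. a m R v = f v" for m
    by (rule good_form.representation[OF a.restrict_H10 f]) blast
  then obtain R where R: "\<And>m. R m \<in> H10 \<Omega>" "\<And>m v. v \<in> H10 \<Omega> \<Longrightarrow> a m (R m) v = f v" by metis
  obtain v where v: "v \<in> H10 \<Omega>" "\<And>w. w \<in> H10 \<Omega> \<Longrightarrow> b v w = f w"
    by (rule good_form.representation[OF b.restrict_H10 f]) blast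
  have B0: "0 \<le> B" using B[of 0] H1_norm_nonneg[of "u 0"] by linarith
  define e where "e k x = u (r k) x - R (n (r k)) x" for k x
  have eH: "e k \<in> H10 \<Omega>" for k unfolding e_def[abs_def] by (intro H10_diff u R)
  \<comment> \<open>Three sources of error: the defect of the approximate solution, the
    \<open>L2\<close> distance to the limit, and the movement of the spectral parameter.\<close>
  define \<delta> where "\<delta> k = \<bar>\<epsilon> (r k)\<bar> + norm (z - of_real t0) * L2_norm \<Omega> (\<lambda>x. u (r k) x - w x) + norm (zs (r k) - z) * B" for k
  have \<delta>0: "0 \<le> \<delta> k" for k unfolding \<delta>_def using B0 by (intro add_nonneg_nonneg mult_nonneg_nonneg) auto
  have ebound: "norm (a (n (r k)) (e k) v) \<le> \<delta> k * H1_norm \<Omega> v" if v: "v \<in> H10 \<Omega>" for k v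
  proof -
    have v1: "v \<in> H1 \<Omega>" and u1: "u (r k) \<in> H1 \<Omega>" and vL: "v \<in> L2 \<Omega>" and uL: "u (r k) \<in> L2 \<Omega>"
      using v u H10_H1 H10_L2 by auto
    have "a (n (r k)) (e k) v = a (n (r k)) (u (r k)) v - f v"
      unfolding e_def[abs_def] using a.diff_left[OF u1 H10_H1[OF R(1)] v1] R(2)[OF v] by simp
    also have "\<dots> = (shift \<Omega> t0 (a (n (r k))) (zs (r k)) (u (r k)) v - G v)
        + ((z - of_real t0) * ip \<Omega> (\<lambda>x. u (r k) x - w x) v + (zs (r k) - z) * ip \<Omega> (u (r k)) v)"
      unfolding shift_def f_def ip_diff_left[OF uL w vL] by (simp add: algebra_simps)
    finally have "norm (a (n (r k)) (e k) v) \<le> norm (shift \<Omega> t0 (a (n (r k))) (zs (r k)) (u (r k)) v - G v)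
        + (norm (z - of_real t0) * norm (ip \<Omega> (\<lambda>x. u (r k) x - w x) v) + norm (zs (r k) - z) * norm (ip \<Omega> (u (r k)) v))"
      by (simp only: norm_mult[symmetric]) (intro order_trans[OF norm_triangle_ineq] add_left_mono norm_triangle_ineq)
    also have "\<dots> \<le> \<bar>\<epsilon> (r k)\<bar> * H1_norm \<Omega> v + (norm (z - of_real t0) * (L2_norm \<Omega> (\<lambda>x. u (r k) x - w x) * H1_norm \<Omega> v)
        + norm (zs (r k) - z) * (B * H1_norm \<Omega> v))"
    proof (intro add_mono mult_left_mono norm_ge_zero)
      show "norm (shift \<Omega> t0 (a (n (r k))) (zs (r k)) (u (r k)) v - G v) \<le> \<bar>\<epsilon> (r k)\<bar> * H1_norm \<Omega> v"
        by (rule order_trans[OF sol[OF v]]) (intro mult_right_mono, simp_all)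
      show "norm (ip \<Omega> (\<lambda>x. u (r k) x - w x) v) \<le> L2_norm \<Omega> (\<lambda>x. u (r k) x - w x) * H1_norm \<Omega> v"
        by (intro ip_le_H1 L2_diff uL w v1)
      show "norm (ip \<Omega> (u (r k)) v) \<le> B * H1_norm \<Omega> v"
        using ip_le_H1[OF uL v1] mult_right_mono[OF order_trans[OF L2_norm_le_H1_norm B[of "r k"]], of "H1_norm \<Omega> v"]
        by simp
    qed
    also have "\<dots> = \<delta> k * H1_norm \<Omega> v" by (simp add: \<delta>_def algebra_simps)
    finally show ?thesis .
  qed
  have "\<delta> \<longlonglongrightarrow> \<bar>0\<bar> + norm (z - of_real t0) * 0 + norm (z - z) * B"
    unfolding \<delta>_def
    by (intro tendsto_intros lim LIMSEQ_subseq_LIMSEQ[OF eps r, unfolded o_def] LIMSEQ_subseq_LIMSEQ[OF z r, unfolded o_def])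
  then have \<delta>lim: "\<delta> \<longlonglongrightarrow> 0" by simp
  have eb: "H1_norm \<Omega> (e k) \<le> \<delta> k / c" for k
  proof -
    have "c * H1_norm \<Omega> (e k) \<le> \<delta> k"
      by (rule good_form.coercive_bound[OF a.restrict_H10 eH ebound \<delta>0])
    then show ?thesis using b.c_pos by (simp add: pos_le_divide_eq mult.commute)
  qed
  have elim: "(\<lambda>k. H1_norm \<Omega> (e k)) \<longlonglongrightarrow> 0"
  proof (rule tendsto_sandwich[OF _ _ tendsto_const])
    show "(\<lambda>k. \<delta> k / c) \<longlonglongrightarrow> 0" using tendsto_divide[OF \<delta>lim tendsto_const[of c]] b.c_pos by simp
  qed (use eb in \<open>auto intro!: always_eventually\<close>)
  have nr: "filterlim (\<lambda>k. n (r k)) at_top sequentially"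
    by (rule filterlim_compose[OF n filterlim_subseq[OF r]])
  have weak: "(\<lambda>k. \<Phi> (u (r k))) \<longlonglongrightarrow> \<Phi> v" if \<Phi>: "\<Phi> \<in> Hm1 \<Omega>" for \<Phi>
  proof -
    obtain D where D: "0 \<le> D" "\<And>v. v \<in> H10 \<Omega> \<Longrightarrow> norm (\<Phi> v) \<le> D * H1_norm \<Omega> v" using Hm1_bound[OF \<Phi>] by metis
    have "(\<lambda>m. \<Phi> (R m)) \<longlonglongrightarrow> \<Phi> v"
      by (rule weak_convergence[OF f \<Phi> R(1) v(1)]) (simp_all add: R v)
    then have 1: "(\<lambda>k. \<Phi> (R (n (r k)))) \<longlonglongrightarrow> \<Phi> v" by (rule filterlim_compose[OF _ nr])
    have 2: "(\<lambda>k. \<Phi> (e k)) \<longlonglongrightarrow> 0"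
    proof (rule Lim_null_comparison)
      show "(\<lambda>k. D * H1_norm \<Omega> (e k)) \<longlonglongrightarrow> 0" using tendsto_mult_right_zero[OF elim] .
    qed (use D(2)[OF eH] in \<open>auto intro!: always_eventually\<close>)
    have "\<Phi> (u (r k)) = \<Phi> (R (n (r k))) + \<Phi> (e k)" for k
      unfolding e_def[abs_def] using Hm1_diff[OF \<Phi> u R(1)] by simp
    then show ?thesis using tendsto_add[OF 1 2] by simp
  qed
  have vL: "v \<in> L2 \<Omega>" by (rule H10_L2[OF v(1)])
  \<comment> \<open>The strong \<open>L2\<close> limit \<open>w\<close> and the weak limit
    \<open>v\<close> are identified by pairing with their difference \<open>\<psi>\<close>.\<close>
  have wv: "L2_norm \<Omega> (\<lambda>x. w x - v x) = 0"
  proof -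
    define \<psi> where "\<psi> x = w x - v x" for x
    have \<psi>: "\<psi> \<in> L2 \<Omega>" unfolding \<psi>_def[abs_def] by (intro L2_diff w vL)
    have 1: "(\<lambda>k. ip \<Omega> \<psi> (u (r k))) \<longlonglongrightarrow> ip \<Omega> \<psi> v" by (rule weak[OF ip_Hm1[OF \<psi>]])
    have "(\<lambda>k. ip \<Omega> \<psi> (u (r k))) \<longlonglongrightarrow> ip \<Omega> \<psi> w"
    proof (rule LIM_zero_cancel, rule Lim_null_comparison)
      show "(\<lambda>k. L2_norm \<Omega> \<psi> * L2_norm \<Omega> (\<lambda>x. u (r k) x - w x)) \<longlonglongrightarrow> 0"
        using tendsto_mult_right_zero[OF lim] .
      show "\<forall>\<^sub>F k in sequentially. norm (ip \<Omega> \<psi> (u (r k)) - ip \<Omega> \<psi> w) \<le> L2_norm \<Omega> \<psi> * L2_norm \<Omega> (\<lambda>x. u (r k) x - w x)"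
      proof (intro always_eventually allI)
        fix k
        show "norm (ip \<Omega> \<psi> (u (r k)) - ip \<Omega> \<psi> w) \<le> L2_norm \<Omega> \<psi> * L2_norm \<Omega> (\<lambda>x. u (r k) x - w x)"
          unfolding ip_diff_right[OF H10_L2[OF u] w \<psi>, symmetric] by (intro ip_integrable \<psi> L2_diff H10_L2[OF u] w)
      qed
    qed
    from LIMSEQ_unique[OF this 1] have "ip \<Omega> \<psi> w - ip \<Omega> \<psi> v = 0" by simp
    then have "ip \<Omega> \<psi> \<psi> = 0" using ip_diff_right[OF w vL \<psi>] unfolding \<psi>_def by simp
    then show ?thesis unfolding ip_self of_real_eq_0_iff \<psi>_def by simp
  qed
  show thesis
  proof (rule that[OF r v(1) _ _ weak])
    fix x assume x: "x \<in> H10 \<Omega>"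
    have "norm (ip \<Omega> (\<lambda>x. w x - v x) x) \<le> 0"
      using ip_integrable(2)[OF L2_diff(1)[OF w vL] H10_L2[OF x]] wv by simp
    then have "ip \<Omega> w x = ip \<Omega> v x" using ip_diff_left[OF w vL H10_L2[OF x]] by simp
    then show "shift \<Omega> t0 b z v x = G x" using v(2)[OF x] by (simp add: shift_def f_def algebra_simps)
  next
    show "(\<lambda>k. L2_norm \<Omega> (\<lambda>x. u (r k) x - v x)) \<longlonglongrightarrow> 0"
    proof (rule tendsto_sandwich[OF _ _ tendsto_const lim])
      show "\<forall>\<^sub>F k in sequentially. L2_norm \<Omega> (\<lambda>x. u (r k) x - v x) \<le> L2_norm \<Omega> (\<lambda>x. u (r k) x - w x)"
      proof (intro always_eventually allI)
        fix k
        show "L2_norm \<Omega> (\<lambda>x. u (r k) x - v x) \<le> L2_norm \<Omega> (\<lambda>x. u (r k) x - w x)"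
          using L2_norm_diff_triangle[OF H10_L2[OF u] w vL, of "r k"] wv by simp
      qed
    qed simp
  qed
qed

text \<open>Absence of an eigenvalue is all that is kept of the resolvent set; solvability is
  regained through \<open>uniform_bound\<close> and \<open>solvable\<close>. Vanishing is expressed
  by the \<open>L2\<close> norm since functions matter up to null sets.\<close>

definition kernel_free :: "complex \<Rightarrow> bool" where
  "kernel_free z \<longleftrightarrow> (\<forall>u\<in>H10 \<Omega>. (\<forall>v\<in>H10 \<Omega>. shift \<Omega> t0 b z u v = 0) \<longrightarrow> L2_norm \<Omega> u = 0)"

text \<open>Off the real axis a kernel is impossible: tested with \<open>u\<close>, Hermitian
  symmetry leaves \<open>Im z\<close> times the squared norm as the imaginary part. On the real axis
  \<open>cnj z = z\<close>.\<close>

lemma kernel_free_cnj: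
  assumes "kernel_free z"
  shows "kernel_free (cnj z)"
  unfolding kernel_free_def
proof (intro ballI impI)
  fix u assume u: "u \<in> H10 \<Omega>" and 0: "\<forall>v\<in>H10 \<Omega>. shift \<Omega> t0 b (cnj z) u v = 0"
  have "b u u + (of_real t0 - cnj z) * of_real ((L2_norm \<Omega> u)\<^sup>2) = 0"
    using bspec[OF 0 u] unfolding shift_def ip_self .
  from arg_cong[OF this, of Im] have "Im z * (L2_norm \<Omega> u)\<^sup>2 = 0"
    using b.Im_a_self[OF H10_H1[OF u]] by simp
  then consider "L2_norm \<Omega> u = 0" | "Im z = 0" by auto
  then show "L2_norm \<Omega> u = 0"
  proof cases
    case 2
    then have "cnj z = z" by (simp add: complex_eq_iff)
    then show ?thesis using assms u 0 unfolding kernel_free_def by simp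
  qed
qed

text \<open>Suppose not. Normalised counterexamples have defects tending to 0, so by
  \<open>approximate_solutions\<close> a subsequence converges in \<open>L2\<close> to an element of
  the kernel of the limit form, that is, to 0. Coercivity at \<open>t0\<close> then bounds
  \<open>c\<close> by quantities tending to 0.\<close>

lemma uniform_bound:
  assumes K: "compact \<K>" and kf: "\<And>z. z \<in> \<K> \<Longrightarrow> kernel_free z"
  obtains N M where "0 < M" "\<And>n z u \<delta>. N \<le> n \<Longrightarrow> z \<in> \<K> \<Longrightarrow> u \<in> H10 \<Omega> \<Longrightarrow> 0 \<le> \<delta> \<Longrightarrow>
      (\<And>v. v \<in> H10 \<Omega> \<Longrightarrow> norm (shift \<Omega> t0 (a n) z u v) \<le> \<delta> * H1_norm \<Omega> v) \<Longrightarrow> H1_norm \<Omega> u \<le> M * \<delta>"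
proof -
  \<comment> \<open>The same \<open>k\<close> bounds \<open>n\<close> from below and the failing
    constant, so a sequence of counterexamples has both indices and constants tending to
    infinity.\<close>
  define bad where "bad k n z u \<delta> \<longleftrightarrow> k \<le> n \<and> z \<in> \<K> \<and> u \<in> H10 \<Omega> \<and> 0 \<le> \<delta> \<and>
      (\<forall>v\<in>H10 \<Omega>. norm (shift \<Omega> t0 (a n) z u v) \<le> \<delta> * H1_norm \<Omega> v) \<and> real (Suc k) * \<delta> < H1_norm \<Omega> u" for k n z u \<delta>
  have "\<exists>k. \<forall>n z u \<delta>. \<not> bad k n z u \<delta>"
  proof (rule ccontr)
    assume "\<not> ?thesis"
    then have "\<forall>k. \<exists>n z u \<delta>. bad k n z u \<delta>" by blast
    then obtain n0 z0 u0 \<delta>0 where "\<forall>k. bad k (n0 k) (z0 k) (u0 k) (\<delta>0 k)" by metis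
    then have bad: "\<And>k. k \<le> n0 k" "\<And>k. z0 k \<in> \<K>" "\<And>k. u0 k \<in> H10 \<Omega>" "\<And>k. 0 \<le> \<delta>0 k"
      "\<And>k v. v \<in> H10 \<Omega> \<Longrightarrow> norm (shift \<Omega> t0 (a (n0 k)) (z0 k) (u0 k) v) \<le> \<delta>0 k * H1_norm \<Omega> v"
      "\<And>k. real (Suc k) * \<delta>0 k < H1_norm \<Omega> (u0 k)"
      unfolding bad_def by auto
    have pos: "0 < H1_norm \<Omega> (u0 k)" for k
    proof -
      have "0 \<le> real (Suc k) * \<delta>0 k" using bad(4) by simp
      then show ?thesis using bad(6)[of k] by linarith
    qed
    define w where "w k x = of_real (1 / H1_norm \<Omega> (u0 k)) * u0 k x" for k x
    have wH: "w k \<in> H10 \<Omega>" for k unfolding w_def[abs_def] by (intro H10_cmult bad)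
    have w1: "H1_norm \<Omega> (w k) = 1" for k
      unfolding w_def[abs_def] H1_norm_cmult[OF H10_H1[OF bad(3)]] using pos[of k] by (simp add: norm_divide)
    have wb: "norm (shift \<Omega> t0 (a (n0 k)) (z0 k) (w k) v) \<le> (1 / real (Suc k)) * H1_norm \<Omega> v" if v: "v \<in> H10 \<Omega>" for k v
    proof -
      have "norm (shift \<Omega> t0 (a (n0 k)) (z0 k) (w k) v) = (1 / H1_norm \<Omega> (u0 k)) * norm (shift \<Omega> t0 (a (n0 k)) (z0 k) (u0 k) v)"
        unfolding w_def[abs_def] a.shift_cmult_left[OF H10_H1[OF bad(3)] H10_H1[OF v]] norm_mult using pos[of k] by (simp add: norm_divide)
      also have "\<dots> \<le> (1 / H1_norm \<Omega> (u0 k)) * (\<delta>0 k * H1_norm \<Omega> v)"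
        using pos[of k] by (intro mult_left_mono bad(5) v) auto
      also have "\<dots> = (\<delta>0 k / H1_norm \<Omega> (u0 k)) * H1_norm \<Omega> v" by simp
      also have "\<dots> \<le> (1 / real (Suc k)) * H1_norm \<Omega> v"
      proof (intro mult_right_mono H1_norm_nonneg)
        show "\<delta>0 k / H1_norm \<Omega> (u0 k) \<le> 1 / real (Suc k)"
          using pos[of k] bad(6)[of k] by (simp only: pos_divide_le_eq) (simp add: field_simps)
      qed
      finally show ?thesis .
    qed
    obtain z s where z: "z \<in> \<K>" and s: "strict_mono s" "(z0 \<circ> s) \<longlonglongrightarrow> z"
      using K bad(2) unfolding compact_def by meson
    have n0: "filterlim n0 at_top sequentially"
      using bad(1) by (rule_tac filterlim_at_top_mono[OF filterlim_ident]) (auto intro: always_eventually)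
    have n0s: "filterlim (\<lambda>k. n0 (s k)) at_top sequentially"
      by (rule filterlim_compose[OF n0 filterlim_subseq[OF s(1)]])
    have zs: "(\<lambda>k. z0 (s k)) \<longlonglongrightarrow> z" using s(2) by (simp add: o_def)
    have es: "(\<lambda>k. 1 / real (Suc (s k))) \<longlonglongrightarrow> 0"
      using LIMSEQ_subseq_LIMSEQ[OF LIMSEQ_Suc[OF lim_1_over_n] s(1)] by (simp add: o_def)
    have w1': "H1_norm \<Omega> (w (s k)) \<le> 1" for k using w1[of "s k"] by simp
    have wb': "norm (shift \<Omega> t0 (a (n0 (s k))) (z0 (s k)) (w (s k)) v - 0) \<le> (1 / real (Suc (s k))) * H1_norm \<Omega> v"
      if "v \<in> H10 \<Omega>" for k v using wb[OF that, of "s k"] by simp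
    obtain r :: "nat \<Rightarrow> nat" and v where r: "strict_mono r" and v: "v \<in> H10 \<Omega>"
      "\<And>w. w \<in> H10 \<Omega> \<Longrightarrow> shift \<Omega> t0 b z v w = 0"
      and lim: "(\<lambda>k. L2_norm \<Omega> (\<lambda>x. w (s (r k)) x - v x)) \<longlonglongrightarrow> 0"
      by (rule approximate_solutions[OF n0s zs wH w1' Hm1_zero es wb']) blast+
    have v0: "L2_norm \<Omega> v = 0" using kf[OF z] v unfolding kernel_free_def by blast
    have wle: "L2_norm \<Omega> (w (s (r k))) \<le> L2_norm \<Omega> (\<lambda>x. w (s (r k)) x - v x)" for k
      using L2_norm_triangle_sub[OF H10_L2[OF wH] H10_L2[OF v(1)], of "s (r k)"] v0 by simp
    have wlim: "(\<lambda>k. L2_norm \<Omega> (w (s (r k)))) \<longlonglongrightarrow> 0"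
      by (rule tendsto_sandwich[OF _ _ tendsto_const lim]) (use wle in \<open>auto intro!: always_eventually\<close>)
    have cle: "c \<le> 1 / real (Suc (s (r k))) + norm (of_real t0 - z0 (s (r k))) * (L2_norm \<Omega> (w (s (r k))))\<^sup>2" for k
    proof -
      let ?k = "s (r k)"
      have "c \<le> Re (a (n0 ?k) (w ?k) (w ?k))" using a.coercive[OF H10_H1[OF wH[of ?k]], of "n0 ?k"] w1[of ?k] by simp
      also have "\<dots> \<le> norm (a (n0 ?k) (w ?k) (w ?k))" by (rule complex_Re_le_cmod)
      also have "a (n0 ?k) (w ?k) (w ?k) = shift \<Omega> t0 (a (n0 ?k)) (z0 ?k) (w ?k) (w ?k)
          - (of_real t0 - z0 ?k) * of_real ((L2_norm \<Omega> (w ?k))\<^sup>2)"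
        unfolding shift_def ip_self by simp
      also have "norm \<dots> \<le> norm (shift \<Omega> t0 (a (n0 ?k)) (z0 ?k) (w ?k) (w ?k))
          + norm ((of_real t0 - z0 ?k) * complex_of_real ((L2_norm \<Omega> (w ?k))\<^sup>2))"
        by (rule norm_triangle_ineq4)
      also have "norm ((of_real t0 - z0 ?k) * complex_of_real ((L2_norm \<Omega> (w ?k))\<^sup>2))
          = norm (of_real t0 - z0 ?k) * (L2_norm \<Omega> (w ?k))\<^sup>2" unfolding norm_mult norm_of_real by simp
      finally show ?thesis using wb[OF wH[of ?k], of ?k] w1[of ?k] by simp
    qed
    have "(\<lambda>k. 1 / real (Suc (s (r k))) + norm (of_real t0 - z0 (s (r k))) * (L2_norm \<Omega> (w (s (r k))))\<^sup>2)
      \<longlonglongrightarrow> 0 + norm (of_real t0 - z) * 0\<^sup>2"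
      by (intro tendsto_intros wlim LIMSEQ_subseq_LIMSEQ[OF zs r, unfolded o_def] LIMSEQ_subseq_LIMSEQ[OF es r, unfolded o_def])
    then have "c \<le> 0 + norm (of_real t0 - z) * 0\<^sup>2"
      by (rule LIMSEQ_le_const) (use cle in blast)
    then show False using b.c_pos by simp
  qed
  then obtain k where k: "\<And>n z u \<delta>. \<not> bad k n z u \<delta>" by blast
  show thesis
  proof (rule that[of "real (Suc k)" k])
    fix n z u \<delta> assume *: "k \<le> n" "z \<in> \<K>" "u \<in> H10 \<Omega>" "0 \<le> \<delta>"
      "\<And>v. v \<in> H10 \<Omega> \<Longrightarrow> norm (shift \<Omega> t0 (a n) z u v) \<le> \<delta> * H1_norm \<Omega> v"
    show "H1_norm \<Omega> u \<le> real (Suc k) * \<delta>"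
      using k[of n z u \<delta>] * unfolding bad_def by (meson not_le)
  qed simp
qed

text \<open>Lower bounds for the form at \<open>z\<close> and at \<open>cnj z\<close> give surjectivity: with \<open>T v\<close> representing the form at
  \<open>cnj z\<close>, the form \<open>(v, w) \<mapsto> a (T v) (T w)\<close> is coercive, and \<open>u = T v\<close> solves the equation at \<open>z\<close>.\<close>

lemma solvable:
  assumes bd: "\<And>u \<delta>. u \<in> H10 \<Omega> \<Longrightarrow> 0 \<le> \<delta> \<Longrightarrow>
      (\<And>v. v \<in> H10 \<Omega> \<Longrightarrow> norm (shift \<Omega> t0 (a n) (cnj z) u v) \<le> \<delta> * H1_norm \<Omega> v) \<Longrightarrow> H1_norm \<Omega> u \<le> M * \<delta>"
    and M: "0 < M" and F: "F \<in> Hm1 \<Omega>"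
  obtains u where "u \<in> H10 \<Omega>" "\<And>v. v \<in> H10 \<Omega> \<Longrightarrow> shift \<Omega> t0 (a n) z u v = F v"
proof -
  let ?s = "shift \<Omega> t0 (a n) (cnj z)"
  have "\<exists>Tv\<in>H10 \<Omega>. \<forall>w\<in>H10 \<Omega>. a n Tv w = ?s v w" if v: "v \<in> H10 \<Omega>" for v
    by (rule good_form.representation[OF a.restrict_H10 a.shift_Hm1[OF H10_H1[OF v]]]) blast
  then obtain T where T: "\<And>v. v \<in> H10 \<Omega> \<Longrightarrow> T v \<in> H10 \<Omega>" "\<And>v w. v \<in> H10 \<Omega> \<Longrightarrow> w \<in> H10 \<Omega> \<Longrightarrow> a n (T v) w = ?s v w"
    by metis
  define D where "D = C + norm (of_real t0 - cnj z)"
  have D: "0 \<le> D" using b.C_nonneg by (simp add: D_def)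
  have sb: "norm (?s v w) \<le> D * (H1_norm \<Omega> v * H1_norm \<Omega> w)" if "v \<in> H10 \<Omega>" "w \<in> H10 \<Omega>" for v w
    unfolding D_def using that by (intro a.shift_bound H10_H1)
  have Tb: "H1_norm \<Omega> (T v) \<le> D / c * H1_norm \<Omega> v" if v: "v \<in> H10 \<Omega>" for v
  proof -
    have "c * H1_norm \<Omega> (T v) \<le> D * H1_norm \<Omega> v"
      by (rule good_form.coercive_bound[OF a.restrict_H10[of n] T(1)[OF v]])
        (use D sb[OF v] T(2)[OF v] in \<open>auto simp: mult.assoc\<close>)
    then show ?thesis using b.c_pos by (simp add: pos_le_divide_eq mult.commute)
  qed
  \<comment> \<open>The summand 1 keeps the constant positive even when \<open>C = 0\<close>, since
    its square becomes a denominator in the coercivity constant of \<open>g\<close>.\<close>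
  have Tl: "H1_norm \<Omega> v \<le> (M * C + 1) * H1_norm \<Omega> (T v)" if v: "v \<in> H10 \<Omega>" for v
  proof -
    have "H1_norm \<Omega> v \<le> M * (C * H1_norm \<Omega> (T v))"
    proof (rule bd[OF v])
      fix w assume w: "w \<in> H10 \<Omega>"
      show "norm (?s v w) \<le> C * H1_norm \<Omega> (T v) * H1_norm \<Omega> w"
        unfolding T(2)[OF v w, symmetric] using a.bound[OF H10_H1[OF T(1)[OF v]] H10_H1[OF w]] by (simp add: mult.assoc)
    qed (use b.C_nonneg in simp)
    also have "\<dots> \<le> M * (C * H1_norm \<Omega> (T v)) + H1_norm \<Omega> (T v)" by simp
    finally show ?thesis by (simp add: distrib_right mult.assoc)
  qed
  define L where "L = M * C + 1"
  have L: "0 < L" using M b.C_nonneg by (simp add: L_def add_nonneg_pos)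
  \<comment> \<open>Applying \<open>T\<close> to the second argument restores Hermitian symmetry,
    which the shifted form at a nonreal point lacks; the representation theorem becomes
    applicable.\<close>
  define g where "g v w = ?s v (T w)" for v w
  have gT: "g v w = a n (T v) (T w)" if "v \<in> H10 \<Omega>" "w \<in> H10 \<Omega>" for v w
    using T(2)[OF that(1) T(1)[OF that(2)]] unfolding g_def by simp
  interpret g: good_form \<Omega> "H10 \<Omega>" "c / L\<^sup>2" "D * (D / c)" g
  proof
    show "H10 \<Omega> \<subseteq> H1 \<Omega>" using H10_H1 by blast
    show "g (\<lambda>x. u x + v x) w = g u w + g v w" if "u \<in> H10 \<Omega>" "v \<in> H10 \<Omega>" "w \<in> H10 \<Omega>" for u v w
      unfolding g_def using that T(1) by (intro a.shift_add_left H10_H1)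
    show "g (\<lambda>x. k * u x) w = k * g u w" if "u \<in> H10 \<Omega>" "w \<in> H10 \<Omega>" for k u w
      unfolding g_def using that T(1) by (intro a.shift_cmult_left H10_H1)
    show "g v u = cnj (g u v)" if "u \<in> H10 \<Omega>" "v \<in> H10 \<Omega>" for u v
      unfolding gT[OF that] gT[OF that(2,1)] using that T(1) by (intro a.herm H10_H1)
    show "norm (g u v) \<le> D * (D / c) * (H1_norm \<Omega> u * H1_norm \<Omega> v)" if "u \<in> H10 \<Omega>" "v \<in> H10 \<Omega>" for u v
    proof -
      have "norm (g u v) \<le> D * (H1_norm \<Omega> u * H1_norm \<Omega> (T v))" unfolding g_def by (rule sb[OF that(1) T(1)[OF that(2)]])
      also have "\<dots> \<le> D * (H1_norm \<Omega> u * (D / c * H1_norm \<Omega> v))"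
        by (intro mult_left_mono Tb that D) auto
      finally show ?thesis by (simp add: mult_ac)
    qed
    show "c / L\<^sup>2 * (H1_norm \<Omega> u)\<^sup>2 \<le> Re (g u u)" if "u \<in> H10 \<Omega>" for u
    proof -
      have "(H1_norm \<Omega> u)\<^sup>2 \<le> (L * H1_norm \<Omega> (T u))\<^sup>2" using Tl[OF that] unfolding L_def by (intro power_mono) auto
      then have "c / L\<^sup>2 * (H1_norm \<Omega> u)\<^sup>2 \<le> c / L\<^sup>2 * (L\<^sup>2 * (H1_norm \<Omega> (T u))\<^sup>2)"
        using b.c_pos by (intro mult_left_mono) (auto simp: power_mult_distrib)
      also have "\<dots> = c * (H1_norm \<Omega> (T u))\<^sup>2" using L by simp
      also have "\<dots> \<le> Re (g u u)" unfolding gT[OF that that] by (rule a.coercive[OF H10_H1[OF T(1)[OF that]]])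
      finally show ?thesis .
    qed
  qed (use b.c_pos L D in \<open>auto intro: H10_add H10_cmult\<close>)
  obtain v where v: "v \<in> H10 \<Omega>" "\<And>w. w \<in> H10 \<Omega> \<Longrightarrow> g v w = F w" by (rule g.representation[OF F]) blast
  show thesis
  proof (rule that[OF T(1)[OF v(1)]])
    fix w assume w: "w \<in> H10 \<Omega>"
    have "shift \<Omega> t0 (a n) z (T v) w = cnj (?s w (T v))"
      by (rule a.shift_herm) (intro H10_H1 w T(1) v(1))+
    also have "?s w (T v) = a n (T w) (T v)" using T(2)[OF w T(1)[OF v(1)]] by simp
    also have "cnj (a n (T w) (T v)) = a n (T v) (T w)"
      by (rule a.herm[symmetric]) (intro H10_H1 w T(1) v(1))+
    also have "\<dots> = F w" using gT[OF v(1) w] v(2)[OF w] by simp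
    finally show "shift \<Omega> t0 (a n) z (T v) w = F w" .
  qed
qed

text \<open>With this instance the lower bound and the solvability for the limit form are special
  cases of those for the sequence.\<close>

lemma constant_family: "G_family \<Omega> (\<lambda>_. b) b c C"
proof
  fix F \<Phi> and u :: "nat \<Rightarrow> real^'d \<Rightarrow> complex" and v
  assume *: "F \<in> Hm1 \<Omega>" "\<Phi> \<in> Hm1 \<Omega>" "\<And>n. u n \<in> H10 \<Omega>" "v \<in> H10 \<Omega>"
    "\<And>n w. w \<in> H10 \<Omega> \<Longrightarrow> b (u n) w = F w" "\<And>w. w \<in> H10 \<Omega> \<Longrightarrow> b v w = F w"
  have "\<Phi> (u n) = \<Phi> v" for n
    by (rule Hm1_eq_of_norm_diff_0[OF *(2-4) good_form.solution_unique[OF b.restrict_H10 *(3,4)]]) (simp add: *)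
  then show "(\<lambda>n. \<Phi> (u n)) \<longlonglongrightarrow> \<Phi> v" by simp
qed

end

section \<open>Forms with bounded coefficients\<close>

lemma pform_measurable:
  assumes [measurable]: "U \<in> borel_measurable M" "V \<in> borel_measurable M" "q \<in> borel_measurable M"
    and \<sigma>: "\<sigma> \<in> borel_measurable M" and A: "A \<in> borel_measurable M"
  shows "(\<lambda>x. pform (\<sigma> x :: real^'d^'d) (A x) (q x) z (U x) (V x)) \<in> borel_measurable M"
proof -
  have [measurable]: "(\<lambda>x. \<sigma> x $ i $ j) \<in> borel_measurable M" for i j
    by (rule measurable_compose[OF \<sigma> borel_measurable_continuous_onI]) (intro continuous_intros)
  have [measurable]: "(\<lambda>x. A x $ i) \<in> borel_measurable M" for i
    by (rule measurable_compose[OF A borel_measurable_continuous_onI]) (intro continuous_intros)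
  have cp: "(\<lambda>x. fst (W x)) \<in> borel_measurable M" "(\<lambda>x. snd (W x) $ i) \<in> borel_measurable M"
    "(\<lambda>x. cnj (fst (W x))) \<in> borel_measurable M" "(\<lambda>x. cnj (snd (W x) $ i)) \<in> borel_measurable M"
    if W: "W \<in> borel_measurable M" for W :: "'a \<Rightarrow> complex \<times> (complex^'d)" and i
    by (rule measurable_compose[OF W borel_measurable_continuous_onI], intro continuous_intros)+
  note [measurable] = cp[OF assms(1)] cp[OF assms(2)]
  show ?thesis
    unfolding pform_def sform_def mg_def by simp
qed

context bounded_open
begin

definition grad :: "(real^'d \<Rightarrow> complex) \<Rightarrow> real^'d \<Rightarrow> complex^'d" where
  "grad \<eta> x = (\<chi> i. pdiff i \<eta> x)"

lemma jet_add:
  "u \<in> H1 \<Omega> \<Longrightarrow> v \<in> H1 \<Omega> \<Longrightarrow> AE x in lebesgue_on \<Omega>. jet \<Omega> (\<lambda>x. u x + v x) x = jet \<Omega> u x + jet \<Omega> v x"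
  using H1_add(2)[of u v] by (auto simp: jet_def elim: eventually_mono)

lemma jet_cmult:
  "u \<in> H1 \<Omega> \<Longrightarrow> AE x in lebesgue_on \<Omega>. jet \<Omega> (\<lambda>x. k * u x) x = jmult k 0 (jet \<Omega> u x)"
  using H1_cmult(2)[of u k] by (auto simp: jet_def jmult_def elim: eventually_mono)

lemma jet_mult_test_fun:
  assumes "u \<in> H1 \<Omega>" "\<eta> \<in> test_fun UNIV"
  shows "AE x in lebesgue_on \<Omega>. jet \<Omega> (\<lambda>x. \<eta> x * u x) x = jmult (\<eta> x) (grad \<eta> x) (jet \<Omega> u x)"
  using H1_mult_test_fun(2)[OF assms]
  by eventually_elim (simp add: jet_def jmult_def grad_def vec_eq_iff mult.commute)

lemma grad_bounded:
  assumes "\<eta> \<in> test_fun \<Omega>'"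
  obtains E where "0 < E" "\<And>x. norm (grad \<eta> x) \<le> E"
proof -
  have "\<exists>C>0. \<forall>x. norm (pdiff i \<eta> x) \<le> C" for i
    by (rule test_fun_bounded[OF test_fun_pdiff[OF assms, of i]]) blast
  then obtain C where C: "\<And>i. 0 < C i" "\<And>i x. norm (pdiff i \<eta> x) \<le> C i" by metis
  have "norm (grad \<eta> x) \<le> (\<Sum>i\<in>UNIV. C i)" for x
  proof -
    have "norm (grad \<eta> x) \<le> (\<Sum>i\<in>UNIV. norm (grad \<eta> x $ i))"
      unfolding norm_vec_def by (rule L2_set_le_sum) simp
    also have "\<dots> \<le> (\<Sum>i\<in>UNIV. C i)" unfolding grad_def by (intro sum_mono) (simp add: C)
    finally show ?thesis .
  qed
  moreover have "0 < (\<Sum>i\<in>UNIV. C i)" using C(1) by (intro sum_pos) auto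
  ultimately show thesis using that by blast
qed

lemma H1_norm_mult_test_fun:
  assumes \<eta>: "\<eta> \<in> test_fun UNIV"
  obtains D where "0 \<le> D" "\<And>u. u \<in> H1 \<Omega> \<Longrightarrow> H1_norm \<Omega> (\<lambda>x. \<eta> x * u x) \<le> D * H1_norm \<Omega> u"
proof -
  obtain E where E: "0 < E" "\<And>x. norm (grad \<eta> x) \<le> E" using grad_bounded[OF \<eta>] by metis
  obtain H where H: "0 < H" "\<And>x. norm (\<eta> x) \<le> H" using test_fun_bounded[OF \<eta>] by metis
  have b: "norm (jmult (\<eta> x) (grad \<eta> x) U) \<le> (2 * H + E) * norm U" for x U
  proof -
    have "norm (jmult (\<eta> x) (grad \<eta> x) U) \<le> norm (\<eta> x * fst U) + norm (\<eta> x *s snd U + fst U *s grad \<eta> x)"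
      unfolding jmult_def by (rule norm_Pair_le)
    also have "\<dots> \<le> norm (\<eta> x) * norm (fst U) + (norm (\<eta> x) * norm (snd U) + norm (fst U) * norm (grad \<eta> x))"
      by (intro add_mono order_trans[OF norm_triangle_ineq]) (simp_all add: norm_mult norm_smult_cvec)
    also have "\<dots> \<le> H * norm U + (H * norm U + norm U * E)"
      by (intro add_mono mult_mono H E norm_fst norm_snd) (use H E in auto)
    finally show ?thesis by (simp add: algebra_simps)
  qed
  show thesis
  proof (rule that[of "2 * H + E"])
    fix u assume u: "u \<in> H1 \<Omega>"
    note \<eta>u = H1_mult_test_fun(1)[OF u \<eta>]
    show "H1_norm \<Omega> (\<lambda>x. \<eta> x * u x) \<le> (2 * H + E) * H1_norm \<Omega> u"
      unfolding H1_norm_eq_jet[OF u] H1_norm_eq_jet[OF \<eta>u]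
    proof (rule L2_dominated(2)[OF jet_L2[OF u] jet_measurable[OF \<eta>u]])
      show "AE x in lebesgue_on \<Omega>. norm (jet \<Omega> (\<lambda>x. \<eta> x * u x) x) \<le> (2 * H + E) * norm (jet \<Omega> u x)"
        using jet_mult_test_fun[OF u \<eta>] by eventually_elim (simp add: b)
    qed (use H E in simp)
  qed (use H E in simp)
qed

end

section \<open>The form of a single operator\<close>

locale coeffs = bounded_open \<Omega> for \<Omega> :: "(real^'d) set" +
  fixes K :: real and \<sigma> :: "real^'d \<Rightarrow> real^'d^'d" and A :: "real^'d \<Rightarrow> real^'d" and q :: "real^'d \<Rightarrow> real"
  assumes K: "1 < K" and \<sigma>: "\<sigma> \<in> M_K \<Omega> K" and A: "A \<in> Linf_ball \<Omega> K" and q: "q \<in> Linf_ball \<Omega> K"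
begin

lemma ok: "AE x in lebesgue_on \<Omega>. coeff_ok K (\<sigma> x) (A x) (q x)"
proof -
  have "AE x in lebesgue_on \<Omega>. transpose (\<sigma> x) = \<sigma> x \<and>
     (\<forall>\<xi>. (1 / K) * (\<xi> \<bullet> \<xi>) \<le> \<xi> \<bullet> (\<sigma> x *v \<xi>) \<and> \<xi> \<bullet> (\<sigma> x *v \<xi>) \<le> K * (\<xi> \<bullet> \<xi>))"
    "AE x in lebesgue_on \<Omega>. norm (A x) \<le> K" "AE x in lebesgue_on \<Omega>. norm (q x) \<le> K"
    using \<sigma> A q by (auto simp: M_K_def Linf_ball_def)
  then show ?thesis by eventually_elim (simp add: coeff_ok_def)
qed

abbreviation pf :: "complex \<Rightarrow> real^'d \<Rightarrow> complex \<times> (complex^'d) \<Rightarrow> complex \<times> (complex^'d) \<Rightarrow> complex" where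
  "pf z x \<equiv> pform (\<sigma> x) (A x) (q x) z"

abbreviation fm :: "complex \<Rightarrow> (real^'d \<Rightarrow> complex) \<Rightarrow> (real^'d \<Rightarrow> complex) \<Rightarrow> complex" where
  "fm z \<equiv> mform \<Omega> \<sigma> A q z"

lemma pf_measurable:
  assumes "U \<in> borel_measurable (lebesgue_on \<Omega>)" "V \<in> borel_measurable (lebesgue_on \<Omega>)"
  shows "(\<lambda>x. pf z x (U x) (V x)) \<in> borel_measurable (lebesgue_on \<Omega>)"
  using \<sigma> A q by (intro pform_measurable assms) (auto simp: M_K_def Linf_ball_def)

lemma pf_integrable:
  assumes U: "U \<in> L2 \<Omega>" and V: "V \<in> L2 \<Omega>"
  shows "integrable (lebesgue_on \<Omega>) (\<lambda>x. pf z x (U x) (V x))"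
    and "norm (LINT x|lebesgue_on \<Omega>. pf z x (U x) (V x)) \<le> (form_const TYPE('d) K + K + norm z) * (L2_norm \<Omega> U * L2_norm \<Omega> V)"
proof -
  have le: "AE x in lebesgue_on \<Omega>. norm (pf z x (U x) (V x)) \<le> (form_const TYPE('d) K + K + norm z) * (norm (U x) * norm (V x))"
    using ok by eventually_elim (rule pform_bound, assumption, use K in simp)
  have C: "0 \<le> form_const TYPE('d) K + K + norm z" using form_const_nonneg[of K, where 'd = 'd] K by simp
  show "integrable (lebesgue_on \<Omega>) (\<lambda>x. pf z x (U x) (V x))"
    "norm (LINT x|lebesgue_on \<Omega>. pf z x (U x) (V x)) \<le> (form_const TYPE('d) K + K + norm z) * (L2_norm \<Omega> U * L2_norm \<Omega> V)"
    using L2_bilinear_bound[OF U V pf_measurable[OF L2_measurable[OF U] L2_measurable[OF V]] le C] by auto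
qed

lemma pf_jet_integrable:
  "u \<in> H1 \<Omega> \<Longrightarrow> v \<in> H1 \<Omega> \<Longrightarrow> integrable (lebesgue_on \<Omega>) (\<lambda>x. pf z x (jet \<Omega> u x) (jet \<Omega> v x))"
  by (intro pf_integrable jet_L2)

lemma pf_jet_measurable:
  "u \<in> H1 \<Omega> \<Longrightarrow> v \<in> H1 \<Omega> \<Longrightarrow> (\<lambda>x. pf z x (jet \<Omega> u x) (jet \<Omega> v x)) \<in> borel_measurable (lebesgue_on \<Omega>)"
  by (intro pf_measurable jet_measurable)

lemma fm_add_left:
  assumes u: "u \<in> H1 \<Omega>" and v: "v \<in> H1 \<Omega>" and w: "w \<in> H1 \<Omega>"
  shows "fm z (\<lambda>x. u x + v x) w = fm z u w + fm z v w"
proof -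
  have "fm z (\<lambda>x. u x + v x) w = (LINT x|lebesgue_on \<Omega>. pf z x (jet \<Omega> u x) (jet \<Omega> w x) + pf z x (jet \<Omega> v x) (jet \<Omega> w x))"
    unfolding mform_eq_pform
  proof (rule integral_cong_AE)
    show "AE x in lebesgue_on \<Omega>. pf z x (jet \<Omega> (\<lambda>x. u x + v x) x) (jet \<Omega> w x) = pf z x (jet \<Omega> u x) (jet \<Omega> w x) + pf z x (jet \<Omega> v x) (jet \<Omega> w x)"
      using jet_add[OF u v] by eventually_elim (simp add: pform_add_left)
  qed (intro borel_measurable_add pf_jet_measurable H1_add u v w)+
  then show ?thesis using pf_jet_integrable[OF u w] pf_jet_integrable[OF v w] by (simp add: mform_eq_pform)
qed

lemma fm_cmult_left:
  assumes u: "u \<in> H1 \<Omega>" and w: "w \<in> H1 \<Omega>"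
  shows "fm z (\<lambda>x. k * u x) w = k * fm z u w"
proof -
  have "fm z (\<lambda>x. k * u x) w = (LINT x|lebesgue_on \<Omega>. k * pf z x (jet \<Omega> u x) (jet \<Omega> w x))"
    unfolding mform_eq_pform
  proof (rule integral_cong_AE)
    show "AE x in lebesgue_on \<Omega>. pf z x (jet \<Omega> (\<lambda>x. k * u x) x) (jet \<Omega> w x) = k * pf z x (jet \<Omega> u x) (jet \<Omega> w x)"
      using jet_cmult[OF u, of k] by eventually_elim (simp add: pform_jmult_left)
  qed (intro borel_measurable_times borel_measurable_const pf_jet_measurable H1_cmult u w)+
  then show ?thesis by (simp add: mform_eq_pform)
qed

lemma fm_herm:
  assumes u: "u \<in> H1 \<Omega>" and v: "v \<in> H1 \<Omega>"
  shows "fm z v u = cnj (fm (cnj z) u v)"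
proof -
  have "cnj (fm (cnj z) u v) = (LINT x|lebesgue_on \<Omega>. cnj (pf (cnj z) x (jet \<Omega> u x) (jet \<Omega> v x)))"
    unfolding mform_eq_pform by (rule Bochner_Integration.integral_cnj[symmetric])
  also have "\<dots> = fm z v u"
    unfolding mform_eq_pform
  proof (rule integral_cong_AE)
    show "AE x in lebesgue_on \<Omega>. cnj (pf (cnj z) x (jet \<Omega> u x) (jet \<Omega> v x)) = pf z x (jet \<Omega> v x) (jet \<Omega> u x)"
      using ok by eventually_elim (simp add: cnj_pform coeff_ok_def)
    show "(\<lambda>x. cnj (pf (cnj z) x (jet \<Omega> u x) (jet \<Omega> v x))) \<in> borel_measurable (lebesgue_on \<Omega>)"
      by (rule measurable_compose[OF pf_jet_measurable[OF u v] borel_measurable_continuous_onI]) (intro continuous_intros)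
  qed (rule pf_jet_measurable[OF v u])
  finally show ?thesis by simp
qed

lemma fm_bound:
  assumes u: "u \<in> H1 \<Omega>" and v: "v \<in> H1 \<Omega>"
  shows "norm (fm z u v) \<le> (form_const TYPE('d) K + K + norm z) * (H1_norm \<Omega> u * H1_norm \<Omega> v)"
  unfolding mform_eq_pform H1_norm_eq_jet[OF u] H1_norm_eq_jet[OF v] by (intro pf_integrable jet_L2 u v)

lemma fm_coercive:
  assumes u: "u \<in> H1 \<Omega>" and t: "t \<le> - 2 * K - 1"
  shows "1 / (2 * K) * (H1_norm \<Omega> u)\<^sup>2 \<le> Re (fm (of_real t) u u)"
proof -
  have "1 / (2 * K) * (H1_norm \<Omega> u)\<^sup>2 = (LINT x|lebesgue_on \<Omega>. 1 / (2 * K) * (norm (jet \<Omega> u x))\<^sup>2)"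
    unfolding H1_norm_eq_jet[OF u] L2_norm_sq by simp
  also have "\<dots> \<le> (LINT x|lebesgue_on \<Omega>. Re (pf (of_real t) x (jet \<Omega> u x) (jet \<Omega> u x)))"
  proof (rule integral_mono_AE)
    show "AE x in lebesgue_on \<Omega>. 1 / (2 * K) * (norm (jet \<Omega> u x))\<^sup>2 \<le> Re (pf (of_real t) x (jet \<Omega> u x) (jet \<Omega> u x))"
      using ok by eventually_elim (rule pform_coercive[OF _ K t])
  qed (use L2_integrable[OF jet_L2[OF u]] pf_jet_integrable[OF u u] in auto)
  also have "\<dots> = Re (fm (of_real t) u u)"
    unfolding mform_eq_pform using pf_jet_integrable[OF u u] by simp
  finally show ?thesis .
qed

text \<open>Connects the concrete form at any complex \<open>z\<close> with the abstract theory, in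
  which only the Hermitian form at a real point is given.\<close>

lemma fm_shift:
  assumes u: "u \<in> H1 \<Omega>" and v: "v \<in> H1 \<Omega>"
  shows "fm z u v = shift \<Omega> t (fm (of_real t)) z u v"
proof -
  have "fm z u v = (LINT x|lebesgue_on \<Omega>. pf (of_real t) x (jet \<Omega> u x) (jet \<Omega> v x) + (of_real t - z) * (u x * cnj (v x)))"
    unfolding mform_eq_pform by (subst pform_shift[where w = "of_real t"]) (simp add: jet_def)
  also have "\<dots> = fm (of_real t) u v + (of_real t - z) * ip \<Omega> u v"
    unfolding mform_eq_pform ip_def using pf_jet_integrable[OF u v] ip_integrable(1)[OF H1_L2[OF u] H1_L2[OF v]] by simp
  finally show ?thesis unfolding shift_def .
qed

lemma good_fm:
  assumes t: "t \<le> - 2 * K - 1"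
  shows "good_form \<Omega> (H1 \<Omega>) (1 / (2 * K)) (form_const TYPE('d) K + K + \<bar>t\<bar>) (fm (of_real t))"
proof
  show "H10 \<Omega> \<subseteq> H1 \<Omega>" using H10_H1 by blast
  show "fm (of_real t) (\<lambda>x. u x + v x) w = fm (of_real t) u w + fm (of_real t) v w"
    if "u \<in> H1 \<Omega>" "v \<in> H1 \<Omega>" "w \<in> H1 \<Omega>" for u v w by (rule fm_add_left[OF that])
  show "fm (of_real t) (\<lambda>x. k * u x) w = k * fm (of_real t) u w" if "u \<in> H1 \<Omega>" "w \<in> H1 \<Omega>" for k u w
    by (rule fm_cmult_left[OF that])
  show "fm (of_real t) v u = cnj (fm (of_real t) u v)" if "u \<in> H1 \<Omega>" "v \<in> H1 \<Omega>" for u v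
    using fm_herm[OF that, of "of_real t"] by simp
  show "norm (fm (of_real t) u v) \<le> (form_const TYPE('d) K + K + \<bar>t\<bar>) * (H1_norm \<Omega> u * H1_norm \<Omega> v)"
    if "u \<in> H1 \<Omega>" "v \<in> H1 \<Omega>" for u v
    using fm_bound[OF that, of "of_real t"] by simp
  show "1 / (2 * K) * (H1_norm \<Omega> u)\<^sup>2 \<le> Re (fm (of_real t) u u)" if "u \<in> H1 \<Omega>" for u
    by (rule fm_coercive[OF that t])
  show "0 < 1 / (2 * K)" using K by simp
  show "0 \<le> form_const TYPE('d) K + K + \<bar>t\<bar>" using form_const_nonneg[of K, where 'd = 'd] K by simp
qed (auto intro: H1_add H1_cmult)

text \<open>Every term of the commutator carries a factor \<open>p\<close> without derivative, localised to the set where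
  \<open>\<eta>2 = 1\<close>.\<close>

lemma Caccioppoli:
  assumes \<eta>: "\<eta> \<in> test_fun UNIV" "\<And>x. cnj (\<eta> x) = \<eta> x" and \<eta>2: "\<eta>2 \<in> test_fun UNIV"
    and supp: "\<And>x. \<eta>2 x \<noteq> 1 \<Longrightarrow> \<eta> x = 0 \<and> grad \<eta> x = 0"
  obtains C1 where "0 \<le> C1" "\<And>p. p \<in> H1 \<Omega> \<Longrightarrow>
    norm (fm z (\<lambda>x. \<eta> x * p x) (\<lambda>x. \<eta> x * p x) - fm z p (\<lambda>x. \<eta> x * (\<eta> x * p x)))
      \<le> C1 * (H1_norm \<Omega> p * L2_norm \<Omega> (\<lambda>x. \<eta>2 x * p x))"
proof -
  obtain E where E: "0 < E" "\<And>x. norm (grad \<eta> x) \<le> E" using grad_bounded[OF \<eta>(1)] by metis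
  obtain H where H: "0 < H" "\<And>x. norm (\<eta> x) \<le> H" using test_fun_bounded[OF \<eta>(1)] by metis
  obtain D where D: "0 \<le> D" "\<And>u. u \<in> H1 \<Omega> \<Longrightarrow> H1_norm \<Omega> (\<lambda>x. \<eta> x * u x) \<le> D * H1_norm \<Omega> u"
    using H1_norm_mult_test_fun[OF \<eta>(1)] by metis
  let ?f = "form_const TYPE('d) K"
  have f: "0 \<le> ?f" using form_const_nonneg[of K, where 'd = 'd] K by simp
  show thesis
  proof (rule that[of "?f * (E * D + E * H)"])
    show "0 \<le> ?f * (E * D + E * H)" using f E H D by simp
    fix p assume p: "p \<in> H1 \<Omega>"
    define v where "v x = \<eta> x * p x" for x
    define w where "w x = \<eta>2 x * p x" for x
    have v: "v \<in> H1 \<Omega>" unfolding v_def[abs_def] by (rule H1_mult_test_fun(1)[OF p \<eta>(1)])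
    have \<eta>v: "(\<lambda>x. \<eta> x * v x) \<in> H1 \<Omega>" by (rule H1_mult_test_fun(1)[OF v \<eta>(1)])
    have w: "w \<in> L2 \<Omega>" unfolding w_def[abs_def] by (rule H1_L2[OF H1_mult_test_fun(1)[OF p \<eta>2]])
    let ?h = "\<lambda>x. pf z x (jet \<Omega> v x) (jet \<Omega> v x) - pf z x (jet \<Omega> p x) (jet \<Omega> (\<lambda>x. \<eta> x * v x) x)"
    have hi: "integrable (lebesgue_on \<Omega>) ?h"
      by (intro Bochner_Integration.integrable_diff pf_jet_integrable p v \<eta>v)
    have le: "AE x in lebesgue_on \<Omega>. norm (?h x) \<le> ?f * E * (norm (w x) * norm (jet \<Omega> v x)) + ?f * (E * H) * (norm (jet \<Omega> p x) * norm (w x))"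
      using ok jet_mult_test_fun[OF p \<eta>(1)] jet_mult_test_fun[OF v \<eta>(1)]
    proof eventually_elim
      case (elim x)
      have jv: "jet \<Omega> v x = jmult (\<eta> x) (grad \<eta> x) (jet \<Omega> p x)" using elim(2) by (simp add: v_def[abs_def])
      have "norm (?h x) = norm (pf z x (jmult (\<eta> x) (grad \<eta> x) (jet \<Omega> p x)) (jet \<Omega> v x)
          - pf z x (jet \<Omega> p x) (jmult (\<eta> x) (grad \<eta> x) (jet \<Omega> v x)))"
        using elim(3) jv by simp
      also have "\<dots> \<le> ?f * ((norm (grad \<eta> x) * norm (fst (jet \<Omega> p x))) * norm (jet \<Omega> v x) + norm (jet \<Omega> p x) * (norm (grad \<eta> x) * norm (fst (jet \<Omega> v x))))"
        using K by (intro commutator_bound[OF elim(1) _ \<eta>(2)]) simp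
      \<comment> \<open>Where \<open>\<eta>\<close> or its gradient does not vanish,
        \<open>\<eta>2\<close> is 1 and \<open>p\<close> may be replaced by
        \<open>w\<close>.\<close>
      also have "\<dots> \<le> ?f * ((E * norm (w x)) * norm (jet \<Omega> v x) + norm (jet \<Omega> p x) * (E * (H * norm (w x))))"
      proof (intro mult_left_mono add_mono mult_right_mono f norm_ge_zero)
        show "norm (grad \<eta> x) * norm (fst (jet \<Omega> p x)) \<le> E * norm (w x)"
          using supp[of x] E(2)[of x] by (cases "\<eta>2 x = 1") (auto simp: w_def jet_def mult_right_mono less_imp_le[OF E(1)])
        have "norm (v x) \<le> H * norm (w x)"
          using supp[of x] H(2)[of x] by (cases "\<eta>2 x = 1") (auto simp: w_def v_def norm_mult mult_right_mono less_imp_le[OF H(1)])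
        then show "norm (grad \<eta> x) * norm (fst (jet \<Omega> v x)) \<le> E * (H * norm (w x))"
          unfolding jet_def using E by (intro mult_mono) auto
      qed
      finally show ?case by (simp add: algebra_simps)
    qed
    note wv = L2_mult_integrable[OF w jet_L2[OF v]] and pw = L2_mult_integrable[OF jet_L2[OF p] w]
    have "norm (fm z v v - fm z p (\<lambda>x. \<eta> x * v x)) = norm (LINT x|lebesgue_on \<Omega>. ?h x)"
      unfolding mform_eq_pform using pf_jet_integrable[OF v v, of z] pf_jet_integrable[OF p \<eta>v, of z] by simp
    also have "\<dots> \<le> (LINT x|lebesgue_on \<Omega>. norm (?h x))" by (rule integral_norm_bound)
    also have "\<dots> \<le> (LINT x|lebesgue_on \<Omega>. ?f * E * (norm (w x) * norm (jet \<Omega> v x)) + ?f * (E * H) * (norm (jet \<Omega> p x) * norm (w x)))"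
      by (rule integral_mono_AE) (use hi wv pw le in auto)
    also have "\<dots> = ?f * E * (LINT x|lebesgue_on \<Omega>. norm (w x) * norm (jet \<Omega> v x)) + ?f * (E * H) * (LINT x|lebesgue_on \<Omega>. norm (jet \<Omega> p x) * norm (w x))"
      using wv pw by simp
    also have "\<dots> \<le> ?f * E * (L2_norm \<Omega> w * (D * H1_norm \<Omega> p)) + ?f * (E * H) * (H1_norm \<Omega> p * L2_norm \<Omega> w)"
    proof (intro add_mono mult_left_mono)
      have "(LINT x|lebesgue_on \<Omega>. norm (w x) * norm (jet \<Omega> v x)) \<le> L2_norm \<Omega> w * H1_norm \<Omega> v"
        unfolding H1_norm_eq_jet[OF v] by (rule L2_Cauchy_Schwarz[OF w jet_L2[OF v]])
      also have "\<dots> \<le> L2_norm \<Omega> w * (D * H1_norm \<Omega> p)"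
        unfolding v_def[abs_def] by (intro mult_left_mono D p) simp
      finally show "(LINT x|lebesgue_on \<Omega>. norm (w x) * norm (jet \<Omega> v x)) \<le> L2_norm \<Omega> w * (D * H1_norm \<Omega> p)" .
      show "(LINT x|lebesgue_on \<Omega>. norm (jet \<Omega> p x) * norm (w x)) \<le> H1_norm \<Omega> p * L2_norm \<Omega> w"
        unfolding H1_norm_eq_jet[OF p] by (rule L2_Cauchy_Schwarz[OF jet_L2[OF p] w])
    qed (use f E H in auto)
    also have "\<dots> = ?f * (E * D + E * H) * (H1_norm \<Omega> p * L2_norm \<Omega> w)" by (simp add: algebra_simps)
    finally show "norm (fm z (\<lambda>x. \<eta> x * p x) (\<lambda>x. \<eta> x * p x) - fm z p (\<lambda>x. \<eta> x * (\<eta> x * p x)))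
      \<le> ?f * (E * D + E * H) * (H1_norm \<Omega> p * L2_norm \<Omega> (\<lambda>x. \<eta>2 x * p x))"
      unfolding v_def w_def .
  qed
qed

end

text \<open>Outside \<open>S\<close> the integrands of the two forms agree. On \<open>S\<close> the
  jets of \<open>u\<close> and of \<open>\<eta> u\<close> agree, because there \<open>\<eta>\<close>
  is 1 and its gradient vanishes.\<close>

lemma (in bounded_open) mform_difference_localised:
  assumes "coeffs \<Omega> K \<sigma>1 A1 q1" "coeffs \<Omega> K \<sigma> A q"
    and eq: "AE x in lebesgue_on \<Omega>. x \<notin> S \<longrightarrow> \<sigma>1 x = \<sigma> x \<and> A1 x = A x \<and> q1 x = q x"
    and \<eta>: "\<eta> \<in> test_fun UNIV" "\<And>x. x \<in> S \<Longrightarrow> \<eta> x = 1 \<and> grad \<eta> x = 0"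
    and u: "u \<in> H1 \<Omega>" and w: "w \<in> H1 \<Omega>"
  shows "mform \<Omega> \<sigma>1 A1 q1 z u w - mform \<Omega> \<sigma> A q z u w
    = mform \<Omega> \<sigma>1 A1 q1 z (\<lambda>x. \<eta> x * u x) w - mform \<Omega> \<sigma> A q z (\<lambda>x. \<eta> x * u x) w"
proof -
  interpret c1: coeffs \<Omega> K \<sigma>1 A1 q1 by fact
  interpret c: coeffs \<Omega> K \<sigma> A q by fact
  note \<eta>u = H1_mult_test_fun(1)[OF u \<eta>(1)]
  have "(LINT x|lebesgue_on \<Omega>. c1.pf z x (jet \<Omega> u x) (jet \<Omega> w x) - c.pf z x (jet \<Omega> u x) (jet \<Omega> w x))
    = (LINT x|lebesgue_on \<Omega>. c1.pf z x (jet \<Omega> (\<lambda>x. \<eta> x * u x) x) (jet \<Omega> w x) - c.pf z x (jet \<Omega> (\<lambda>x. \<eta> x * u x) x) (jet \<Omega> w x))"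
  proof (rule integral_cong_AE)
    show "AE x in lebesgue_on \<Omega>. c1.pf z x (jet \<Omega> u x) (jet \<Omega> w x) - c.pf z x (jet \<Omega> u x) (jet \<Omega> w x)
      = c1.pf z x (jet \<Omega> (\<lambda>x. \<eta> x * u x) x) (jet \<Omega> w x) - c.pf z x (jet \<Omega> (\<lambda>x. \<eta> x * u x) x) (jet \<Omega> w x)"
      using eq jet_mult_test_fun[OF u \<eta>(1)]
    proof eventually_elim
      case (elim x)
      show ?case
      proof (cases "x \<in> S")
        case True
        then have "jet \<Omega> (\<lambda>x. \<eta> x * u x) x = jet \<Omega> u x"
          unfolding elim(2) using \<eta>(2) by (simp add: jmult_def)
        then show ?thesis by simp
      qed (use elim(1) in simp)
    qed
  qed (intro borel_measurable_diff c1.pf_jet_measurable c.pf_jet_measurable u w \<eta>u)+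
  then show ?thesis
    unfolding mform_eq_pform
    using c1.pf_jet_integrable[OF u w] c.pf_jet_integrable[OF u w] c1.pf_jet_integrable[OF \<eta>u w] c.pf_jet_integrable[OF \<eta>u w]
    by simp
qed

section \<open>Convergence of localised solutions\<close>

text \<open>From here on the coefficients are forgotten: the last two hypotheses retain what the
  argument uses of their structure. A second cut-off appears because Caccioppoli's inequality
  estimates the gradient of \<open>\<eta> p\<close> through the values of \<open>p\<close> on the
  support of \<open>\<eta>\<close>, and these have to be extended to a function in
  \<open>H10\<close>.\<close>

locale localised_family = G_family \<Omega> a b t0 c C for \<Omega> :: "(real^'d) set" and a b t0 c C +
  fixes \<eta> \<eta>2 :: "real^'d \<Rightarrow> complex" and C1 :: real
  assumes \<eta>: "\<eta> \<in> test_fun \<Omega>" and \<eta>2: "\<eta>2 \<in> test_fun \<Omega>"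
    and supp: "\<And>x. \<eta>2 x \<noteq> 1 \<Longrightarrow> \<eta> x = 0"
    and C1: "0 \<le> C1"
    and Caccioppoli: "\<And>p. p \<in> H1 \<Omega> \<Longrightarrow> norm (b (\<lambda>x. \<eta> x * p x) (\<lambda>x. \<eta> x * p x) - b p (\<lambda>x. \<eta> x * (\<eta> x * p x)))
      \<le> C1 * (H1_norm \<Omega> p * L2_norm \<Omega> (\<lambda>x. \<eta>2 x * p x))"
    and localised: "\<And>n u w. u \<in> H1 \<Omega> \<Longrightarrow> w \<in> H1 \<Omega> \<Longrightarrow>
      a n u w - b u w = a n (\<lambda>x. \<eta> x * u x) w - b (\<lambda>x. \<eta> x * u x) w"
begin

lemma \<eta>_H10: "u \<in> H1 \<Omega> \<Longrightarrow> (\<lambda>x. \<eta> x * u x) \<in> H10 \<Omega>"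
  by (rule test_fun_mult_H10[OF _ \<eta>])

text \<open>Rellich's theorem applies to \<open>\<eta>2 u\<close>, which lies in \<open>H10\<close>
  whatever the boundary values of \<open>u\<close> are. Caccioppoli's inequality, applied to
  differences of solutions, turns the resulting \<open>L2\<close> convergence into \<open>H1\<close>
  convergence of \<open>\<eta> u\<close>.\<close>

lemma localised_solutions_compact:
  assumes u: "\<And>k. u k \<in> H1 \<Omega>" and B: "\<And>k. H1_norm \<Omega> (u k) \<le> B" and z: "zs \<longlonglongrightarrow> z"
    and sol: "\<And>k w. w \<in> H10 \<Omega> \<Longrightarrow> shift \<Omega> t0 b (zs k) (u k) w = 0"
  obtains r :: "nat \<Rightarrow> nat" and y where "strict_mono r" "y \<in> H10 \<Omega>"
    "(\<lambda>k. H1_norm \<Omega> (\<lambda>x. \<eta> x * u (r k) x - y x)) \<longlonglongrightarrow> 0"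
proof -
  have B0: "0 \<le> B" using B[of 0] H1_norm_nonneg[of "u 0"] by linarith
  obtain D2 where D2: "0 \<le> D2" "\<And>u. u \<in> H1 \<Omega> \<Longrightarrow> H1_norm \<Omega> (\<lambda>x. \<eta>2 x * u x) \<le> D2 * H1_norm \<Omega> u"
    using H1_norm_mult_test_fun[OF test_fun_UNIV[OF \<eta>2]] by metis
  obtain H where H: "0 < H" "\<And>x. norm (\<eta> x) \<le> H" using test_fun_bounded[OF \<eta>] by metis
  have "convergent (\<lambda>k. of_real t0 - zs k)" using z by (intro convergent_diff convergent_const) (auto simp: convergent_def)
  then obtain Z where Z: "0 < Z" "\<And>k. norm (of_real t0 - zs k) \<le> Z"
    using Bseq_def convergent_imp_Bseq by (metis (no_types, lifting))
  have "H1_norm \<Omega> (\<lambda>x. \<eta>2 x * u k x) \<le> D2 * B" for k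
    by (rule order_trans[OF D2(2)[OF u]]) (intro mult_left_mono B D2)
  then obtain r :: "nat \<Rightarrow> nat" and w where r: "strict_mono r" and w: "w \<in> L2 \<Omega>"
    and lim: "(\<lambda>k. L2_norm \<Omega> (\<lambda>x. \<eta>2 x * u (r k) x - w x)) \<longlonglongrightarrow> 0"
    by (rule Rellich[OF test_fun_mult_H10[OF u \<eta>2]])
  define \<delta> where "\<delta> k = L2_norm \<Omega> (\<lambda>x. \<eta>2 x * u (r k) x - w x)" for k
  \<comment> \<open>In the first summand \<open>2 * B\<close> bounds the norm of a difference of two
    solutions in the commutator estimate; the second collects the zero order terms of the two
    equations.\<close>
  define Q where "Q = 2 * B * C1 + 2 * Z * B * H\<^sup>2"
  have Q: "0 \<le> Q" using B0 C1 Z by (simp add: Q_def)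
  have est: "c * (H1_norm \<Omega> (\<lambda>x. \<eta> x * u (r k) x - \<eta> x * u (r l) x))\<^sup>2 \<le> Q * (\<delta> k + \<delta> l)" for k l
  proof -
    define p where "p x = u (r k) x - u (r l) x" for x
    define g where "g x = \<eta> x * (\<eta> x * p x)" for x
    have p: "p \<in> H1 \<Omega>" unfolding p_def[abs_def] by (intro H1_diff u)
    have \<eta>p: "(\<lambda>x. \<eta> x * p x) \<in> H10 \<Omega>" by (rule \<eta>_H10[OF p])
    have g: "g \<in> H10 \<Omega>" unfolding g_def[abs_def] by (intro \<eta>_H10 H10_H1 \<eta>p)
    have \<eta>2p: "(\<lambda>x. \<eta>2 x * p x) \<in> L2 \<Omega>" by (intro H10_L2 test_fun_mult_H10[OF p \<eta>2])
    have pB: "H1_norm \<Omega> p \<le> 2 * B"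
      using H1_norm_diff[OF u[of "r k"] u[of "r l"]] B[of "r k"] B[of "r l"] unfolding p_def by linarith
    have \<delta>: "L2_norm \<Omega> (\<lambda>x. \<eta>2 x * p x) \<le> \<delta> k + \<delta> l"
    proof -
      note U = H10_L2[OF test_fun_mult_H10[OF u \<eta>2]]
      have "L2_norm \<Omega> (\<lambda>x. \<eta>2 x * u (r k) x - \<eta>2 x * u (r l) x) \<le> \<delta> k + L2_norm \<Omega> (\<lambda>x. w x - \<eta>2 x * u (r l) x)"
        unfolding \<delta>_def by (intro L2_norm_diff_triangle U w)
      then show ?thesis unfolding \<delta>_def p_def L2_norm_minus_commute[of \<Omega> w] by (simp add: right_diff_distrib)
    qed
    have gL: "L2_norm \<Omega> g \<le> H\<^sup>2 * L2_norm \<Omega> (\<lambda>x. \<eta>2 x * p x)"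
    proof (rule L2_dominated(2)[OF \<eta>2p L2_measurable[OF H10_L2[OF g]]])
      show "AE x in lebesgue_on \<Omega>. norm (g x) \<le> H\<^sup>2 * norm (\<eta>2 x * p x)"
      proof (rule AE_I2)
        fix x
        show "norm (g x) \<le> H\<^sup>2 * norm (\<eta>2 x * p x)"
        proof (cases "\<eta>2 x = 1")
          case True
          have "norm (\<eta> x) * (norm (\<eta> x) * norm (p x)) \<le> H * (H * norm (p x))"
            using H(1) by (intro mult_mono H(2)) auto
          then show ?thesis using True by (simp add: g_def norm_mult power2_eq_square mult.assoc)
        qed (use supp[of x] in \<open>simp add: g_def\<close>)
      qed
    qed simp
    \<comment> \<open>The equation turns the form into a zero order term. The two solutions may
      belong to different parameters: boundedness of \<open>zs\<close> suffices because
      \<open>g\<close> itself is small in \<open>L2\<close>.\<close>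
    have bu: "norm (b (u (r j)) g) \<le> Z * (B * L2_norm \<Omega> g)" for j
    proof -
      have "b (u (r j)) g = - ((of_real t0 - zs (r j)) * ip \<Omega> (u (r j)) g)"
        using sol[OF g, of "r j"] unfolding shift_def by (simp add: add_eq_0_iff2)
      then have "norm (b (u (r j)) g) = norm (of_real t0 - zs (r j)) * norm (ip \<Omega> (u (r j)) g)"
        by (simp only: norm_minus_cancel norm_mult)
      also have "\<dots> \<le> Z * (L2_norm \<Omega> (u (r j)) * L2_norm \<Omega> g)"
        using Z(1) by (intro mult_mono Z ip_integrable H1_L2 u H10_L2 g) auto
      also have "\<dots> \<le> Z * (B * L2_norm \<Omega> g)"
        using Z(1) by (intro mult_left_mono mult_right_mono order_trans[OF L2_norm_le_H1_norm B]) auto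
      finally show ?thesis .
    qed
    have bp: "b p g = b (u (r k)) g - b (u (r l)) g"
      unfolding p_def[abs_def] by (rule b.diff_left[OF u u H10_H1[OF g]])
    have "norm (b p g) \<le> Z * (B * L2_norm \<Omega> g) + Z * (B * L2_norm \<Omega> g)"
      unfolding bp by (rule order_trans[OF norm_triangle_ineq4 add_mono[OF bu bu]])
    also have "\<dots> = (2 * Z * B) * L2_norm \<Omega> g" by simp
    also have "\<dots> \<le> (2 * Z * B) * (H\<^sup>2 * L2_norm \<Omega> (\<lambda>x. \<eta>2 x * p x))"
      using Z(1) B0 by (intro mult_left_mono gL) auto
    finally have bpg: "norm (b p g) \<le> (2 * Z * B) * (H\<^sup>2 * L2_norm \<Omega> (\<lambda>x. \<eta>2 x * p x))" .
    have "c * (H1_norm \<Omega> (\<lambda>x. \<eta> x * p x))\<^sup>2 \<le> Re (b (\<lambda>x. \<eta> x * p x) (\<lambda>x. \<eta> x * p x))"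
      by (rule b.coercive[OF H10_H1[OF \<eta>p]])
    also have "\<dots> \<le> norm (b (\<lambda>x. \<eta> x * p x) (\<lambda>x. \<eta> x * p x))" by (rule complex_Re_le_cmod)
    also have "\<dots> \<le> norm (b (\<lambda>x. \<eta> x * p x) (\<lambda>x. \<eta> x * p x) - b p g) + norm (b p g)"
      using norm_triangle_sub by (metis add.commute)
    also have "\<dots> \<le> C1 * (H1_norm \<Omega> p * L2_norm \<Omega> (\<lambda>x. \<eta>2 x * p x)) + (2 * Z * B) * (H\<^sup>2 * L2_norm \<Omega> (\<lambda>x. \<eta>2 x * p x))"
      using Caccioppoli[OF p] bpg unfolding g_def by (rule add_mono)
    also have "\<dots> \<le> C1 * ((2 * B) * L2_norm \<Omega> (\<lambda>x. \<eta>2 x * p x)) + (2 * Z * B) * (H\<^sup>2 * L2_norm \<Omega> (\<lambda>x. \<eta>2 x * p x))"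
      by (intro add_right_mono mult_left_mono mult_right_mono pB C1) simp
    also have "\<dots> = Q * L2_norm \<Omega> (\<lambda>x. \<eta>2 x * p x)" by (simp add: Q_def algebra_simps)
    also have "\<dots> \<le> Q * (\<delta> k + \<delta> l)" by (intro mult_left_mono \<delta> Q)
    finally show ?thesis by (simp add: p_def right_diff_distrib)
  qed
  have Cauchy: "\<exists>N. \<forall>k\<ge>N. \<forall>l\<ge>N. H1_norm \<Omega> (\<lambda>x. \<eta> x * u (r k) x - \<eta> x * u (r l) x) < e" if e: "0 < e" for e
  proof -
    define d where "d = c * e\<^sup>2 / (2 * (Q + 1))"
    have d: "0 < d" using e b.c_pos Q by (simp add: d_def)
    have "\<forall>\<^sub>F k in sequentially. \<delta> k < d" using lim d unfolding \<delta>_def by (rule order_tendstoD(2))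
    then obtain N where N: "\<And>k. N \<le> k \<Longrightarrow> \<delta> k < d" by (auto simp: eventually_sequentially)
    show ?thesis
    proof (intro exI[of _ N] allI impI)
      fix k l assume kl: "N \<le> k" "N \<le> l"
      have "\<delta> k + \<delta> l \<le> d + d" using N[OF kl(1)] N[OF kl(2)] by linarith
      then have "Q * (\<delta> k + \<delta> l) \<le> Q * (d + d)" by (intro mult_left_mono Q)
      also have "\<dots> < (Q + 1) * (d + d)" using d by (intro mult_strict_right_mono) auto
      also have "\<dots> = d * (2 * (Q + 1))" by (simp add: algebra_simps)
      also have "\<dots> = c * e\<^sup>2"
      proof -
        have "2 * (Q + 1) \<noteq> 0" using Q by simp
        then show ?thesis unfolding d_def times_divide_eq_left by (rule nonzero_mult_div_cancel_right)
      qed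
      finally have "c * (H1_norm \<Omega> (\<lambda>x. \<eta> x * u (r k) x - \<eta> x * u (r l) x))\<^sup>2 < c * e\<^sup>2" using est[of k l] by linarith
      then show "H1_norm \<Omega> (\<lambda>x. \<eta> x * u (r k) x - \<eta> x * u (r l) x) < e"
        using b.c_pos e by (simp add: power2_less_imp_less)
    qed
  qed
  obtain y where "y \<in> H10 \<Omega>" "(\<lambda>k. H1_norm \<Omega> (\<lambda>x. \<eta> x * u (r k) x - y x)) \<longlonglongrightarrow> 0"
    by (rule H10_complete[of "\<lambda>k x. \<eta> x * u (r k) x", OF \<eta>_H10[OF u] Cauchy])
  then show thesis by (rule that[OF r])
qed

text \<open>Joint continuity in the first argument and in the parameter, measured in the dual norm.
  It allows varying cut-off functions and parameters to be replaced by their limits.\<close>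

lemma shift_perturbation:
  assumes x1: "x1 \<in> H1 \<Omega>" and x2: "x2 \<in> H1 \<Omega>" and w: "w \<in> H1 \<Omega>"
  shows "norm (shift \<Omega> t0 b z1 x1 w - shift \<Omega> t0 b z2 x2 w)
    \<le> ((C + norm (of_real t0 - z1)) * H1_norm \<Omega> (\<lambda>x. x1 x - x2 x) + norm (z2 - z1) * H1_norm \<Omega> x2) * H1_norm \<Omega> w"
proof -
  have "shift \<Omega> t0 b z1 x1 w - shift \<Omega> t0 b z2 x2 w = shift \<Omega> t0 b z1 (\<lambda>x. x1 x - x2 x) w + (z2 - z1) * ip \<Omega> x2 w"
    unfolding b.shift_diff_left[OF x1 x2 w] by (simp add: shift_def algebra_simps)
  also have "norm \<dots> \<le> norm (shift \<Omega> t0 b z1 (\<lambda>x. x1 x - x2 x) w) + norm ((z2 - z1) * ip \<Omega> x2 w)"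
    by (rule norm_triangle_ineq)
  also have "\<dots> \<le> (C + norm (of_real t0 - z1)) * (H1_norm \<Omega> (\<lambda>x. x1 x - x2 x) * H1_norm \<Omega> w) + norm (z2 - z1) * (H1_norm \<Omega> x2 * H1_norm \<Omega> w)"
    unfolding norm_mult
  proof (intro add_mono mult_left_mono norm_ge_zero b.shift_bound H1_diff x1 x2 w)
    show "norm (ip \<Omega> x2 w) \<le> H1_norm \<Omega> x2 * H1_norm \<Omega> w"
      by (rule order_trans[OF ip_le_H1[OF H1_L2[OF x2] w]]) (intro mult_right_mono L2_norm_le_H1_norm H1_norm_nonneg)
  qed
  finally show ?thesis by (simp add: algebra_simps)
qed

text \<open>\<open>kernel_free\<close> gives vanishing in \<open>L2\<close>; the equation then makes
  the form at \<open>t0\<close> vanish, and coercivity gives vanishing in \<open>H1\<close>.\<close>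

lemma kernel_free_unique:
  assumes kf: "kernel_free z" and u: "u \<in> H10 \<Omega>" and v: "v \<in> H10 \<Omega>"
    and eq: "\<And>w. w \<in> H10 \<Omega> \<Longrightarrow> shift \<Omega> t0 b z u w = shift \<Omega> t0 b z v w"
  shows "H1_norm \<Omega> (\<lambda>x. u x - v x) = 0"
proof -
  define d where "d x = u x - v x" for x
  have d: "d \<in> H10 \<Omega>" unfolding d_def[abs_def] by (intro H10_diff u v)
  have d0: "shift \<Omega> t0 b z d w = 0" if "w \<in> H10 \<Omega>" for w
    unfolding d_def[abs_def] using b.shift_diff_left[OF H10_H1[OF u] H10_H1[OF v] H10_H1[OF that]] eq[OF that] by simp
  then have "L2_norm \<Omega> d = 0" using kf d unfolding kernel_free_def by blast
  then have "b d d = 0" using d0[OF d] unfolding shift_def ip_self by simp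
  then have "c * (H1_norm \<Omega> d)\<^sup>2 \<le> 0" using b.coercive[OF H10_H1[OF d]] by simp
  then have "(H1_norm \<Omega> d)\<^sup>2 \<le> 0" using b.c_pos by (simp add: mult_le_0_iff)
  then show ?thesis unfolding d_def by simp
qed

text \<open>Writing \<open>r = un - u\<close>, the function \<open>r + \<eta> u \<in> H\<^sup>1\<^sub>0\<close> solves the \<open>n\<close>-th equation with right-hand side
  \<open>(\<L> - z)(\<eta> u)\<close>. Along a subsequence \<open>\<eta> u\<close> converges strongly to some \<open>y\<close>, hence \<open>r + \<eta> u\<close> converges
  weakly to \<open>y\<close> as well and \<open>r\<close> converges weakly to 0.\<close>

lemma localised_form_tendsto:
  assumes K: "compact \<K>" and kf: "\<And>z. z \<in> \<K> \<Longrightarrow> kernel_free z" and e: "0 < e"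
  obtains N :: nat where "\<And>n z u un v. N \<le> n \<Longrightarrow> z \<in> \<K> \<Longrightarrow> u \<in> H1 \<Omega> \<Longrightarrow> un \<in> H1 \<Omega> \<Longrightarrow> v \<in> H1 \<Omega> \<Longrightarrow>
      (\<lambda>x. un x - u x) \<in> H10 \<Omega> \<Longrightarrow> H1_norm \<Omega> u \<le> B \<Longrightarrow> H1_norm \<Omega> v \<le> B \<Longrightarrow>
      (\<And>w. w \<in> H10 \<Omega> \<Longrightarrow> shift \<Omega> t0 b z u w = 0) \<Longrightarrow>
      (\<And>w. w \<in> H10 \<Omega> \<Longrightarrow> shift \<Omega> t0 (a n) z un w = 0) \<Longrightarrow>
      (\<And>w. w \<in> H10 \<Omega> \<Longrightarrow> shift \<Omega> t0 b (cnj z) v w = 0) \<Longrightarrow>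
      norm (shift \<Omega> t0 b z (\<lambda>x. un x - u x) (\<lambda>x. \<eta> x * v x)) \<le> e"
proof -
  define bad where "bad N n z u un v \<longleftrightarrow> N \<le> n \<and> z \<in> \<K> \<and> u \<in> H1 \<Omega> \<and> un \<in> H1 \<Omega> \<and> v \<in> H1 \<Omega> \<and>
      (\<lambda>x. un x - u x) \<in> H10 \<Omega> \<and> H1_norm \<Omega> u \<le> B \<and> H1_norm \<Omega> v \<le> B \<and>
      (\<forall>w\<in>H10 \<Omega>. shift \<Omega> t0 b z u w = 0) \<and> (\<forall>w\<in>H10 \<Omega>. shift \<Omega> t0 (a n) z un w = 0) \<and>
      (\<forall>w\<in>H10 \<Omega>. shift \<Omega> t0 b (cnj z) v w = 0) \<and>
      e < norm (shift \<Omega> t0 b z (\<lambda>x. un x - u x) (\<lambda>x. \<eta> x * v x))" for N n z u un v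
  \<comment> \<open>The uniform lower bound keeps the functions \<open>g k\<close> below bounded in
    \<open>H1\<close>, as \<open>approximate_solutions\<close> demands.\<close>
  obtain N0 M where M: "0 < M" "\<And>n z u \<delta>. N0 \<le> n \<Longrightarrow> z \<in> \<K> \<Longrightarrow> u \<in> H10 \<Omega> \<Longrightarrow> 0 \<le> \<delta> \<Longrightarrow>
      (\<And>v. v \<in> H10 \<Omega> \<Longrightarrow> norm (shift \<Omega> t0 (a n) z u v) \<le> \<delta> * H1_norm \<Omega> v) \<Longrightarrow> H1_norm \<Omega> u \<le> M * \<delta>"
    by (rule uniform_bound[OF K kf]) blast+
  have "\<exists>N. \<forall>n z u un v. \<not> bad N n z u un v"
  proof (rule ccontr)
    assume "\<not> ?thesis"
    then have "\<forall>k. \<exists>n z u un v. bad (N0 + k) n z u un v" by blast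
    then obtain n0 z0 u0 un0 v0 where "\<forall>k. bad (N0 + k) (n0 k) (z0 k) (u0 k) (un0 k) (v0 k)" by metis
    then have bad: "\<And>k. N0 + k \<le> n0 k" "\<And>k. z0 k \<in> \<K>" "\<And>k. u0 k \<in> H1 \<Omega>" "\<And>k. un0 k \<in> H1 \<Omega>" "\<And>k. v0 k \<in> H1 \<Omega>"
      "\<And>k. (\<lambda>x. un0 k x - u0 k x) \<in> H10 \<Omega>" "\<And>k. H1_norm \<Omega> (u0 k) \<le> B" "\<And>k. H1_norm \<Omega> (v0 k) \<le> B"
      "\<And>k w. w \<in> H10 \<Omega> \<Longrightarrow> shift \<Omega> t0 b (z0 k) (u0 k) w = 0"
      "\<And>k w. w \<in> H10 \<Omega> \<Longrightarrow> shift \<Omega> t0 (a (n0 k)) (z0 k) (un0 k) w = 0"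
      "\<And>k w. w \<in> H10 \<Omega> \<Longrightarrow> shift \<Omega> t0 b (cnj (z0 k)) (v0 k) w = 0"
      "\<And>k. e < norm (shift \<Omega> t0 b (z0 k) (\<lambda>x. un0 k x - u0 k x) (\<lambda>x. \<eta> x * v0 k x))"
      unfolding bad_def by auto
    have B0: "0 \<le> B" using bad(7)[of 0] H1_norm_nonneg[of "u0 0"] by linarith
    obtain z s1 where z: "z \<in> \<K>" and s1: "strict_mono (s1 :: nat \<Rightarrow> nat)" "(z0 \<circ> s1) \<longlonglongrightarrow> z"
      using K bad(2) unfolding compact_def by meson
    have z1: "(\<lambda>k. z0 (s1 k)) \<longlonglongrightarrow> z" using s1(2) by (simp add: o_def)
    obtain r1 :: "nat \<Rightarrow> nat" and y where r1: "strict_mono r1" and y: "y \<in> H10 \<Omega>"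
      and lim1: "(\<lambda>k. H1_norm \<Omega> (\<lambda>x. \<eta> x * u0 (s1 (r1 k)) x - y x)) \<longlonglongrightarrow> 0"
      by (rule localised_solutions_compact[of "\<lambda>k. u0 (s1 k)", OF bad(3) bad(7) z1 bad(9)])
    have z2: "(\<lambda>k. cnj (z0 (s1 (r1 k)))) \<longlonglongrightarrow> cnj z"
      by (intro tendsto_cnj LIMSEQ_subseq_LIMSEQ[OF z1 r1, unfolded o_def])
    obtain r2 :: "nat \<Rightarrow> nat" and y' where r2: "strict_mono r2" and y': "y' \<in> H10 \<Omega>"
      and lim2: "(\<lambda>k. H1_norm \<Omega> (\<lambda>x. \<eta> x * v0 (s1 (r1 (r2 k))) x - y' x)) \<longlonglongrightarrow> 0"
      by (rule localised_solutions_compact[of "\<lambda>k. v0 (s1 (r1 k))", OF bad(5) bad(8) z2 bad(11)])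
    \<comment> \<open>Three extractions are composed: for the parameters, for the cut-off solutions
      and for the cut-off adjoint solutions.\<close>
    define s where "s k = s1 (r1 (r2 k))" for k
    have s: "strict_mono s" using s1(1) r1 r2 by (simp add: s_def strict_mono_def)
    define r where "r k x = un0 (s k) x - u0 (s k) x" for k x
    define h where "h k x = \<eta> x * u0 (s k) x" for k x
    define h' where "h' k x = \<eta> x * v0 (s k) x" for k x
    define zs where "zs k = z0 (s k)" for k
    define n where "n k = n0 (s k)" for k
    have zlim: "zs \<longlonglongrightarrow> z" unfolding zs_def s_def
      by (rule LIMSEQ_subseq_LIMSEQ[OF LIMSEQ_subseq_LIMSEQ[OF z1 r1, unfolded o_def] r2, unfolded o_def])
    have hlim: "(\<lambda>k. H1_norm \<Omega> (\<lambda>x. h k x - y x)) \<longlonglongrightarrow> 0" unfolding h_def s_def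
      using LIMSEQ_subseq_LIMSEQ[OF lim1 r2] by (simp add: o_def)
    have h'lim: "(\<lambda>k. H1_norm \<Omega> (\<lambda>x. h' k x - y' x)) \<longlonglongrightarrow> 0" unfolding h'_def s_def by (rule lim2)
    have rH: "r k \<in> H10 \<Omega>" for k unfolding r_def[abs_def] by (rule bad(6))
    have hH: "h k \<in> H10 \<Omega>" for k unfolding h_def[abs_def] by (rule \<eta>_H10[OF bad(3)])
    have h'H: "h' k \<in> H10 \<Omega>" for k unfolding h'_def[abs_def] by (rule \<eta>_H10[OF bad(5)])
    have nN: "N0 \<le> n k" for k using bad(1)[of "s k"] by (simp add: n_def)
    have nlim: "filterlim n at_top sequentially"
    proof (rule filterlim_at_top_mono[OF filterlim_subseq[OF s]])
      show "\<forall>\<^sub>F k in sequentially. s k \<le> n k"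
        using bad(1) by (intro always_eventually allI) (metis n_def add_leD2)
    qed
    define g where "g k x = r k x + h k x" for k x
    have gH: "g k \<in> H10 \<Omega>" for k unfolding g_def[abs_def] by (intro H10_add rH hH)
    \<comment> \<open>Subtracting the two equations leaves the difference of the forms at
      \<open>u0 (s k)\<close>, where \<open>localised\<close> replaces this function by
      \<open>h k\<close>.\<close>
    have gsol: "shift \<Omega> t0 (a (n k)) (zs k) (g k) w = shift \<Omega> t0 b (zs k) (h k) w" if w: "w \<in> H10 \<Omega>" for k w
    proof -
      note w1 = H10_H1[OF w] and u1 = bad(3)[of "s k"] and un1 = bad(4)[of "s k"]
      have "shift \<Omega> t0 (a (n k)) (zs k) (r k) w = - shift \<Omega> t0 (a (n k)) (zs k) (u0 (s k)) w"
        unfolding r_def[abs_def] a.shift_diff_left[OF un1 u1 w1] using bad(10)[OF w, of "s k"] by (simp add: n_def zs_def)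
      also have "\<dots> = shift \<Omega> t0 b (zs k) (u0 (s k)) w - shift \<Omega> t0 (a (n k)) (zs k) (u0 (s k)) w"
        using bad(9)[OF w, of "s k"] by (simp add: zs_def)
      also have "\<dots> = - (a (n k) (u0 (s k)) w - b (u0 (s k)) w)" by (simp add: shift_def)
      also have "\<dots> = - (a (n k) (h k) w - b (h k) w)"
        unfolding h_def[abs_def] using localised[OF u1 w1, of "n k"] by simp
      also have "\<dots> = shift \<Omega> t0 b (zs k) (h k) w - shift \<Omega> t0 (a (n k)) (zs k) (h k) w" by (simp add: shift_def)
      finally show ?thesis
        unfolding g_def[abs_def] a.shift_add_left[OF H10_H1[OF rH] H10_H1[OF hH] w1] by simp
    qed
    obtain D where D: "0 \<le> D" "\<And>u. u \<in> H1 \<Omega> \<Longrightarrow> H1_norm \<Omega> (\<lambda>x. \<eta> x * u x) \<le> D * H1_norm \<Omega> u"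
      using H1_norm_mult_test_fun[OF test_fun_UNIV[OF \<eta>]] by metis
    have hB: "H1_norm \<Omega> (h k) \<le> D * B" for k
      unfolding h_def[abs_def] by (rule order_trans[OF D(2)[OF bad(3)]]) (intro mult_left_mono bad D)
    have "convergent (\<lambda>k. of_real t0 - zs k)" using zlim by (intro convergent_diff convergent_const) (auto simp: convergent_def)
    then obtain Z where Z: "0 < Z" "\<And>k. norm (of_real t0 - zs k) \<le> Z"
      using Bseq_def convergent_imp_Bseq by (metis (no_types, lifting))
    define G0 where "G0 = M * ((C + Z) * (D * B))"
    have gB: "H1_norm \<Omega> (g k) \<le> G0" for k
      unfolding G0_def
    proof (rule M(2)[OF nN[of k], of "zs k"])
      show "zs k \<in> \<K>" unfolding zs_def by (rule bad(2))
      show "g k \<in> H10 \<Omega>" by (rule gH)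
      show "0 \<le> (C + Z) * (D * B)" using b.C_nonneg Z(1) D(1) B0 by simp
      fix w assume w: "w \<in> H10 \<Omega>"
      have "norm (shift \<Omega> t0 (a (n k)) (zs k) (g k) w) \<le> (C + norm (of_real t0 - zs k)) * (H1_norm \<Omega> (h k) * H1_norm \<Omega> w)"
        unfolding gsol[OF w] by (intro b.shift_bound H10_H1 hH w)
      also have "\<dots> \<le> (C + Z) * ((D * B) * H1_norm \<Omega> w)"
        using b.C_nonneg Z D(1) B0 hB[of k] by (intro mult_mono add_left_mono mult_right_mono) auto
      finally show "norm (shift \<Omega> t0 (a (n k)) (zs k) (g k) w) \<le> (C + Z) * (D * B) * H1_norm \<Omega> w" by (simp add: mult.assoc)
    qed
    define \<epsilon> where "\<epsilon> k = (C + norm (of_real t0 - zs k)) * H1_norm \<Omega> (\<lambda>x. h k x - y x) + norm (z - zs k) * H1_norm \<Omega> y" for k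
    have "\<epsilon> \<longlonglongrightarrow> (C + norm (of_real t0 - z)) * 0 + norm (z - z) * H1_norm \<Omega> y"
      unfolding \<epsilon>_def by (intro tendsto_intros zlim hlim)
    then have \<epsilon>lim: "\<epsilon> \<longlonglongrightarrow> 0" by simp
    define G where "G w = shift \<Omega> t0 b z y w" for w
    have GH: "G \<in> Hm1 \<Omega>" unfolding G_def[abs_def] by (rule b.shift_Hm1[OF H10_H1[OF y]])
    have gapp: "norm (shift \<Omega> t0 (a (n k)) (zs k) (g k) w - G w) \<le> \<epsilon> k * H1_norm \<Omega> w" if w: "w \<in> H10 \<Omega>" for k w
      unfolding gsol[OF w] G_def \<epsilon>_def by (intro shift_perturbation H10_H1 hH y w)
    obtain r3 :: "nat \<Rightarrow> nat" and v where r3: "strict_mono r3" and v: "v \<in> H10 \<Omega>"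
      "\<And>w. w \<in> H10 \<Omega> \<Longrightarrow> shift \<Omega> t0 b z v w = G w"
      and weak: "\<And>\<Phi>. \<Phi> \<in> Hm1 \<Omega> \<Longrightarrow> (\<lambda>k. \<Phi> (g (r3 k))) \<longlonglongrightarrow> \<Phi> v"
      by (rule approximate_solutions[OF nlim zlim gH gB GH \<epsilon>lim gapp]) blast+
    have vy: "H1_norm \<Omega> (\<lambda>x. v x - y x) = 0"
      by (rule kernel_free_unique[OF kf[OF z] v(1) y]) (simp add: v(2) G_def)
    \<comment> \<open>The parameter and the cut-off adjoint solution are frozen at their limits:
      weak convergence of \<open>r\<close> can be tested only against a fixed functional, and the
      replacement error is controlled by \<open>\<epsilon>'\<close>.\<close>
    define \<Phi> where "\<Phi> w = shift \<Omega> t0 b (cnj z) y' w" for w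
    have \<Phi>: "\<Phi> \<in> Hm1 \<Omega>" unfolding \<Phi>_def[abs_def] by (rule b.shift_Hm1[OF H10_H1[OF y']])
    obtain P where P: "0 \<le> P" "\<And>w. w \<in> H10 \<Omega> \<Longrightarrow> norm (\<Phi> w) \<le> P * H1_norm \<Omega> w" using Hm1_bound[OF \<Phi>] by metis
    have lg: "(\<lambda>k. \<Phi> (g (r3 k))) \<longlonglongrightarrow> \<Phi> y"
      using weak[OF \<Phi>] Hm1_eq_of_norm_diff_0[OF \<Phi> v(1) y vy] by simp
    have lh: "(\<lambda>k. \<Phi> (h (r3 k))) \<longlonglongrightarrow> \<Phi> y"
    proof (rule LIM_zero_cancel, rule Lim_null_comparison)
      show "(\<lambda>k. P * H1_norm \<Omega> (\<lambda>x. h (r3 k) x - y x)) \<longlonglongrightarrow> 0"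
        using tendsto_mult_right_zero[OF LIMSEQ_subseq_LIMSEQ[OF hlim r3]] by (simp add: o_def)
      show "\<forall>\<^sub>F k in sequentially. norm (\<Phi> (h (r3 k)) - \<Phi> y) \<le> P * H1_norm \<Omega> (\<lambda>x. h (r3 k) x - y x)"
        using P(2)[OF H10_diff[OF hH y]] Hm1_diff[OF \<Phi> hH y] by (intro always_eventually allI) metis
    qed
    have "\<Phi> (g k) = \<Phi> (r k) + \<Phi> (h k)" for k
      unfolding g_def[abs_def] by (rule Hm1D(1)[OF \<Phi> rH hH])
    then have lr: "(\<lambda>k. \<Phi> (r (r3 k))) \<longlonglongrightarrow> 0" using tendsto_diff[OF lg lh] by simp
    define \<epsilon>' where "\<epsilon>' k = (C + norm (of_real t0 - cnj (zs k))) * H1_norm \<Omega> (\<lambda>x. h' k x - y' x) + norm (cnj z - cnj (zs k)) * H1_norm \<Omega> y'" for k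
    have "\<epsilon>' \<longlonglongrightarrow> (C + norm (of_real t0 - cnj z)) * 0 + norm (cnj z - cnj z) * H1_norm \<Omega> y'"
      unfolding \<epsilon>'_def by (intro tendsto_intros tendsto_cnj zlim h'lim)
    then have \<epsilon>'lim: "\<epsilon>' \<longlonglongrightarrow> 0" by simp
    have \<epsilon>'0: "0 \<le> \<epsilon>' k" for k unfolding \<epsilon>'_def using b.C_nonneg by simp
    have rB: "H1_norm \<Omega> (r k) \<le> G0 + D * B" for k
    proof -
      have "H1_norm \<Omega> (\<lambda>x. g k x - h k x) \<le> H1_norm \<Omega> (g k) + H1_norm \<Omega> (h k)"
        by (intro H1_norm_diff H10_H1 gH hH)
      then show ?thesis using gB[of k] hB[of k] by (simp add: g_def)
    qed
    have fin: "norm (shift \<Omega> t0 b (zs k) (r k) (h' k)) \<le> norm (\<Phi> (r k)) + \<epsilon>' k * (G0 + D * B)" for k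
    proof -
      have "shift \<Omega> t0 b (zs k) (r k) (h' k) = cnj (shift \<Omega> t0 b (cnj (zs k)) (h' k) (r k))"
        by (rule b.shift_herm[OF H10_H1[OF h'H] H10_H1[OF rH]])
      then have "norm (shift \<Omega> t0 b (zs k) (r k) (h' k)) = norm (shift \<Omega> t0 b (cnj (zs k)) (h' k) (r k))"
        by simp
      also have "\<dots> \<le> norm (\<Phi> (r k)) + norm (shift \<Omega> t0 b (cnj (zs k)) (h' k) (r k) - \<Phi> (r k))"
        by (rule norm_triangle_sub)
      also have "norm (shift \<Omega> t0 b (cnj (zs k)) (h' k) (r k) - \<Phi> (r k)) \<le> \<epsilon>' k * H1_norm \<Omega> (r k)"
        unfolding \<Phi>_def \<epsilon>'_def by (intro shift_perturbation H10_H1 h'H y' rH)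
      also have "\<epsilon>' k * H1_norm \<Omega> (r k) \<le> \<epsilon>' k * (G0 + D * B)" by (intro mult_left_mono rB \<epsilon>'0)
      finally show ?thesis by simp
    qed
    have "(\<lambda>k. norm (\<Phi> (r (r3 k))) + \<epsilon>' (r3 k) * (G0 + D * B)) \<longlonglongrightarrow> norm (0::complex) + 0 * (G0 + D * B)"
      by (intro tendsto_intros lr LIMSEQ_subseq_LIMSEQ[OF \<epsilon>'lim r3, unfolded o_def])
    then have "e \<le> norm (0::complex) + 0 * (G0 + D * B)"
    proof (rule LIMSEQ_le_const)
      have "e \<le> norm (\<Phi> (r (r3 k))) + \<epsilon>' (r3 k) * (G0 + D * B)" for k
      proof -
        have "e < norm (shift \<Omega> t0 b (zs (r3 k)) (r (r3 k)) (h' (r3 k)))"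
          unfolding zs_def r_def[abs_def] h'_def[abs_def] by (rule bad(12))
        then show ?thesis using fin[of "r3 k"] by linarith
      qed
      then show "\<exists>N. \<forall>k\<ge>N. e \<le> norm (\<Phi> (r (r3 k))) + \<epsilon>' (r3 k) * (G0 + D * B)" by blast
    qed
    then show False using e by simp
  qed
  then obtain N where N: "\<And>n z u un v. \<not> bad N n z u un v" by blast
  show thesis
  proof (rule that[of N])
    fix n z u un v
    assume *: "N \<le> n" "z \<in> \<K>" "u \<in> H1 \<Omega>" "un \<in> H1 \<Omega>" "v \<in> H1 \<Omega>"
      "(\<lambda>x. un x - u x) \<in> H10 \<Omega>" "H1_norm \<Omega> u \<le> B" "H1_norm \<Omega> v \<le> B"
      "\<And>w. w \<in> H10 \<Omega> \<Longrightarrow> shift \<Omega> t0 b z u w = 0"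
      "\<And>w. w \<in> H10 \<Omega> \<Longrightarrow> shift \<Omega> t0 (a n) z un w = 0"
      "\<And>w. w \<in> H10 \<Omega> \<Longrightarrow> shift \<Omega> t0 b (cnj z) v w = 0"
    show "norm (shift \<Omega> t0 b z (\<lambda>x. un x - u x) (\<lambda>x. \<eta> x * v x)) \<le> e"
    proof (rule ccontr)
      assume "\<not> ?thesis"
      then have "bad N n z u un v" unfolding bad_def using * by auto
      then show False using N by blast
    qed
  qed
qed

text \<open>The difference of the two boundary forms, tested with an extension \<open>v - \<eta> v\<close> that vanishes where the
  coefficients differ.\<close>

lemma boundary_form_difference:
  assumes u: "u \<in> H1 \<Omega>" and un: "un \<in> H1 \<Omega>" and v: "v \<in> H1 \<Omega>" and \<phi>: "\<phi> \<in> H1 \<Omega>"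
    and r: "(\<lambda>x. un x - u x) \<in> H10 \<Omega>" and v\<phi>: "(\<lambda>x. v x - \<phi> x) \<in> H10 \<Omega>"
    and su: "\<And>w. w \<in> H10 \<Omega> \<Longrightarrow> shift \<Omega> t0 b z u w = 0"
    and sun: "\<And>w. w \<in> H10 \<Omega> \<Longrightarrow> shift \<Omega> t0 (a n) z un w = 0"
    and sv: "\<And>w. w \<in> H10 \<Omega> \<Longrightarrow> shift \<Omega> t0 b (cnj z) v w = 0"
  shows "shift \<Omega> t0 (a n) z un \<phi> - shift \<Omega> t0 b z u \<phi> = - shift \<Omega> t0 b z (\<lambda>x. un x - u x) (\<lambda>x. \<eta> x * v x)"
proof -
  define h where "h x = \<eta> x * v x" for x
  have h: "h \<in> H10 \<Omega>" unfolding h_def[abs_def] by (rule \<eta>_H10[OF v])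
  note h1 = H10_H1[OF h]
  \<comment> \<open>A form whose first argument is a solution does not see \<open>H10\<close>
    changes of the second, so the arbitrary extension \<open>\<phi>\<close> may be replaced by the
    adjoint solution \<open>v\<close>.\<close>
  have 1: "shift \<Omega> t0 (a n) z un \<phi> = shift \<Omega> t0 (a n) z un v"
    using sun[OF v\<phi>] a.shift_diff_right[OF v \<phi> un, of t0 n z] by simp
  have 2: "shift \<Omega> t0 b z u \<phi> = shift \<Omega> t0 b z u v"
    using su[OF v\<phi>] b.shift_diff_right[OF v \<phi> u, of t0 z] by simp
  \<comment> \<open>\<open>localised\<close> cuts off a first argument; conjugation carries the
    cut-off over to the second one, and the shift terms cancel in the difference.\<close>
  have "a n v un - b v un = a n h un - b h un" unfolding h_def[abs_def] by (rule localised[OF v un])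
  then have "cnj (a n v un - b v un) = cnj (a n h un - b h un)" by simp
  then have "a n un v - b un v = a n un h - b un h"
    using a.herm[OF v un, of n] b.herm[OF v un] a.herm[OF h1 un, of n] b.herm[OF h1 un] by simp
  then have 3: "shift \<Omega> t0 (a n) z un v - shift \<Omega> t0 b z un v = shift \<Omega> t0 (a n) z un h - shift \<Omega> t0 b z un h"
    by (simp add: shift_def)
  have 4: "shift \<Omega> t0 (a n) z un h = 0" "shift \<Omega> t0 b z u h = 0" using sun[OF h] su[OF h] by auto
  have 5: "shift \<Omega> t0 b z (\<lambda>x. un x - u x) h = shift \<Omega> t0 b z un h - shift \<Omega> t0 b z u h"
    by (rule b.shift_diff_left[OF un u h1])
  have "shift \<Omega> t0 b z (\<lambda>x. un x - u x) v = 0"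
    using b.shift_herm[OF v H10_H1[OF r], of t0 z] sv[OF r] by simp
  then have 6: "shift \<Omega> t0 b z un v = shift \<Omega> t0 b z u v"
    using b.shift_diff_left[OF un u v, of t0 z] by simp
  have "shift \<Omega> t0 (a n) z un \<phi> - shift \<Omega> t0 b z u \<phi> = - shift \<Omega> t0 b z (\<lambda>x. un x - u x) h"
    using 1 2 3 4 5 6 by (simp add: algebra_simps)
  then show ?thesis unfolding h_def .
qed

end

section \<open>Boundary data and spectra\<close>

context bounded_open
begin

lemma Hhalf_H1: "\<Psi> \<in> Hhalf \<Omega> \<Longrightarrow> u \<in> \<Psi> \<Longrightarrow> u \<in> H1 \<Omega>"
  by (auto simp: Hhalf_def trace_class_def)

lemma Hhalf_diff:
  assumes "\<Psi> \<in> Hhalf \<Omega>" "u \<in> \<Psi>" "v \<in> \<Psi>"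
  shows "(\<lambda>x. u x - v x) \<in> H10 \<Omega>"
proof -
  obtain \<psi> where "(\<lambda>x. u x - \<psi> x) \<in> H10 \<Omega>" "(\<lambda>x. v x - \<psi> x) \<in> H10 \<Omega>"
    using assms by (auto simp: Hhalf_def trace_class_def)
  from H10_diff[OF this] show ?thesis by simp
qed

lemma Hhalf_add:
  assumes "\<Psi> \<in> Hhalf \<Omega>" "u \<in> \<Psi>" "h \<in> H10 \<Omega>"
  shows "(\<lambda>x. u x + h x) \<in> \<Psi>"
proof -
  obtain \<psi> where \<psi>: "\<Psi> = trace_class \<Omega> \<psi>" "\<psi> \<in> H1 \<Omega>" using assms(1) by (auto simp: Hhalf_def)
  then have u: "u \<in> H1 \<Omega>" "(\<lambda>x. u x - \<psi> x) \<in> H10 \<Omega>" using assms(2) by (auto simp: trace_class_def)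
  have "(\<lambda>x. (u x - \<psi> x) + h x) \<in> H10 \<Omega>" by (intro H10_add u assms)
  moreover have "(\<lambda>x. (u x - \<psi> x) + h x) = (\<lambda>x. u x + h x - \<psi> x)" by auto
  ultimately show ?thesis using H1_add(1)[OF u(1) H10_H1[OF assms(3)]] by (simp add: \<psi>(1) trace_class_def)
qed

lemma Hhalf_nonempty: "\<Psi> \<in> Hhalf \<Omega> \<Longrightarrow> \<Psi> \<noteq> {}"
  by (auto simp: Hhalf_def trace_class_def)

text \<open>The quotient norm is an infimum over the coset, and a representative is taken slightly
  above it, hence the bound 2 in place of 1.\<close>

lemma Hhalf_representative:
  assumes "\<Psi> \<in> Hhalf \<Omega>" "Hhalf_norm \<Omega> \<Psi> \<le> 1"
  obtains \<psi> where "\<psi> \<in> \<Psi>" "H1_norm \<Omega> \<psi> \<le> 2"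
proof -
  have "Inf (H1_norm \<Omega> ` \<Psi>) < 2" using assms(2) by (simp add: Hhalf_norm_def)
  then have "\<exists>x\<in>H1_norm \<Omega> ` \<Psi>. x < 2"
    using cInf_lessD[of "H1_norm \<Omega> ` \<Psi>" 2] Hhalf_nonempty[OF assms(1)] by auto
  then show thesis using that by force
qed

end

text \<open>The boundary values are absorbed into a right-hand side in \<open>Hm1\<close>. The lower
  bound is demanded at two points: at \<open>cnj z\<close> for existence, at \<open>z\<close> for
  the estimate. The number 2 is the norm bound of a representative of the data.\<close>

lemma (in G_family) boundary_value_problem:
  assumes bd: "\<And>z' u \<delta>. z' \<in> {z, cnj z} \<Longrightarrow> u \<in> H10 \<Omega> \<Longrightarrow> 0 \<le> \<delta> \<Longrightarrow>
      (\<And>v. v \<in> H10 \<Omega> \<Longrightarrow> norm (shift \<Omega> t0 (a n) z' u v) \<le> \<delta> * H1_norm \<Omega> v) \<Longrightarrow> H1_norm \<Omega> u \<le> M * \<delta>"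
    and M: "0 < M" and \<Psi>: "\<Psi> \<in> Hhalf \<Omega>"
  shows "\<exists>u\<in>\<Psi>. \<forall>w\<in>H10 \<Omega>. shift \<Omega> t0 (a n) z u w = 0"
    and "Hhalf_norm \<Omega> \<Psi> \<le> 1 \<Longrightarrow> u \<in> \<Psi> \<Longrightarrow> (\<And>w. w \<in> H10 \<Omega> \<Longrightarrow> shift \<Omega> t0 (a n) z u w = 0) \<Longrightarrow>
      H1_norm \<Omega> u \<le> 2 + M * ((C + norm (of_real t0 - z)) * 2)"
proof -
  obtain \<psi> where \<psi>: "\<psi> \<in> \<Psi>" using Hhalf_nonempty[OF \<Psi>] by blast
  note \<psi>1 = Hhalf_H1[OF \<Psi> \<psi>]
  have F: "(\<lambda>w. shift \<Omega> t0 (a n) z (\<lambda>x. (-1) * \<psi> x) w) \<in> Hm1 \<Omega>"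
    by (rule a.shift_Hm1[OF H1_cmult(1)[OF \<psi>1]])
  obtain h where h: "h \<in> H10 \<Omega>" "\<And>w. w \<in> H10 \<Omega> \<Longrightarrow> shift \<Omega> t0 (a n) z h w = shift \<Omega> t0 (a n) z (\<lambda>x. (-1) * \<psi> x) w"
  proof (rule solvable[OF _ M F, of n z])
    fix u \<delta>
    assume *: "u \<in> H10 \<Omega>" "0 \<le> \<delta>" "\<And>v. v \<in> H10 \<Omega> \<Longrightarrow> norm (shift \<Omega> t0 (a n) (cnj z) u v) \<le> \<delta> * H1_norm \<Omega> v"
    show "H1_norm \<Omega> u \<le> M * \<delta>" by (rule bd[of "cnj z", OF _ *]) simp_all
  qed blast
  have "shift \<Omega> t0 (a n) z (\<lambda>x. \<psi> x + h x) w = 0" if w: "w \<in> H10 \<Omega>" for w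
    using h(2)[OF w] a.shift_add_left[OF \<psi>1 H10_H1[OF h(1)] H10_H1[OF w], of t0 n z]
      a.shift_cmult_left[OF \<psi>1 H10_H1[OF w], of t0 n z "-1"] by simp
  then show "\<exists>u\<in>\<Psi>. \<forall>w\<in>H10 \<Omega>. shift \<Omega> t0 (a n) z u w = 0"
    using Hhalf_add[OF \<Psi> \<psi> h(1)] by blast
  assume n1: "Hhalf_norm \<Omega> \<Psi> \<le> 1" and u: "u \<in> \<Psi>" and sol: "\<And>w. w \<in> H10 \<Omega> \<Longrightarrow> shift \<Omega> t0 (a n) z u w = 0"
  obtain \<phi> where \<phi>: "\<phi> \<in> \<Psi>" "H1_norm \<Omega> \<phi> \<le> 2" by (rule Hhalf_representative[OF \<Psi> n1])
  note \<phi>1 = Hhalf_H1[OF \<Psi> \<phi>(1)] and u1 = Hhalf_H1[OF \<Psi> u]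
  have d: "(\<lambda>x. u x - \<phi> x) \<in> H10 \<Omega>" by (rule Hhalf_diff[OF \<Psi> u \<phi>(1)])
  have "H1_norm \<Omega> (\<lambda>x. u x - \<phi> x) \<le> M * ((C + norm (of_real t0 - z)) * 2)"
  proof (rule bd[OF _ d])
    show "0 \<le> (C + norm (of_real t0 - z)) * 2" using b.C_nonneg by simp
    fix w assume w: "w \<in> H10 \<Omega>"
    have "norm (shift \<Omega> t0 (a n) z (\<lambda>x. u x - \<phi> x) w) = norm (shift \<Omega> t0 (a n) z \<phi> w)"
      unfolding a.shift_diff_left[OF u1 \<phi>1 H10_H1[OF w]] sol[OF w] by simp
    also have "\<dots> \<le> (C + norm (of_real t0 - z)) * (H1_norm \<Omega> \<phi> * H1_norm \<Omega> w)"
      by (intro a.shift_bound \<phi>1 H10_H1 w)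
    also have "\<dots> \<le> (C + norm (of_real t0 - z)) * (2 * H1_norm \<Omega> w)"
      using b.C_nonneg by (intro mult_left_mono mult_right_mono \<phi>) auto
    finally show "norm (shift \<Omega> t0 (a n) z (\<lambda>x. u x - \<phi> x) w) \<le> (C + norm (of_real t0 - z)) * 2 * H1_norm \<Omega> w"
      by (simp only: mult.assoc)
  qed simp
  moreover have "H1_norm \<Omega> u \<le> H1_norm \<Omega> \<phi> + H1_norm \<Omega> (\<lambda>x. u x - \<phi> x)"
    using H1_norm_add[OF \<phi>1 H10_H1[OF d]] by simp
  ultimately show "H1_norm \<Omega> u \<le> 2 + M * ((C + norm (of_real t0 - z)) * 2)" using \<phi>(2) by linarith
qed

section \<open>Spectra expressed by forms\<close>

context coeffs
begin

lemma fm_zero: "u \<in> H1 \<Omega> \<Longrightarrow> v \<in> H1 \<Omega> \<Longrightarrow> fm 0 u v = fm z u v + z * ip \<Omega> u v"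
  using fm_shift[of u v z 0] by (simp add: shift_def)

lemma op_graph_iff:
  "(u, f) \<in> op_graph \<Omega> \<sigma> A q \<longleftrightarrow> u \<in> H10 \<Omega> \<and> f \<in> L2 \<Omega> \<and> (\<forall>v\<in>H10 \<Omega>. fm z u v = ip \<Omega> (\<lambda>x. f x - z * u x) v)"
proof -
  have "fm 0 u v = (LINT x|lebesgue_on \<Omega>. f x * cnj (v x)) \<longleftrightarrow> fm z u v = ip \<Omega> (\<lambda>x. f x - z * u x) v"
    if u: "u \<in> H10 \<Omega>" and f: "f \<in> L2 \<Omega>" and v: "v \<in> H10 \<Omega>" for v
    unfolding fm_zero[OF H10_H1[OF u] H10_H1[OF v], of z] ip_cmult_left
      ip_diff_left[OF f L2_cmult[OF H10_L2[OF u]] H10_L2[OF v], of z] ip_def[of _ f v, symmetric]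
    by (simp add: eq_diff_eq)
  then show ?thesis unfolding op_graph_def by auto
qed

text \<open>The pair of \<open>u\<close> and \<open>z u\<close> lies in the graph, and the resolvent
  estimate bounds the norm of \<open>u\<close> by a multiple of 0.\<close>

lemma kernel_trivial:
  assumes z: "z \<notin> op_spec \<Omega> \<sigma> A q" and u: "u \<in> H10 \<Omega>" and 0: "\<And>v. v \<in> H10 \<Omega> \<Longrightarrow> fm z u v = 0"
  shows "L2_norm \<Omega> u = 0"
proof -
  have "z \<in> resolvent_set_L2 \<Omega> (op_graph \<Omega> \<sigma> A q)" using z by (simp add: op_spec_def)
  then obtain D where D: "\<forall>(u, g)\<in>op_graph \<Omega> \<sigma> A q. L2_norm \<Omega> u \<le> D * L2_norm \<Omega> (\<lambda>x. g x - z * u x)"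
    unfolding resolvent_set_L2_def by blast
  have "(u, \<lambda>x. z * u x) \<in> op_graph \<Omega> \<sigma> A q"
    unfolding op_graph_iff[where z = z] using u 0 L2_cmult[OF H10_L2[OF u]] by (simp add: ip_def)
  from bspec[OF D this] have "L2_norm \<Omega> u \<le> D * L2_norm \<Omega> (\<lambda>x. z * u x - z * u x)" by simp
  then show ?thesis using L2_norm_nonneg[of \<Omega> u] by simp
qed

text \<open>The resolvent set refers to \<open>L2\<close> data, the bounds to dual norms. Pairing
  with an \<open>L2\<close> function gives an element of \<open>Hm1\<close> bounded by the
  \<open>L2\<close> norm of that function, which settles both surjectivity and the estimate.\<close>

lemma not_in_spectrum:
  assumes solv: "\<And>F. F \<in> Hm1 \<Omega> \<Longrightarrow> \<exists>u\<in>H10 \<Omega>. \<forall>v\<in>H10 \<Omega>. fm z u v = F v"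
    and bd: "\<And>u \<delta>. u \<in> H10 \<Omega> \<Longrightarrow> 0 \<le> \<delta> \<Longrightarrow>
      (\<And>v. v \<in> H10 \<Omega> \<Longrightarrow> norm (fm z u v) \<le> \<delta> * H1_norm \<Omega> v) \<Longrightarrow> H1_norm \<Omega> u \<le> M * \<delta>"
  shows "z \<notin> op_spec \<Omega> \<sigma> A q"
proof -
  have "\<exists>u. (u, \<lambda>x. f x + z * u x) \<in> op_graph \<Omega> \<sigma> A q" if f: "f \<in> L2 \<Omega>" for f
  proof -
    obtain u where u: "u \<in> H10 \<Omega>" "\<And>v. v \<in> H10 \<Omega> \<Longrightarrow> fm z u v = ip \<Omega> f v" using solv[OF ip_Hm1[OF f]] by blast
    then have "(u, \<lambda>x. f x + z * u x) \<in> op_graph \<Omega> \<sigma> A q"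
      unfolding op_graph_iff[where z = z] using L2_add(1)[OF f L2_cmult[OF H10_L2[OF u(1)]]] by simp
    then show ?thesis by blast
  qed
  moreover have "L2_norm \<Omega> u \<le> M * L2_norm \<Omega> (\<lambda>x. g x - z * u x)" if ug: "(u, g) \<in> op_graph \<Omega> \<sigma> A q" for u g
  proof -
    have u: "u \<in> H10 \<Omega>" and g: "g \<in> L2 \<Omega>" and eq: "\<And>v. v \<in> H10 \<Omega> \<Longrightarrow> fm z u v = ip \<Omega> (\<lambda>x. g x - z * u x) v"
      using ug unfolding op_graph_iff[where z = z] by auto
    have "(\<lambda>x. g x - z * u x) \<in> L2 \<Omega>" by (intro L2_diff g L2_cmult H10_L2 u)
    then have "H1_norm \<Omega> u \<le> M * L2_norm \<Omega> (\<lambda>x. g x - z * u x)"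
      using ip_le_H1 H10_H1 by (intro bd u) (auto simp: eq)
    then show ?thesis using L2_norm_le_H1_norm[of u] by linarith
  qed
  ultimately have "z \<in> resolvent_set_L2 \<Omega> (op_graph \<Omega> \<sigma> A q)" unfolding resolvent_set_L2_def by blast
  then show ?thesis by (simp add: op_spec_def)
qed

lemma dirichlet_sol:
  assumes "\<exists>u\<in>\<Psi>. \<forall>w\<in>H10 \<Omega>. fm z u w = 0"
  shows "dirichlet_sol \<Omega> \<sigma> A q z \<Psi> \<in> \<Psi>" "w \<in> H10 \<Omega> \<Longrightarrow> fm z (dirichlet_sol \<Omega> \<sigma> A q z \<Psi>) w = 0"
  using someI_ex[of "\<lambda>u. u \<in> \<Psi> \<and> (\<forall>w\<in>H10 \<Omega>. fm z u w = 0)"] assms unfolding dirichlet_sol_def by auto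

end

lemma ennreal_tendsto_0I:
  fixes f :: "nat \<Rightarrow> ennreal"
  assumes "\<And>e. 0 < e \<Longrightarrow> \<forall>\<^sub>F n in sequentially. f n \<le> ennreal e"
  shows "f \<longlonglongrightarrow> 0"
proof (rule order_tendstoI)
  fix y :: ennreal assume "0 < y"
  then obtain x where x: "0 < x" "x < y" using dense by blast
  then obtain e where e: "x = ennreal e" "0 < e" by (cases x) (auto simp: ennreal_less_zero_iff)
  show "\<forall>\<^sub>F n in sequentially. f n < y"
    using assms[OF e(2)] by eventually_elim (use x e in simp)
qed simp

lemma DN_dist_le:
  assumes "\<And>\<Psi> \<Phi>. \<Psi> \<in> Hhalf \<Omega> \<Longrightarrow> Hhalf_norm \<Omega> \<Psi> \<le> 1 \<Longrightarrow> \<Phi> \<in> Hhalf \<Omega> \<Longrightarrow> Hhalf_norm \<Omega> \<Phi> \<le> 1 \<Longrightarrow>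
    norm (DN \<Omega> \<sigma>1 A1 q1 z \<Psi> \<Phi> - DN \<Omega> \<sigma>2 A2 q2 z \<Psi> \<Phi>) \<le> e"
  shows "DN_dist \<Omega> \<sigma>1 A1 q1 \<sigma>2 A2 q2 z \<le> ennreal e"
  unfolding DN_dist_def boundary_op_norm_def Hmhalf_norm_def
  by (intro SUP_least ennreal_leI) (use assms in auto)

section \<open>The convergence theorem\<close>

theorem theorem2p1:
  fixes \<Omega> \<Omega>' :: "(real^'d) set"
    and K lamK :: real
    and \<sigma>n :: "nat \<Rightarrow> real^'d \<Rightarrow> real^'d^'d"
    and An :: "nat \<Rightarrow> real^'d \<Rightarrow> real^'d"
    and qn :: "nat \<Rightarrow> real^'d \<Rightarrow> real"
    and \<sigma> :: "real^'d \<Rightarrow> real^'d^'d"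
    and A :: "real^'d \<Rightarrow> real^'d"
    and q :: "real^'d \<Rightarrow> real"
  assumes "open \<Omega>" "connected \<Omega>" "\<Omega> \<noteq> {}" "bounded \<Omega>"
    and "K > 1"
    and "below_all_spectra \<Omega> K lamK"
    and "\<And>n. \<sigma>n n \<in> M_K \<Omega> K" "\<And>n. An n \<in> Linf_ball \<Omega> K" "\<And>n. qn n \<in> Linf_ball \<Omega> K"
    and "\<sigma> \<in> M_K \<Omega> K" "A \<in> Linf_ball \<Omega> K" "q \<in> Linf_ball \<Omega> K"
    and "compact (closure \<Omega>')" "closure \<Omega>' \<subseteq> \<Omega>"
    and "\<And>n. AE x in lebesgue_on \<Omega>. x \<notin> \<Omega>' \<longrightarrow> \<sigma>n n x = \<sigma> x \<and> An n x = A x \<and> qn n x = q x"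
    and "G_converges \<Omega> lamK \<sigma>n An qn \<sigma> A q"
  shows "(\<forall>z. z \<notin> op_spec \<Omega> \<sigma> A q \<longrightarrow>
            (\<forall>\<^sub>F n in sequentially. z \<notin> op_spec \<Omega> (\<sigma>n n) (An n) (qn n)) \<and>
            (\<lambda>n. DN_dist \<Omega> (\<sigma>n n) (An n) (qn n) \<sigma> A q z) \<longlonglongrightarrow> 0) \<and>
         (\<forall>\<K>. compact \<K> \<and> \<K> \<inter> op_spec \<Omega> \<sigma> A q = {} \<longrightarrow>
            (\<forall>\<^sub>F n in sequentially. \<K> \<inter> op_spec \<Omega> (\<sigma>n n) (An n) (qn n) = {}) \<and>
            (\<lambda>n. SUP z\<in>\<K>. DN_dist \<Omega> (\<sigma>n n) (An n) (qn n) \<sigma> A q z) \<longlonglongrightarrow> 0)"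
proof -
  \<comment> \<open>Below \<open>lamK\<close> the G-convergence can be used; at or below
    \<open>- 2 * K - 1\<close> the forms are coercive on all of \<open>H1\<close>.\<close>
  define t0 where "t0 = min (lamK - 1) (- 2 * K - 1)"
  have t0: "t0 \<le> - 2 * K - 1" "t0 < lamK" by (auto simp: t0_def)
  interpret bounded_open \<Omega> by unfold_locales fact+
  have cn: "coeffs \<Omega> K (\<sigma>n n) (An n) (qn n)" for n by unfold_locales (intro assms)+
  interpret c: coeffs \<Omega> K \<sigma> A q by unfold_locales fact+
  define C where "C = form_const TYPE('d) K + K + \<bar>t0\<bar>"
  define a where "a n = mform \<Omega> (\<sigma>n n) (An n) (qn n) (of_real t0)" for n
  define b where "b = mform \<Omega> \<sigma> A q (of_real t0)"
  have ga: "good_form \<Omega> (H1 \<Omega>) (1 / (2 * K)) C (a n)" for n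
    unfolding a_def C_def by (rule coeffs.good_fm[OF cn t0(1)])
  have gb: "good_form \<Omega> (H1 \<Omega>) (1 / (2 * K)) C b"
    unfolding b_def C_def by (rule c.good_fm[OF t0(1)])
  interpret G: G_family \<Omega> a b t0 "1 / (2 * K)" C
  proof (intro G_family.intro G_family_axioms.intro bounded_open_axioms ga gb)
    fix F \<Phi> :: "(real^'d \<Rightarrow> complex) \<Rightarrow> complex" and u :: "nat \<Rightarrow> real^'d \<Rightarrow> complex" and v
    assume F: "F \<in> Hm1 \<Omega>" and \<Phi>: "\<Phi> \<in> Hm1 \<Omega>" and u: "\<And>n. u n \<in> H10 \<Omega>" and v: "v \<in> H10 \<Omega>"
      and su: "\<And>n w. w \<in> H10 \<Omega> \<Longrightarrow> a n (u n) w = F w" and sv: "\<And>w. w \<in> H10 \<Omega> \<Longrightarrow> b v w = F w"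
    define R where "R n = Hm1_resolvent \<Omega> (\<sigma>n n) (An n) (qn n) (complex_of_real t0) F" for n
    define R0 where "R0 = Hm1_resolvent \<Omega> \<sigma> A q (complex_of_real t0) F"
    have "\<exists>w. w \<in> H10 \<Omega> \<and> (\<forall>v\<in>H10 \<Omega>. mform \<Omega> (\<sigma>n n) (An n) (qn n) (complex_of_real t0) w v = F v)" for n
      using u[of n] su[of _ n] unfolding a_def by blast
    from someI_ex[OF this] have R: "R n \<in> H10 \<Omega>" "\<And>w. w \<in> H10 \<Omega> \<Longrightarrow> a n (R n) w = F w" for n
      unfolding R_def Hm1_resolvent_def a_def by auto
    have "\<exists>w. w \<in> H10 \<Omega> \<and> (\<forall>v\<in>H10 \<Omega>. mform \<Omega> \<sigma> A q (complex_of_real t0) w v = F v)"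
      using v sv unfolding b_def by blast
    from someI_ex[OF this] have R0: "R0 \<in> H10 \<Omega>" "\<And>w. w \<in> H10 \<Omega> \<Longrightarrow> b R0 w = F w"
      unfolding R0_def Hm1_resolvent_def b_def by auto
    \<comment> \<open>The choice operator picks some solution; any two differ by a function of
      \<open>H1\<close> norm 0, and functionals in \<open>Hm1\<close> do not distinguish
      them.\<close>
    have "\<Phi> (R n) = \<Phi> (u n)" for n
      by (rule Hm1_eq_of_norm_diff_0[OF \<Phi> R(1) u good_form.solution_unique[OF good_form.restrict_H10[OF ga[of n]] R(1) u]])
        (simp add: R su)
    moreover have "\<Phi> R0 = \<Phi> v"
      by (rule Hm1_eq_of_norm_diff_0[OF \<Phi> R0(1) v good_form.solution_unique[OF good_form.restrict_H10[OF gb] R0(1) v]])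
        (simp add: R0 sv)
    moreover have "(\<lambda>n. \<Phi> (R n)) \<longlonglongrightarrow> \<Phi> R0"
      using \<open>G_converges \<Omega> lamK \<sigma>n An qn \<sigma> A q\<close> F \<Phi> t0(2)
      unfolding G_converges_def weakly_converges_H10_def R_def R0_def by blast
    ultimately show "(\<lambda>n. \<Phi> (u n)) \<longlonglongrightarrow> \<Phi> v" by simp
  qed
  obtain \<eta> W where \<eta>: "\<eta> \<in> test_fun \<Omega>" "\<And>x. cnj (\<eta> x) = \<eta> x" and W: "closure \<Omega>' \<subseteq> W"
    "\<And>x. x \<in> W \<Longrightarrow> \<eta> x = 1" "\<And>x i. x \<in> W \<Longrightarrow> pdiff i \<eta> x = 0"
    by (rule cutoff_exists[OF \<open>compact (closure \<Omega>')\<close> \<open>open \<Omega>\<close> \<open>closure \<Omega>' \<subseteq> \<Omega>\<close>]) blast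
  obtain S where S: "compact S" "S \<subseteq> \<Omega>" "\<And>x. x \<notin> S \<Longrightarrow> \<eta> x = 0" "\<And>x i. x \<notin> S \<Longrightarrow> pdiff i \<eta> x = 0"
    using test_funE[OF \<eta>(1)] by metis
  \<comment> \<open>The second cut-off is 1 on a compact set outside which \<open>\<eta>\<close> and
    its derivatives vanish.\<close>
  obtain \<eta>2 W2 where \<eta>2: "\<eta>2 \<in> test_fun \<Omega>" and W2: "S \<subseteq> W2" "\<And>x. x \<in> W2 \<Longrightarrow> \<eta>2 x = 1"
    by (rule cutoff_exists[OF S(1) \<open>open \<Omega>\<close> S(2)]) blast
  have supp: "\<eta> x = 0 \<and> grad \<eta> x = 0" if "\<eta>2 x \<noteq> 1" for x
  proof -
    have "x \<notin> S" using W2 that by blast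
    then show ?thesis using S(3,4) by (simp add: grad_def vec_eq_iff)
  qed
  have one: "\<eta> x = 1 \<and> grad \<eta> x = 0" if "x \<in> \<Omega>'" for x
  proof -
    have "x \<in> W" using W(1) that closure_subset by blast
    then show ?thesis using W(2,3) by (simp add: grad_def vec_eq_iff)
  qed
  obtain C1 where C1: "0 \<le> C1" "\<And>p. p \<in> H1 \<Omega> \<Longrightarrow>
    norm (b (\<lambda>x. \<eta> x * p x) (\<lambda>x. \<eta> x * p x) - b p (\<lambda>x. \<eta> x * (\<eta> x * p x)))
      \<le> C1 * (H1_norm \<Omega> p * L2_norm \<Omega> (\<lambda>x. \<eta>2 x * p x))"
    unfolding b_def
    by (rule c.Caccioppoli[OF test_fun_UNIV[OF \<eta>(1)] \<eta>(2) test_fun_UNIV[OF \<eta>2] supp, of "of_real t0"]) blast+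
  interpret L: localised_family \<Omega> a b t0 "1 / (2 * K)" C \<eta> \<eta>2 C1
  proof
    show "a n u w - b u w = a n (\<lambda>x. \<eta> x * u x) w - b (\<lambda>x. \<eta> x * u x) w" if "u \<in> H1 \<Omega>" "w \<in> H1 \<Omega>" for n u w
      unfolding a_def b_def
      by (rule mform_difference_localised[OF cn c.coeffs_axioms assms(15) test_fun_UNIV[OF \<eta>(1)] one that])
  qed (use \<eta> \<eta>2 supp C1 in auto)
  interpret Gc: G_family \<Omega> "\<lambda>_. b" b t0 "1 / (2 * K)" C by (rule G.constant_family)
  have fn: "mform \<Omega> (\<sigma>n n) (An n) (qn n) z u v = shift \<Omega> t0 (a n) z u v" if "u \<in> H1 \<Omega>" "v \<in> H1 \<Omega>" for n z u v
    unfolding a_def by (rule coeffs.fm_shift[OF cn that])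
  have f: "mform \<Omega> \<sigma> A q z u v = shift \<Omega> t0 b z u v" if "u \<in> H1 \<Omega>" "v \<in> H1 \<Omega>" for z u v
    unfolding b_def by (rule c.fm_shift[OF that])
  have main: "(\<forall>\<^sub>F n in sequentially. \<K> \<inter> op_spec \<Omega> (\<sigma>n n) (An n) (qn n) = {}) \<and>
      (\<lambda>n. SUP z\<in>\<K>. DN_dist \<Omega> (\<sigma>n n) (An n) (qn n) \<sigma> A q z) \<longlonglongrightarrow> 0"
    if \<K>: "compact \<K>" and disj: "\<K> \<inter> op_spec \<Omega> \<sigma> A q = {}" for \<K>
  proof -
    \<comment> \<open>Existence at \<open>z\<close> rests on a bound at \<open>cnj z\<close>, and
      the adjoint solutions live at \<open>cnj z\<close>; hence the set is made symmetric.\<close>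
    define \<K>' where "\<K>' = \<K> \<union> cnj ` \<K>"
    have \<K>': "compact \<K>'" unfolding \<K>'_def
      by (intro compact_Un \<K> compact_continuous_image continuous_intros)
    have cnj\<K>: "z \<in> \<K>'" "cnj z \<in> \<K>'" if "z \<in> \<K>" for z using that by (auto simp: \<K>'_def)
    have kf0: "G.kernel_free z" if z: "z \<in> \<K>" for z
      unfolding G.kernel_free_def
    proof (intro ballI impI)
      fix u assume u: "u \<in> H10 \<Omega>" and 0: "\<forall>v\<in>H10 \<Omega>. shift \<Omega> t0 b z u v = 0"
      have "z \<notin> op_spec \<Omega> \<sigma> A q" using disj z by blast
      then show "L2_norm \<Omega> u = 0"
        by (rule c.kernel_trivial[OF _ u]) (use 0 f[OF H10_H1[OF u] H10_H1] in simp)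
    qed
    have kf: "G.kernel_free z" if "z \<in> \<K>'" for z
      using that kf0 G.kernel_free_cnj unfolding \<K>'_def by blast
    obtain N1 M1 where M1: "0 < M1" "\<And>n z u \<delta>. N1 \<le> n \<Longrightarrow> z \<in> \<K>' \<Longrightarrow> u \<in> H10 \<Omega> \<Longrightarrow> 0 \<le> \<delta> \<Longrightarrow>
      (\<And>v. v \<in> H10 \<Omega> \<Longrightarrow> norm (shift \<Omega> t0 (a n) z u v) \<le> \<delta> * H1_norm \<Omega> v) \<Longrightarrow> H1_norm \<Omega> u \<le> M1 * \<delta>"
      by (rule G.uniform_bound[OF \<K>' kf]) blast+
    obtain N2 M2 where M2: "0 < M2" "\<And>n z u \<delta>. N2 \<le> (n::nat) \<Longrightarrow> z \<in> \<K>' \<Longrightarrow> u \<in> H10 \<Omega> \<Longrightarrow> 0 \<le> \<delta> \<Longrightarrow>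
      (\<And>v. v \<in> H10 \<Omega> \<Longrightarrow> norm (shift \<Omega> t0 b z u v) \<le> \<delta> * H1_norm \<Omega> v) \<Longrightarrow> H1_norm \<Omega> u \<le> M2 * \<delta>"
      by (rule Gc.uniform_bound[OF \<K>' kf]) blast+
    \<comment> \<open>The constant family is the same at every index, so its estimate may be read
      off at the threshold \<open>N2\<close> itself.\<close>
    have bd: "H1_norm \<Omega> u \<le> M2 * \<delta>" if "z \<in> \<K>'" "u \<in> H10 \<Omega>" "0 \<le> \<delta>"
      "\<And>v. v \<in> H10 \<Omega> \<Longrightarrow> norm (shift \<Omega> t0 b z u v) \<le> \<delta> * H1_norm \<Omega> v" for z u \<delta>
      by (rule M2(2)[OF order_refl that])
    have spec: "z \<notin> op_spec \<Omega> (\<sigma>n n) (An n) (qn n)" if n: "N1 \<le> n" and z: "z \<in> \<K>" for n z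
    proof (rule coeffs.not_in_spectrum[OF cn])
      fix F assume F: "F \<in> Hm1 \<Omega>"
      obtain u where "u \<in> H10 \<Omega>" "\<And>v. v \<in> H10 \<Omega> \<Longrightarrow> shift \<Omega> t0 (a n) z u v = F v"
        by (rule G.solvable[OF M1(2)[OF n cnj\<K>(2)[OF z]] M1(1) F]) blast+
      then show "\<exists>u\<in>H10 \<Omega>. \<forall>v\<in>H10 \<Omega>. mform \<Omega> (\<sigma>n n) (An n) (qn n) z u v = F v"
        using fn H10_H1 by (intro bexI[of _ u]) auto
    next
      fix u \<delta> assume u: "u \<in> H10 \<Omega>" and \<delta>: "0 \<le> \<delta>"
        and le: "\<And>v. v \<in> H10 \<Omega> \<Longrightarrow> norm (mform \<Omega> (\<sigma>n n) (An n) (qn n) z u v) \<le> \<delta> * H1_norm \<Omega> v"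
      show "H1_norm \<Omega> u \<le> M1 * \<delta>"
        by (rule M1(2)[OF n cnj\<K>(1)[OF z] u \<delta>]) (use le fn[OF H10_H1[OF u] H10_H1] in auto)
    qed
    obtain R where R: "\<And>z. z \<in> \<K>' \<Longrightarrow> norm z \<le> R"
      using compact_imp_bounded[OF \<K>'] unfolding bounded_iff by blast
    define Z where "Z = \<bar>t0\<bar> + R"
    have Z: "norm (of_real t0 - z) \<le> Z" if "z \<in> \<K>'" for z
      using norm_triangle_ineq4[of "of_real t0" z] R[OF that] by (simp add: Z_def)
    \<comment> \<open>The estimate of \<open>boundary_value_problem\<close> with
      \<open>norm (t0 - z)\<close> replaced by its bound \<open>Z\<close>: one constant for all
      solutions with data of norm at most 1.\<close>
    define B where "B = 2 + M2 * ((C + Z) * 2)"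
    have solB: "H1_norm \<Omega> u \<le> B"
      if z: "z \<in> \<K>'" "cnj z \<in> \<K>'" and \<Psi>: "\<Psi> \<in> Hhalf \<Omega>" "Hhalf_norm \<Omega> \<Psi> \<le> 1" and u: "u \<in> \<Psi>"
        and sol: "\<And>w. w \<in> H10 \<Omega> \<Longrightarrow> shift \<Omega> t0 b z u w = 0" for z \<Psi> u
    proof -
      have "H1_norm \<Omega> u \<le> 2 + M2 * ((C + norm (of_real t0 - z)) * 2)"
        by (rule Gc.boundary_value_problem(2)[OF _ M2(1) \<Psi>(1) \<Psi>(2) u sol]) (use bd z in blast)+
      also have "\<dots> \<le> B"
        unfolding B_def using M2(1) Z[OF z(1)] by (intro add_left_mono mult_left_mono mult_right_mono) auto
      finally show ?thesis .
    qed
    have exb: "\<exists>u\<in>\<Psi>. \<forall>w\<in>H10 \<Omega>. shift \<Omega> t0 b z u w = 0"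
      if z: "z \<in> \<K>'" "cnj z \<in> \<K>'" and \<Psi>: "\<Psi> \<in> Hhalf \<Omega>" for z \<Psi>
      by (rule Gc.boundary_value_problem(1)[OF _ M2(1) \<Psi>]) (use bd z in blast)
    have exa: "\<exists>u\<in>\<Psi>. \<forall>w\<in>H10 \<Omega>. shift \<Omega> t0 (a n) z u w = 0"
      if n: "N1 \<le> n" and z: "z \<in> \<K>" and \<Psi>: "\<Psi> \<in> Hhalf \<Omega>" for n z \<Psi>
      by (rule G.boundary_value_problem(1)[OF _ M1(1) \<Psi>]) (use M1(2)[OF n] cnj\<K>[OF z] in blast)
    have dist: "\<forall>\<^sub>F n in sequentially. (SUP z\<in>\<K>. DN_dist \<Omega> (\<sigma>n n) (An n) (qn n) \<sigma> A q z) \<le> ennreal e"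
      if e: "0 < e" for e
    proof -
      obtain N3 :: nat where N3: "\<And>n z u un v. N3 \<le> n \<Longrightarrow> z \<in> \<K> \<Longrightarrow> u \<in> H1 \<Omega> \<Longrightarrow> un \<in> H1 \<Omega> \<Longrightarrow> v \<in> H1 \<Omega> \<Longrightarrow>
        (\<lambda>x. un x - u x) \<in> H10 \<Omega> \<Longrightarrow> H1_norm \<Omega> u \<le> B \<Longrightarrow> H1_norm \<Omega> v \<le> B \<Longrightarrow>
        (\<And>w. w \<in> H10 \<Omega> \<Longrightarrow> shift \<Omega> t0 b z u w = 0) \<Longrightarrow>
        (\<And>w. w \<in> H10 \<Omega> \<Longrightarrow> shift \<Omega> t0 (a n) z un w = 0) \<Longrightarrow>
        (\<And>w. w \<in> H10 \<Omega> \<Longrightarrow> shift \<Omega> t0 b (cnj z) v w = 0) \<Longrightarrow>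
        norm (shift \<Omega> t0 b z (\<lambda>x. un x - u x) (\<lambda>x. \<eta> x * v x)) \<le> e"
        by (rule L.localised_form_tendsto[OF \<K> kf0 e, of B]) blast+
      show ?thesis
        unfolding eventually_sequentially
      \<comment> \<open>The threshold is independent of \<open>z\<close> and of the boundary data,
        so the suprema over all of them can be opened at once.\<close>
      proof (intro exI[of _ "max N1 N3"] allI impI SUP_least DN_dist_le)
        fix n z \<Psi> \<Phi>
        assume n: "max N1 N3 \<le> n" and z: "z \<in> \<K>" and \<Psi>: "\<Psi> \<in> Hhalf \<Omega>" "Hhalf_norm \<Omega> \<Psi> \<le> 1"
          and \<Phi>: "\<Phi> \<in> Hhalf \<Omega>" "Hhalf_norm \<Omega> \<Phi> \<le> 1"
        have n1: "N1 \<le> n" and n3: "N3 \<le> n" using n by auto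
        note z' = cnj\<K>[OF z]
        define u where "u = dirichlet_sol \<Omega> \<sigma> A q z \<Psi>"
        define un where "un = dirichlet_sol \<Omega> (\<sigma>n n) (An n) (qn n) z \<Psi>"
        define \<phi> where "\<phi> = (SOME \<phi>. \<phi> \<in> \<Phi>)"
        have "\<exists>u\<in>\<Psi>. \<forall>w\<in>H10 \<Omega>. mform \<Omega> \<sigma> A q z u w = 0"
          using exb[OF z' \<Psi>(1)] f Hhalf_H1[OF \<Psi>(1)] H10_H1 by metis
        note u = c.dirichlet_sol[OF this, folded u_def]
        note u1 = Hhalf_H1[OF \<Psi>(1) u(1)]
        have su: "shift \<Omega> t0 b z u w = 0" if "w \<in> H10 \<Omega>" for w
          using u(2)[OF that] f[OF u1 H10_H1[OF that]] by simp
        have "\<exists>u\<in>\<Psi>. \<forall>w\<in>H10 \<Omega>. mform \<Omega> (\<sigma>n n) (An n) (qn n) z u w = 0"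
          using exa[OF n1 z \<Psi>(1)] fn Hhalf_H1[OF \<Psi>(1)] H10_H1 by metis
        note un = coeffs.dirichlet_sol[OF cn this, folded un_def]
        note un1 = Hhalf_H1[OF \<Psi>(1) un(1)]
        have sun: "shift \<Omega> t0 (a n) z un w = 0" if "w \<in> H10 \<Omega>" for w
          using un(2)[OF that] fn[OF un1 H10_H1[OF that]] by simp
        \<comment> \<open>An adjoint solution in the same coset as the chosen extension
          \<open>\<phi>\<close>; the symmetry of \<open>\<K>'\<close> provides it.\<close>
        obtain v where v: "v \<in> \<Phi>" and sv: "\<And>w. w \<in> H10 \<Omega> \<Longrightarrow> shift \<Omega> t0 b (cnj z) v w = 0"
          using exb[of "cnj z", OF z'(2) _ \<Phi>(1)] z'(1) by auto
        note v1 = Hhalf_H1[OF \<Phi>(1) v]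
        have \<phi>: "\<phi> \<in> \<Phi>" unfolding \<phi>_def using someI[of "\<lambda>\<phi>. \<phi> \<in> \<Phi>", OF v] .
        note \<phi>1 = Hhalf_H1[OF \<Phi>(1) \<phi>]
        have r: "(\<lambda>x. un x - u x) \<in> H10 \<Omega>" by (rule Hhalf_diff[OF \<Psi>(1) un(1) u(1)])
        have uB: "H1_norm \<Omega> u \<le> B" by (rule solB[OF z' \<Psi> u(1) su])
        have vB: "H1_norm \<Omega> v \<le> B" by (rule solB[OF z'(2) _ \<Phi> v sv]) (simp add: z'(1))
        have "DN \<Omega> (\<sigma>n n) (An n) (qn n) z \<Psi> \<Phi> - DN \<Omega> \<sigma> A q z \<Psi> \<Phi> = shift \<Omega> t0 (a n) z un \<phi> - shift \<Omega> t0 b z u \<phi>"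
          unfolding DN_def un_def[symmetric] u_def[symmetric] \<phi>_def[symmetric] fn[OF un1 \<phi>1] f[OF u1 \<phi>1] ..
        also have "\<dots> = - shift \<Omega> t0 b z (\<lambda>x. un x - u x) (\<lambda>x. \<eta> x * v x)"
          by (rule L.boundary_form_difference[OF u1 un1 v1 \<phi>1 r Hhalf_diff[OF \<Phi>(1) v \<phi>] su sun sv])
        finally have "norm (DN \<Omega> (\<sigma>n n) (An n) (qn n) z \<Psi> \<Phi> - DN \<Omega> \<sigma> A q z \<Psi> \<Phi>)
          = norm (shift \<Omega> t0 b z (\<lambda>x. un x - u x) (\<lambda>x. \<eta> x * v x))" by simp
        also have "\<dots> \<le> e" by (rule N3[OF n3 z u1 un1 v1 r uB vB su sun sv])
        finally show "norm (DN \<Omega> (\<sigma>n n) (An n) (qn n) z \<Psi> \<Phi> - DN \<Omega> \<sigma> A q z \<Psi> \<Phi>) \<le> e" .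
      qed
    qed
    have "\<forall>\<^sub>F n in sequentially. \<K> \<inter> op_spec \<Omega> (\<sigma>n n) (An n) (qn n) = {}"
      unfolding eventually_sequentially using spec by (intro exI[of _ N1]) blast
    then show ?thesis using ennreal_tendsto_0I[OF dist] by blast
  qed
  show ?thesis
  proof (intro conjI allI impI)
    fix z assume z: "z \<notin> op_spec \<Omega> \<sigma> A q"
    \<comment> \<open>A single point is the compact set \<open>{z}\<close>, over which the supremum
      reduces to one term.\<close>
    then have d: "{z} \<inter> op_spec \<Omega> \<sigma> A q = {}" by simp
    from main[OF _ d]
    show "\<forall>\<^sub>F n in sequentially. z \<notin> op_spec \<Omega> (\<sigma>n n) (An n) (qn n)"
      "(\<lambda>n. DN_dist \<Omega> (\<sigma>n n) (An n) (qn n) \<sigma> A q z) \<longlonglongrightarrow> 0" by simp_all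
  next
    fix \<K> assume "compact \<K> \<and> \<K> \<inter> op_spec \<Omega> \<sigma> A q = {}"
    then show "\<forall>\<^sub>F n in sequentially. \<K> \<inter> op_spec \<Omega> (\<sigma>n n) (An n) (qn n) = {}"
      "(\<lambda>n. SUP z\<in>\<K>. DN_dist \<Omega> (\<sigma>n n) (An n) (qn n) \<sigma> A q z) \<longlonglongrightarrow> 0"
      using main by blast+
  qed
qed

end
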